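(* Let $L\in\mathbb N$, $0<p,q\leq\infty$, $s\in\mathbb R$ and $f\in\dot B^s_{p,q}(\mathbb R^n)$. Put $\sigma_p=\max\{0,n(\frac1p-1)\}$. (i) If $0<p\leq\infty$, $0<q<\infty$ and $0<s<L$, then for each $j\in\{1,\dots,n\}$ $$\Big(\int_0^\infty t^{-sq}\|\Delta^L_{t,j}f\|_{L^p(\mathbb R^n)}^q\frac{dt}{t}\Big)^{1/q}\lesssim\|f\|_{\dot B^s_{p,q}(\mathbb R^n)}.$$ (ii) Suppose $f$ has a function representative. If $1<p\leq\infty$, $1\leq q<\infty$ and $s\in\mathbb R$, or if $1<p\leq\infty$, $0<q<1$ and $0<s<L$, or if $0<p\leq1$, $0<q<\infty$ and $\sigma_p<s<L$, then $$\|f\|_{\dot B^s_{p,q}(\mathbb R^n)}\lesssim\sum_{j=1}^n\Big(\int_0^\infty t^{-sq}\|\Delta^L_{t,j}f\|_{L^p(\mathbb R^n)}^q\frac{dt}{t}\Big)^{1/q}.$$ (iii) If $0<p\leq\infty$, $q=\infty$ and $0<s<L$, then for each $j\in\{1,\dots,n\}$ $$\operatorname*{ess\,sup}_{t>0}t^{-s}\|\Delta^L_{t,j}f\|_{L^p(\mathbb R^n)}\lesssim\|f\|_{\dot B^s_{p,\infty}(\mathbb R^n)}.$$ (iv) Suppose $f$ has a function representative. If $1<p\leq\infty$, $q=\infty$ and $s\in\mathbb R$, or if $0<p\leq1$, $q=\infty$ and $\sigma_p<s<\infty$, then $$\|f\|_{\dot B^s_{p,\infty}(\mathbb R^n)}\lesssim\sum_{j=1}^n\operatorname*{ess\,sup}_{t>0}t^{-s}\|\Delta^L_{t,j}f\|_{L^p(\mathbb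 R^n)}.$$
   Context: $\mathbb N$ is the set of positive integers. $\mathcal S(\mathbb R^n)$ is the Schwartz space, $\mathcal S'(\mathbb R^n)$ the tempered distributions, $\mathcal P(\mathbb R^n)$ the polynomials. The Fourier transform is $\mathcal F_n f(\xi)=\int f(x)e^{-2\pi i x\cdot\xi}dx$. Fix $\psi\in\mathcal S(\mathbb R^n)$ with $0\le\mathcal F_n\psi\le1$, $\operatorname{supp}\mathcal F_n\psi\subseteq\{\frac12\le|\xi|<2\}$ and $\sum_{j\in\mathbb Z}\mathcal F_n\psi(2^{-j}\xi)=1$ for $\xi\ne0$. For $f\in\mathcal S'(\mathbb R^n)$, $l\in\mathbb Z$, put $f_l=\psi_{2^{-l}}*f$ with $\psi_{2^{-l}}(y)=2^{ln}\psi(2^ly)$. $\|\{g_k\}\|_{l^q(L^p)}$ is the $l^q$-quasinorm of $\{\|g_k\|_{L^p(\mathbb R^n)}\}_k$. For $0<p,q\le\infty$, $s\in\mathbb R$: $\dot B^s_{p,q}(\mathbb R^n)=\{f\in\mathcal S'(\mathbb R^n)/\mathcal P(\mathbb R^n):\|f\|_{\dot B^s_{p,q}(\mathbb R^n)}:=\|\{2^{ks}f_k\}_{k\in\mathbb Z}\|_{l^q(L^p)}<\infty\}$. Iterated differences: $\Delta^1_hf(x)=f(x+h)-f(x)$, $\Delta^L_hf=\Delta^1_h(\Delta^{L-1}_hf)$ (extended to tempered distributions by duality, $\langle\Delta^L_hf,\varphi\rangle=\langle f,\Delta^L_{-h}\varphi\rangle$). With $e_j\in\mathbb R^n$ the $j$-th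 standard unit vector, $\Delta^L_{t,j}f=\Delta^L_{te_j}f$. $X\lesssim Y$ means $X\le CY$ with a constant $C$ determined by the fixed parameters and independent of $f$. Convention for elements of $\mathcal S'/\mathcal P$: an integral (or supremum) of an equivalence class is understood when the class has a function representative, and integrals (suprema) of distinct representatives of the same class are identified. In the upper bounds (i) and (iii), where $f$ need not be a function, the class $\Delta^L_{t,j}f$ is represented by the function given by the pointwise sum $\sum_{l\in\mathbb Z}\Delta^L_{t,j}f_l(x)$ for almost every $t$ and $x$ (so it is $0$ when $f$ is a polynomial). *)

theory Defs
  imports "HOL-Analysis.Analysis" "HOL-Probability.Essential_Supremum"
begin

section \<open>Schwartz functions and tempered distributions\<close>

primrec iter_partial :: "'n list \<Rightarrow> (real^'n \<Rightarrow> complex) \<Rightarrow> (real^'n::finite \<Rightarrow> complex)" where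
  "iter_partial [] f = f"
| "iter_partial (j # js) f = (\<lambda>x. frechet_derivative (iter_partial js f) (at x) (axis j 1))"

text \<open>Multi-indices are given as lists of coordinate directions. Differentiability of every iterated
partial derivative is smoothness, and the weights \<open>(1 + norm x) ^ N\<close> control all \<open>x\<^sup>\<beta>\<close>.\<close>

definition schwartz :: "(real^'n::finite \<Rightarrow> complex) \<Rightarrow> bool" where
  "schwartz \<phi> \<longleftrightarrow>
     (\<forall>js. (\<forall>x. iter_partial js \<phi> differentiable (at x)) \<and>
           (\<forall>N::nat. \<exists>B. \<forall>x. (1 + norm x) ^ N * norm (iter_partial js \<phi> x) \<le> B))"

definition schwartz_seminorm :: "nat \<Rightarrow> (real^'n::finite \<Rightarrow> complex) \<Rightarrow> real" where
  "schwartz_seminorm N \<phi> =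
     Sup {(1 + norm x) ^ N * norm (iter_partial js \<phi> x) |x js. length js \<le> N}"

text \<open>Tempered distributions are the linear functionals on Schwartz functions that are continuous, i.e.
bounded by one of the (increasing) seminorms above. Their values outside the Schwartz
space are irrelevant, and are forgotten by the quotient below.\<close>

definition tempered_distributions :: "((real^'n::finite \<Rightarrow> complex) \<Rightarrow> complex) set" where
  "tempered_distributions =
     {T. (\<forall>a b \<phi> \<theta>. schwartz \<phi> \<longrightarrow> schwartz \<theta> \<longrightarrow>
            T (\<lambda>x. a * \<phi> x + b * \<theta> x) = a * T \<phi> + b * T \<theta>) \<and>
         (\<exists>C N. \<forall>\<phi>. schwartz \<phi> \<longrightarrow> norm (T \<phi>) \<le> C * schwartz_seminorm N \<phi>)}"

definition poly_equiv ::
    "(((real^'n::finite \<Rightarrow> complex) \<Rightarrow> complex) \<times> ((real^'n \<Rightarrow> complex) \<Rightarrow> complex)) set" where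
  "poly_equiv =
     {(S, T). S \<in> tempered_distributions \<and> T \<in> tempered_distributions \<and>
        (\<exists>P. polynomial_function P \<and>
             (\<forall>\<phi>. schwartz \<phi> \<longrightarrow> S \<phi> - T \<phi> = (\<integral>x. P x * \<phi> x \<partial>lebesgue)))}"

type_synonym 'n dist_class = "((real^'n \<Rightarrow> complex) \<Rightarrow> complex) set"

definition tempered_mod_poly :: "'n::finite dist_class set" where
  "tempered_mod_poly = tempered_distributions // poly_equiv"

text \<open>A function representative is a locally integrable function which, as a distribution (that is,
against compactly supported smooth functions), is some member of the class.\<close>

definition function_representative :: "(real^'n::finite \<Rightarrow> complex) \<Rightarrow> 'n dist_class \<Rightarrow> bool" where
  "function_representative g u \<longleftrightarrow>
     (\<forall>K. compact K \<longrightarrow> set_integrable lebesgue K g) \<and>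
     (\<exists>T\<in>u. \<forall>\<phi>. schwartz \<phi> \<longrightarrow> compact (closure {x. \<phi> x \<noteq> 0}) \<longrightarrow>
        T \<phi> = (\<integral>x. g x * \<phi> x \<partial>lebesgue))"


section \<open>Littlewood--Paley pieces\<close>

definition fourier :: "(real^'n::finite \<Rightarrow> complex) \<Rightarrow> real^'n \<Rightarrow> complex" where
  "fourier f \<xi> = (\<integral>x. f x * exp (- 2 * of_real pi * \<i> * of_real (x \<bullet> \<xi>)) \<partial>lebesgue)"

definition littlewood_paley_function :: "(real^'n::finite \<Rightarrow> complex) \<Rightarrow> bool" where
  "littlewood_paley_function \<psi> \<longleftrightarrow>
     schwartz \<psi> \<and>
     (\<forall>\<xi>. fourier \<psi> \<xi> \<in> complex_of_real ` {0..1}) \<and>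
     closure {\<xi>. fourier \<psi> \<xi> \<noteq> 0} \<subseteq> {\<xi>. 1/2 \<le> norm \<xi> \<and> norm \<xi> < 2} \<and>
     (\<forall>\<xi>. \<xi> \<noteq> 0 \<longrightarrow> ((\<lambda>j::int. fourier \<psi> ((2 powi (- j)) *\<^sub>R \<xi>)) has_sum 1) UNIV)"

text \<open>\<open>dilate l \<psi>\<close> is \<open>\<psi>\<close> with index \<open>2\<^bsup>-l\<^esup>\<close>.\<close>

definition dilate :: "int \<Rightarrow> (real^'n::finite \<Rightarrow> complex) \<Rightarrow> real^'n \<Rightarrow> complex" where
  "dilate l \<psi> y = of_real ((2 powi l) ^ CARD('n)) * \<psi> ((2 powi l) *\<^sub>R y)"

definition schwartz_convolution ::
    "(real^'n::finite \<Rightarrow> complex) \<Rightarrow> ((real^'n \<Rightarrow> complex) \<Rightarrow> complex) \<Rightarrow> real^'n \<Rightarrow> complex" where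
  "schwartz_convolution \<phi> T x = T (\<lambda>y. \<phi> (x - y))"

text \<open>The choice of the representative is immaterial: \<open>fourier \<psi>\<close> vanishes near \<open>0\<close>, so
convolution with the dilates of \<open>\<psi>\<close> annihilates polynomials.\<close>

definition lp_piece :: "(real^'n::finite \<Rightarrow> complex) \<Rightarrow> int \<Rightarrow> 'n dist_class \<Rightarrow> real^'n \<Rightarrow> complex" where
  "lp_piece \<psi> l u = schwartz_convolution (dilate l \<psi>) (SOME T. T \<in> u)"


section \<open>Quasinorms and Besov spaces\<close>

text \<open>Powers with exponent \<open>a > 0\<close>.\<close>

definition ennreal_powr :: "ennreal \<Rightarrow> real \<Rightarrow> ennreal" where
  "ennreal_powr x a = (if x = \<infinity> then \<infinity> else ennreal (enn2real x powr a))"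

definition Lp_qnorm :: "ennreal \<Rightarrow> (real^'n::finite \<Rightarrow> complex) \<Rightarrow> ennreal" where
  "Lp_qnorm p g =
     (if p = \<infinity> then esssup lebesgue (\<lambda>x. ennreal (norm (g x)))
      else ennreal_powr (\<integral>\<^sup>+x. ennreal (norm (g x) powr enn2real p) \<partial>lebesgue) (1 / enn2real p))"

definition lq_qnorm :: "ennreal \<Rightarrow> (int \<Rightarrow> ennreal) \<Rightarrow> ennreal" where
  "lq_qnorm q a =
     (if q = \<infinity> then (SUP k. a k)
      else ennreal_powr (\<integral>\<^sup>+k. ennreal_powr (a k) (enn2real q) \<partial>count_space UNIV) (1 / enn2real q))"

definition besov_qnorm ::
    "(real^'n::finite \<Rightarrow> complex) \<Rightarrow> real \<Rightarrow> ennreal \<Rightarrow> ennreal \<Rightarrow> 'n dist_class \<Rightarrow> ennreal" where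
  "besov_qnorm \<psi> s p q u =
     lq_qnorm q (\<lambda>k. Lp_qnorm p (\<lambda>x. of_real (2 powr (of_int k * s)) * lp_piece \<psi> k u x))"

definition besov_space ::
    "(real^'n::finite \<Rightarrow> complex) \<Rightarrow> real \<Rightarrow> ennreal \<Rightarrow> ennreal \<Rightarrow> 'n dist_class set" where
  "besov_space \<psi> s p q = {u \<in> tempered_mod_poly. besov_qnorm \<psi> s p q u < \<infinity>}"

definition sigma_p :: "nat \<Rightarrow> ennreal \<Rightarrow> real" where
  "sigma_p n p = max 0 (real n * (enn2real (1 / p) - 1))"


section \<open>Iterated differences\<close>

primrec iter_diff :: "nat \<Rightarrow> real^'n::finite \<Rightarrow> (real^'n \<Rightarrow> complex) \<Rightarrow> real^'n \<Rightarrow> complex" where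
  "iter_diff 0 h f = f"
| "iter_diff (Suc L) h f = (\<lambda>x. iter_diff L h f (x + h) - iter_diff L h f x)"

definition axis_diff ::
    "nat \<Rightarrow> real \<Rightarrow> 'n \<Rightarrow> (real^'n::finite \<Rightarrow> complex) \<Rightarrow> real^'n \<Rightarrow> complex" where
  "axis_diff L t j f = iter_diff L (t *\<^sub>R axis j 1) f"

text \<open>The function representing the class of the difference of a class that need not contain a function.
Since \<^const>\<open>infsum\<close> is \<open>0\<close> for families that are not summable, statements about
\<open>class_diff\<close> should be accompanied by \<open>class_diff_converges\<close>.\<close>

definition class_diff ::
    "(real^'n::finite \<Rightarrow> complex) \<Rightarrow> nat \<Rightarrow> real \<Rightarrow> 'n \<Rightarrow> 'n dist_class \<Rightarrow> real^'n \<Rightarrow> complex" where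
  "class_diff \<psi> L t j u x = (\<Sum>\<^sub>\<infinity>l\<in>UNIV. axis_diff L t j (lp_piece \<psi> l u) x)"

definition class_diff_converges ::
    "(real^'n::finite \<Rightarrow> complex) \<Rightarrow> nat \<Rightarrow> 'n \<Rightarrow> 'n dist_class \<Rightarrow> bool" where
  "class_diff_converges \<psi> L j u \<longleftrightarrow>
     (AE t in lebesgue. t > 0 \<longrightarrow>
        (AE x in lebesgue. (\<lambda>l. axis_diff L t j (lp_piece \<psi> l u) x) summable_on UNIV))"

text \<open>\<open>(\<integral>\<^sub>0\<^sup>\<infinity> t\<^bsup>-sq\<^esup> F(t)\<^sup>q dt/t)\<^bsup>1/q\<^esup>\<close> for finite \<open>q\<close>, and the essential supremum of \<open>t\<^bsup>-s\<^esup> F(t)\<close> over \<open>t > 0\<close>.\<close>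

definition weighted_integral :: "ennreal \<Rightarrow> real \<Rightarrow> (real \<Rightarrow> ennreal) \<Rightarrow> ennreal" where
  "weighted_integral q s F =
     ennreal_powr
       (\<integral>\<^sup>+t\<in>{0<..}. ennreal (t powr (- s * enn2real q)) * ennreal_powr (F t) (enn2real q) * ennreal (1 / t)
          \<partial>lebesgue)
       (1 / enn2real q)"

definition weighted_esssup :: "real \<Rightarrow> (real \<Rightarrow> ennreal) \<Rightarrow> ennreal" where
  "weighted_esssup s F =
     esssup (restrict_space lebesgue {0<..}) (\<lambda>t. ennreal (t powr (- s)) * F t)"

end

theory Submission
  imports Defs "HOL-Probability.Probability"
begin

text \<open>A distribution \<open>T\<close> splits into Littlewood--Paley pieces \<open>T\<^sub>l\<close> of frequency about \<open>2\<^sup>l\<close>. A difference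
with step \<open>t\<close> multiplies the quasinorm of \<open>T\<^sub>l\<close> by at most a constant times \<open>min 1 ((2\<^sup>l t)\<^sup>L)\<close>, because on frequencies
of this size it acts as convolution with a kernel from a bounded family of Schwartz functions; for \<open>p < 1\<close>
Young's inequality is replaced by Nikolskii's. Summing over \<open>l\<close> with geometric weights gives the upper bounds.

Conversely, on the annulus of frequencies of \<open>T\<^sub>k\<close> the multiplier is a sum over \<open>j\<close> of smooth multiples of
\<open>(e\<^bsup>2\<pi>it\<^sub>j\<xi>\<^sub>j\<^esup> - 1)\<^sup>L\<close>, so that \<open>T\<^sub>k\<close> is recovered from differences with any steps \<open>t\<^sub>j\<close> of size about \<open>2\<^bsup>-k\<^esup>\<close>.
For \<open>p < 1\<close> only frequencies up to \<open>2\<^bsup>k+N\<^esup>\<close> can be treated in this way, at the cost of a factor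
\<open>2\<^bsup>N\<sigma>\<^esup>\<close> with \<open>\<sigma> = n(1/p - 1)\<close>. The remaining ones contribute \<open>O(2\<^bsup>N(\<sigma> - s)\<^esup>)\<close> times the Besov quasinorm, which is
finite by assumption and hence can be absorbed for large \<open>N\<close>.\<close>

text \<open>The obstacle is \<open>p < 1\<close>: a difference of \<open>g\<close> lying in
  \<open>L^p\<close> need not be integrable against a Schwartz kernel, so pieces cannot be written
  as convolutions with differences of \<open>g\<close>. For band-limited functions Nikolskii's
  inequality costs \<open>2^((l+N)*\<sigma>)\<close> at frequency radius \<open>2^(l+N)\<close>,
  while a kernel of scale \<open>2^l\<close> has \<open>L^p\<close> quasinorm of order
  \<open>2^(-l*\<sigma>)\<close>. The level \<open>l\<close> cancels and only the gap
  \<open>N\<close> is paid for. As \<open>g\<close> is not band-limited, it is split into a low-pass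
  part and the pieces above it; that this series represents \<open>g\<close> at all rests on
  absolute summability in \<open>L^1\<close>, again from Nikolskii and \<open>s > \<sigma>\<close>.

  The steps \<open>t_j\<close> are chosen independently of each other, each in the dyadic block
  \<open>k + 5\<close>, so infima over the block can be taken for each \<open>j\<close> separately.
  Such an infimum is a minorant constant on the block, and one-dimensional integrals arise without
  any measurability in \<open>t\<close>. The shift \<open>5\<close> keeps
  \<open>t_j * \<xi>_j\<close> below \<open>1\<close> on the relevant annulus, so that a character
  equals \<open>1\<close> only where \<open>\<xi>_j = 0\<close>.\<close>

abbreviation nn_lebesgue :: "('a::euclidean_space \<Rightarrow> ennreal) \<Rightarrow> ennreal" (binder \<open>NN \<close> 10) where
  "nn_lebesgue f \<equiv> nn_integral lborel f"

abbreviation nn_series :: "('a \<Rightarrow> ennreal) \<Rightarrow> ennreal" (binder \<open>NS \<close> 10) where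
  "nn_series f \<equiv> nn_integral (count_space UNIV) f"

abbreviation epowr :: "ennreal \<Rightarrow> real \<Rightarrow> ennreal" where
  "epowr \<equiv> ennreal_powr"

abbreviation enorm :: "'a::real_normed_vector \<Rightarrow> ennreal" where
  "enorm x \<equiv> ennreal (norm x)"

type_synonym 'n cfun = "real^'n \<Rightarrow> complex"

abbreviation borel_funs :: "('a::topological_space \<Rightarrow> 'b::topological_space) set" where
  "borel_funs \<equiv> borel_measurable borel"

abbreviation tempered :: "('n::finite cfun \<Rightarrow> complex) \<Rightarrow> bool" where
  "tempered T \<equiv> T \<in> tempered_distributions"

abbreviation conv :: "'n::finite cfun \<Rightarrow> ('n cfun \<Rightarrow> complex) \<Rightarrow> 'n cfun" where
  "conv \<equiv> schwartz_convolution"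

section \<open>Families of functions of uniform polynomial growth\<close>

definition partial :: "'n \<Rightarrow> 'n::finite cfun \<Rightarrow> 'n cfun" where
  "partial j f = (\<lambda>x. frechet_derivative f (at x) (axis j 1))"

lemma iter_partial_Cons: "iter_partial (j # js) f = partial j (iter_partial js f)"
  by (simp add: partial_def)

lemma iter_partial_snoc: "iter_partial (js @ [j]) f = iter_partial js (partial j f)"
  by (induction js) (simp_all add: partial_def)

lemma partial_eq: "(f has_derivative f') (at x) \<Longrightarrow> partial j f x = f' (axis j 1)"
  unfolding partial_def using frechet_derivative_at by metis

lemma differentiable_has_derivative:
  "f differentiable (at x) \<Longrightarrow> (f has_derivative frechet_derivative f (at x)) (at x)"
  using frechet_derivative_works by blast

text \<open>The families of Schwartz functions below are the bounded subsets of the Schwartz space. Working with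
them instead of single functions makes all constants uniform in the scale and in the step of
the differences.\<close>

primrec growth :: "nat \<Rightarrow> real \<Rightarrow> 'i set \<Rightarrow> ('i \<Rightarrow> 'n::finite cfun) \<Rightarrow> bool" where
  "growth 0 m I F \<longleftrightarrow> (\<exists>B. \<forall>i\<in>I. \<forall>x. norm (F i x) \<le> B * (1 + norm x) powr m)"
| "growth (Suc k) m I F \<longleftrightarrow>
     (\<exists>B. \<forall>i\<in>I. \<forall>x. norm (F i x) \<le> B * (1 + norm x) powr m) \<and>
     (\<forall>i\<in>I. \<forall>x. F i differentiable (at x)) \<and> (\<forall>j. growth k m I (\<lambda>i. partial j (F i)))"

lemma growth_imp_0: "growth k m I F \<Longrightarrow> growth 0 m I F"
  by (cases k) auto

lemma growthD:
  assumes "growth k m I F"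
  shows "\<exists>B>0. \<forall>i\<in>I. \<forall>x. norm (F i x) \<le> B * (1 + norm x) powr m"
proof -
  from growth_imp_0[OF assms] obtain B where B: "\<forall>i\<in>I. \<forall>x. norm (F i x) \<le> B * (1 + norm x) powr m" by auto
  have "B * (1 + norm x) powr m \<le> (\<bar>B\<bar> + 1) * (1 + norm x) powr m" for x :: "real^'b"
    by (intro mult_right_mono) auto
  then show ?thesis using B by (intro exI[of _ "\<bar>B\<bar> + 1"] conjI ballI allI) (auto intro: order_trans)
qed

lemma one_plus_norm_simps [simp]: "0 < 1 + norm x" "1 + norm x \<noteq> 0" "0 \<le> 1 + norm x"
  using norm_ge_zero[of x] by linarith+

lemma growth_SucD:
  assumes "growth (Suc k) m I F"
  shows "i \<in> I \<Longrightarrow> F i differentiable (at x)" "growth k m I (\<lambda>i. partial j (F i))" using assms by auto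

lemma growth_SucI:
  assumes "growth 0 m I F" "\<And>i x. i \<in> I \<Longrightarrow> F i differentiable (at x)"
    "\<And>j. growth k m I (\<lambda>i. partial j (F i))" shows "growth (Suc k) m I F" using assms by simp

lemma growth_cong:
  assumes "\<And>i. i \<in> I \<Longrightarrow> F i = G i"
  shows "growth k m I F \<longleftrightarrow> growth k m I G" using assms
proof (induction k arbitrary: F G)
  case (Suc k)
  have "growth k m I (\<lambda>i. partial j (F i)) = growth k m I (\<lambda>i. partial j (G i))" for j
    by (rule Suc.IH) (simp add: Suc.prems)
  then show ?case using Suc.prems by simp
qed simp

lemma growth_le_k: "growth k m I F \<Longrightarrow> k' \<le> k \<Longrightarrow> growth k' m I F"
proof (induction k' arbitrary: k F)
  case 0 then show ?case by (auto dest: growth_imp_0)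
next
  case (Suc k')
  then obtain l where l: "k = Suc l" "k' \<le> l" by (cases k) auto
  have "growth k' m I (\<lambda>i. partial j (F i))" for j using Suc.IH[OF growth_SucD(2)[of l]] Suc.prems l by simp
  then show ?case using growth_imp_0[OF Suc.prems(1)] Suc.prems(1) l by (intro growth_SucI) auto
qed

lemma growth_0I:
  assumes "\<And>i x. i \<in> I \<Longrightarrow> norm (F i x) \<le> B * (1 + norm x) powr m"
  shows "growth 0 m I F" using assms by auto

lemma growth_le_m: 
  assumes "growth k m I F" "m \<le> m'" shows "growth k m' I F"
  using assms(1)
proof (induction k arbitrary: F)
  case 0
  obtain B where B: "B > 0" "\<forall>i\<in>I. \<forall>x. norm (F i x) \<le> B * (1 + norm x) powr m" using growthD[OF 0] by blast
  have "B * (1 + norm x) powr m \<le> B * (1 + norm x) powr m'" for x :: "real^'b"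
    using B(1) assms(2) by (intro mult_left_mono powr_mono) auto
  then show ?case using B(2) by (intro growth_0I) (auto intro: order_trans)
next
  case (Suc k)
  have "growth 0 m' I F" by (rule growth_imp_0[OF Suc.IH[OF growth_le_k[OF Suc.prems]]]) simp
  then show ?case using Suc by (intro growth_SucI) auto
qed

lemma growth_reindex:
  assumes "growth k m I F" "\<And>j. j \<in> J \<Longrightarrow> r j \<in> I"
  shows "growth k m J (\<lambda>j. F (r j))" using assms(1)
proof (induction k arbitrary: F)
  case 0
  then show ?case using assms(2) by auto
next
  case (Suc k)
  have "growth 0 m J (\<lambda>j. F (r j))" using growth_imp_0[OF Suc.prems] assms(2) by fastforce
  then show ?case using Suc assms(2) by (intro growth_SucI Suc.IH) auto
qed

lemma growth_add:
  assumes "growth k m I F" "growth k m I G"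
  shows "growth k m I (\<lambda>i x. F i x + G i x)" using assms
proof (induction k arbitrary: F G)
  case 0
  obtain A B where "\<forall>i\<in>I. \<forall>x. norm (F i x) \<le> A * (1 + norm x) powr m" "\<forall>i\<in>I. \<forall>x. norm (G i x) \<le> B * (1 + norm x) powr m"
    using 0 by auto
  then have "norm (F i x + G i x) \<le> (A + B) * (1 + norm x) powr m" if "i \<in> I" for i x
    using that by (simp add: distrib_right norm_triangle_mono)
  then show ?case by (rule growth_0I)
next
  case (Suc k)
  have "growth k m I (\<lambda>i. partial j (\<lambda>x. F i x + G i x))" for j
  proof -
    have "partial j (\<lambda>x. F i x + G i x) = (\<lambda>x. partial j (F i) x + partial j (G i) x)" if "i \<in> I" for i
    proof
      fix x
      have "((\<lambda>x. F i x + G i x) has_derivative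
          (\<lambda>h. frechet_derivative (F i) (at x) h + frechet_derivative (G i) (at x) h)) (at x)"
        using Suc.prems that by (intro has_derivative_add differentiable_has_derivative) auto
      then show "partial j (\<lambda>x. F i x + G i x) x = partial j (F i) x + partial j (G i) x"
        by (subst partial_eq) (auto simp: partial_def)
    qed
    with Suc show ?thesis by (subst growth_cong) auto
  qed
  moreover have "growth 0 m I (\<lambda>i x. F i x + G i x)"
    by (rule growth_imp_0[OF Suc.IH]) (intro growth_le_k[OF Suc.prems(1)] growth_le_k[OF Suc.prems(2)]; simp)+
  ultimately show ?case using Suc.prems by (intro growth_SucI) auto
qed

lemma partial_const: "partial j (\<lambda>x. c) = (\<lambda>x. 0)"
  by (rule ext, subst partial_eq[OF has_derivative_const]) auto

lemma growth_zero: "growth k m I (\<lambda>i x. 0)"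
  by (induction k) (auto simp: partial_const intro!: exI[of _ 0])

lemma growth_const:
  assumes "\<And>i. i \<in> I \<Longrightarrow> norm (c i) \<le> B"
  shows "growth k 0 I (\<lambda>i x. c i)" using assms
  by (cases k) (auto simp: partial_const growth_zero intro!: exI[of _ B])

lemma partial_mult:
  assumes "f differentiable (at x)" "g differentiable (at x)"
  shows "partial j (\<lambda>x. f x * g x) x = partial j f x * g x + f x * partial j g x"
proof -
  have "((\<lambda>x. f x * g x) has_derivative
      (\<lambda>h. f x * frechet_derivative g (at x) h + frechet_derivative f (at x) h * g x)) (at x)"
    using assms by (intro has_derivative_mult differentiable_has_derivative)
  from partial_eq[OF this] show ?thesis by (simp add: partial_def)
qed

lemma growth_mult:
  assumes "growth k m I F" "growth k m' I G"
  shows "growth k (m + m') I (\<lambda>i x. F i x * G i x)" using assms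
proof (induction k arbitrary: F G)
  case 0
  obtain A where A: "A > 0" "\<forall>i\<in>I. \<forall>x. norm (F i x) \<le> A * (1 + norm x) powr m" using growthD[OF 0(1)] by blast
  obtain B where B: "\<forall>i\<in>I. \<forall>x. norm (G i x) \<le> B * (1 + norm x) powr m'" using 0(2) by auto
  have "norm (F i x * G i x) \<le> (A * B) * (1 + norm x) powr (m + m')" if "i \<in> I" for i x
  proof -
    have "norm (F i x * G i x) \<le> (A * (1 + norm x) powr m) * (B * (1 + norm x) powr m')"
      unfolding norm_mult using A B that by (intro mult_mono) auto
    then show ?thesis by (simp add: powr_add mult_ac)
  qed
  then show ?case by (rule growth_0I)
next
  case (Suc k)
  note k = Suc.prems[THEN growth_le_k, of k]
  have "growth k (m + m') I (\<lambda>i. partial j (\<lambda>x. F i x * G i x))" for j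
  proof -
    have "partial j (\<lambda>x. F i x * G i x) = (\<lambda>x. partial j (F i) x * G i x + F i x * partial j (G i) x)"
      if "i \<in> I" for i using Suc.prems that by (intro ext partial_mult) auto
    moreover have "growth k (m + m') I (\<lambda>i x. partial j (F i) x * G i x + F i x * partial j (G i) x)"
      using Suc.prems[THEN growth_SucD(2)] k by (intro growth_add Suc.IH) simp_all
    ultimately show ?thesis by (subst growth_cong) auto
  qed
  moreover have "growth 0 (m + m') I (\<lambda>i x. F i x * G i x)" using k by (intro growth_imp_0[OF Suc.IH]) simp_all
  ultimately show ?case using Suc.prems by (intro growth_SucI) auto
qed

lemma growth_cmult:
  assumes "growth k m I F" "\<And>i. i \<in> I \<Longrightarrow> norm (c i) \<le> B"
  shows "growth k m I (\<lambda>i x. c i * F i x)" using growth_mult[OF growth_const[OF assms(2)] assms(1)] by simp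

lemma growth_diff:
  assumes "growth k m I F" "growth k m I G"
  shows "growth k m I (\<lambda>i x. F i x - G i x)"
  using growth_add[OF assms(1) growth_cmult[OF assms(2), of "\<lambda>_. -1" 1]] by simp

lemma growth_sum:
  assumes "\<And>a. a \<in> A \<Longrightarrow> growth k m I (F a)"
  shows "growth k m I (\<lambda>i x. \<Sum>a\<in>A. F a i x)"
  using assms by (induction A rule: infinite_finite_induct) (auto intro!: growth_add growth_zero)

lemma growth_power0:
  assumes "growth k 0 I F"
  shows "growth k 0 I (\<lambda>i x. F i x ^ L)"
proof (induction L)
  case 0 show ?case using growth_const[of I "\<lambda>_. 1" 1 k] by simp
next
  case (Suc L) show ?case using growth_mult[OF assms Suc] by simp
qed

lemma growth_power:
  assumes "growth k m I F"
  shows "growth k (of_nat L * m) I (\<lambda>i x. F i x ^ L)"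
proof (induction L)
  case 0 show ?case using growth_const[of I "\<lambda>_. 1" 1 k] by simp
next
  case (Suc L) show ?case using growth_mult[OF assms Suc] by (simp add: algebra_simps)
qed

lemma partial_inverse:
  assumes "f differentiable (at x)" "f x \<noteq> 0"
  shows "partial j (\<lambda>x. inverse (f x)) x = - (partial j f x * (inverse (f x) * inverse (f x)))"
proof -
  have "((\<lambda>x. inverse (f x)) has_derivative
      (\<lambda>h. - (inverse (f x) * frechet_derivative f (at x) h * inverse (f x)))) (at x)"
    using assms by (intro Deriv.has_derivative_inverse differentiable_has_derivative) auto
  from partial_eq[OF this] show ?thesis by (simp add: partial_def)
qed

text \<open>The order is stable under differentiation: the partial derivative of an inverse is
  \<open>- D' / D^2\<close>, of order \<open>m - 2 * m = - m\<close>. So a lower bound is needed for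
  \<open>D\<close> itself but never for its derivatives.\<close>

lemma growth_inverse:
  assumes "growth k m I D" "c > 0" "\<And>i x. i \<in> I \<Longrightarrow> c * (1 + norm x) powr m \<le> norm (D i x)"
  shows "growth k (- m) I (\<lambda>i x. inverse (D i x))" using assms(1)
proof (induction k)
  case 0
  have "norm (inverse (D i x)) \<le> inverse c * (1 + norm x) powr (- m)" if "i \<in> I" for i x
  proof -
    have "0 < c * (1 + norm x) powr m" using assms(2) by simp
    then have "inverse (norm (D i x)) \<le> inverse (c * (1 + norm x) powr m)"
      using assms(3)[OF that, of x] by (intro le_imp_inverse_le)
    then show ?thesis by (simp add: norm_inverse powr_minus)
  qed
  then show ?case by (rule growth_0I)
next
  case (Suc k)
  have IH: "growth k (- m) I (\<lambda>i x. inverse (D i x))" using Suc growth_le_k[of "Suc k" m I D k] by simp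
  have nz: "D i x \<noteq> 0" if "i \<in> I" for i x
  proof -
    have "0 < c * (1 + norm x) powr m" using assms(2) by simp
    with assms(3)[OF that, of x] show ?thesis by auto
  qed
  have "growth k (m + (- m + - m)) I (\<lambda>i x. partial j (D i) x * (inverse (D i x) * inverse (D i x)))" for j
    by (intro growth_mult IH growth_SucD(2)[OF Suc.prems])
  then have "growth k (- m) I (\<lambda>i x. (-1) * (partial j (D i) x * (inverse (D i x) * inverse (D i x))))" for j
    by (intro growth_cmult[where B=1]) auto
  moreover have "partial j (\<lambda>x. inverse (D i x)) =
      (\<lambda>x. (-1) * (partial j (D i) x * (inverse (D i x) * inverse (D i x))))" if "i \<in> I" for i j
    using Suc.prems that nz by (intro ext) (subst partial_inverse, auto)
  ultimately have "growth k (- m) I (\<lambda>i. partial j (\<lambda>x. inverse (D i x)))" for j by (subst growth_cong) auto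
  moreover have "(\<lambda>x. inverse (D i x)) differentiable (at x)" if "i \<in> I" for i x
    using nz that Suc.prems by (intro differentiable_inverse) auto
  ultimately show ?case using growth_imp_0[OF IH] by (intro growth_SucI)
qed

lemma bounded_linear_coord: "bounded_linear (\<lambda>x::real^'n::finite. complex_of_real (x $ l))"
  by (rule bounded_linear_compose[OF bounded_linear_of_real bounded_linear_vec_nth])

lemma partial_coord: "partial j (\<lambda>x::real^'n::finite. complex_of_real (x $ l)) = (\<lambda>x. if j = l then 1 else 0)"
proof
  fix x :: "real^'n"
  show "partial j (\<lambda>x. complex_of_real (x $ l)) x = (if j = l then 1 else 0)"
    by (subst partial_eq[OF bounded_linear_imp_has_derivative[OF bounded_linear_coord]]) (auto simp: axis_def)
qed

lemma growth_coord: "growth k 1 I (\<lambda>i x::real^'n::finite. complex_of_real (x $ l))"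
proof -
  have 0: "growth 0 1 I (\<lambda>i (x::real^'n). complex_of_real (x $ l))"
    by (rule growth_0I[where B=1]) (auto intro: order_trans[OF component_le_norm_cart])
  have "growth k 1 I (\<lambda>i. partial j (\<lambda>x::real^'n. complex_of_real (x $ l)))" for j k
    unfolding partial_coord by (intro growth_le_m[OF growth_const[where B=1]]) auto
  moreover have "(\<lambda>x. complex_of_real (x $ l)) differentiable (at x)" for x :: "real^'n"
    by (rule bounded_linear_imp_differentiable[OF bounded_linear_coord])
  ultimately show ?thesis using 0 by (cases k) (auto intro: growth_SucI)
qed

lemma has_derivative_exp_inner:
  "((\<lambda>x. exp (\<i> * complex_of_real (v \<bullet> x))) has_derivative
     (\<lambda>h. \<i> * complex_of_real (v \<bullet> h) * exp (\<i> * complex_of_real (v \<bullet> x)))) (at x)"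
proof -
  have "((\<lambda>x. \<i> * complex_of_real (v \<bullet> x)) has_derivative (\<lambda>h. \<i> * complex_of_real (v \<bullet> h))) (at x)"
    by (auto intro!: derivative_eq_intros)
  from has_derivative_compose[OF this DERIV_exp[unfolded has_field_derivative_def]]
  show ?thesis by (simp add: mult_ac)
qed

lemma partial_exp_inner:
  "partial j (\<lambda>x. exp (\<i> * complex_of_real (v \<bullet> x))) =
     (\<lambda>x. \<i> * complex_of_real (v $ j) * exp (\<i> * complex_of_real (v \<bullet> x)))"
  by (rule ext, subst partial_eq[OF has_derivative_exp_inner]) (auto simp: inner_axis)

lemma growth_exp_inner:
  assumes "\<And>i. i \<in> I \<Longrightarrow> norm (v i) \<le> B"
  shows "growth k 0 I (\<lambda>i x. exp (\<i> * complex_of_real (v i \<bullet> x)))"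
proof (induction k)
  case 0
  show ?case by (rule growth_0I[where B=1]) auto
next
  case (Suc k)
  have "growth k 0 I (\<lambda>i x. (\<i> * complex_of_real (v i $ j)) * exp (\<i> * complex_of_real (v i \<bullet> x)))" for j
    using assms by (intro growth_cmult[OF Suc, where B=B]) (auto simp: norm_mult intro: order_trans[OF component_le_norm_cart])
  moreover have "(\<lambda>x. exp (\<i> * complex_of_real (v i \<bullet> x))) differentiable (at x)" for i x
    using has_derivative_exp_inner differentiableI by blast
  ultimately show ?case by (intro growth_SucI growth_0I[where B=1]) (auto simp: partial_exp_inner)
qed

lemma partial_affine:
  assumes "f differentiable (at (c *\<^sub>R x + v))"
  shows "partial j (\<lambda>x. f (c *\<^sub>R x + v)) x = of_real c * partial j f (c *\<^sub>R x + v)"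
    and "(\<lambda>x. f (c *\<^sub>R x + v)) differentiable (at x)"
proof -
  let ?f' = "frechet_derivative f (at (c *\<^sub>R x + v))"
  have "((\<lambda>x. c *\<^sub>R x + v) has_derivative (\<lambda>h. c *\<^sub>R h)) (at x)" by (auto intro!: derivative_eq_intros)
  from has_derivative_compose[OF this differentiable_has_derivative[OF assms]]
  have d: "((\<lambda>x. f (c *\<^sub>R x + v)) has_derivative (\<lambda>h. ?f' (c *\<^sub>R h))) (at x)" .
  have "?f' (c *\<^sub>R axis j 1) = c *\<^sub>R ?f' (axis j 1)"
    using linear_frechet_derivative[OF assms] by (simp add: linear_cmul)
  then show "partial j (\<lambda>x. f (c *\<^sub>R x + v)) x = of_real c * partial j f (c *\<^sub>R x + v)"
    by (subst partial_eq[OF d]) (simp add: partial_def scaleR_conv_of_real)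
  show "(\<lambda>x. f (c *\<^sub>R x + v)) differentiable (at x)" using d differentiableI by blast
qed

text \<open>Differentiation only produces further factors \<open>c i\<close>, bounded by
  \<open>B\<close>, in front of derivatives of \<open>F i\<close> at the same point. Hence the
  single comparison of weights with constant \<open>K\<close> controls all orders at once. The
  factors \<open>w i\<close> compensate for translations that depend on the index.\<close>

lemma growth_affine:
  assumes "growth k m I F" "\<And>i. i \<in> I \<Longrightarrow> \<bar>c i\<bar> \<le> B"
    "\<And>i x. i \<in> I \<Longrightarrow> norm (w i) * (1 + norm (c i *\<^sub>R x + v i)) powr m \<le> K * (1 + norm x) powr m'"
  shows "growth k m' I (\<lambda>i x. w i * F i (c i *\<^sub>R x + v i))" using assms(1)
proof (induction k arbitrary: F)
  case 0
  obtain A where A: "A > 0" "\<And>i x. i \<in> I \<Longrightarrow> norm (F i x) \<le> A * (1 + norm x) powr m" using growthD[OF 0] by blast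
  have "norm (w i * F i (c i *\<^sub>R x + v i)) \<le> (A * K) * (1 + norm x) powr m'" if "i \<in> I" for i x
  proof -
    have "norm (w i * F i (c i *\<^sub>R x + v i)) \<le> norm (w i) * (A * (1 + norm (c i *\<^sub>R x + v i)) powr m)"
      unfolding norm_mult using A that by (intro mult_left_mono) auto
    also have "\<dots> = A * (norm (w i) * (1 + norm (c i *\<^sub>R x + v i)) powr m)" by simp
    also have "\<dots> \<le> A * (K * (1 + norm x) powr m')" using A assms(3)[OF that] by (intro mult_left_mono) auto
    finally show ?thesis by simp
  qed
  then show ?case by (rule growth_0I)
next
  case (Suc k)
  have IH: "growth k m' I (\<lambda>i x. w i * F i (c i *\<^sub>R x + v i))"
    using Suc.IH Suc.prems growth_le_k[of "Suc k" m I F k] by auto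
  have d: "F i differentiable (at x)" if "i \<in> I" for i x using Suc.prems that by auto
  have "partial j (\<lambda>x. w i * F i (c i *\<^sub>R x + v i)) =
      (\<lambda>x. of_real (c i) * (w i * partial j (F i) (c i *\<^sub>R x + v i)))" if "i \<in> I" for i j
    using partial_affine[OF d] that by (intro ext) (subst partial_mult, auto simp: partial_const)
  moreover have "growth k m' I (\<lambda>i x. of_real (c i) * (w i * partial j (F i) (c i *\<^sub>R x + v i)))" for j
    using assms(2) Suc.prems by (intro growth_cmult[where B=B] Suc.IH) auto
  ultimately have "growth k m' I (\<lambda>i. partial j (\<lambda>x. w i * F i (c i *\<^sub>R x + v i)))" for j
    by (subst growth_cong) auto
  moreover have "(\<lambda>x. w i * F i (c i *\<^sub>R x + v i)) differentiable (at x)" if "i \<in> I" for i x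
    using partial_affine(2)[OF d] that by (intro differentiable_mult) auto
  ultimately show ?case using growth_imp_0[OF IH] by (intro growth_SucI) auto
qed

section \<open>Bounded families of Schwartz functions under a tempered distribution\<close>

definition schwartz_family :: "'i set \<Rightarrow> ('i \<Rightarrow> 'n::finite cfun) \<Rightarrow> bool" where
  "schwartz_family I F \<longleftrightarrow> (\<forall>k m. growth k m I F)"

lemma growth_iter_partial:
  assumes "growth k m I F" "length js \<le> k"
  shows "growth (k - length js) m I (\<lambda>i. iter_partial js (F i))" using assms
proof (induction js)
  case (Cons j js)
  then have "growth (Suc (k - length (j # js))) m I (\<lambda>i. iter_partial js (F i))" by (simp add: Suc_diff_Suc)
  then show ?case by (simp only: iter_partial_Cons growth_SucD(2))
qed simp

lemma growth_of_iter_partial: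
  assumes "\<And>js x. iter_partial js f differentiable (at x)"
    "\<And>js. \<exists>B. \<forall>x. norm (iter_partial js f x) \<le> B * (1 + norm x) powr m" shows "growth k m I (\<lambda>_. f)" using assms
proof (induction k arbitrary: f)
  case 0 then show ?case using 0(2)[of "[]"] by auto
next
  case (Suc k)
  have "growth k m I (\<lambda>i. partial j f)" for j
    by (rule Suc.IH) (use Suc.prems in \<open>auto simp: iter_partial_snoc[symmetric] simp del: iter_partial.simps\<close>)
  then show ?case using Suc.prems[of "[]"] by (intro growth_SucI) auto
qed

lemma schwartz_imp_growth:
  assumes "schwartz \<phi>"
  shows "growth k m I (\<lambda>_. \<phi>)"
proof (rule growth_of_iter_partial)
  show "iter_partial js \<phi> differentiable (at x)" for js x using assms by (auto simp: schwartz_def)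
  fix js
  define N where "N = nat \<lceil>- m\<rceil>"
  obtain B where B: "\<And>x. (1 + norm x) ^ N * norm (iter_partial js \<phi> x) \<le> B"
    using assms unfolding schwartz_def by blast
  have "norm (iter_partial js \<phi> x) \<le> B * (1 + norm x) powr m" for x
  proof -
    have pos: "0 < 1 + norm x" by (simp add: add_pos_nonneg)
    have B0: "B \<ge> 0" using B[of 0] by (auto intro: order_trans[rotated])
    have "norm (iter_partial js \<phi> x) \<le> B * (1 + norm x) powr (- real N)"
      using B[of x] pos by (simp add: powr_minus powr_realpow field_simps)
    also have "\<dots> \<le> B * (1 + norm x) powr m"
      using B0 by (intro mult_left_mono powr_mono) (auto simp: N_def, linarith)
    finally show ?thesis .
  qed
  then show "\<exists>B. \<forall>x. norm (iter_partial js \<phi> x) \<le> B * (1 + norm x) powr m" by blast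
qed

lemma growth_iter_partial_bound:
  assumes "growth k (- real N) I F" "length js \<le> k"
  obtains B where "\<And>i x. i \<in> I \<Longrightarrow> (1 + norm x) ^ N * norm (iter_partial js (F i) x) \<le> B"
proof -
  obtain B where B: "B > 0" "\<And>i x. i \<in> I \<Longrightarrow> norm (iter_partial js (F i) x) \<le> B * (1 + norm x) powr (- real N)"
    using growthD[OF growth_iter_partial[OF assms]] by blast
  have "(1 + norm x) ^ N * norm (iter_partial js (F i) x) \<le> B" if "i \<in> I" for i x
  proof -
    have pos: "0 < 1 + norm x" by (simp add: add_pos_nonneg)
    show ?thesis using B(2)[OF that, of x] pos by (simp add: powr_minus powr_realpow field_simps)
  qed
  then show thesis by (rule that)
qed

lemma schwartz_iff_family: "schwartz \<phi> \<longleftrightarrow> schwartz_family {()} (\<lambda>_. \<phi>)"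
proof
  show "schwartz \<phi> \<Longrightarrow> schwartz_family {()} (\<lambda>_. \<phi>)" by (simp add: schwartz_family_def schwartz_imp_growth)
next
  assume f: "schwartz_family {()} (\<lambda>_. \<phi>)"
  have "iter_partial js \<phi> differentiable (at x)" for js x
  proof -
    have "growth (Suc (length js)) 0 {()} (\<lambda>_. \<phi>)" using f by (simp add: schwartz_family_def)
    from growth_iter_partial[OF this] have "growth (Suc 0) 0 {()} (\<lambda>i. iter_partial js \<phi>)"
      by (metis Suc_diff_le diff_self_eq_0 le_SucI order_refl)
    then show ?thesis by (auto dest: growth_SucD(1))
  qed
  moreover have "\<exists>B. \<forall>x. (1 + norm x) ^ N * norm (iter_partial js \<phi> x) \<le> B" for js N
    using growth_iter_partial_bound[of "length js" N "{()}" "\<lambda>_. \<phi>" js] f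
    by (metis insertI1 le_refl schwartz_family_def)
  ultimately show "schwartz \<phi>" by (auto simp: schwartz_def)
qed

lemma schwartz_familyD: "schwartz_family I F \<Longrightarrow> i \<in> I \<Longrightarrow> schwartz (F i)"
  unfolding schwartz_iff_family schwartz_family_def
  using growth_reindex[where J="{()}" and r="\<lambda>_. i" and I=I and F=F] by auto

lemma schwartz_imp_family: "schwartz \<phi> \<Longrightarrow> schwartz_family I (\<lambda>_. \<phi>)"
  by (simp add: schwartz_family_def schwartz_imp_growth)

text \<open>There are only finitely many lists of directions of length at most \<open>N\<close>, so
  the separate bounds have a maximum. Nonnegativity is recorded because the constant in the
  continuity of a distribution may be negative.\<close>

lemma seminorm_family_bound:
  fixes F :: "'i \<Rightarrow> 'n::finite cfun"
  assumes "growth N (- real N) I F"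
  shows "\<exists>B. \<forall>i\<in>I. 0 \<le> schwartz_seminorm N (F i) \<and> schwartz_seminorm N (F i) \<le> B"
proof -
  have "\<exists>B. \<forall>i\<in>I. \<forall>x. (1 + norm x) ^ N * norm (iter_partial js (F i) x) \<le> B" if "length js \<le> N" for js
    using growth_iter_partial_bound[OF assms that] by metis
  then obtain B where B: "\<And>js i x. length js \<le> N \<Longrightarrow> i \<in> I \<Longrightarrow>
      (1 + norm x) ^ N * norm (iter_partial js (F i) x) \<le> B js" by metis
  let ?J = "{js::'n list. length js \<le> N}"
  have fin: "finite ?J" using finite_lists_length_le[of "UNIV::'n set" N] by simp
  have "0 \<le> schwartz_seminorm N (F i) \<and> schwartz_seminorm N (F i) \<le> Max (B ` ?J)" if "i \<in> I" for i
  proof -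
    let ?S = "{(1 + norm x) ^ N * norm (iter_partial js (F i) x) |x js. length js \<le> N}"
    have le: "y \<le> Max (B ` ?J)" if y: "y \<in> ?S" for y
    proof -
      obtain x js where "y = (1 + norm x) ^ N * norm (iter_partial js (F i) x)" "length js \<le> N" using y by auto
      then have "y \<le> B js" "B js \<le> Max (B ` ?J)" using B \<open>i \<in> I\<close> fin by auto
      then show ?thesis by simp
    qed
    have "norm (F i 0) \<in> ?S" by (rule CollectI, rule exI[of _ 0], rule exI[of _ "[]"]) simp
    then have "norm (F i 0) \<le> Sup ?S" using le by (rule cSup_upper[OF _ bdd_aboveI])
    moreover have "Sup ?S \<le> Max (B ` ?J)" using \<open>norm (F i 0) \<in> ?S\<close> le by (intro cSup_least) blast+
    ultimately show ?thesis unfolding schwartz_seminorm_def using norm_ge_zero[of "F i 0"] by linarith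
  qed
  then show ?thesis by blast
qed

text \<open>Continuity in the form in which it is used: \<open>N\<close> depends on \<open>T\<close>
  and is fixed before the family, so that families can afterwards be built with weights of order
  \<open>N\<close>.\<close>

lemma tempered_bounded:
  assumes "tempered T"
  shows "\<exists>N. \<forall>(I::'i set) F. growth N (- real N) I F \<longrightarrow> (\<forall>i\<in>I. schwartz (F i)) \<longrightarrow>
    (\<exists>C. \<forall>i\<in>I. norm (T (F i)) \<le> C)"
proof -
  from assms obtain C N where CN: "\<And>\<phi>. schwartz \<phi> \<Longrightarrow> norm (T \<phi>) \<le> C * schwartz_seminorm N \<phi>"
    unfolding tempered_distributions_def by blast
  have "\<exists>C. \<forall>i\<in>I. norm (T (F i)) \<le> C" if g: "growth N (- real N) I F" "\<forall>i\<in>I. schwartz (F i)"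
    for I :: "'i set" and F
  proof -
    obtain B where B: "\<forall>i\<in>I. 0 \<le> schwartz_seminorm N (F i) \<and> schwartz_seminorm N (F i) \<le> B"
      using seminorm_family_bound[OF g(1)] by blast
    have "norm (T (F i)) \<le> \<bar>C\<bar> * B" if i: "i \<in> I" for i
    proof -
      have "norm (T (F i)) \<le> C * schwartz_seminorm N (F i)" using g(2) i by (intro CN) blast
      also have "\<dots> \<le> \<bar>C\<bar> * B" using B i by (intro mult_mono) auto
      finally show ?thesis .
    qed
    then show ?thesis by blast
  qed
  then show ?thesis by blast
qed

lemma tempered_linear:
  assumes "tempered T" "schwartz \<phi>" "schwartz \<theta>"
  shows "T (\<lambda>x. a * \<phi> x + b * \<theta> x) = a * T \<phi> + b * T \<theta>"
  using assms unfolding tempered_distributions_def by blast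

section \<open>Integrals depending on a parameter\<close>

lemma has_derivative_partials:
  fixes f :: "'n::finite cfun"
  assumes "f differentiable (at x)"
  shows "(f has_derivative (\<lambda>h. \<Sum>l\<in>UNIV. of_real (h $ l) * partial l f x)) (at x)"
proof -
  let ?f' = "frechet_derivative f (at x)"
  have lin: "linear ?f'" by (rule linear_frechet_derivative[OF assms])
  have "?f' h = (\<Sum>l\<in>UNIV. of_real (h $ l) * partial l f x)" for h
  proof -
    have "?f' h = ?f' (\<Sum>l\<in>UNIV. (h $ l) *\<^sub>R axis l 1)"
      using basis_expansion[of h] by (simp add: scalar_mult_eq_scaleR)
    then show ?thesis unfolding partial_def scaleR_conv_of_real[symmetric] by (simp add: linear_sum[OF lin] linear_cmul[OF lin])
  qed
  then show ?thesis using differentiable_has_derivative[OF assms] by presburger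
qed

lemma powr_le_powr_abs:
  fixes a b m :: real
  assumes "1 \<le> a" "a \<le> b"
  shows "a powr m \<le> b powr \<bar>m\<bar>"
proof -
  have "a powr m \<le> a powr \<bar>m\<bar>" using assms by (intro powr_mono) linarith+
  also have "\<dots> \<le> b powr \<bar>m\<bar>" using assms by (intro powr_mono2) auto
  finally show ?thesis .
qed

text \<open>The mean value inequality on the ball of radius \<open>norm x + norm y\<close>, which is
  convex and contains both points. There a weight of order \<open>m\<close> is at most the power
  \<open>abs m\<close> of \<open>1 + norm x + norm y\<close>, whatever the sign of
  \<open>m\<close>.\<close>

lemma growth_mean_value:
  fixes F :: "'i \<Rightarrow> 'n::finite cfun"
  assumes "growth (Suc 0) m I F"
  shows "\<exists>B>0. (\<forall>i\<in>I. \<forall>x y. norm (F i y - F i x) \<le> B * (1 + norm x + norm y) powr \<bar>m\<bar> * norm (y - x)) \<and>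
    (\<forall>i\<in>I. \<forall>x h. norm (\<Sum>l\<in>UNIV. of_real (h $ l) * partial l (F i) x) \<le> B * (1 + norm x) powr m * norm h)"
proof -
  let ?L = "\<lambda>i z h. \<Sum>l\<in>UNIV. of_real (h $ l) * partial l (F i) z"
  have "\<exists>B>0. \<forall>i\<in>I. \<forall>x. norm (partial l (F i) x) \<le> B * (1 + norm x) powr m" for l
    by (rule growthD[OF growth_SucD(2)[OF assms]])
  then obtain A where A: "\<And>l. A l > 0" "\<And>l i x. i \<in> I \<Longrightarrow> norm (partial l (F i) x) \<le> A l * (1 + norm x) powr m"
    by metis
  define B where "B = (\<Sum>l\<in>UNIV. A l)"
  have B: "B > 0" unfolding B_def using A by (intro sum_pos) auto
  have 1: "norm (?L i x h) \<le> B * (1 + norm x) powr m * norm h" if "i \<in> I" for i x h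
  proof -
    have "norm (?L i x h) \<le> (\<Sum>l\<in>UNIV. norm h * (A l * (1 + norm x) powr m))"
      using A that component_le_norm_cart[of h] by (intro sum_norm_le) (auto simp: norm_mult intro!: mult_mono)
    also have "\<dots> = B * (1 + norm x) powr m * norm h" by (simp add: B_def sum_distrib_left sum_distrib_right mult_ac)
    finally show ?thesis .
  qed
  have 2: "norm (F i y - F i x) \<le> B * (1 + norm x + norm y) powr \<bar>m\<bar> * norm (y - x)" if i: "i \<in> I" for i x y
  proof (rule differentiable_bound[where S="cball 0 (norm x + norm y)" and f'="?L i"])
    fix z :: "real^'n" assume z: "z \<in> cball 0 (norm x + norm y)"
    show "(F i has_derivative (?L i z)) (at z within cball 0 (norm x + norm y))"
      by (rule has_derivative_at_withinI, rule has_derivative_partials, rule growth_SucD(1)[OF assms i])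
    show "onorm (?L i z) \<le> B * (1 + norm x + norm y) powr \<bar>m\<bar>"
    proof (rule onorm_bound)
      fix h
      have "norm (?L i z h) \<le> B * (1 + norm z) powr m * norm h" by (rule 1[OF i])
      also have "\<dots> \<le> B * (1 + norm x + norm y) powr \<bar>m\<bar> * norm h"
        using B z by (intro mult_right_mono mult_left_mono powr_le_powr_abs) auto
      finally show "norm (?L i z h) \<le> B * (1 + norm x + norm y) powr \<bar>m\<bar> * norm h" .
    qed (use B in auto)
  qed auto
  show ?thesis using B 1 2 by (intro exI[of _ B] conjI ballI allI)
qed

text \<open>A partial derivative as the limit of a sequence: this transfers measurability in a
  parameter from functions to their derivatives.\<close>

lemma partial_sequence_limit:
  fixes f :: "'n::finite cfun"
  assumes "f differentiable (at z)"
  shows "(\<lambda>n. of_nat (Suc n) * (f (z + (1 / real (Suc n)) *\<^sub>R axis j 1) - f z)) \<longlonglongrightarrow> partial j f z"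
proof -
  let ?X = "\<lambda>n. (1 / real (Suc n)) *\<^sub>R axis j 1 :: real^'n"
  let ?L = "\<lambda>h. \<Sum>l\<in>UNIV. of_real (h $ l) * partial l f z"
  have "(\<lambda>h. norm (f (z + h) - f z - ?L h) / norm h) \<midarrow>0\<rightarrow> 0"
    using has_derivative_partials[OF assms] unfolding has_derivative_at by simp
  moreover have "?X \<longlonglongrightarrow> 0"
    using tendsto_scaleR[OF LIMSEQ_inverse_real_of_nat tendsto_const, of "axis j 1 :: real^'n"] by (simp add: inverse_eq_divide)
  ultimately have *: "(\<lambda>n. norm (f (z + ?X n) - f z - ?L (?X n)) / norm (?X n)) \<longlonglongrightarrow> 0"
    unfolding tendsto_at_iff_sequentially comp_def
    by (auto dest!: spec[of _ ?X] simp: axis_eq_0_iff simp del: of_nat_Suc norm_scaleR)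
  have L: "?L (?X n) = of_real (1 / real (Suc n)) * partial j f z" for n
  proof -
    have "?L (?X n) = (\<Sum>l\<in>UNIV. if l = j then of_real (1 / real (Suc n)) * partial j f z else 0)"
      by (intro sum.cong) (auto simp: axis_def)
    then show ?thesis by simp
  qed
  have "norm (f (z + ?X n) - f z - ?L (?X n)) / norm (?X n) =
      norm (of_nat (Suc n) * (f (z + ?X n) - f z) - partial j f z)" for n
  proof -
    have "of_nat (Suc n) * (f (z + ?X n) - f z) - partial j f z
        = of_nat (Suc n) * (f (z + ?X n) - f z - ?L (?X n))"
      unfolding L by (simp add: right_diff_distrib del: of_nat_Suc)
    then have "norm (of_nat (Suc n) * (f (z + ?X n) - f z) - partial j f z)
       = real (Suc n) * norm (f (z + ?X n) - f z - ?L (?X n))" by (simp add: norm_mult del: of_nat_Suc)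
    then show ?thesis by simp
  qed
  with * have "(\<lambda>n. norm (of_nat (Suc n) * (f (z + ?X n) - f z) - partial j f z)) \<longlonglongrightarrow> 0" by simp
  then show ?thesis by (simp add: LIM_zero_iff tendsto_norm_zero_iff)
qed

lemma norm_scaleR_inverse_norm:
  fixes v :: "'a::real_normed_vector" and w :: "'b::real_normed_vector"
  shows "norm (v /\<^sub>R norm w) = norm v / norm w" by (simp add: divide_inverse)

lemma integrable_growth:
  assumes a: "integrable M a" and meas: "(\<lambda>y. G y z) \<in> borel_measurable M" and g: "growth k m UNIV G"
  shows "integrable M (\<lambda>y. a y * G y z)"
proof -
  obtain B where B: "B > 0" "\<And>y x. norm (G y x) \<le> B * (1 + norm x) powr m" using growthD[OF g] by blast
  show ?thesis
  proof (rule Bochner_Integration.integrable_bound)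
    show "integrable M (\<lambda>y. (B * (1 + norm z) powr m) * norm (a y))" using a by simp
    show "(\<lambda>y. a y * G y z) \<in> borel_measurable M"
      using borel_measurable_integrable[OF a] meas by (rule borel_measurable_times)
    show "AE y in M. norm (a y * G y z) \<le> norm ((B * (1 + norm z) powr m) * norm (a y))"
      using mult_right_mono[OF B(2) norm_ge_zero] B(1) by (intro AE_I2) (simp add: norm_mult mult.commute abs_mult)
  qed
qed

context
  fixes M :: "'y measure" and G :: "'y \<Rightarrow> 'n::finite cfun"
  assumes meas: "\<And>z. (\<lambda>y. G y z) \<in> borel_measurable M"
begin

lemma borel_measurable_partial:
  assumes "\<And>y z. G y differentiable (at z)"
  shows "(\<lambda>y. partial j (G y) z) \<in> borel_measurable M"
  by (rule borel_measurable_LIMSEQ_metric[OF _ partial_sequence_limit[OF assms]])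
    (intro borel_measurable_times borel_measurable_diff meas borel_measurable_const)

text \<open>Differentiation under the integral sign by dominated convergence. The growth of the
  integrands and of their partial derivatives is uniform in \<open>y\<close>, so the majorant is a
  multiple of \<open>norm (a y)\<close>.\<close>

lemma param_has_derivative:
  assumes a: "integrable M a" and g: "growth (Suc 0) m UNIV G"
  shows "((\<lambda>z. \<integral>y. a y * G y z \<partial>M) has_derivative
          (\<lambda>h. \<Sum>l\<in>UNIV. of_real (h $ l) * (\<integral>y. a y * partial l (G y) z \<partial>M))) (at z)" unfolding has_derivative_at
proof
  have d: "G y differentiable (at z)" for y z by (rule growth_SucD(1)[OF g]) auto
  let ?L = "\<lambda>y h. \<Sum>l\<in>UNIV. of_real (h $ l) * partial l (G y) z"
  let ?I = "\<lambda>h. \<Sum>l\<in>UNIV. of_real (h $ l) * (\<integral>y. a y * partial l (G y) z \<partial>M)"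
  show "bounded_linear ?I" by (intro bounded_linear_sum bounded_linear_mult_const bounded_linear_coord)
  obtain B where B: "B > 0"
    "\<forall>i\<in>UNIV. \<forall>x y. norm (G i y - G i x) \<le> B * (1 + norm x + norm y) powr \<bar>m\<bar> * norm (y - x)"
    "\<forall>i\<in>UNIV. \<forall>x h. norm (\<Sum>l\<in>UNIV. of_real (h $ l) * partial l (G i) x) \<le> B * (1 + norm x) powr m * norm h"
    using growth_mean_value[OF g] by (elim exE conjE)
  have intpart: "integrable M (\<lambda>y. a y * partial l (G y) z)" for l
    by (rule integrable_growth[OF a borel_measurable_partial[OF d] growth_SucD(2)[OF g]])
  have I: "?I h = (\<integral>y. a y * ?L y h \<partial>M)" and intL: "integrable M (\<lambda>y. a y * ?L y h)" for h
  proof -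
    have "a y * ?L y h = (\<Sum>l\<in>UNIV. of_real (h $ l) * (a y * partial l (G y) z))" for y
      by (simp add: sum_distrib_left mult_ac)
    then show "?I h = (\<integral>y. a y * ?L y h \<partial>M)" "integrable M (\<lambda>y. a y * ?L y h)"
      using intpart by (auto simp: Bochner_Integration.integral_sum)
  qed
  show "(\<lambda>h. norm ((\<integral>y. a y * G y (z + h) \<partial>M) - (\<integral>y. a y * G y z \<partial>M) - ?I h) / norm h) \<midarrow>0\<rightarrow> 0"
    unfolding tendsto_at_iff_sequentially comp_def
  proof safe
    fix X :: "nat \<Rightarrow> real^'n" assume X: "\<forall>i. X i \<in> UNIV - {0}" "X \<longlonglongrightarrow> 0"
    have Xn: "X i \<noteq> 0" for i using X by auto
    obtain K where K: "\<And>i. norm (X i) \<le> K"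
      using X(2) convergent_imp_Bseq[of X] by (auto simp: convergent_def Bseq_def)
    \<comment> \<open>Bounds the remainder divided by \<open>norm (X n)\<close>: the increment by
      the mean value inequality with \<open>norm (z + X n) \<le> norm z + K\<close>, the
      differential by the second half of \<open>growth_mean_value\<close>.\<close>
    define C where "C = B * (1 + norm z + (norm z + K)) powr \<bar>m\<bar> + B * (1 + norm z) powr m"
    let ?r = "\<lambda>n y. (G y (z + X n) - G y z - ?L y (X n)) /\<^sub>R norm (X n)"
    have lim: "(\<lambda>n. \<integral>y. a y * ?r n y \<partial>M) \<longlonglongrightarrow> (\<integral>y. 0 \<partial>M)"
    proof (rule integral_dominated_convergence[where w="\<lambda>y. C * norm (a y)"])
      show "integrable M (\<lambda>y. C * norm (a y))" using a by simp
      have [measurable]: "(\<lambda>y. G y z) \<in> borel_measurable M" "\<And>l. (\<lambda>y. partial l (G y) z) \<in> borel_measurable M"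
        "a \<in> borel_measurable M" for z using meas borel_measurable_partial d a by auto
      show "(\<lambda>y. a y * ?r n y) \<in> borel_measurable M" for n by measurable
      show "AE y in M. (\<lambda>n. a y * ?r n y) \<longlonglongrightarrow> 0"
      proof (rule AE_I2)
        fix y
        have "(\<lambda>h. norm (G y (z + h) - G y z - ?L y h) / norm h) \<midarrow>0\<rightarrow> 0"
          using has_derivative_partials[OF d] unfolding has_derivative_at by simp
        then have "(\<lambda>n. norm (G y (z + X n) - G y z - ?L y (X n)) / norm (X n)) \<longlonglongrightarrow> 0"
          using X unfolding tendsto_at_iff_sequentially comp_def by auto
        then have "(\<lambda>n. norm (?r n y)) \<longlonglongrightarrow> 0" by (simp add: divide_inverse mult_ac)
        then have "(\<lambda>n. ?r n y) \<longlonglongrightarrow> 0" by (rule tendsto_norm_zero_cancel)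
        from tendsto_mult[OF tendsto_const this] show "(\<lambda>n. a y * ?r n y) \<longlonglongrightarrow> 0" by simp
      qed
      show "AE y in M. norm (a y * ?r n y) \<le> C * norm (a y)" for n
      proof (rule AE_I2)
        fix y
        have "norm (G y (z + X n) - G y z - ?L y (X n)) \<le> norm (G y (z + X n) - G y z) + norm (?L y (X n))"
          by (rule norm_triangle_ineq4)
        also have "\<dots> \<le> B * (1 + norm z + norm (z + X n)) powr \<bar>m\<bar> * norm (X n) + B * (1 + norm z) powr m * norm (X n)"
          using B(2)[rule_format, OF UNIV_I, of y "z + X n" z] B(3)[rule_format, OF UNIV_I, of "X n" y z] by (intro add_mono) auto
        also have "\<dots> \<le> C * norm (X n)"
        proof -
          have "(1 + norm z + norm (z + X n)) powr \<bar>m\<bar> \<le> (1 + norm z + (norm z + K)) powr \<bar>m\<bar>"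
            using norm_triangle_ineq[of z "X n"] K[of n] by (intro powr_mono2) auto
          then show ?thesis using B(1) unfolding C_def distrib_right
            by (intro add_mono mult_right_mono mult_left_mono) auto
        qed
        finally have "norm (G y (z + X n) - G y z - ?L y (X n)) / norm (X n) \<le> C"
          by (subst pos_divide_le_eq) (simp_all only: zero_less_norm_iff Xn not_False_eq_True)
        then have "norm (?r n y) \<le> C" unfolding norm_scaleR_inverse_norm .
        from mult_right_mono[OF this norm_ge_zero[of "a y"]] show "norm (a y * ?r n y) \<le> C * norm (a y)"
          by (simp only: norm_mult mult.commute[of "norm (a y)"])
      qed
    qed simp_all
    have eq: "(\<integral>y. a y * ?r n y \<partial>M) =
        ((\<integral>y. a y * G y (z + X n) \<partial>M) - (\<integral>y. a y * G y z \<partial>M) - ?I (X n)) /\<^sub>R norm (X n)" for n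
    proof -
      have "a y * ?r n y = (a y * G y (z + X n) - a y * G y z - a y * ?L y (X n)) /\<^sub>R norm (X n)" for y
        by (simp add: algebra_simps)
      then have "(\<integral>y. a y * ?r n y \<partial>M) = (\<integral>y. (a y * G y (z + X n) - a y * G y z - a y * ?L y (X n)) /\<^sub>R norm (X n) \<partial>M)"
        by presburger
      also have "\<dots> = (\<integral>y. a y * G y (z + X n) - a y * G y z - a y * ?L y (X n) \<partial>M) /\<^sub>R norm (X n)"
        by (rule integral_scaleR_right)
      also have "\<dots> = ((\<integral>y. a y * G y (z + X n) \<partial>M) - (\<integral>y. a y * G y z \<partial>M) - (\<integral>y. a y * ?L y (X n) \<partial>M)) /\<^sub>R norm (X n)"
        by (simp only: Bochner_Integration.integral_diff Bochner_Integration.integrable_diff intL integrable_growth[OF a meas g])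
      finally show ?thesis by (simp only: I)
    qed
    show "(\<lambda>n. norm ((\<integral>y. a y * G y (z + X n) \<partial>M) - (\<integral>y. a y * G y z \<partial>M) - ?I (X n)) / norm (X n)) \<longlonglongrightarrow> 0"
      using tendsto_norm_zero[OF lim[unfolded eq Bochner_Integration.integral_zero]]
      unfolding norm_scaleR_inverse_norm .
  qed
qed

lemma param_partial:
  assumes a: "integrable M a" and g: "growth (Suc 0) m UNIV G"
  shows "partial j (\<lambda>z. \<integral>y. a y * G y z \<partial>M) = (\<lambda>z. \<integral>y. a y * partial j (G y) z \<partial>M)"
    and "(\<lambda>z. \<integral>y. a y * G y z \<partial>M) differentiable (at z)"
proof -
  have "partial j (\<lambda>z. \<integral>y. a y * G y z \<partial>M) z = (\<integral>y. a y * partial j (G y) z \<partial>M)" for z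
  proof -
    have "(\<Sum>l\<in>UNIV. complex_of_real ((axis j 1 :: real^'n) $ l) * (\<integral>y. a y * partial l (G y) z \<partial>M))
       = (\<Sum>l\<in>UNIV. if l = j then (\<integral>y. a y * partial j (G y) z \<partial>M) else 0)"
      by (intro sum.cong) (auto simp: axis_def)
    then show ?thesis by (subst partial_eq[OF param_has_derivative[OF a g]]) simp
  qed
  then show "partial j (\<lambda>z. \<integral>y. a y * G y z \<partial>M) = (\<lambda>z. \<integral>y. a y * partial j (G y) z \<partial>M)" by blast
  show "(\<lambda>z. \<integral>y. a y * G y z \<partial>M) differentiable (at z)"
    using param_has_derivative[OF a g] differentiableI by blast
qed

end

text \<open>A superposition inherits the growth of its integrands as long as the densities
  \<open>a i\<close> stay bounded in \<open>L^1\<close>. Differentiation under the integral sign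
  keeps the densities and lowers \<open>k\<close> by one.\<close>

lemma growth_param_integral:
  assumes "\<And>i z. i \<in> I \<Longrightarrow> (\<lambda>y. G i y z) \<in> borel_measurable M" "growth k m (I \<times> UNIV) (\<lambda>p. G (fst p) (snd p))"
    and a: "\<And>i. i \<in> I \<Longrightarrow> integrable M (a i)" "\<And>i. i \<in> I \<Longrightarrow> (\<integral>y. norm (a i y) \<partial>M) \<le> A"
  shows "growth k m I (\<lambda>i z. \<integral>y. a i y * G i y z \<partial>M)" using assms(1,2)
proof (induction k arbitrary: G)
  case 0
  obtain B where B: "B > 0" "\<And>i y x. i \<in> I \<Longrightarrow> norm (G i y x) \<le> B * (1 + norm x) powr m"
    using growthD[OF 0(2)] by auto
  show ?case
  proof (rule growth_0I)
    fix i z assume i: "i \<in> I"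
    have g: "growth 0 m UNIV (G i)" using growth_reindex[OF 0(2), of UNIV "\<lambda>y. (i, y)"] i by simp
    have "norm (\<integral>y. a i y * G i y z \<partial>M) \<le> (\<integral>y. norm (a i y * G i y z) \<partial>M)" by (rule integral_norm_bound)
    also have "\<dots> \<le> (\<integral>y. (B * (1 + norm z) powr m) * norm (a i y) \<partial>M)"
    proof (rule integral_mono)
      show "integrable M (\<lambda>y. norm (a i y * G i y z))"
        by (intro integrable_norm integrable_growth[OF a(1)[OF i] 0(1)[OF i] g])
      show "integrable M (\<lambda>y. (B * (1 + norm z) powr m) * norm (a i y))" using a(1)[OF i] by simp
      show "norm (a i y * G i y z) \<le> (B * (1 + norm z) powr m) * norm (a i y)" for y
        using mult_right_mono[OF B(2)[OF i, of y z] norm_ge_zero[of "a i y"]] by (simp only: norm_mult mult.commute)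
    qed
    also have "\<dots> = (B * (1 + norm z) powr m) * (\<integral>y. norm (a i y) \<partial>M)" by simp
    also have "\<dots> \<le> (B * (1 + norm z) powr m) * A" using a(2)[OF i] B(1) by (intro mult_left_mono) auto
    finally show "norm (\<integral>y. a i y * G i y z \<partial>M) \<le> (B * A) * (1 + norm z) powr m" by (simp add: mult_ac)
  qed
next
  case (Suc k)
  have g1: "growth (Suc 0) m UNIV (G i)" if "i \<in> I" for i
    using growth_reindex[OF growth_le_k[OF Suc.prems(2), of "Suc 0"], of UNIV "\<lambda>y. (i, y)"] that by simp
  have d: "G i y differentiable (at z)" if "i \<in> I" for i y z using growth_SucD(1)[OF g1[OF that]] by simp
  have "growth k m I (\<lambda>i z. \<integral>y. a i y * partial j (G i y) z \<partial>M)" for j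
    using borel_measurable_partial[OF Suc.prems(1) d] growth_SucD(2)[OF Suc.prems(2)] by (intro Suc.IH) auto
  then have 1: "growth k m I (\<lambda>i. partial j (\<lambda>z. \<integral>y. a i y * G i y z \<partial>M))" for j
    by (subst growth_cong) (simp_all only: param_partial(1)[OF Suc.prems(1) a(1) g1])
  have "growth k m I (\<lambda>i z. \<integral>y. a i y * G i y z \<partial>M)"
    by (intro Suc.IH Suc.prems growth_le_k[OF Suc.prems(2)]) auto
  from growth_imp_0[OF this] 1 show ?case
    using param_partial(2)[OF Suc.prems(1) a(1) g1] by (intro growth_SucI) auto
qed

section \<open>Integrability of Schwartz functions\<close>

lemma integrable_inverse_1_plus_square:
  "(NN x. ennreal (inverse (1 + x\<^sup>2))) < \<infinity>"
proof -
  have "set_integrable lborel (einterval (-\<infinity>) \<infinity>) (\<lambda>x. inverse (1 + x^2))"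
    by (rule integrable_inverse_1_plus_square)
  then have "integrable lborel (\<lambda>x::real. inverse (1 + x\<^sup>2))" by (simp add: set_integrable_def)
  then show ?thesis by (simp add: integrable_iff_bounded)
qed

text \<open>The exponent is \<open>2 * n\<close> because the weight is then dominated by the product
  over the coordinates of \<open>1 / (1 + x_b^2)\<close>, whose integrals are known.\<close>

definition weight_exponent :: "'n::finite itself \<Rightarrow> real" where
  "weight_exponent _ = 2 * real CARD('n)"

lemma nn_integral_weight:
  assumes "M \<ge> weight_exponent TYPE('n)"
  shows "(NN x. ennreal ((1 + norm (x :: real^'n::finite)) powr (- M))) < \<infinity>"
proof -
  have le: "(1 + norm x) powr (- M) \<le> (\<Prod>b\<in>Basis. inverse (1 + (x \<bullet> b)\<^sup>2))" for x :: "real^'n"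
  proof -
    have "(1 + norm x) powr (- M) \<le> (1 + norm x) powr (- real (2 * CARD('n)))"
      using assms by (intro powr_mono) (auto simp: weight_exponent_def)
    also have "\<dots> = (\<Prod>b\<in>(Basis::(real^'n) set). inverse ((1 + norm x)^2))"
      by (simp add: powr_minus powr_realpow power_mult power_inverse del: of_nat_mult)
    also have "\<dots> \<le> (\<Prod>b\<in>Basis. inverse (1 + (x \<bullet> b)\<^sup>2))"
    proof (intro prod_mono conjI le_imp_inverse_le)
      fix b :: "real^'n" assume b: "b \<in> Basis"
      have "(x \<bullet> b)\<^sup>2 \<le> (norm x)\<^sup>2" using Basis_le_norm[OF b, of x] by (metis abs_le_square_iff abs_norm_cancel)
      then show "1 + (x \<bullet> b)\<^sup>2 \<le> (1 + norm x)\<^sup>2" by (simp add: power2_sum add_increasing2)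
      show "0 < 1 + (x \<bullet> b)\<^sup>2" by (rule add_pos_nonneg) auto
    qed auto
    finally show ?thesis .
  qed
  have "(NN x. ennreal ((1 + norm (x::real^'n)) powr (- M)))
      \<le> (NN x. (\<Prod>b\<in>Basis. ennreal (inverse (1 + ((x::real^'n) \<bullet> b)\<^sup>2))))"
    using le by (intro nn_integral_mono) (auto simp: prod_ennreal intro!: ennreal_leI)
  also have "\<dots> = (\<Prod>b\<in>(Basis::(real^'n) set). (NN x. ennreal (inverse (1 + x\<^sup>2))))"
    by (rule nn_integral_lborel_prod) auto
  also have "\<dots> < \<infinity>" using integrable_inverse_1_plus_square by (simp add: power_less_top_ennreal)
  finally show ?thesis .
qed

lemma integrable_weight:
  assumes "M \<ge> weight_exponent TYPE('n)"
  shows "integrable lborel (\<lambda>x::real^'n::finite. (1 + norm x) powr (- M))"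
  using nn_integral_weight[OF assms] by (simp add: integrable_iff_bounded)

lemma schwartz_differentiable: "schwartz f \<Longrightarrow> f differentiable (at x)"
  using schwartz_def iter_partial.simps(1) by metis

lemma schwartz_continuous: "schwartz f \<Longrightarrow> continuous_on A f"
  using schwartz_differentiable differentiable_imp_continuous_within by (metis continuous_at_imp_continuous_on)

lemma schwartz_measurable [measurable_dest]: "schwartz f \<Longrightarrow> f \<in> borel_funs"
  by (rule borel_measurable_continuous_onI[OF schwartz_continuous])

lemma growth_integrable:
  fixes F :: "'i \<Rightarrow> 'n::finite cfun"
  assumes "growth k (- weight_exponent TYPE('n)) I F"
  shows "\<exists>A>0. \<forall>i\<in>I. F i \<in> borel_funs \<longrightarrow> integrable lborel (F i) \<and> (LBINT x. norm (F i x)) \<le> A"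
proof -
  let ?W = "- weight_exponent TYPE('n)"
  obtain B where B: "B > 0" "\<And>i x. i \<in> I \<Longrightarrow> norm (F i x) \<le> B * (1 + norm x) powr ?W"
    using growthD[OF assms] by blast
  let ?A = "integral\<^sup>L lborel (\<lambda>x::real^'n. B * (1 + norm x) powr ?W)"
  have i: "integrable lborel (\<lambda>x::real^'n. B * (1 + norm x) powr ?W)"
    using integrable_weight[OF order_refl, where 'n='n] by simp
  have "integrable lborel (F i) \<and> (LBINT x. norm (F i x)) \<le> ?A + 1" if "i \<in> I" "F i \<in> borel_funs" for i
  proof -
    have *: "integrable lborel (F i)"
      using B that by (intro Bochner_Integration.integrable_bound[OF i]) (auto simp: abs_mult)
    have "(LBINT x. norm (F i x)) \<le> ?A" using B that * i by (intro integral_mono) auto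
    with * show ?thesis by simp
  qed
  moreover have "?A \<ge> 0" using B(1) by (intro integral_nonneg_AE) auto
  ultimately show ?thesis by (intro exI[of _ "?A + 1"]) auto
qed

lemma growth_integrable_single:
  fixes f :: "'n::finite cfun"
  assumes "growth 0 (- weight_exponent TYPE('n)) {()} (\<lambda>_. f)" "f \<in> borel_funs"
  shows "integrable lborel f" using growth_integrable[OF assms(1)] assms(2) by auto

lemma schwartz_integrable:
  fixes f :: "'n::finite cfun"
  shows "schwartz f \<Longrightarrow> integrable lborel f"
  by (rule growth_integrable_single[OF schwartz_imp_growth schwartz_measurable])

lemma integral_lborel_affine:
  fixes f :: "'a::euclidean_space \<Rightarrow> 'b::{banach, second_countable_topology}"
  assumes "c \<noteq> 0" "f \<in> borel_funs"
  shows "(LBINT x. f (t + c *\<^sub>R x)) = (1 / \<bar>c\<bar> ^ DIM('a)) *\<^sub>R (LBINT x. f x)"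
proof -
  have "(LBINT x. f x) = (\<integral>x. f x \<partial>density (distr lborel borel (\<lambda>x. t + c *\<^sub>R x)) (\<lambda>_. ennreal (\<bar>c\<bar> ^ DIM('a))))"
    using lborel_affine[OF assms(1)] by metis
  also have "\<dots> = \<bar>c\<bar> ^ DIM('a) *\<^sub>R (LBINT x. f (t + c *\<^sub>R x))"
    using assms(2) by (simp add: integral_density integral_distr)
  finally show ?thesis using assms(1) by simp
qed

lemma nn_integral_lborel_affine:
  fixes f :: "'a::euclidean_space \<Rightarrow> ennreal"
  assumes "c \<noteq> 0" "f \<in> borel_funs"
  shows "(NN x. f (t + c *\<^sub>R x)) = ennreal (1 / \<bar>c\<bar> ^ DIM('a)) * (NN x. f x)"
proof -
  have "(NN x. f x) = (\<integral>\<^sup>+x. f x \<partial>density (distr lborel borel (\<lambda>x. t + c *\<^sub>R x)) (\<lambda>_. ennreal (\<bar>c\<bar> ^ DIM('a))))"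
    using lborel_affine[OF assms(1)] by metis
  also have "\<dots> = ennreal (\<bar>c\<bar> ^ DIM('a)) * (NN x. f (t + c *\<^sub>R x))"
    using assms(2) by (simp add: nn_integral_density nn_integral_distr nn_integral_cmult)
  finally show ?thesis using assms(1) by (simp add: mult.assoc[symmetric] ennreal_mult[symmetric])
qed

section \<open>The Fourier transform on the Schwartz space\<close>

lemma schwartz_family_mult:
  assumes "schwartz_family I F" "\<And>k. growth k m I G"
  shows "schwartz_family I (\<lambda>i x. F i x * G i x)" unfolding schwartz_family_def
proof safe
  fix k m'
  have "growth k (m' - m) I F" using assms(1) by (simp add: schwartz_family_def)
  from growth_mult[OF this assms(2)[of k]] show "growth k m' I (\<lambda>i x. F i x * G i x)" by simp
qed

lemma schwartz_family_mult':
  "schwartz_family I F \<Longrightarrow> schwartz_family I G \<Longrightarrow> schwartz_family I (\<lambda>i x. F i x * G i x)"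
  by (rule schwartz_family_mult[where m=0]) (auto simp: schwartz_family_def)

lemma schwartz_family_partial: "schwartz_family I F \<Longrightarrow> schwartz_family I (\<lambda>i. partial j (F i))"
  unfolding schwartz_family_def using growth_SucD(2) by blast

lemma schwartz_family_add:
  "schwartz_family I F \<Longrightarrow> schwartz_family I G \<Longrightarrow> schwartz_family I (\<lambda>i x. F i x + G i x)"
  unfolding schwartz_family_def by (blast intro: growth_add)

lemma schwartz_family_diff:
  "schwartz_family I F \<Longrightarrow> schwartz_family I G \<Longrightarrow> schwartz_family I (\<lambda>i x. F i x - G i x)"
  unfolding schwartz_family_def by (blast intro: growth_diff)

lemma schwartz_family_sum:
  "(\<And>a. a \<in> A \<Longrightarrow> schwartz_family I (F a)) \<Longrightarrow> schwartz_family I (\<lambda>i x. \<Sum>a\<in>A. F a i x)"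
  unfolding schwartz_family_def by (blast intro: growth_sum)

lemma schwartz_family_cmult:
  "schwartz_family I F \<Longrightarrow> (\<And>i. i \<in> I \<Longrightarrow> norm (c i) \<le> B) \<Longrightarrow> schwartz_family I (\<lambda>i x. c i * F i x)"
  unfolding schwartz_family_def by (blast intro: growth_cmult)

lemma schwartz_family_affine:
  assumes "schwartz_family I F" "c \<noteq> 0"
  shows "schwartz_family I (\<lambda>i x. F i (c *\<^sub>R x + v))"
proof -
  let ?y = "\<lambda>x. norm (c *\<^sub>R x + v)" and ?A = "1 + 1 / \<bar>c\<bar> + norm v / \<bar>c\<bar>" and ?B = "1 + \<bar>c\<bar> + norm v"
  have up: "1 + ?y x \<le> ?B * (1 + norm x)" for x
  proof -
    have "?y x \<le> \<bar>c\<bar> * norm x + norm v" using norm_triangle_ineq[of "c *\<^sub>R x" v] by simp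
    moreover have "0 \<le> norm v * norm x" "0 \<le> \<bar>c\<bar>" "0 \<le> norm x" by auto
    moreover have "?B * (1 + norm x) = 1 + norm x + \<bar>c\<bar> + \<bar>c\<bar> * norm x + norm v + norm v * norm x"
      by (simp add: algebra_simps)
    ultimately show ?thesis by linarith
  qed
  have dn: "1 + norm x \<le> ?A * (1 + ?y x)" for x
  proof -
    have "\<bar>c\<bar> * norm x \<le> ?y x + norm v" using norm_triangle_ineq4[of "c *\<^sub>R x + v" v] by simp
    then have "norm x \<le> ?y x / \<bar>c\<bar> + norm v / \<bar>c\<bar>" using assms(2) by (simp add: field_simps)
    moreover have "0 \<le> norm v / \<bar>c\<bar> * ?y x" "0 \<le> 1 / \<bar>c\<bar>" "0 \<le> ?y x" by auto
    moreover have "?A * (1 + ?y x) = 1 + ?y x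
      + 1 / \<bar>c\<bar> + ?y x / \<bar>c\<bar> + norm v / \<bar>c\<bar> + norm v / \<bar>c\<bar> * ?y x" by (simp add: algebra_simps)
    ultimately show ?thesis by linarith
  qed
  show ?thesis unfolding schwartz_family_def
  proof safe
    fix k m
    \<comment> \<open>Nonnegative orders need the upper comparison of the two weights, negative
      orders the lower one.\<close>
    define K where "K = max (?B powr m) (?A powr (- m))"
    have "norm (1::complex) * (1 + ?y x) powr m \<le> K * (1 + norm x) powr m" for x
    proof (cases "m \<ge> 0")
      case True
      have "(1 + ?y x) powr m \<le> (?B * (1 + norm x)) powr m" using True up by (intro powr_mono2) auto
      also have "\<dots> = ?B powr m * (1 + norm x) powr m" by (simp add: powr_mult)
      also have "\<dots> \<le> K * (1 + norm x) powr m" unfolding K_def by (intro mult_right_mono) auto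
      finally show ?thesis by simp
    next
      case False
      have "(?A * (1 + ?y x)) powr m \<le> (1 + norm x) powr m" using False dn by (intro powr_mono2') auto
      then have "?A powr m * (1 + ?y x) powr m \<le> (1 + norm x) powr m" by (simp add: powr_mult)
      moreover have "0 < ?A" by (simp add: add_pos_nonneg)
      ultimately have "(1 + ?y x) powr m \<le> ?A powr (-m) * (1 + norm x) powr m"
        by (simp add: powr_minus field_simps)
      also have "\<dots> \<le> K * (1 + norm x) powr m" unfolding K_def by (intro mult_right_mono) auto
      finally show ?thesis by simp
    qed
    then have "growth k m I (\<lambda>i x. 1 * F i (c *\<^sub>R x + v))"
      using assms(1) by (intro growth_affine[where B="\<bar>c\<bar>" and m=m]) (auto simp: schwartz_family_def)
    then show "growth k m I (\<lambda>i x. F i (c *\<^sub>R x + v))" by simp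
  qed
qed

lemma schwartz_affine: "schwartz f \<Longrightarrow> c \<noteq> 0 \<Longrightarrow> schwartz (\<lambda>x. f (c *\<^sub>R x + v))"
  unfolding schwartz_iff_family by (rule schwartz_family_affine)

lemma schwartz_mult: "schwartz f \<Longrightarrow> schwartz g \<Longrightarrow> schwartz (\<lambda>x. f x * g x)"
  unfolding schwartz_iff_family by (rule schwartz_family_mult')

lemma schwartz_mult_growth: "schwartz f \<Longrightarrow> (\<And>k. growth k m {()} (\<lambda>_. g)) \<Longrightarrow> schwartz (\<lambda>x. f x * g x)"
  unfolding schwartz_iff_family by (rule schwartz_family_mult)

lemma schwartz_partial: "schwartz f \<Longrightarrow> schwartz (partial j f)"
  unfolding schwartz_iff_family by (rule schwartz_family_partial)

lemma schwartz_add: "schwartz f \<Longrightarrow> schwartz g \<Longrightarrow> schwartz (\<lambda>x. f x + g x)"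
  unfolding schwartz_iff_family by (rule schwartz_family_add)

lemma schwartz_diff: "schwartz f \<Longrightarrow> schwartz g \<Longrightarrow> schwartz (\<lambda>x. f x - g x)"
  unfolding schwartz_iff_family by (rule schwartz_family_diff)

lemma schwartz_sum: "(\<And>a. a \<in> A \<Longrightarrow> schwartz (F a)) \<Longrightarrow> schwartz (\<lambda>x. \<Sum>a\<in>A. F a x)"
  unfolding schwartz_iff_family by (rule schwartz_family_sum)

lemma schwartz_cmult: "schwartz f \<Longrightarrow> schwartz (\<lambda>x. c * f x)"
  unfolding schwartz_iff_family by (rule schwartz_family_cmult) auto

text \<open>The character \<open>exp (2 pi i v . x)\<close>. It is symmetric in its two arguments,
  which lets it be differentiated in either of them.\<close>

definition cexp :: "real^'n::finite \<Rightarrow> 'n cfun" where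
  "cexp v x = exp (\<i> * complex_of_real (((2 * pi) *\<^sub>R v) \<bullet> x))"

lemma cexp_commute: "cexp v x = cexp x v"
  by (simp add: cexp_def inner_commute)

lemma norm_cexp [simp]: "norm (cexp v x) = 1"
  by (simp add: cexp_def)

lemma cexp_add_left: "cexp (v + w) x = cexp v x * cexp w x"
  by (simp add: cexp_def inner_add_left distrib_left exp_add)

lemma cexp_add_right: "cexp v (x + y) = cexp v x * cexp v y"
  by (metis cexp_add_left cexp_commute)

lemma cexp_zero [simp]: "cexp 0 x = 1" "cexp v 0 = 1"
  by (simp_all add: cexp_def)

lemma cexp_minus: "cexp (- v) x = cexp v (- x)"
  by (simp add: cexp_def)

lemma cexp_scaleR: "cexp (c *\<^sub>R v) x = cexp v (c *\<^sub>R x)"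
  by (simp add: cexp_def mult_ac)

lemma cexp_cancel [simp]: "cexp v x * cexp (- v) x = 1" "cexp (- v) x * cexp v x = 1"
  using cexp_add_left[of v "- v" x] cexp_add_left[of "- v" v x] by auto

lemma continuous_cexp [continuous_intros]:
  "continuous_on S f \<Longrightarrow> continuous_on S g \<Longrightarrow> continuous_on S (\<lambda>x. cexp (f x) (g x))"
  unfolding cexp_def by (intro continuous_intros)

lemma borel_measurable_cexp [measurable]:
  assumes [measurable]: "f \<in> borel_measurable M" "g \<in> borel_measurable M"
  shows "(\<lambda>x. cexp (f x) (g x)) \<in> borel_measurable M" unfolding cexp_def by measurable

lemma growth_cexp:
  assumes "\<And>i. i \<in> I \<Longrightarrow> norm (v i) \<le> B"
  shows "growth k 0 I (\<lambda>i. cexp (v i))" unfolding cexp_def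
  by (rule growth_exp_inner[where B="2 * pi * B"]) (use assms in auto)

lemma partial_cexp: "partial j (cexp v) = (\<lambda>x. 2 * of_real pi * \<i> * of_real (v $ j) * cexp v x)"
  unfolding cexp_def[abs_def] by (subst partial_exp_inner) (auto simp: mult_ac)

lemma cexp_differentiable: "cexp v differentiable (at x)"
proof -
  have "growth (Suc 0) 0 {()} (\<lambda>_. cexp v)" by (rule growth_cexp[where B="norm v"]) simp
  from growth_SucD(1)[OF this, of "()"] show ?thesis by simp
qed

lemma schwartz_mult_cexp: "schwartz f \<Longrightarrow> schwartz (\<lambda>x. f x * cexp v x)"
  by (rule schwartz_mult_growth) (auto intro!: growth_cexp[where B="norm v"])

lemma fourier_lborel:
  assumes "f \<in> borel_funs"
  shows "fourier f \<xi> = (LBINT x. f x * cexp (- \<xi>) x)"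
proof -
  have eq: "f x * exp (- 2 * of_real pi * \<i> * of_real (x \<bullet> \<xi>)) = f x * cexp (- \<xi>) x" for x
    by (simp add: cexp_def inner_commute mult_ac)
  show ?thesis unfolding fourier_def eq by (rule integral_completion) (use assms in measurable)
qed

lemma partial_fourier:
  fixes f :: "'n::finite cfun"
  assumes "schwartz f"
  shows "partial j (fourier f) \<xi> = fourier (\<lambda>x. - 2 * of_real pi * \<i> * of_real (x $ j) * f x) \<xi>"
    and "fourier f differentiable (at \<xi>)"
proof -
  \<comment> \<open>A factor \<open>1 + norm x\<close> is moved from the kernel to the density. The
    kernel and its derivatives in the frequency are then bounded uniformly in \<open>x\<close>, as
    differentiation under the integral sign requires.\<close>
  let ?w = "\<lambda>x. inverse (1 + norm x)"
  let ?a = "\<lambda>x. f x * of_real (1 + norm x)"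
  let ?G = "\<lambda>x \<xi> :: real^'n. of_real (?w x) * cexp (- x) \<xi>"
  let ?W = "weight_exponent TYPE('n)"
  have [measurable]: "f \<in> borel_funs" by (rule schwartz_measurable[OF assms])
  have a: "integrable lborel ?a"
  proof -
    have "growth 0 1 {()} (\<lambda>_ x::real^'n. complex_of_real (1 + norm x))"
      by (rule growth_0I[where B=1]) (auto simp del: of_real_add simp: norm_of_real)
    from growth_mult[OF schwartz_imp_growth[OF assms, of 0 "- ?W - 1"] this]
    show ?thesis by (intro growth_integrable_single) auto
  qed
  have pG: "partial j (?G x) = (\<lambda>\<xi>. (2 * of_real pi * \<i> * of_real (- x $ j) * of_real (?w x)) * cexp (- x) \<xi>)" for j x
    by (rule ext, subst partial_mult) (auto simp: partial_const partial_cexp cexp_differentiable)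
  have g: "growth (Suc 0) 0 UNIV ?G"
  proof (rule growth_SucI)
    have "norm (?G x \<xi>) \<le> 1 * (1 + norm \<xi>) powr 0" for x \<xi>
      by (simp add: norm_mult inverse_le_1_iff del: of_real_inverse)
    then show "growth 0 0 UNIV ?G" by (intro growth_0I)
    have "norm (2 * of_real pi * \<i> * of_real (- x $ j) * of_real (?w x) * cexp (- x) \<xi>) \<le> (2 * pi) * (1 + norm \<xi>) powr 0" for x \<xi> j
    proof -
      have "\<bar>x $ j\<bar> \<le> 1 + norm x" using component_le_norm_cart[of x j] by simp
      then have "\<bar>x $ j\<bar> * ?w x \<le> 1" by (simp add: divide_le_eq flip: divide_inverse)
      then have "(2 * pi) * (\<bar>x $ j\<bar> * ?w x) \<le> (2 * pi) * 1" by (intro mult_left_mono) auto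
      then show ?thesis by (simp add: norm_mult mult_ac del: of_real_inverse)
    qed
    then show "growth 0 0 UNIV (\<lambda>x. partial j (?G x))" for j unfolding pG by (intro growth_0I)
  qed (auto intro!: differentiable_mult cexp_differentiable)
  have one: "?a x * (of_real (?w x) * c) = f x * c" for x c
  proof -
    have 1: "complex_of_real (1 + norm x) * of_real (?w x) = 1" unfolding of_real_mult[symmetric] by simp
    have "?a x * (of_real (?w x) * c) = f x * (of_real (1 + norm x) * of_real (?w x)) * c" by (simp only: mult.assoc)
    then show ?thesis unfolding 1 by simp
  qed
  have c: "cexp (- x) z = cexp (- z) x" for x z :: "real^'n" by (simp add: cexp_def inner_commute)
  have "?a x * ?G x z = f x * cexp (- z) x" for x z unfolding one c[of x z] ..
  then have eq: "fourier f = (\<lambda>z. (LBINT x. ?a x * ?G x z))" by (intro ext) (simp only: fourier_lborel[OF schwartz_measurable[OF assms]])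
  show "fourier f differentiable (at \<xi>)" unfolding eq by (rule param_partial(2)[OF _ a g]) measurable
  have pt: "?a x * partial j (?G x) \<xi> = (- 2 * of_real pi * \<i> * of_real (x $ j) * f x) * cexp (- \<xi>) x" for x
    using one[of x "2 * of_real pi * \<i> * of_real (- x $ j) * cexp (- x) \<xi>"] unfolding pG c[of x \<xi>]
    by (simp add: mult_ac)
  have "partial j (fourier f) \<xi> = (LBINT x. ?a x * partial j (?G x) \<xi>)"
    unfolding eq by (subst param_partial(1)[OF _ a g]) auto
  also have "\<dots> = fourier (\<lambda>x. - 2 * of_real pi * \<i> * of_real (x $ j) * f x) \<xi>"
    unfolding pt by (rule fourier_lborel[symmetric]) measurable
  finally show "partial j (fourier f) \<xi> = fourier (\<lambda>x. - 2 * of_real pi * \<i> * of_real (x $ j) * f x) \<xi>" .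
qed

text \<open>Smoothness and boundedness, not yet decay: a derivative of the transform is the
  transform of a coordinate multiple, which again runs through a bounded family, so a bound in
  \<open>L^1\<close> suffices for every order.\<close>

lemma growth_fourier:
  fixes F :: "'i \<Rightarrow> 'n::finite cfun"
  assumes "schwartz_family I F"
  shows "growth k 0 I (\<lambda>i. fourier (F i))" using assms
proof (induction k arbitrary: F)
  case (0 F)
  have m: "F i \<in> borel_funs" if "i \<in> I" for i by (rule schwartz_measurable[OF schwartz_familyD[OF 0 that]])
  have "growth 0 (- weight_exponent TYPE('n)) I F" using 0 by (simp add: schwartz_family_def)
  from growth_integrable[OF this] obtain A where A: "\<forall>i\<in>I. F i \<in> borel_funs \<longrightarrow> integrable lborel (F i) \<and> (LBINT x. norm (F i x)) \<le> A"
    by blast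
  show ?case
  proof (rule growth_0I)
    fix i and \<xi> :: "real^'n" assume i: "i \<in> I"
    have "norm (fourier (F i) \<xi>) \<le> (LBINT x. norm (F i x * cexp (- \<xi>) x))"
      unfolding fourier_lborel[OF m[OF i]] by (rule integral_norm_bound)
    then show "norm (fourier (F i) \<xi>) \<le> A * (1 + norm \<xi>) powr 0" using A m[OF i] i by (force simp: norm_mult)
  qed
next
  case (Suc k F)
  have s: "schwartz (F i)" if "i \<in> I" for i by (rule schwartz_familyD[OF Suc.prems that])
  have "growth k 0 I (\<lambda>i. partial j (fourier (F i)))" for j
  proof -
    have "schwartz_family I (\<lambda>i x. F i x * (- 2 * of_real pi * \<i> * of_real (x $ j)))"
      by (rule schwartz_family_mult[OF Suc.prems growth_cmult[OF growth_coord order_refl]])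
    from Suc.IH[OF this] show ?thesis
      by (rule growth_cong[THEN iffD1, rotated]) (use s in \<open>auto simp: partial_fourier(1) mult.commute\<close>)
  qed
  with growth_imp_0[OF Suc.IH[OF Suc.prems]] partial_fourier(2)[OF s] show ?case by (intro growth_SucI)
qed

lemma peetre: "1 + norm (x::'a::real_normed_vector) \<le> (1 + norm (z + x)) * (1 + norm z)"
proof -
  have "norm x \<le> norm (z + x) + norm z" using norm_triangle_ineq4[of "z + x" z] by simp
  moreover have "0 \<le> norm (z + x) * norm z" by simp
  moreover have "(1 + norm (z + x)) * (1 + norm z) = 1 + norm z + norm (z + x) + norm (z + x) * norm z"
    by (simp add: algebra_simps)
  ultimately show ?thesis by linarith
qed

lemma peetre_powr:
  fixes x z :: "'a::real_normed_vector"
  assumes "W \<ge> 0"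
  shows "(1 + norm x) powr W * (1 + norm (z + x)) powr (- W) \<le> (1 + norm z) powr W"
proof -
  have "(1 + norm x) powr W \<le> ((1 + norm (z + x)) * (1 + norm z)) powr W"
    using assms peetre by (intro powr_mono2) auto
  then have "(1 + norm x) powr W * (1 + norm (z + x)) powr (- W)
      \<le> ((1 + norm (z + x)) powr W * (1 + norm z) powr W) * (1 + norm (z + x)) powr (- W)"
    by (intro mult_right_mono) (auto simp: powr_mult)
  then show ?thesis by (simp add: powr_minus field_simps)
qed

text \<open>The integral of \<open>g (z + x)\<close> over \<open>x\<close> does not depend on
  \<open>z\<close>. Differentiating it in \<open>z\<close> at \<open>0\<close> under the integral
  sign gives the claim.\<close>

lemma integral_partial_zero:
  fixes g :: "'n::finite cfun"
  assumes "schwartz g"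
  shows "(LBINT x. partial j g x) = 0"
proof -
  let ?W = "weight_exponent TYPE('n)"
  have W: "?W \<ge> 0" by (simp add: weight_exponent_def)
  \<comment> \<open>Inserting a weight and its inverse writes \<open>g (z + x)\<close> as an
    integrable density times a family of functions of \<open>z\<close>, which has growth
    \<open>?W\<close> by Peetre's inequality.\<close>
  let ?a = "\<lambda>x::real^'n. complex_of_real ((1 + norm x) powr (- ?W))"
  let ?G = "\<lambda>x z :: real^'n. of_real ((1 + norm x) powr ?W) * g (z + x)"
  have [measurable]: "g \<in> borel_funs" by (rule schwartz_measurable[OF assms])
  have a: "integrable lborel ?a" using integrable_weight[OF order_refl] by (rule integrable_of_real)
  have "growth (Suc 0) ?W UNIV (\<lambda>x z. of_real ((1 + norm x) powr ?W) * g (1 *\<^sub>R z + x))"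
    by (rule growth_affine[where m="- ?W" and B=1 and K=1, OF schwartz_imp_growth[OF assms]])
      (auto simp: peetre_powr[OF W])
  then have g: "growth (Suc 0) ?W UNIV ?G" by simp
  have *: "(\<lambda>z. (LBINT x. ?a x * ?G x z)) = (\<lambda>z. (LBINT x. g x))"
  proof
    fix z
    have "complex_of_real ((1 + norm x) powr (- ?W)) * of_real ((1 + norm x) powr ?W) = 1" for x :: "real^'n"
      by (simp flip: of_real_mult powr_add)
    then have eq: "?a x * ?G x z = g (z + 1 *\<^sub>R x)" for x
      by (simp only: mult.assoc[symmetric] mult_1 scaleR_one)
    show "(LBINT x. ?a x * ?G x z) = (LBINT x. g x)" unfolding eq using integral_lborel_affine[of 1 g z] by simp
  qed
  have "(\<lambda>z. (LBINT x. ?a x * partial j (?G x) z)) = (\<lambda>z. 0)"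
    using param_partial(1)[of ?G lborel ?a ?W j] a g unfolding * by (simp add: partial_const)
  then have "(LBINT x. ?a x * partial j (?G x) 0) = 0" by meson
  moreover have "?a x * partial j (?G x) 0 = partial j g x" for x
  proof -
    have "partial j (?G x) 0 = of_real ((1 + norm x) powr ?W) * partial j (\<lambda>z. g (1 *\<^sub>R z + x)) 0"
      using partial_affine(2)[of g 1 0 x] schwartz_differentiable[OF assms]
      by (subst partial_mult) (auto simp: partial_const)
    also have "partial j (\<lambda>z. g (1 *\<^sub>R z + x)) 0 = partial j g x"
      by (subst partial_affine) (auto simp: schwartz_differentiable[OF assms])
    finally have 1: "partial j (?G x) 0 = of_real ((1 + norm x) powr ?W) * partial j g x" .
    have "complex_of_real ((1 + norm x) powr (- ?W)) * of_real ((1 + norm x) powr ?W) = 1"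
      by (simp flip: of_real_mult powr_add)
    then show ?thesis unfolding 1 by (simp add: mult.assoc[symmetric])
  qed
  ultimately show ?thesis by simp
qed

lemma fourier_partial:
  fixes f :: "'n::finite cfun"
  assumes "schwartz f"
  shows "fourier (partial j f) \<xi> = 2 * of_real pi * \<i> * of_real (\<xi> $ j) * fourier f \<xi>"
proof -
  have s: "schwartz (\<lambda>x. f x * cexp (- \<xi>) x)" "schwartz (\<lambda>x. partial j f x * cexp (- \<xi>) x)"
    using assms by (auto intro!: schwartz_mult_cexp schwartz_partial)
  have "partial j (\<lambda>x. f x * cexp (- \<xi>) x) =
      (\<lambda>x. partial j f x * cexp (- \<xi>) x - 2 * of_real pi * \<i> * of_real (\<xi> $ j) * (f x * cexp (- \<xi>) x))"
    by (rule ext, subst partial_mult)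
      (auto simp: partial_cexp schwartz_differentiable[OF assms] cexp_differentiable)
  then have "(LBINT x. partial j f x * cexp (- \<xi>) x - 2 * of_real pi * \<i> * of_real (\<xi> $ j) * (f x * cexp (- \<xi>) x)) = 0"
    using integral_partial_zero[OF s(1), of j] by simp
  then show ?thesis
    using s[THEN schwartz_integrable] schwartz_measurable[OF assms] schwartz_measurable[OF schwartz_partial[OF assms]]
    by (simp add: fourier_lborel)
qed

lemma fourier_cmult: "schwartz f \<Longrightarrow> fourier (\<lambda>x. c * f x) \<xi> = c * fourier f \<xi>"
  using schwartz_measurable[of f] schwartz_measurable[OF schwartz_cmult[of f c]]
  by (simp add: fourier_lborel mult.assoc)

lemma fourier_diff:
  assumes "schwartz f" "schwartz g"
  shows "fourier (\<lambda>x. f x - g x) \<xi> = fourier f \<xi> - fourier g \<xi>"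
  using schwartz_measurable[OF assms(1)] schwartz_measurable[OF assms(2)] schwartz_measurable[OF schwartz_diff[OF assms]]
    schwartz_integrable[OF schwartz_mult_cexp[OF assms(1)]] schwartz_integrable[OF schwartz_mult_cexp[OF assms(2)]]
  by (simp add: fourier_lborel left_diff_distrib)

lemma fourier_sum:
  assumes "\<And>a. a \<in> A \<Longrightarrow> schwartz (F a)"
  shows "fourier (\<lambda>x. \<Sum>a\<in>A. F a x) \<xi> = (\<Sum>a\<in>A. fourier (F a) \<xi>)"
  using schwartz_measurable[OF assms] schwartz_measurable[OF schwartz_sum[OF assms]]
    schwartz_integrable[OF schwartz_mult_cexp[OF assms]]
  by (simp add: fourier_lborel sum_distrib_right Bochner_Integration.integral_sum)

lemma norm_sq_eq_sum: "(norm (x::real^'n::finite))\<^sup>2 = (\<Sum>l\<in>UNIV. (x $ l)\<^sup>2)"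
  unfolding power2_norm_eq_inner inner_vec_def by (simp add: power2_eq_square)

lemma growth_one_plus_square: "growth k 2 I (\<lambda>i x::real^'n::finite. complex_of_real (1 + (norm x)\<^sup>2))"
proof -
  have "growth k 2 I (\<lambda>i x::real^'n. 1 + (\<Sum>l\<in>UNIV. of_real (x $ l) * of_real (x $ l)))"
    using growth_mult[OF growth_coord growth_coord, of k I]
    by (intro growth_add growth_sum growth_le_m[OF growth_const[where B=1]]) auto
  then show ?thesis by (simp add: norm_sq_eq_sum power2_eq_square[of "_ $ _"])
qed

text \<open>Decay comes from smoothness: the transform of \<open>F\<close> minus its Laplacian
  divided by \<open>4 pi^2\<close> is \<open>1 + norm \<xi> ^ 2\<close> times the transform of
  \<open>F\<close>. Each application of this operator to the family therefore gains two
  orders.\<close>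

lemma schwartz_family_fourier:
  fixes F :: "'i \<Rightarrow> 'n::finite cfun"
  assumes "schwartz_family I F"
  shows "schwartz_family I (\<lambda>i. fourier (F i))"
proof -
  define D where "D x = complex_of_real (1 + (norm x)\<^sup>2)" for x :: "real^'n"
  have inv: "growth k (-2) I (\<lambda>i x. inverse (D x))" for k
  proof (rule growth_inverse[where c="1/2"])
    show "growth k 2 I (\<lambda>i. D)" unfolding D_def by (rule growth_one_plus_square)
    fix x :: "real^'n"
    have "(1 + norm x)\<^sup>2 \<le> 2 * (1 + (norm x)\<^sup>2)" using zero_le_power2[of "1 - norm x"]
      by (simp add: power2_eq_square algebra_simps)
    moreover have "norm (D x) = 1 + (norm x)\<^sup>2" unfolding D_def norm_of_real by simp
    ultimately show "1/2 * (1 + norm x) powr 2 \<le> norm (D x)" by (simp add: powr_numeral)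
  qed auto
  have "growth k (- (2 * real N)) I (\<lambda>i. fourier (F i))" for N k using assms
  proof (induction N arbitrary: F)
    case 0
    then show ?case using growth_fourier[of I F k] by simp
  next
    case (Suc N)
    let ?Lap = "\<lambda>f x. (\<Sum>l\<in>UNIV. (1 / (4 * of_real pi ^ 2)) * partial l (partial l f) x)"
    let ?H = "\<lambda>i x. F i x - ?Lap (F i) x"
    have "schwartz_family I ?H"
      by (intro schwartz_family_diff schwartz_family_sum schwartz_family_cmult[where B="norm (1 / (4 * of_real pi ^ 2) :: complex)"] schwartz_family_partial Suc.prems) auto
    then have g: "growth k (- (2 * real N)) I (\<lambda>i. fourier (?H i))" by (rule Suc.IH)
    have eq: "fourier (F i) = (\<lambda>\<xi>. inverse (D \<xi>) * fourier (?H i) \<xi>)" if "i \<in> I" for i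
    proof
      fix \<xi>
      have s: "schwartz (F i)" by (rule schwartz_familyD[OF Suc.prems that])
      then have s': "schwartz (partial l (partial l (F i)))" for l by (intro schwartz_partial)
      have 1: "schwartz (\<lambda>x. (1 / (4 * of_real pi ^ 2)) * partial l (partial l (F i)) x)" for l
        by (intro schwartz_cmult s')
      have "fourier (?H i) \<xi> = fourier (F i) \<xi> - (\<Sum>l\<in>UNIV. (1 / (4 * of_real pi ^ 2)) * fourier (partial l (partial l (F i))) \<xi>)"
        by (subst fourier_diff[OF s schwartz_sum[OF 1]]) (simp only: fourier_sum[OF 1] fourier_cmult[OF s'])
      also have "\<dots> = fourier (F i) \<xi> + (\<Sum>l\<in>UNIV. of_real (\<xi> $ l) ^ 2 * fourier (F i) \<xi>)"
        by (simp add: fourier_partial schwartz_partial s power2_eq_square field_simps sum_negf)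
      also have "\<dots> = D \<xi> * fourier (F i) \<xi>" by (simp add: D_def norm_sq_eq_sum sum_distrib_right distrib_right)
      finally have HD: "fourier (?H i) \<xi> = D \<xi> * fourier (F i) \<xi>" .
      show "fourier (F i) \<xi> = inverse (D \<xi>) * fourier (?H i) \<xi>"
      proof -
        have "norm (D \<xi>) = 1 + (norm \<xi>)\<^sup>2" unfolding D_def norm_of_real by simp
        then have "D \<xi> \<noteq> 0" by (metis add_pos_nonneg norm_eq_zero zero_le_power2 less_irrefl zero_less_one)
        then show ?thesis unfolding HD by simp
      qed
    qed
    have "growth k (- (2 * real (Suc N))) I (\<lambda>i \<xi>. inverse (D \<xi>) * fourier (?H i) \<xi>)"
      using growth_mult[OF inv g] by (simp add: algebra_simps)
    then show ?case using eq by (subst growth_cong) auto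
  qed
  note N = this
  show ?thesis unfolding schwartz_family_def
  proof safe
    fix k m
    have "- (2 * real (nat \<lceil>- m\<rceil>)) \<le> m" by linarith
    then show "growth k m I (\<lambda>i. fourier (F i))" by (rule growth_le_m[OF N])
  qed
qed

lemma schwartz_fourier: "schwartz f \<Longrightarrow> schwartz (fourier f)"
  unfolding schwartz_iff_family by (rule schwartz_family_fourier)

lemma Fubini_kernel:
  fixes a :: "'a::euclidean_space \<Rightarrow> complex" and b :: "'b::euclidean_space \<Rightarrow> complex"
  assumes a: "integrable lborel a" and b: "integrable lborel b"
    and K [measurable]: "(\<lambda>(x, y). K x y) \<in> borel_measurable (lborel \<Otimes>\<^sub>M lborel)" and C: "\<And>x y. norm (K x y) \<le> C"
  shows "(LBINT x. a x * (LBINT y. b y * K x y)) = (LBINT y. b y * (LBINT x. a x * K x y))"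
proof -
  let ?f = "\<lambda>x y. a x * (b y * K x y)"
  have C0: "C \<ge> 0" using C[of undefined undefined] norm_ge_zero order_trans by blast
  have [measurable]: "a \<in> borel_funs" "b \<in> borel_funs" using a b by auto
  have bd: "norm (?f x y) \<le> norm (a x) * (C * norm (b y))" for x y
    unfolding norm_mult using C[of x y] by (intro mult_left_mono) (auto simp: mult.commute[of C] intro: mult_left_mono)
  have iy: "integrable lborel (\<lambda>y. ?f x y)" for x
  proof (rule Bochner_Integration.integrable_bound)
    show "integrable lborel (\<lambda>y. norm (a x) * (C * norm (b y)))" using b by simp
    show "AE y in lborel. norm (?f x y) \<le> norm (norm (a x) * (C * norm (b y)))"
      using order_trans[OF bd abs_ge_self] by simp
  qed measurable
  have int: "integrable (lborel \<Otimes>\<^sub>M lborel) (\<lambda>(x, y). ?f x y)"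
  proof (rule lborel_pair.Fubini_integrable)
    show "(\<lambda>(x, y). ?f x y) \<in> borel_measurable (lborel \<Otimes>\<^sub>M lborel)" by measurable
    show "AE x in lborel. integrable lborel (\<lambda>y. case (x, y) of (x, y) \<Rightarrow> ?f x y)" using iy by simp
    show "integrable lborel (\<lambda>x. (LBINT y. norm (case (x, y) of (x, y) \<Rightarrow> ?f x y)))"
    proof (rule Bochner_Integration.integrable_bound)
      show "integrable lborel (\<lambda>x. norm (a x) * (LBINT y. C * norm (b y)))" using a by simp
      have "(LBINT y. norm (?f x y)) \<le> (LBINT y. norm (a x) * (C * norm (b y)))" for x
        using iy b by (intro integral_mono bd) auto
      moreover have "0 \<le> (LBINT y. norm (?f x y))" for x by simp
      ultimately show "AE x in lborel. norm (LBINT y. norm (case (x, y) of (x, y) \<Rightarrow> ?f x y))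
          \<le> norm (norm (a x) * (LBINT y. C * norm (b y)))"
        using C0 by (auto intro!: AE_I2 order_trans[OF _ abs_ge_self])
    qed measurable
  qed
  have "(LBINT x. a x * (LBINT y. b y * K x y)) = (LBINT x. (LBINT y. ?f x y))" by simp
  also have "\<dots> = (LBINT y. (LBINT x. ?f x y))" by (rule lborel_pair.Fubini_integral[symmetric, OF int])
  also have "\<dots> = (LBINT y. (LBINT x. b y * (a x * K x y)))" by (simp add: mult_ac)
  finally show ?thesis by simp
qed

section \<open>The Gaussian and Fourier inversion\<close>

definition gauss :: "'n::finite cfun" where
  "gauss x = complex_of_real (exp (- pi * (norm x)\<^sup>2))"

lemma gauss_0 [simp]: "gauss 0 = 1"
  by (simp add: gauss_def)

lemma gauss_has_derivative:
  "(gauss has_derivative (\<lambda>h. complex_of_real (- 2 * pi * (x \<bullet> h)) * gauss x)) (at x)"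
proof -
  have "((\<lambda>x::real^'a. exp (- pi * (x \<bullet> x))) has_derivative (\<lambda>h. - 2 * pi * (x \<bullet> h) * exp (- pi * (x \<bullet> x)))) (at x)"
    by (auto intro!: derivative_eq_intros simp: inner_commute algebra_simps)
  from bounded_linear.has_derivative[OF bounded_linear_of_real this] show ?thesis
    unfolding gauss_def[abs_def] power2_norm_eq_inner by simp
qed

lemma partial_gauss: "partial j gauss = (\<lambda>x. (- 2 * of_real pi) * (of_real (x $ j) * gauss x))"
  by (rule ext, subst partial_eq[OF gauss_has_derivative]) (simp add: inner_axis)

lemma gauss_differentiable: "gauss differentiable (at x)"
  using gauss_has_derivative differentiableI by blast

text \<open>From \<open>(1 + y / N) ^ N \<le> exp y\<close> at \<open>y = pi * norm x ^ 2\<close>.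
  This yields decay of order \<open>- 2 * N\<close>, and \<open>N\<close> is taken larger than
  \<open>- m\<close>.\<close>

lemma gauss_bound: "growth 0 m I (\<lambda>_. gauss :: 'n::finite cfun)"
proof -
  define N where "N = nat \<lceil>- m\<rceil> + 1"
  have N: "N > 0" by (simp add: N_def)
  have "norm (gauss x) \<le> (2 * real N) ^ N * (1 + norm x) powr m" for x :: "real^'n"
  proof -
    have "(1 + norm x)\<^sup>2 \<le> 2 * (1 + (norm x)\<^sup>2)" using zero_le_power2[of "1 - norm x"]
      by (simp add: power2_eq_square algebra_simps)
    moreover have "1 + (norm x)\<^sup>2 \<le> real N + pi * (norm x)\<^sup>2"
    proof -
      have "1 \<le> real N" using N by simp
      moreover have "1 * (norm x)\<^sup>2 \<le> pi * (norm x)\<^sup>2" using pi_ge_two by (intro mult_right_mono) auto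
      ultimately show ?thesis by simp
    qed
    ultimately have "(1 + norm x)\<^sup>2 / (2 * real N) \<le> 1 + pi * (norm x)\<^sup>2 / real N"
      using N by (simp add: field_simps)
    then have "((1 + norm x)\<^sup>2 / (2 * real N)) ^ N \<le> (1 + pi * (norm x)\<^sup>2 / real N) ^ N"
      by (intro power_mono) auto
    also have "\<dots> \<le> exp (pi * (norm x)\<^sup>2)"
    proof (rule exp_ge_one_plus_x_over_n_power_n)
      have "0 \<le> pi * (norm x)\<^sup>2" by simp
      then show "- real N \<le> pi * (norm x)\<^sup>2" by linarith
    qed (use N in auto)
    finally have "(1 + norm x) ^ (2 * N) \<le> (2 * real N) ^ N * exp (pi * (norm x)\<^sup>2)"
      using N unfolding power_mult by (simp add: power_divide power_mult_distrib divide_le_eq mult_ac)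
    then have "exp (- (pi * (norm x)\<^sup>2)) \<le> (2 * real N) ^ N * inverse ((1 + norm x) ^ (2 * N))"
      by (simp add: exp_minus field_simps)
    also have "inverse ((1 + norm x) ^ (2 * N)) = (1 + norm x) powr (- real (2 * N))"
      by (simp add: powr_minus powr_realpow del: of_nat_mult)
    also have "(2 * real N) ^ N * \<dots> \<le> (2 * real N) ^ N * (1 + norm x) powr m"
      by (intro mult_left_mono powr_mono) (auto simp: N_def, linarith)
    finally show ?thesis by (simp add: gauss_def)
  qed
  then show ?thesis by (intro growth_0I)
qed

lemma growth_gauss: "growth k m I (\<lambda>_. gauss :: 'n::finite cfun)"
proof (induction k arbitrary: m)
  case 0 show ?case by (rule gauss_bound)
next
  case (Suc k)
  have "growth k (1 + (m - 1)) I (\<lambda>_ x :: real^'n. of_real (x $ j) * gauss x)" for j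
    by (intro growth_mult growth_coord Suc)
  then have "growth k m I (\<lambda>_ x :: real^'n. (- 2 * of_real pi) * (of_real (x $ j) * gauss x))" for j
    by (intro growth_cmult[where B="2 * pi"]) (auto simp: norm_mult)
  then show ?case by (intro growth_SucI gauss_bound) (auto simp: partial_gauss gauss_differentiable)
qed

lemma schwartz_gauss: "schwartz gauss"
  by (simp add: schwartz_iff_family schwartz_family_def growth_gauss)

text \<open>The Gaussian is a product over the coordinates of normal densities of variance
  \<open>1 / (2 pi)\<close>.\<close>

lemma integral_gauss: "(LBINT x. gauss (x :: real^'n::finite)) = 1"
proof -
  let ?g = "\<lambda>x::real^'n. exp (- pi * (norm x)\<^sup>2)"
  have 1: "(NN x. ennreal (exp (- pi * x\<^sup>2))) = 1"
  proof -
    have eq: "normal_density 0 (sqrt (1 / (2 * pi))) x = exp (- pi * x\<^sup>2)" for x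
      by (simp add: normal_density_def field_simps)
    have "(LBINT x. normal_density 0 (sqrt (1 / (2 * pi))) x) = 1" "integrable lborel (normal_density 0 (sqrt (1 / (2 * pi))))"
      by (auto intro!: integral_normal_density integrable_normal_density)
    then show ?thesis unfolding eq[abs_def] by (subst nn_integral_eq_integral) auto
  qed
  have prod: "?g x = (\<Prod>b\<in>Basis. exp (- pi * (x \<bullet> b)\<^sup>2))" for x
  proof -
    have "(norm x)\<^sup>2 = (\<Sum>b\<in>Basis. (x \<bullet> b)\<^sup>2)"
      unfolding power2_norm_eq_inner by (subst euclidean_inner) (simp add: power2_eq_square)
    then show ?thesis by (simp add: exp_sum[symmetric] sum_distrib_left)
  qed
  have "(NN x. ennreal (?g x)) = (NN x. (\<Prod>b\<in>Basis. ennreal (exp (- pi * ((x :: real^'n) \<bullet> b)\<^sup>2))))"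
    unfolding prod by (simp add: prod_ennreal)
  also have "\<dots> = 1" by (subst nn_integral_lborel_prod) (simp_all only: 1, auto)
  finally have "(LBINT x. ?g x) = 1" by (subst integral_eq_nn_integral) auto
  moreover have "(LBINT x. gauss (x :: real^'n)) = complex_of_real (LBINT x. ?g x)"
    unfolding gauss_def by (rule integral_complex_of_real)
  ultimately show ?thesis by simp
qed

text \<open>The Gaussian and its transform both solve \<open>partial j u = - 2 pi \<xi>_j u\<close>.
  So the product of the transform with \<open>?E\<close>, the reciprocal of the Gaussian, has zero
  derivative and equals its value \<open>1\<close> at the origin.\<close>

lemma fourier_gauss: "fourier gauss = (gauss :: 'n::finite cfun)"
proof -
  let ?E = "\<lambda>x::real^'n. complex_of_real (exp (pi * (norm x)\<^sup>2))"
  let ?h = "\<lambda>\<xi>. fourier gauss \<xi> * ?E \<xi>"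
  have E: "(?E has_derivative (\<lambda>h. complex_of_real (2 * pi * (x \<bullet> h)) * ?E x)) (at x)" for x
  proof -
    have "((\<lambda>x::real^'n. exp (pi * (x \<bullet> x))) has_derivative (\<lambda>h. 2 * pi * (x \<bullet> h) * exp (pi * (x \<bullet> x)))) (at x)"
      by (auto intro!: derivative_eq_intros simp: inner_commute algebra_simps)
    from bounded_linear.has_derivative[OF bounded_linear_of_real this] show ?thesis
      unfolding power2_norm_eq_inner by simp
  qed
  have Ed: "?E differentiable (at x)" for x using E differentiableI by blast
  have gd: "fourier gauss differentiable (at x)" for x
    by (rule schwartz_differentiable[OF schwartz_fourier[OF schwartz_gauss]])
  have pg: "partial j (fourier gauss) \<xi> = - 2 * of_real pi * of_real (\<xi> $ j) * fourier gauss \<xi>" for j and \<xi> :: "real^'n"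
  proof -
    have "partial j (fourier gauss) \<xi> = fourier (\<lambda>x. \<i> * partial j gauss x) \<xi>"
      unfolding partial_fourier[OF schwartz_gauss] partial_gauss by (simp add: mult_ac)
    also have "\<dots> = \<i> * (2 * of_real pi * \<i> * of_real (\<xi> $ j) * fourier gauss \<xi>)"
      unfolding fourier_cmult[OF schwartz_partial[OF schwartz_gauss]] fourier_partial[OF schwartz_gauss] ..
    also have "\<dots> = - 2 * of_real pi * of_real (\<xi> $ j) * fourier gauss \<xi>"
    proof -
      have "\<i> * (2 * a * \<i> * b * c) = - 2 * a * b * c" for a b c :: complex by (simp add: algebra_simps)
      then show ?thesis .
    qed
    finally show ?thesis .
  qed
  have "(?h has_derivative (\<lambda>h. 0)) (at \<xi>)" for \<xi>
  proof -
    have "partial j ?h \<xi> = 0" for j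
    proof -
      have "partial j ?E \<xi> = of_real (2 * pi * \<xi> $ j) * ?E \<xi>" by (subst partial_eq[OF E]) (simp add: inner_axis)
      then show ?thesis by (subst partial_mult[OF gd Ed]) (simp add: pg)
    qed
    moreover have "?h differentiable (at \<xi>)" using gd Ed by (rule differentiable_mult)
    ultimately show ?thesis using has_derivative_partials[of ?h \<xi>] by simp
  qed
  then have "\<exists>c. \<forall>\<xi>\<in>UNIV. ?h \<xi> = c" by (intro has_derivative_zero_constant) auto
  then have c: "?h \<xi> = ?h 0" for \<xi> by (metis UNIV_I)
  have "fourier gauss 0 = (1::complex)"
    using integral_gauss schwartz_measurable[OF schwartz_gauss] by (subst fourier_lborel) auto
  then have "fourier gauss \<xi> * ?E \<xi> = 1" for \<xi> :: "real^'n" using c[of \<xi>] by simp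
  moreover have "gauss \<xi> * ?E \<xi> = 1" for \<xi> :: "real^'n" by (simp add: gauss_def flip: of_real_mult exp_add)
  ultimately have eq: "fourier gauss \<xi> * ?E \<xi> = gauss \<xi> * ?E \<xi>" for \<xi> :: "real^'n" by metis
  have "?E \<xi> \<noteq> 0" for \<xi> :: "real^'n" by simp
  with eq show ?thesis by (intro ext) (metis mult_right_cancel)
qed

definition inv_fourier :: "'n::finite cfun \<Rightarrow> 'n cfun" where
  "inv_fourier a x = (LBINT \<xi>. a \<xi> * cexp x \<xi>)"

text \<open>The Fourier multiplier with symbol \<open>a\<close>.\<close>

abbreviation fourier_op :: "'n::finite cfun \<Rightarrow> ('n cfun \<Rightarrow> complex) \<Rightarrow> 'n cfun" where
  "fourier_op a T \<equiv> conv (inv_fourier a) T"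

lemma inv_fourier_eq: "a \<in> borel_funs \<Longrightarrow> inv_fourier a x = fourier a (- x)"
  by (simp add: inv_fourier_def fourier_lborel)

lemma schwartz_family_inv_fourier:
  assumes "schwartz_family I F"
  shows "schwartz_family I (\<lambda>i. inv_fourier (F i))"
proof -
  have "schwartz_family I (\<lambda>i x. fourier (F i) ((-1) *\<^sub>R x + 0))"
    by (intro schwartz_family_affine schwartz_family_fourier assms) auto
  moreover have "inv_fourier (F i) = (\<lambda>x. fourier (F i) ((-1) *\<^sub>R x + 0))" if "i \<in> I" for i
    using inv_fourier_eq[OF schwartz_measurable[OF schwartz_familyD[OF assms that]]] by auto
  ultimately show ?thesis unfolding schwartz_family_def by (subst growth_cong) auto
qed

lemma schwartz_inv_fourier: "schwartz a \<Longrightarrow> schwartz (inv_fourier a)"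
  unfolding schwartz_iff_family by (rule schwartz_family_inv_fourier)

lemma schwartz_bounded:
  assumes "schwartz f" shows "\<exists>B>0. \<forall>x. norm (f x) \<le> B"
  using growthD[OF schwartz_imp_growth[OF assms, of 0 0 "{()}"]] by auto

text \<open>Gaussian regularisation: by Fubini and \<open>fourier_gauss\<close>, the integral of
  \<open>fourier f \<xi> * gauss (e \<xi>)\<close> equals that of \<open>f (e x) * gauss x\<close>.
  The limit \<open>e = 0\<close> on both sides is the claim; other points follow by
  translation.\<close>

lemma fourier_inversion_0:
  fixes f :: "'n::finite cfun"
  assumes "schwartz f"
  shows "(LBINT \<xi>. fourier f \<xi>) = f 0"
proof -
  let ?e = "\<lambda>m. 1 / real (Suc m)"
  have [measurable]: "f \<in> borel_funs" "fourier f \<in> borel_funs" "(gauss :: 'n cfun) \<in> borel_funs"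
    using assms schwartz_fourier schwartz_measurable schwartz_gauss by blast+
  obtain B where B: "B > 0" "\<And>x. norm (f x) \<le> B" using schwartz_bounded[OF assms] by metis
  have e0: "?e \<longlonglongrightarrow> 0" using LIMSEQ_inverse_real_of_nat by (simp add: inverse_eq_divide)
  have lim0: "(\<lambda>m. ?e m *\<^sub>R x) \<longlonglongrightarrow> 0" for x :: "real^'n" using tendsto_scaleR[OF e0 tendsto_const[of x]] by simp
  have g1: "norm (gauss x) \<le> 1" for x :: "real^'n" by (simp add: gauss_def)
  have L: "(\<lambda>m. (LBINT \<xi>. fourier f \<xi> * gauss (?e m *\<^sub>R \<xi>))) \<longlonglongrightarrow> (LBINT \<xi>. fourier f \<xi>)"
  proof (rule integral_dominated_convergence[where w="\<lambda>x. norm (fourier f x)"])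
    show "integrable lborel (\<lambda>x. norm (fourier f x))"
      by (intro integrable_norm schwartz_integrable schwartz_fourier assms)
    show "AE x in lborel. (\<lambda>m. fourier f x * gauss (?e m *\<^sub>R x)) \<longlonglongrightarrow> fourier f x"
    proof (rule AE_I2)
      fix x :: "real^'n"
      have "isCont gauss (0::real^'n)" using gauss_differentiable differentiable_imp_continuous_within by blast
      from isCont_tendsto_compose[OF this lim0[of x]] have "(\<lambda>m. gauss (?e m *\<^sub>R x)) \<longlonglongrightarrow> 1" by simp
      from tendsto_mult[OF tendsto_const this] show "(\<lambda>m. fourier f x * gauss (?e m *\<^sub>R x)) \<longlonglongrightarrow> fourier f x" by simp
    qed
    show "AE x in lborel. norm (fourier f x * gauss (?e m *\<^sub>R x)) \<le> norm (fourier f x)" for m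
      using g1 by (auto simp: norm_mult intro!: AE_I2 mult_left_le)
  qed measurable
  have R: "(\<lambda>m. (LBINT x. f (?e m *\<^sub>R x) * gauss x)) \<longlonglongrightarrow> (LBINT x. f 0 * gauss (x :: real^'n))"
  proof (rule integral_dominated_convergence[where w="\<lambda>x. B * norm (gauss x :: complex)"])
    show "integrable lborel (\<lambda>x. B * norm (gauss x :: complex))"
      by (intro integrable_mult_right integrable_norm schwartz_integrable schwartz_gauss)
    show "AE x in lborel. (\<lambda>m. f (?e m *\<^sub>R x) * gauss x) \<longlonglongrightarrow> f 0 * gauss x"
    proof (rule AE_I2)
      fix x :: "real^'n"
      have "isCont f 0" using schwartz_differentiable[OF assms] differentiable_imp_continuous_within by blast
      from tendsto_mult[OF isCont_tendsto_compose[OF this lim0[of x]] tendsto_const]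
      show "(\<lambda>m. f (?e m *\<^sub>R x) * gauss x) \<longlonglongrightarrow> f 0 * gauss x" .
    qed
    show "AE x in lborel. norm (f (?e m *\<^sub>R x) * gauss x) \<le> B * norm (gauss x)" for m
      using B by (auto simp: norm_mult intro!: AE_I2 mult_right_mono)
  qed measurable
  have eq: "(LBINT \<xi>. fourier f \<xi> * gauss (e *\<^sub>R \<xi>)) = (LBINT x. f (e *\<^sub>R x) * gauss x)" if e: "e > 0" for e
  proof -
    have sg: "schwartz (\<lambda>\<xi>. gauss (e *\<^sub>R \<xi> + 0) :: complex)" using e by (intro schwartz_affine schwartz_gauss) auto
    have "(LBINT \<xi>. fourier f \<xi> * gauss (e *\<^sub>R \<xi>)) =
        (LBINT \<xi>. gauss (e *\<^sub>R \<xi>) * (LBINT x. f x * cexp (- \<xi>) x))" by (simp add: fourier_lborel mult.commute)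
    also have "\<dots> = (LBINT x. f x * (LBINT \<xi>. gauss (e *\<^sub>R \<xi>) * cexp (- \<xi>) x))"
      using schwartz_integrable[OF sg] schwartz_integrable[OF assms] by (intro Fubini_kernel[where C=1]) auto
    also have "\<dots> = (LBINT x. f (e *\<^sub>R x) * gauss x)"
    proof -
      have 1: "(LBINT \<xi>. gauss (e *\<^sub>R \<xi>) * cexp (- \<xi>) (e *\<^sub>R x)) = (1 / \<bar>e\<bar> ^ DIM(real^'n)) *\<^sub>R gauss x" for x :: "real^'n"
      proof -
        have "(LBINT \<xi>. gauss (0 + e *\<^sub>R \<xi>) * cexp (- (0 + e *\<^sub>R \<xi>)) x)
            = (1 / \<bar>e\<bar> ^ DIM(real^'n)) *\<^sub>R (LBINT \<xi>. gauss \<xi> * cexp (- \<xi>) x)"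
          using e by (intro integral_lborel_affine[of e "\<lambda>\<xi>. gauss \<xi> * cexp (- \<xi>) x"]) auto
        also have "(LBINT \<xi>. gauss \<xi> * cexp (- \<xi>) x) = gauss x"
        proof -
          have "cexp (- \<xi>) x = cexp (- x) \<xi>" for \<xi> by (simp add: cexp_def inner_commute)
          then show ?thesis using fourier_gauss[THEN fun_cong, of x] fourier_lborel[of gauss x] by simp
        qed
        finally show ?thesis by (simp add: cexp_minus cexp_scaleR)
      qed
      let ?F = "\<lambda>x. f x * (LBINT \<xi>. gauss (e *\<^sub>R \<xi>) * cexp (- \<xi>) x)"
      have "(LBINT x. ?F (0 + e *\<^sub>R x)) = (1 / \<bar>e\<bar> ^ DIM(real^'n)) *\<^sub>R (LBINT x. ?F x)"
        using e by (intro integral_lborel_affine) auto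
      moreover have "(LBINT x. ?F (0 + e *\<^sub>R x)) = (1 / \<bar>e\<bar> ^ DIM(real^'n)) *\<^sub>R (LBINT x. f (e *\<^sub>R x) * gauss x)"
        by (simp add: 1)
      ultimately show ?thesis using e by simp
    qed
    finally show ?thesis .
  qed
  have "(\<lambda>m. (LBINT \<xi>. fourier f \<xi> * gauss (?e m *\<^sub>R \<xi>))) = (\<lambda>m. (LBINT x. f (?e m *\<^sub>R x) * gauss x))"
    by (rule ext, rule eq) simp
  with R have "(LBINT \<xi>. fourier f \<xi>) = (LBINT x. f 0 * gauss (x :: real^'n))"
    by (intro LIMSEQ_unique[OF L]) simp
  then show ?thesis by (simp add: integral_gauss)
qed

lemma fourier_translate:
  assumes "schwartz f"
  shows "fourier (\<lambda>x. f (x + v)) \<xi> = cexp v \<xi> * fourier f \<xi>"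
proof -
  have [measurable]: "f \<in> borel_funs" by (rule schwartz_measurable[OF assms])
  have "fourier (\<lambda>x. f (x + v)) \<xi> = (LBINT x. f (x + v) * cexp (- \<xi>) x)" by (rule fourier_lborel) measurable
  also have "\<dots> = (LBINT x. cexp v \<xi> * (f (v + 1 *\<^sub>R x) * cexp (- \<xi>) (v + 1 *\<^sub>R x)))"
  proof (rule Bochner_Integration.integral_cong[OF refl])
    fix x
    have "cexp v \<xi> * cexp (- \<xi>) v = 1" by (metis cexp_cancel(1) cexp_commute)
    then have "f (v + x) * cexp (- \<xi>) x = (cexp v \<xi> * cexp (- \<xi>) v) * (f (v + x) * cexp (- \<xi>) x)" by simp
    also have "\<dots> = cexp v \<xi> * (f (v + x) * (cexp (- \<xi>) v * cexp (- \<xi>) x))" by (simp only: mult_ac)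
    finally show "f (x + v) * cexp (- \<xi>) x = cexp v \<xi> * (f (v + 1 *\<^sub>R x) * cexp (- \<xi>) (v + 1 *\<^sub>R x))"
      by (simp add: cexp_add_right add.commute)
  qed
  also have "\<dots> = cexp v \<xi> * (LBINT x. f (v + 1 *\<^sub>R x) * cexp (- \<xi>) (v + 1 *\<^sub>R x))"
    by (rule integral_mult_right_zero)
  also have "(LBINT x. f (v + 1 *\<^sub>R x) * cexp (- \<xi>) (v + 1 *\<^sub>R x)) = (LBINT x. f x * cexp (- \<xi>) x)"
    by (subst integral_lborel_affine[of 1 "\<lambda>x. f x * cexp (- \<xi>) x"]) auto
  also have "(LBINT x. f x * cexp (- \<xi>) x) = fourier f \<xi>" by (rule fourier_lborel[symmetric]) measurable
  finally show ?thesis .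
qed

lemma inv_fourier_fourier:
  assumes "schwartz f"
  shows "inv_fourier (fourier f) = f"
proof
  fix x
  have s: "schwartz (\<lambda>y. f (1 *\<^sub>R y + x))" using assms by (intro schwartz_affine) auto
  have "f x = (LBINT \<xi>. fourier (\<lambda>y. f (1 *\<^sub>R y + x)) \<xi>)" unfolding fourier_inversion_0[OF s] by simp
  also have "\<dots> = inv_fourier (fourier f) x"
    by (simp add: fourier_translate[OF assms] inv_fourier_def mult.commute)
  finally show "inv_fourier (fourier f) x = f x" by simp
qed

lemma fourier_inv_fourier:
  assumes "schwartz a"
  shows "fourier (inv_fourier a) = a"
proof
  fix \<xi>
  have [measurable]: "a \<in> borel_funs" "inv_fourier a \<in> borel_funs" "fourier a \<in> borel_funs"
    using assms schwartz_measurable schwartz_inv_fourier schwartz_fourier by blast+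
  have "fourier (inv_fourier a) \<xi> = (LBINT x. inv_fourier a x * cexp (- \<xi>) x)"
    by (rule fourier_lborel) measurable
  also have "\<dots> = (LBINT x. fourier a (0 + (-1) *\<^sub>R x) * cexp \<xi> (0 + (-1) *\<^sub>R x))"
    by (simp add: inv_fourier_eq cexp_minus)
  also have "\<dots> = inv_fourier (fourier a) \<xi>"
    unfolding inv_fourier_def by (subst integral_lborel_affine[of "-1" "\<lambda>x. fourier a x * cexp \<xi> x"]) auto
  finally show "fourier (inv_fourier a) \<xi> = a \<xi>" by (simp add: inv_fourier_fourier[OF assms])
qed

section \<open>Convolution of Schwartz functions with given spectrum\<close>

lemma inv_fourier_convolution:
  assumes "schwartz a" "schwartz g"
  shows "(LBINT y. inv_fourier a (x - y) * g y) = inv_fourier (\<lambda>\<xi>. a \<xi> * fourier g \<xi>) x"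
proof -
  have [measurable]: "a \<in> borel_funs" "g \<in> borel_funs" "fourier g \<in> borel_funs"
    using assms schwartz_measurable schwartz_fourier by blast+
  have "(LBINT y. inv_fourier a (x - y) * g y) = (LBINT y. g y * (LBINT \<xi>. a \<xi> * cexp (x - y) \<xi>))"
    by (simp add: inv_fourier_def mult.commute)
  also have "\<dots> = (LBINT \<xi>. a \<xi> * (LBINT y. g y * cexp (x - y) \<xi>))"
    by (rule Fubini_kernel[where C=1]) (use assms schwartz_integrable in auto)
  also have "\<dots> = inv_fourier (\<lambda>\<xi>. a \<xi> * fourier g \<xi>) x" unfolding inv_fourier_def
  proof (rule Bochner_Integration.integral_cong[OF refl])
    fix \<xi>
    have "cexp (x - y) \<xi> = cexp (- \<xi>) y * cexp x \<xi>" for y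
      using cexp_add_left[of x "- y" \<xi>] by (simp add: cexp_minus cexp_commute mult.commute)
        (metis cexp_commute cexp_minus)
    then have "(LBINT y. g y * cexp (x - y) \<xi>) = (LBINT y. (g y * cexp (- \<xi>) y) * cexp x \<xi>)"
      by (simp add: mult_ac)
    also have "\<dots> = fourier g \<xi> * cexp x \<xi>" by (simp add: fourier_lborel)
    finally show "a \<xi> * (LBINT y. g y * cexp (x - y) \<xi>) = a \<xi> * fourier g \<xi> * cexp x \<xi>" by simp
  qed
  finally show ?thesis .
qed

lemma inv_fourier_reproducing:
  assumes "schwartz a" "schwartz g" "\<And>\<xi>. fourier g \<xi> \<noteq> 0 \<Longrightarrow> a \<xi> = 1"
  shows "(LBINT y. inv_fourier a (x - y) * g y) = g x"
proof -
  have "(\<lambda>\<xi>. a \<xi> * fourier g \<xi>) = fourier g" using assms(3) by force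
  then show ?thesis using inv_fourier_convolution[OF assms(1,2)] inv_fourier_fourier[OF assms(2)] by simp
qed

lemma fourier_reflect_translate:
  assumes "schwartz b"
  shows "fourier (\<lambda>y. inv_fourier b (y - z)) \<xi> = cexp (- z) \<xi> * b \<xi>"
  using fourier_translate[OF schwartz_inv_fourier[OF assms], of "- z" \<xi>] fourier_inv_fourier[OF assms] by simp

text \<open>Up to characters, the transform of the product is the integral of
  \<open>a \<alpha> * b (\<xi> + \<alpha>)\<close> over \<open>\<alpha>\<close>. The two factors are
  both nonzero only if \<open>\<xi>\<close> is a difference of two vectors of norm at most
  \<open>R\<close>.\<close>

lemma fourier_product_support:
  fixes a b :: "'n::finite cfun"
  assumes a: "schwartz a" and b: "schwartz b"
    and supp: "\<And>\<xi>. a \<xi> \<noteq> 0 \<Longrightarrow> norm \<xi> \<le> R" "\<And>\<xi>. b \<xi> \<noteq> 0 \<Longrightarrow> norm \<xi> \<le> R"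
    and \<xi>: "fourier (\<lambda>y. inv_fourier a (x - y) * inv_fourier b (y - z)) \<xi> \<noteq> 0" shows "norm \<xi> \<le> 2 * R"
proof (rule ccontr)
  assume n: "\<not> norm \<xi> \<le> 2 * R"
  have [measurable]: "a \<in> borel_funs" "inv_fourier a \<in> borel_funs"
      "inv_fourier b \<in> borel_funs" using a b schwartz_measurable schwartz_inv_fourier by blast+
  let ?g = "\<lambda>y. inv_fourier b (y - z)"
  have g: "schwartz ?g" using schwartz_affine[OF schwartz_inv_fourier[OF b], of 1 "- z"] by simp
  have "fourier (\<lambda>y. inv_fourier a (x - y) * ?g y) \<xi>
      = (LBINT y. (?g y * cexp (- \<xi>) y) * (LBINT \<alpha>. a \<alpha> * cexp (x - y) \<alpha>))"
    by (subst fourier_lborel) (auto simp: inv_fourier_def[of a] mult_ac)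
  also have "\<dots> = (LBINT \<alpha>. a \<alpha> * (LBINT y. (?g y * cexp (- \<xi>) y) * cexp (x - y) \<alpha>))"
    by (rule Fubini_kernel[where C=1]) (use a g schwartz_mult_cexp[OF g] schwartz_integrable in auto)
  also have "\<dots> = integral\<^sup>L lborel (\<lambda>\<alpha> :: real^'n. 0)"
  proof (rule Bochner_Integration.integral_cong[OF refl])
    fix \<alpha>
    have "cexp (- \<xi>) y * cexp (x - y) \<alpha> = cexp (- (\<xi> + \<alpha>)) y * cexp x \<alpha>" for y
    proof -
      have "cexp (x - y) \<alpha> = cexp x \<alpha> * cexp (- \<alpha>) y"
        using cexp_add_left[of x "- y" \<alpha>] by (simp add: cexp_minus cexp_commute)
          (metis cexp_commute cexp_minus)
      then show ?thesis using cexp_add_left[of "- \<xi>" "- \<alpha>" y] by (simp add: mult_ac)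
    qed
    then have "(LBINT y. (?g y * cexp (- \<xi>) y) * cexp (x - y) \<alpha>) = (LBINT y. (?g y * cexp (- (\<xi> + \<alpha>)) y) * cexp x \<alpha>)"
      by (simp only: mult.assoc)
    also have "\<dots> = fourier ?g (\<xi> + \<alpha>) * cexp x \<alpha>" by (subst fourier_lborel) auto
    also have "\<dots> = cexp (- z) (\<xi> + \<alpha>) * b (\<xi> + \<alpha>) * cexp x \<alpha>" by (simp add: fourier_reflect_translate[OF b])
    finally have eq: "a \<alpha> * (LBINT y. (?g y * cexp (- \<xi>) y) * cexp (x - y) \<alpha>) = a \<alpha> * (cexp (- z) (\<xi> + \<alpha>) * b (\<xi> + \<alpha>) * cexp x \<alpha>)" by simp
    have "a \<alpha> = 0 \<or> b (\<xi> + \<alpha>) = 0"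
    proof (rule ccontr)
      assume "\<not> ?thesis"
      then have "norm \<alpha> \<le> R" "norm (\<xi> + \<alpha>) \<le> R" using supp by auto
      then show False using n norm_triangle_ineq4[of "\<xi> + \<alpha>" \<alpha>] by simp
    qed
    then show "a \<alpha> * (LBINT y. (?g y * cexp (- \<xi>) y) * cexp (x - y) \<alpha>) = 0" unfolding eq by auto
  qed
  finally show False using \<xi> by simp
qed

lemma iter_diff_inv_fourier:
  assumes "schwartz a"
  shows "iter_diff L h (inv_fourier a) = inv_fourier (\<lambda>\<xi>. a \<xi> * (cexp h \<xi> - 1) ^ L)"
    and "schwartz (\<lambda>\<xi>. a \<xi> * (cexp h \<xi> - 1) ^ L)"
proof -
  show s: "schwartz (\<lambda>\<xi>. a \<xi> * (cexp h \<xi> - 1) ^ L)" for L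
  proof (rule schwartz_mult_growth[OF assms])
    show "growth k 0 {()} (\<lambda>_ \<xi>. (cexp h \<xi> - 1) ^ L)" for k
      by (intro growth_power0 growth_diff growth_cexp[where B="norm h"] growth_const[where B=1]) auto
  qed
  show "iter_diff L h (inv_fourier a) = inv_fourier (\<lambda>\<xi>. a \<xi> * (cexp h \<xi> - 1) ^ L)"
  proof (induction L)
    case (Suc L)
    let ?b = "\<lambda>\<xi>. a \<xi> * (cexp h \<xi> - 1) ^ L"
    have "inv_fourier ?b (x + h) - inv_fourier ?b x = inv_fourier (\<lambda>\<xi>. a \<xi> * (cexp h \<xi> - 1) ^ Suc L) x" for x
    proof -
      have i: "integrable lborel (\<lambda>\<xi>. ?b \<xi> * cexp x \<xi>)" for x
        by (intro schwartz_integrable schwartz_mult_cexp s)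
      have "inv_fourier ?b (x + h) - inv_fourier ?b x = (LBINT \<xi>. ?b \<xi> * cexp (x + h) \<xi> - ?b \<xi> * cexp x \<xi>)"
        unfolding inv_fourier_def by (rule Bochner_Integration.integral_diff[symmetric]) (rule i)+
      also have "\<dots> = inv_fourier (\<lambda>\<xi>. a \<xi> * (cexp h \<xi> - 1) ^ Suc L) x"
        unfolding inv_fourier_def by (simp add: cexp_add_left algebra_simps)
      finally show ?thesis .
    qed
    then show ?case by (simp add: Suc)
  qed simp
qed

lemma dilate_inv_fourier:
  fixes a :: "'n::finite cfun"
  assumes "schwartz a"
  shows "dilate l (inv_fourier a) = inv_fourier (\<lambda>\<xi>. a ((2 powi (- l)) *\<^sub>R \<xi>))"
proof
  fix x :: "real^'n"
  have [measurable]: "a \<in> borel_funs" by (rule schwartz_measurable[OF assms])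
  let ?c = "2 powi (- l) :: real"
  have c: "?c \<noteq> 0" "?c > 0" by auto
  have "inv_fourier (\<lambda>\<xi>. a (?c *\<^sub>R \<xi>)) x = (LBINT \<xi>. a (0 + ?c *\<^sub>R \<xi>) * cexp ((2 powi l) *\<^sub>R x) (0 + ?c *\<^sub>R \<xi>))"
    by (simp add: inv_fourier_def cexp_scaleR power_int_minus)
  also have "\<dots> = (1 / \<bar>?c\<bar> ^ DIM(real^'n)) *\<^sub>R inv_fourier a ((2 powi l) *\<^sub>R x)" unfolding inv_fourier_def
    by (rule integral_lborel_affine[OF c(1), of "\<lambda>\<xi>. a \<xi> * cexp ((2 powi l) *\<^sub>R x) \<xi>" 0]) measurable
  also have "\<dots> = dilate l (inv_fourier a) x"
    by (simp add: dilate_def scaleR_conv_of_real power_int_minus power_inverse divide_inverse)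
  finally show "dilate l (inv_fourier a) x = inv_fourier (\<lambda>\<xi>. a (?c *\<^sub>R \<xi>)) x" by simp
qed

section \<open>Convolution of Schwartz functions with tempered distributions\<close>

lemma schwartz_reflect: "schwartz f \<Longrightarrow> schwartz (\<lambda>y. f (x - y))"
  using schwartz_affine[of f "-1" x] by simp

text \<open>By Peetre's inequality all translates of a Schwartz function become a bounded family
  once each is divided by a weight at its position. Under a tempered distribution this yields
  polynomial growth of convolutions.\<close>

lemma growth_reflect_translate:
  assumes "schwartz \<eta>" "N \<ge> 0"
  shows "growth k (- N) UNIV (\<lambda>y z. of_real ((1 + norm y) powr (- N)) * \<eta> (y - z))"
proof -
  have "(1 + norm y) powr (- N) * (1 + norm (y - z)) powr (- N) \<le> (1 + norm z) powr (- N)" for y z :: "real^'a"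
  proof -
    have "(1 + norm z) powr N * (1 + norm (y - z)) powr (- N) \<le> (1 + norm y) powr N"
      using peetre_powr[OF assms(2), of "-z" y] by simp
    then show ?thesis by (simp add: powr_minus field_simps)
  qed
  then have "growth k (- N) UNIV (\<lambda>y z. of_real ((1 + norm y) powr (- N)) * \<eta> ((-1) *\<^sub>R z + y))"
    using assms by (intro growth_affine[where B=1 and K=1 and m="-N"] schwartz_imp_growth) auto
  then show ?thesis by simp
qed

text \<open>The analogue for difference quotients of translates; it will give a weighted Lipschitz
  bound. At equal points the factor is a division by zero, hence \<open>0\<close>. A derivative in
  \<open>z\<close> is, up to sign, the same expression for \<open>partial j \<eta>\<close>, so the
  mean value inequality is needed only at order zero.\<close>

lemma growth_translate_difference:
  assumes "schwartz \<eta>" "N \<ge> 0"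
  shows "growth k (- N) UNIV (\<lambda>p z. of_real ((1 + norm (fst p) + norm (snd p)) powr (- N) / norm (fst p - snd p))
     * (\<eta> (fst p - z) - \<eta> (snd p - z)))" using assms(1)
proof (induction k arbitrary: \<eta>)
  case (0 \<eta>)
  have gr: "growth (Suc 0) N UNIV (\<lambda>z w. of_real ((1 + norm z) powr N) * \<eta> (1 *\<^sub>R w + (- z)))"
  proof (rule growth_affine[where m="- N" and B=1 and K=1, OF schwartz_imp_growth[OF 0]])
    fix z w :: "real^'a"
    show "norm (complex_of_real ((1 + norm z) powr N)) * (1 + norm (1 *\<^sub>R w + - z)) powr - N \<le> 1 * (1 + norm w) powr N"
      using peetre_powr[OF assms(2), of "-z" w] by simp
  qed auto
  obtain B where B: "B > 0"
    "\<forall>z\<in>UNIV. \<forall>x y. norm (of_real ((1 + norm z) powr N) * \<eta> (1 *\<^sub>R y + - z) - of_real ((1 + norm z) powr N) * \<eta> (1 *\<^sub>R x + - z))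
      \<le> B * (1 + norm x + norm y) powr \<bar>N\<bar> * norm (y - x)" using growth_mean_value[OF gr] by (elim exE conjE)
  have "norm (of_real ((1 + norm y + norm x) powr (- N) / norm (y - x)) * (\<eta> (y - z) - \<eta> (x - z))) \<le> B * (1 + norm z) powr (- N)"
    for x y z :: "real^'a"
  proof (cases "x = y")
    case False
    then have p: "norm (y - x) > 0" by simp
    have q: "(1 + norm x + norm y) powr N > 0"
      by (metis add_nonneg_pos add.commute add_pos_nonneg less_irrefl norm_ge_zero powr_gt_zero zero_less_one)
    have "norm (of_real ((1 + norm z) powr N) * \<eta> (y - z) - of_real ((1 + norm z) powr N) * \<eta> (x - z))
      \<le> B * (1 + norm x + norm y) powr N * norm (y - x)"
      using B(2)[rule_format, OF UNIV_I, of z y x] assms(2) by simp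
    moreover have "of_real ((1 + norm z) powr N) * \<eta> (y - z) - of_real ((1 + norm z) powr N) * \<eta> (x - z)
       = of_real ((1 + norm z) powr N) * (\<eta> (y - z) - \<eta> (x - z))" by (simp add: algebra_simps)
    ultimately have "(1 + norm z) powr N * norm (\<eta> (y - z) - \<eta> (x - z)) \<le> B * (1 + norm x + norm y) powr N * norm (y - x)"
      by (simp add: norm_mult)
    then have "norm (\<eta> (y - z) - \<eta> (x - z)) \<le> B * (1 + norm x + norm y) powr N * norm (y - x) * (1 + norm z) powr (- N)"
      by (simp add: powr_minus field_simps)
    then have "((1 + norm x + norm y) powr (- N) / norm (y - x)) * norm (\<eta> (y - z) - \<eta> (x - z))
       \<le> ((1 + norm x + norm y) powr (- N) / norm (y - x)) * (B * (1 + norm x + norm y) powr N * norm (y - x) * (1 + norm z) powr (- N))"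
      by (intro mult_left_mono) auto
    also have "\<dots> = B * (1 + norm z) powr (- N)" using p q by (simp add: powr_minus field_simps)
    finally show ?thesis by (simp add: norm_mult norm_divide add_ac)
  qed (use B(1) in auto)
  then show ?case by (intro growth_0I) auto
next
  case (Suc k)
  let ?c = "\<lambda>p. complex_of_real ((1 + norm (fst p) + norm (snd p)) powr (- N) / norm (fst p - snd p))"
  have sp: "schwartz (partial j \<eta>)" for j by (rule schwartz_partial[OF Suc.prems])
  have d: "(\<lambda>z. \<eta> (y - z)) differentiable (at z)" for y z
    by (rule schwartz_differentiable[OF schwartz_reflect[OF Suc.prems]])
  have pr: "partial j (\<lambda>z. \<eta> (y - z)) z = - partial j \<eta> (y - z)" for j y z
    using partial_affine(1)[of \<eta> "-1" z y j] schwartz_differentiable[OF Suc.prems] by simp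
  have e1: "partial j (\<lambda>z. c * (\<eta> (x - z) - \<eta> (y - z))) = (\<lambda>z. (- 1) * (c * (partial j \<eta> (x - z) - partial j \<eta> (y - z))))" for c x y j
  proof
    fix z
    have "((\<lambda>z. \<eta> (x - z) - \<eta> (y - z)) has_derivative (\<lambda>h. frechet_derivative (\<lambda>z. \<eta> (x - z)) (at z) h - frechet_derivative (\<lambda>z. \<eta> (y - z)) (at z) h)) (at z)"
      by (intro has_derivative_diff differentiable_has_derivative d)
    from partial_eq[OF this, of j]
    have e: "partial j (\<lambda>z. \<eta> (x - z) - \<eta> (y - z)) z = - partial j \<eta> (x - z) + partial j \<eta> (y - z)"
      by (simp add: partial_def[symmetric] pr[unfolded partial_def] ) (simp add: pr partial_def)
    show "partial j (\<lambda>z. c * (\<eta> (x - z) - \<eta> (y - z))) z = (- 1) * (c * (partial j \<eta> (x - z) - partial j \<eta> (y - z)))"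
      by (subst partial_mult) (auto simp: partial_const e right_diff_distrib distrib_left intro!: differentiable_diff d)
  qed
  have "growth k (- N) UNIV (\<lambda>p z. (-1) * (?c p * (partial j \<eta> (fst p - z) - partial j \<eta> (snd p - z))))" for j
    by (intro growth_cmult[where B=1] Suc.IH sp) auto
  then have "growth k (- N) UNIV (\<lambda>p. partial j (\<lambda>z. ?c p * (\<eta> (fst p - z) - \<eta> (snd p - z))))" for j
    unfolding e1 .
  moreover have "growth 0 (- N) UNIV (\<lambda>p z. ?c p * (\<eta> (fst p - z) - \<eta> (snd p - z)))"
    by (rule growth_imp_0[OF Suc.IH[OF Suc.prems]])
  ultimately show ?case by (intro growth_SucI differentiable_mult differentiable_diff d differentiable_const)
qed

section \<open>Tempered distributions as functionals, and their convolutions as functions\<close>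

context
  fixes T :: "'n::finite cfun \<Rightarrow> complex"
  assumes T: "tempered T"
begin

lemma tempered_cmult: "schwartz \<phi> \<Longrightarrow> T (\<lambda>x. a * \<phi> x) = a * T \<phi>"
  using tempered_linear[OF T, of \<phi> \<phi> a 0] by simp

lemma tempered_add: "schwartz \<phi> \<Longrightarrow> schwartz \<theta> \<Longrightarrow> T (\<lambda>x. \<phi> x + \<theta> x) = T \<phi> + T \<theta>"
  using tempered_linear[OF T, of \<phi> \<theta> 1 1] by simp

lemma tempered_diff: "schwartz \<phi> \<Longrightarrow> schwartz \<theta> \<Longrightarrow> T (\<lambda>x. \<phi> x - \<theta> x) = T \<phi> - T \<theta>"
  using tempered_linear[OF T, of \<phi> \<theta> 1 "-1"] by simp

lemma schwartz_zero: "schwartz (\<lambda>x :: real^'n. 0)"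
  by (simp add: schwartz_iff_family schwartz_family_def growth_zero)

lemma tempered_zero: "T (\<lambda>x. 0) = 0"
  using tempered_cmult[OF schwartz_zero, of 0] by simp

lemma tempered_sum: "(\<And>i. i \<in> A \<Longrightarrow> schwartz (F i)) \<Longrightarrow> T (\<lambda>x. \<Sum>i\<in>A. F i x) = (\<Sum>i\<in>A. T (F i))"
  by (induction A rule: infinite_finite_induct) (auto simp: tempered_zero tempered_add schwartz_sum)

text \<open>Boundedness after multiplication by \<open>2 ^ n\<close> stands in for convergence in
  the Schwartz topology: \<open>T (F n)\<close> is then \<open>O(2^-n)\<close>.\<close>

lemma tempered_null_sequence:
  assumes "schwartz_family UNIV (\<lambda>n x. of_real (2 ^ n) * F n x)" "\<And>n. schwartz (F n)"
  shows "(\<lambda>n::nat. T (F n)) \<longlonglongrightarrow> 0"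
proof -
  have "\<exists>C. \<forall>n. norm (T (\<lambda>x. of_real (2 ^ n) * F n x)) \<le> C"
  proof -
    obtain N where N: "\<forall>(I::nat set) F. growth N (- real N) I F \<longrightarrow> (\<forall>i\<in>I. schwartz (F i)) \<longrightarrow>
      (\<exists>C. \<forall>i\<in>I. norm (T (F i)) \<le> C)" using tempered_bounded[OF T] by (rule exE)
    have "\<exists>C. \<forall>i\<in>UNIV. norm (T (\<lambda>x. of_real (2 ^ i) * F i x)) \<le> C"
      by (rule N[rule_format]) (use assms schwartz_familyD[OF assms(1)] in \<open>auto simp: schwartz_family_def\<close>)
    then show ?thesis by simp
  qed
  then obtain C where C: "\<forall>n. norm (T (\<lambda>x. of_real (2 ^ n) * F n x)) \<le> C" by (rule exE)
  have le: "norm (T (F n)) \<le> C * (1/2) ^ n" for n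
    using C[rule_format, of n] tempered_cmult[OF assms(2), of "of_real (2 ^ n)" n]
    by (simp add: norm_mult norm_power field_simps)
  have "(\<lambda>n. C * (1/2) ^ n) \<longlonglongrightarrow> C * 0" by (rule tendsto_mult[OF tendsto_const LIMSEQ_power_zero]) simp
  then have "(\<lambda>n. C * (1/2) ^ n) \<longlonglongrightarrow> 0" by simp
  with always_eventually[OF allI[OF le]] show ?thesis by (rule Lim_null_comparison)
qed

text \<open>\<open>T\<close> is applied to the two bounded families of weighted translates and of
  weighted difference quotients of translates; undoing the weights gives the two estimates with one
  common \<open>N\<close>.\<close>

lemma convolution_growth:
  assumes "schwartz \<eta>"
  obtains N C where "N \<ge> 0" "C > 0" "\<forall>y. norm (conv \<eta> T y) \<le> C * (1 + norm y) powr N"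
    "\<forall>x y. norm (conv \<eta> T y - conv \<eta> T x) \<le> C * (1 + norm y + norm x) powr N * norm (y - x)"
proof -
  let ?D = "\<lambda>N p z. of_real ((1 + norm (fst p) + norm (snd p)) powr (- N) / norm (fst p - snd p))
     * (\<eta> (fst p - z) - \<eta> (snd p - z))"
  obtain N0 where N0: "\<forall>(I::((real^'n) \<times> (real^'n)) set) F. growth N0 (- real N0) I F \<longrightarrow> (\<forall>i\<in>I. schwartz (F i)) \<longrightarrow>
      (\<exists>C. \<forall>i\<in>I. norm (T (F i)) \<le> C)" using tempered_bounded[OF T] by (rule exE)
  define N where "N = real N0"
  \<comment> \<open>The index set consists of pairs although only the first component enters,
    because the index type in \<open>N0\<close> is fixed and the second family needs pairs.\<close>
  have "\<exists>C. \<forall>p\<in>UNIV :: ((real^'n) \<times> (real^'n)) set. norm (T (\<lambda>z. of_real ((1 + norm (fst p)) powr (- N)) * \<eta> (fst p - z))) \<le> C"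
    unfolding N_def by (rule N0[rule_format])
      (auto intro!: growth_reindex[where r=fst, OF growth_reflect_translate[OF assms]] schwartz_cmult schwartz_reflect assms)
  then obtain C1 where 1: "\<forall>p\<in>UNIV :: ((real^'n) \<times> (real^'n)) set. norm (T (\<lambda>z. of_real ((1 + norm (fst p)) powr (- N)) * \<eta> (fst p - z))) \<le> C1" by (rule exE)
  have "\<exists>C. \<forall>p\<in>UNIV. norm (T (?D N p)) \<le> C" unfolding N_def
    by (rule N0[rule_format]) (intro growth_translate_difference schwartz_cmult schwartz_diff schwartz_reflect assms of_nat_0_le_iff)+
  then obtain C2 where 2: "\<forall>p\<in>UNIV. norm (T (?D N p)) \<le> C2" by (rule exE)
  define C where "C = max (max C1 C2) 1"
  show thesis
  proof
    show "N \<ge> 0" "C > 0" by (auto simp: N_def C_def)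
    show "\<forall>y. norm (conv \<eta> T y) \<le> C * (1 + norm y) powr N"
    proof
      fix y
      have "norm (conv \<eta> T y) * (1 + norm y) powr (- N) \<le> C1"
        using 1[rule_format, OF UNIV_I, of "(y, y)"] unfolding fst_conv tempered_cmult[OF schwartz_reflect[OF assms, of y]]
        by (simp add: schwartz_convolution_def norm_mult mult.commute)
      then have "norm (conv \<eta> T y) \<le> C1 * (1 + norm y) powr N" by (simp add: powr_minus field_simps)
      also have "\<dots> \<le> C * (1 + norm y) powr N" by (intro mult_right_mono) (auto simp: C_def)
      finally show "norm (conv \<eta> T y) \<le> C * (1 + norm y) powr N" .
    qed
    show "\<forall>x y. norm (conv \<eta> T y - conv \<eta> T x) \<le> C * (1 + norm y + norm x) powr N * norm (y - x)"
    proof safe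
      fix x y :: "real^'n"
      let ?w = "1 + norm y + norm x"
      have w: "?w > 0" "?w \<ge> 1" by (auto simp: add_pos_nonneg)
      show "norm (conv \<eta> T y - conv \<eta> T x) \<le> C * ?w powr N * norm (y - x)"
      proof (cases "x = y")
        case False
        then have p: "norm (y - x) > 0" by simp
        have "norm (of_real (?w powr (- N) / norm (y - x)) * (conv \<eta> T y - conv \<eta> T x)) \<le> C2"
          using 2[rule_format, OF UNIV_I, of "(y, x)"] unfolding fst_conv snd_conv schwartz_convolution_def
            tempered_cmult[OF schwartz_diff[OF schwartz_reflect[OF assms] schwartz_reflect[OF assms]]]
              tempered_diff[OF schwartz_reflect[OF assms] schwartz_reflect[OF assms]] .
        then have f1: "norm (conv \<eta> T y - conv \<eta> T x) * (?w powr (- N) / norm (y - x)) \<le> C2"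
          by (simp add: norm_mult norm_divide mult.commute)
        have "norm (conv \<eta> T y - conv \<eta> T x) \<le> C2 * ?w powr N * norm (y - x)"
        proof -
          have aux: "A \<le> C2 * U * P" if "A * (inverse U / P) \<le> C2" "U > 0" "P > 0" for A U P :: real
            using that by (simp add: field_simps)
          have "?w powr N > 0" unfolding powr_gt_zero using w(1) by (rule less_imp_neq[symmetric])
          from aux[OF f1[unfolded powr_minus] this p] show ?thesis .
        qed
        also have "\<dots> \<le> C * ?w powr N * norm (y - x)" by (intro mult_right_mono) (auto simp: C_def)
        finally show ?thesis .
      qed simp
    qed
  qed
qed

lemma convolution_continuous:
  assumes "schwartz \<eta>"
  shows "continuous_on S (conv \<eta> T)"
proof -
  obtain N C where NC: "\<forall>x y. norm (conv \<eta> T y - conv \<eta> T x) \<le> C * (1 + norm y + norm x) powr N * norm (y - x)"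
    by (rule convolution_growth[OF assms])
  have "isCont (conv \<eta> T) x" for x unfolding isCont_def
  proof (rule LIM_zero_cancel, rule Lim_null_comparison)
    show "\<forall>\<^sub>F y in at x. norm (conv \<eta> T y - conv \<eta> T x) \<le> C * (1 + norm y + norm x) powr N * norm (y - x)"
      using NC by auto
    have "((\<lambda>y. C * (1 + norm y + norm x) powr N * norm (y - x)) \<longlongrightarrow> C * (1 + norm x + norm x) powr N * norm (x - x)) (at x)"
      by (intro tendsto_intros) (auto simp: add_nonneg_eq_0_iff)
    then show "((\<lambda>y. C * (1 + norm y + norm x) powr N * norm (y - x)) \<longlongrightarrow> 0) (at x)" by simp
  qed
  then show ?thesis by (simp add: continuous_at_imp_continuous_on)
qed

lemma convolution_measurable: "schwartz \<eta> \<Longrightarrow> conv \<eta> T \<in> borel_funs"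
  by (rule borel_measurable_continuous_onI[OF convolution_continuous])

end

lemma schwartz_weight_integrable:
  fixes a :: "'n::finite cfun"
  assumes "schwartz a" shows "integrable lborel (\<lambda>y. of_real ((1 + norm y) powr N) * a y)"
proof -
  have [measurable]: "a \<in> borel_funs" by (rule schwartz_measurable[OF assms])
  have "growth 0 N {()} (\<lambda>_ y::real^'n. complex_of_real ((1 + norm y) powr N))"
    by (rule growth_0I[where B=1]) auto
  from growth_mult[OF this schwartz_imp_growth[OF assms, of 0 "- weight_exponent TYPE('n) - N"]]
  show ?thesis by (intro growth_integrable_single) auto
qed

lemma schwartz_superposition:
  fixes a \<eta> :: "'n::finite cfun"
  assumes "schwartz a" "schwartz \<eta>"
  shows "schwartz (\<lambda>z. (LBINT y. a y * \<eta> (y - z)))" unfolding schwartz_iff_family schwartz_family_def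
proof safe
  fix k and m :: real
  define N where "N = max 0 (- m)"
  have [measurable]: "\<eta> \<in> borel_funs" by (rule schwartz_measurable[OF assms(2)])
  let ?a = "\<lambda>y. of_real ((1 + norm y) powr N) * a y"
  let ?G = "\<lambda>y z. of_real ((1 + norm y) powr (- N)) * \<eta> (y - z)"
  have "growth k (- N) {()} (\<lambda>i z. (LBINT y. ?a y * ?G y z))"
    by (rule growth_param_integral[OF _ growth_reindex[OF growth_reflect_translate[OF assms(2)], where r=snd], where A="(LBINT y. norm (?a y))"])
      (use schwartz_weight_integrable[OF assms(1)] in \<open>auto simp: N_def\<close>)
  moreover have "?a y * ?G y z = a y * \<eta> (y - z)" for y z
  proof -
    have "complex_of_real ((1 + norm y) powr N) * of_real ((1 + norm y) powr (- N)) = 1"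
      by (simp flip: of_real_mult powr_add)
    moreover have "?a y * ?G y z = (of_real ((1 + norm y) powr N) * of_real ((1 + norm y) powr (- N))) * (a y * \<eta> (y - z))"
      by (simp only: mult_ac)
    ultimately show ?thesis by simp
  qed
  ultimately have "growth k (- N) {()} (\<lambda>i z. (LBINT y. a y * \<eta> (y - z)))" by simp
  then show "growth k m {()} (\<lambda>i z. (LBINT y. a y * \<eta> (y - z)))" by (rule growth_le_m) (simp add: N_def)
qed

lemma integral_simple_function:
  fixes a :: "'a \<Rightarrow> complex" and g :: "'b \<Rightarrow> complex"
  assumes "simple_function M r" "integrable M a"
  shows "(\<integral>y. a y * g (r y) \<partial>M) = (\<Sum>v\<in>r ` space M. (\<integral>y. indicator (r -` {v} \<inter> space M) y * a y \<partial>M) * g v)"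
proof -
  have fin: "finite (r ` space M)" using assms(1) by (rule simple_functionD)
  have "(\<integral>y. a y * g (r y) \<partial>M) = (\<integral>y. (\<Sum>v\<in>r ` space M. (indicator (r -` {v} \<inter> space M) y * a y) * g v) \<partial>M)"
  proof (rule Bochner_Integration.integral_cong[OF refl])
    fix y assume y: "y \<in> space M"
    have "(\<Sum>v\<in>r ` space M. (indicator (r -` {v} \<inter> space M) y * a y) * g v) = (\<Sum>v\<in>r ` space M. if v = r y then a y * g (r y) else 0)"
      using y by (intro sum.cong) (auto simp: indicator_def)
    then show "a y * g (r y) = (\<Sum>v\<in>r ` space M. (indicator (r -` {v} \<inter> space M) y * a y) * g v)"
      using y fin by simp
  qed
  also have "\<dots> = (\<Sum>v\<in>r ` space M. (\<integral>y. (indicator (r -` {v} \<inter> space M) y * a y) * g v \<partial>M))"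
  proof (rule Bochner_Integration.integral_sum)
    fix v
    have "integrable M (\<lambda>y. indicat_real (r -` {v} \<inter> space M) y *\<^sub>R a y)"
      using simple_functionD(2)[OF assms(1)] assms(2) by (intro integrable_mult_indicator) auto
    then have "integrable M (\<lambda>y. indicator (r -` {v} \<inter> space M) y * a y)"
      by (rule Bochner_Integration.integrable_cong[THEN iffD1, rotated 2]) (auto simp: indicator_def)
    then show "integrable M (\<lambda>y. (indicator (r -` {v} \<inter> space M) y * a y) * g v)" by simp
  qed
  finally show ?thesis by simp
qed

text \<open>A tempered distribution is moved under the integral sign by approximating the superposition by
finite ones, in which the position is replaced by a simple function of it.\<close>

lemma tempered_superposition:
  fixes T :: "'n::finite cfun \<Rightarrow> complex"
  assumes T: "tempered T" and a: "schwartz a" and \<eta>: "schwartz \<eta>"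
  shows "T (\<lambda>z. (LBINT y. a y * \<eta> (y - z))) = (LBINT y. a y * conv \<eta> T y)"
proof -
  let ?g = "conv \<eta> T"
  let ?th = "\<lambda>z. (LBINT y. a y * \<eta> (y - z))"
  have [measurable]: "\<eta> \<in> borel_funs" by (rule schwartz_measurable[OF \<eta>])
  have [measurable]: "?g \<in> borel_funs" by (rule convolution_measurable[OF T \<eta>])
  have [measurable]: "a \<in> borel_funs" by (rule schwartz_measurable[OF a])
  have ia: "integrable lborel a" by (rule schwartz_integrable[OF a])
  \<comment> \<open>Simple functions tending to the identity. The bound
    \<open>norm (r i x) \<le> 2 * norm x\<close> keeps weights at \<open>r i x\<close> comparable
    with those at \<open>x\<close> and accounts for the factor \<open>3\<close> in
    \<open>wle\<close>.\<close>
  obtain r :: "nat \<Rightarrow> real^'n \<Rightarrow> real^'n" where r: "\<And>i. simple_function borel (r i)"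
    "\<And>x. (\<lambda>i. r i x) \<longlonglongrightarrow> x" "\<And>i x. norm (r i x) \<le> 2 * norm x"
    using borel_measurable_implies_sequence_metric[of "\<lambda>x::real^'n. x" borel 0] by auto
  have r': "simple_function lborel (r i)" for i using r(1)[of i] by (simp add: simple_function_def)
  have [measurable]: "r i \<in> borel_funs" for i using r(1) by (rule borel_measurable_simple_function)
  let ?tm = "\<lambda>m z. (LBINT y. a y * \<eta> (r m y - z))"
  let ?c = "\<lambda>m v. (LBINT y. indicator (r m -` {v} \<inter> UNIV) y * a y)"
  have tm: "?tm m = (\<lambda>z. \<Sum>v\<in>range (r m). ?c m v * \<eta> (v - z))" for m
    using integral_simple_function[OF r'[of m] ia, of "\<lambda>v. \<eta> (v - z)" for z] by simp
  have sthm: "schwartz (?tm m)" for m unfolding tm by (intro schwartz_sum schwartz_cmult schwartz_reflect \<eta>)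
  have sth: "schwartz ?th" by (rule schwartz_superposition[OF a \<eta>])
  have Tthm: "T (?tm m) = (LBINT y. a y * ?g (r m y))" for m
  proof -
    have "T (?tm m) = (\<Sum>v\<in>range (r m). ?c m v * ?g v)" unfolding tm
      by (subst tempered_sum[OF T]) (auto intro!: schwartz_cmult schwartz_reflect \<eta> sum.cong
          simp: schwartz_convolution_def tempered_cmult[OF T schwartz_reflect[OF \<eta>]])
    then show ?thesis using integral_simple_function[OF r' ia, of ?g m] by simp
  qed
  obtain N C where NC: "N \<ge> 0" "C > 0" "\<forall>y. norm (?g y) \<le> C * (1 + norm y) powr N"
    by (rule convolution_growth[OF T \<eta>])
  have wle: "(1 + norm y + norm (r m y)) powr M \<le> 3 powr M * (1 + norm y) powr M" if "M \<ge> 0" for M m y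
  proof -
    have "1 + norm y + norm (r m y) \<le> 3 * (1 + norm y)" using r(3)[of m y] by simp
    then have "(1 + norm y + norm (r m y)) powr M \<le> (3 * (1 + norm y)) powr M"
      using that by (intro powr_mono2) auto
    also have "(3 * (1 + norm y)) powr M = 3 powr M * (1 + norm y) powr M" by (rule powr_mult)
    finally show ?thesis .
  qed
  have iN: "integrable lborel (\<lambda>y. (1 + norm y) powr M * norm (a y))" for M
  proof -
    have "integrable lborel (\<lambda>y. norm (complex_of_real ((1 + norm y) powr M) * a y))"
      by (intro integrable_norm schwartz_weight_integrable a)
    then show ?thesis by (simp add: norm_mult)
  qed
  let ?u = "\<lambda>y. C * 3 powr N * ((1 + norm y) powr N * norm (a y))"
  have lim1: "(\<lambda>m. T (?tm m)) \<longlonglongrightarrow> (LBINT y. a y * ?g y)" unfolding Tthm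
  proof (rule integral_dominated_convergence[where w="?u"])
    show "integrable lborel ?u" using iN by simp
    show "AE y in lborel. (\<lambda>m. a y * ?g (r m y)) \<longlonglongrightarrow> a y * ?g y"
    proof (rule AE_I2)
      fix y
      have "isCont ?g y" using convolution_continuous[OF T \<eta>, of UNIV]
        by (simp add: continuous_on_eq_continuous_at)
      then show "(\<lambda>m. a y * ?g (r m y)) \<longlonglongrightarrow> a y * ?g y"
        by (intro tendsto_mult tendsto_const isCont_tendsto_compose[OF _ r(2)])
    qed
    show "AE y in lborel. norm (a y * ?g (r m y)) \<le> ?u y" for m
    proof (rule AE_I2)
      fix y
      have "norm (?g (r m y)) \<le> C * (1 + norm (r m y)) powr N" using NC by blast
      also have "\<dots> \<le> C * (1 + norm y + norm (r m y)) powr N" using NC by (intro mult_left_mono powr_mono2) auto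
      also have "\<dots> \<le> C * (3 powr N * (1 + norm y) powr N)" using NC wle[of N] by (intro mult_left_mono) auto
      finally have "norm (a y) * norm (?g (r m y)) \<le> norm (a y) * (C * (3 powr N * (1 + norm y) powr N))"
        by (intro mult_left_mono) auto
      then show "norm (a y * ?g (r m y)) \<le> ?u y" by (simp add: norm_mult mult_ac)
    qed
  qed measurable
  have lim2: "(\<lambda>m. T (?tm m)) \<longlonglongrightarrow> T ?th"
  proof -
    obtain N where N: "\<forall>(I::nat set) F. growth N (- real N) I F \<longrightarrow> (\<forall>i\<in>I. schwartz (F i)) \<longrightarrow>
      (\<exists>C. \<forall>i\<in>I. norm (T (F i)) \<le> C)" using tempered_bounded[OF T] by (rule exE)
    let ?w = "\<lambda>m y. (1 + norm y + norm (r m y)) powr real N * norm (y - r m y)"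
    let ?h = "\<lambda>m y. ?w m y * norm (a y)" and ?v = "\<lambda>y. 3 powr real N * 3 * ((1 + norm y) powr (real N + 1) * norm (a y))"
    \<comment> \<open>A weighted \<open>L^1\<close> distance between the identity and
      \<open>r m\<close>. The summand \<open>1 / (m + 1)\<close> keeps it positive, so that the
      error may be divided by it.\<close>
    define \<delta> where "\<delta> m = (LBINT y. ?h m y) + 1 / real (Suc m)" for m
    have wbd: "?w m y \<le> 3 powr real N * 3 * (1 + norm y) powr (real N + 1)" for m y
    proof -
      have "norm (y - r m y) \<le> 3 * (1 + norm y)" using norm_triangle_ineq4[of y "r m y"] r(3)[of m y] by simp
      then have "?w m y \<le> (3 powr real N * (1 + norm y) powr real N) * (3 * (1 + norm y))"
        using wle[of "real N" y m] by (intro mult_mono) auto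
      also have "(c * X powr e) * (3 * X) = c * 3 * X powr (e + 1)" if "X > 0" for c X e :: real
        using that by (simp add: powr_add)
      finally show ?thesis by simp
    qed
    have wbd': "norm (?h m y) \<le> ?v y" for m y
    proof -
      have "norm (?h m y) = ?h m y" by simp
      also have "\<dots> \<le> (3 powr real N * 3 * (1 + norm y) powr (real N + 1)) * norm (a y)"
        by (rule mult_right_mono[OF wbd norm_ge_zero])
      finally show ?thesis by (simp only: mult.assoc)
    qed
    have iw: "integrable lborel (?h m)" for m
    proof (rule Bochner_Integration.integrable_bound)
      show "integrable lborel ?v" using iN by simp
      show "AE y in lborel. norm (?h m y) \<le> norm (?v y)"
        using order_trans[OF wbd' abs_ge_self] unfolding real_norm_def by (intro AE_I2)
    qed measurable
    have dpos: "\<delta> m > 0" for m unfolding \<delta>_def by (intro add_nonneg_pos integral_nonneg_AE) auto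
    have d0: "\<delta> \<longlonglongrightarrow> 0"
    proof -
      have "(\<lambda>m. (LBINT y. ?h m y)) \<longlonglongrightarrow> integral\<^sup>L lborel (\<lambda>y :: real^'n. 0)"
      proof (rule integral_dominated_convergence[where w="?v"])
        show "integrable lborel ?v" using iN by simp
        show "AE y in lborel. norm (?h m y) \<le> ?v y" for m by (intro AE_I2 wbd')
        show "AE y in lborel. (\<lambda>m. ?h m y) \<longlonglongrightarrow> 0"
        proof (rule AE_I2)
          fix y :: "real^'n"
          have "(\<lambda>m. ?h m y) \<longlonglongrightarrow> (1 + norm y + norm y) powr real N * norm (y - y) * norm (a y)"
            by (intro tendsto_intros r(2)) (auto simp: add_nonneg_eq_0_iff)
          then show "(\<lambda>m. ?h m y) \<longlonglongrightarrow> 0" by simp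
        qed
      qed measurable
      moreover have "(\<lambda>m. 1 / real (Suc m)) \<longlonglongrightarrow> 0"
        using LIMSEQ_inverse_real_of_nat by (simp add: inverse_eq_divide)
      ultimately have "\<delta> \<longlonglongrightarrow> 0 + 0" unfolding \<delta>_def by (intro tendsto_add) auto
      then show ?thesis by simp
    qed
    let ?a = "\<lambda>m y. of_real (?w m y / \<delta> m) * a y"
    let ?D = "\<lambda>p z. of_real ((1 + norm (fst p) + norm (snd p)) powr (- real N) / norm (fst p - snd p))
     * (\<eta> (fst p - z) - \<eta> (snd p - z))"
    \<comment> \<open>The error divided by \<open>\<delta> m\<close> is a superposition of weighted
      difference quotients whose densities have \<open>L^1\<close> norm at most \<open>1\<close>. It
      therefore runs through a bounded family, and \<open>T\<close> of the error is
      \<open>O(\<delta> m)\<close>.\<close>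
    have "growth N (- real N) UNIV (\<lambda>m z. (LBINT y. ?a m y * ?D (y, r m y) z))"
    proof (rule growth_param_integral[where A=1])
      show "(\<lambda>y. ?D (y, r m y) z) \<in> borel_measurable lborel" for m z by (simp only: fst_conv snd_conv) measurable
      have "growth N (- real N) (UNIV \<times> UNIV) (\<lambda>p. ?D (snd p, r (fst p) (snd p)))"
        by (rule growth_reindex[OF growth_translate_difference[OF \<eta>, of "real N" N]]) auto
      then show "growth N (- real N) (UNIV \<times> UNIV) (\<lambda>p z. ?D (snd p, r (fst p) (snd p)) z)" .
      have eq: "norm (?a m y) = (1 / \<delta> m) * (?h m y)" for m y
        using dpos[of m] by (simp add: norm_mult norm_divide)
      show "integrable lborel (?a m)" for m
      proof -
        have "integrable lborel (\<lambda>y. (1 / \<delta> m) * (?h m y))" using iw by (intro integrable_mult_right)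
        then have "integrable lborel (\<lambda>y. norm (?a m y))" unfolding eq .
        then show ?thesis by (subst (asm) integrable_norm_iff) measurable
      qed
      show "(LBINT y. norm (?a m y)) \<le> 1" for m
      proof -
        have "(LBINT y. norm (?a m y)) = (1 / \<delta> m) * (LBINT y. ?h m y)"
          unfolding eq by (rule integral_mult_right_zero)
        also have "\<dots> \<le> (1 / \<delta> m) * \<delta> m" using dpos[of m] by (intro mult_left_mono) (auto simp: \<delta>_def)
        finally show ?thesis using dpos[of m] by simp
      qed
    qed
    moreover have eq: "(LBINT y. ?a m y * ?D (y, r m y) z) = of_real (1 / \<delta> m) * (?th z - ?tm m z)" for m z
    proof -
      have pt: "?a m y * ?D (y, r m y) z = of_real (1 / \<delta> m) * (a y * \<eta> (y - z) - a y * \<eta> (r m y - z))" for y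
      proof (cases "y = r m y")
        case False
        then have p: "norm (y - r m y) \<noteq> 0" by simp
        let ?W = "1 + norm y + norm (r m y)"
        have q: "?W powr real N * ?W powr (- real N) = 1" by (simp flip: powr_add add: add_nonneg_eq_0_iff)
        have "(?w m y / \<delta> m) * (?W powr (- real N) / norm (y - r m y)) = (?W powr real N * ?W powr (- real N)) * (1 / \<delta> m)"
          using p by simp
        then have "complex_of_real (?w m y / \<delta> m) * of_real (?W powr (- real N) / norm (y - r m y)) = of_real (1 / \<delta> m)"
          unfolding q of_real_mult[symmetric] by simp
        then have "?a m y * ?D (y, r m y) z = of_real (1 / \<delta> m) * (a y * (\<eta> (y - z) - \<eta> (r m y - z)))"
          by (simp only: fst_conv snd_conv mult_ac)
        then show ?thesis by (simp add: right_diff_distrib)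
      next
        case True
        then show ?thesis by (metis (no_types, lifting) diff_self fst_conv snd_conv mult_zero_right)
      qed
      obtain B where B: "B > 0" "\<forall>x. norm (\<eta> x) \<le> B" using schwartz_bounded[OF \<eta>] by blast
      have i: "integrable lborel (\<lambda>y. a y * \<eta> (f y))" if [measurable]: "f \<in> borel_funs" for f
        by (rule Bochner_Integration.integrable_bound[where f="\<lambda>y. B * norm (a y)"])
          (use ia B in \<open>auto simp: norm_mult mult.commute[of _ "norm (a _)"] intro!: mult_left_mono\<close>)
      show ?thesis unfolding pt by (simp add: i)
    qed
    ultimately have "growth N (- real N) UNIV (\<lambda>m z. of_real (1 / \<delta> m) * (?th z - ?tm m z))" by simp
    then have "\<exists>C. \<forall>m\<in>UNIV. norm (T (\<lambda>z. of_real (1 / \<delta> m) * (?th z - ?tm m z))) \<le> C"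
      by (rule N[rule_format]) (intro schwartz_cmult schwartz_diff sth sthm)
    then obtain C where C: "\<forall>m\<in>UNIV. norm (T (\<lambda>z. of_real (1 / \<delta> m) * (?th z - ?tm m z))) \<le> C" by (rule exE)
    have bd: "norm (T ?th - T (?tm m)) \<le> C * \<delta> m" for m
    proof -
      have "T (\<lambda>z. of_real (1 / \<delta> m) * (?th z - ?tm m z)) = of_real (1 / \<delta> m) * (T ?th - T (?tm m))"
        by (simp only: tempered_cmult[OF T schwartz_diff[OF sth sthm]] tempered_diff[OF T sth sthm])
      then have "(1 / \<delta> m) * norm (T ?th - T (?tm m)) \<le> C" using C[rule_format, OF UNIV_I, of m] dpos[of m]
        by (simp only: norm_mult norm_of_real abs_of_pos zero_less_divide_1_iff)
      then show ?thesis using dpos[of m] by (simp add: field_simps)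
    qed
    have "(\<lambda>m. T ?th - T (?tm m)) \<longlonglongrightarrow> 0"
      by (rule Lim_null_comparison[where g="\<lambda>m. C * \<delta> m"]) (use bd tendsto_mult[OF tendsto_const d0, of C] in auto)
    from tendsto_diff[OF tendsto_const this, of "T ?th"] show ?thesis by simp
  qed
  show ?thesis by (rule LIMSEQ_unique[OF lim2 lim1])
qed

lemma convolution_inv_fourier:
  fixes A B :: "'n::finite cfun"
  assumes T: "tempered T" and A: "schwartz A" and B: "schwartz B"
  shows "(LBINT y. inv_fourier A (x - y) * fourier_op B T y)
    = fourier_op (\<lambda>\<xi>. A \<xi> * B \<xi>) T x"
proof -
  have sA: "schwartz (\<lambda>y. inv_fourier A (x - y))" by (intro schwartz_reflect schwartz_inv_fourier A)
  have "(LBINT y. inv_fourier A (x - y) * fourier_op B T y)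
      = T (\<lambda>z. (LBINT y. inv_fourier A (x - y) * inv_fourier B (y - z)))"
    by (rule tempered_superposition[symmetric, OF T sA schwartz_inv_fourier[OF B]])
  also have "(\<lambda>z. (LBINT y. inv_fourier A (x - y) * inv_fourier B (y - z))) = (\<lambda>z. inv_fourier (\<lambda>\<xi>. A \<xi> * B \<xi>) (x - z))"
  proof
    fix z
    have s: "schwartz (\<lambda>y. inv_fourier B (y - z))"
      using schwartz_affine[OF schwartz_inv_fourier[OF B], of 1 "- z"] by simp
    have "(LBINT y. inv_fourier A (x - y) * inv_fourier B (y - z))
        = inv_fourier (\<lambda>\<xi>. A \<xi> * fourier (\<lambda>y. inv_fourier B (y - z)) \<xi>) x"
      by (rule inv_fourier_convolution[OF A s])
    also have "\<dots> = inv_fourier (\<lambda>\<xi>. A \<xi> * (cexp (- z) \<xi> * B \<xi>)) x" unfolding fourier_reflect_translate[OF B] ..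
    also have "\<dots> = inv_fourier (\<lambda>\<xi>. A \<xi> * B \<xi>) (x - z)" unfolding inv_fourier_def
      using cexp_add_left[of x "- z"] by (simp add: mult_ac)
    finally show "(LBINT y. inv_fourier A (x - y) * inv_fourier B (y - z)) = inv_fourier (\<lambda>\<xi>. A \<xi> * B \<xi>) (x - z)" .
  qed
  finally show ?thesis by (simp add: schwartz_convolution_def)
qed

text \<open>For fixed \<open>x\<close> the integrand of a convolution is itself band-limited in
  \<open>y\<close>, with twice the radius, so a symbol equal to \<open>1\<close> on the larger ball
  reproduces it. This is what makes Nikolskii's inequality applicable to the integrand. The claim is
  first shown for Schwartz functions and then carried over by
  \<open>tempered_superposition\<close>.\<close>

lemma band_limited_product_reproducing:
  fixes A B C :: "'n::finite cfun"
  assumes T: "tempered T" and A: "schwartz A" and B: "schwartz B" and C: "schwartz C"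
    and supp: "\<And>\<xi>. A \<xi> \<noteq> 0 \<Longrightarrow> norm \<xi> \<le> R" "\<And>\<xi>. B \<xi> \<noteq> 0 \<Longrightarrow> norm \<xi> \<le> R" "\<And>\<xi>. norm \<xi> \<le> 2 * R \<Longrightarrow> C \<xi> = 1"
  defines "F \<equiv> \<lambda>x y. inv_fourier A (x - y) * fourier_op B T y"
  shows "(LBINT y. inv_fourier C (w - y) * F x y) = F x w"
proof -
  have sA: "schwartz (\<lambda>y. inv_fourier A (x - y))" by (intro schwartz_reflect schwartz_inv_fourier A)
  have sC: "schwartz (\<lambda>y. inv_fourier C (w - y))" by (intro schwartz_reflect schwartz_inv_fourier C)
  have sB: "schwartz (\<lambda>y. inv_fourier B (y - z))" for z
    using schwartz_affine[OF schwartz_inv_fourier[OF B], of 1 "- z"] by simp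
  have "(LBINT y. inv_fourier C (w - y) * F x y)
      = (LBINT y. (inv_fourier C (w - y) * inv_fourier A (x - y)) * fourier_op B T y)"
    unfolding F_def by (simp only: mult.assoc)
  also have "\<dots> = T (\<lambda>z. (LBINT y. (inv_fourier C (w - y) * inv_fourier A (x - y)) * inv_fourier B (y - z)))"
    by (rule tempered_superposition[symmetric, OF T schwartz_mult[OF sC sA] schwartz_inv_fourier[OF B]])
  also have "(\<lambda>z. (LBINT y. (inv_fourier C (w - y) * inv_fourier A (x - y)) * inv_fourier B (y - z)))
      = (\<lambda>z. inv_fourier A (x - w) * inv_fourier B (w - z))"
  proof
    fix z
    have "(LBINT y. inv_fourier C (w - y) * (inv_fourier A (x - y) * inv_fourier B (y - z))) = inv_fourier A (x - w) * inv_fourier B (w - z)"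
      by (rule inv_fourier_reproducing[OF C schwartz_mult[OF sA sB]])
        (rule supp(3), rule fourier_product_support[OF A B supp(1,2)], auto)
    then show "(LBINT y. (inv_fourier C (w - y) * inv_fourier A (x - y)) * inv_fourier B (y - z))
        = inv_fourier A (x - w) * inv_fourier B (w - z)" by (simp only: mult.assoc)
  qed
  also have "T (\<lambda>z. inv_fourier A (x - w) * inv_fourier B (w - z)) = F x w"
    unfolding F_def schwartz_convolution_def
    by (rule tempered_cmult[OF T schwartz_reflect[OF schwartz_inv_fourier[OF B]]])
  finally show ?thesis .
qed

lemma iter_diff_reflect: "iter_diff L h K (x - y) = iter_diff L (- h) (\<lambda>y. K (x - y)) y"
proof (induction L arbitrary: y)
  case (Suc L)
  have "x - y + h = x - (y + - h)" by simp
  then have "iter_diff L h K (x - y + h) = iter_diff L (- h) (\<lambda>y. K (x - y)) (y + - h)"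
    using Suc[of "y + - h"] by metis
  then show ?case using Suc[of y] by (simp only: iter_diff.simps)
qed simp

lemma schwartz_family_iter_diff:
  assumes "schwartz_family I F" shows "schwartz_family I (\<lambda>i. iter_diff L h (F i))"
proof (induction L)
  case (Suc L)
  have "schwartz_family I (\<lambda>i x. iter_diff L h (F i) (1 *\<^sub>R x + h) - iter_diff L h (F i) x)"
    by (intro schwartz_family_diff schwartz_family_affine Suc) auto
  then show ?case by simp
qed (simp add: assms)

lemma schwartz_iter_diff: "schwartz f \<Longrightarrow> schwartz (iter_diff L h f)"
  unfolding schwartz_iff_family by (rule schwartz_family_iter_diff)

lemma iter_diff_convolution:
  assumes T: "tempered T" and K: "schwartz K"
  shows "iter_diff L h (conv K T) = conv (iter_diff L h K) T"
proof (induction L)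
  case (Suc L)
  have s: "schwartz (\<lambda>y. iter_diff L h K (x - y))" for x by (intro schwartz_reflect schwartz_iter_diff K)
  have "conv (iter_diff L h K) T (x + h) - conv (iter_diff L h K) T x
      = conv (iter_diff (Suc L) h K) T x" for x using tempered_diff[OF T s[of "x + h"] s[of x]]
    by (simp add: schwartz_convolution_def algebra_simps)
  then show ?case by (simp only: iter_diff.simps Suc)
qed simp

lemma schwartz_convolution_diff:
  assumes T: "tempered T" and "schwartz K1" "schwartz K2"
  shows "conv (\<lambda>x. K1 x - K2 x) T x = conv K1 T x - conv K2 T x"
  unfolding schwartz_convolution_def by (rule tempered_diff[OF T]) (intro schwartz_reflect assms)+

lemma schwartz_convolution_sum:
  assumes T: "tempered T" and "\<And>i. i \<in> A \<Longrightarrow> schwartz (K i)"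
  shows "conv (\<lambda>x. \<Sum>i\<in>A. K i x) T x = (\<Sum>i\<in>A. conv (K i) T x)"
  unfolding schwartz_convolution_def by (rule tempered_sum[OF T]) (intro schwartz_reflect assms)

section \<open>Littlewood--Paley multipliers\<close>

lemma partial_local:
  assumes "open U" "\<And>x. x \<in> U \<Longrightarrow> f x = g x" "x \<in> U"
  shows "partial j f x = partial j g x" "f differentiable (at x) \<longleftrightarrow> g differentiable (at x)"
proof -
  have "(f has_derivative D) (at x) \<longleftrightarrow> (g has_derivative D) (at x)" for D
    using has_derivative_transform_within_open[OF _ assms(1,3), of f D UNIV g]
      has_derivative_transform_within_open[OF _ assms(1,3), of g D UNIV f] assms(2) by fastforce
  then show "partial j f x = partial j g x" "f differentiable (at x) \<longleftrightarrow> g differentiable (at x)"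
    by (simp_all add: partial_def frechet_derivative_def differentiable_def)
qed

lemma iter_partial_local:
  assumes "open U" "\<And>x. x \<in> U \<Longrightarrow> f x = g x" "x \<in> U"
  shows "iter_partial js f x = iter_partial js g x" using assms(3)
proof (induction js arbitrary: x)
  case (Cons j js)
  then show ?case unfolding iter_partial_Cons by (intro partial_local(1)[OF assms(1)]) auto
qed (use assms in simp)

lemma iter_partial_zero: "iter_partial js (\<lambda>x. 0) = (\<lambda>x. 0)"
  by (induction js) (simp_all only: iter_partial.simps(1) iter_partial_Cons partial_const)

locale littlewood_paley =
  fixes \<psi> :: "'n::finite cfun"
  assumes lp: "littlewood_paley_function \<psi>"
begin

abbreviation "\<Psi> \<equiv> fourier \<psi>"

lemma schwartz_psi: "schwartz \<psi>"
  using lp by (simp add: littlewood_paley_function_def)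

lemma schwartz_Psi: "schwartz \<Psi>"
  by (rule schwartz_fourier[OF schwartz_psi])

lemma Psi_real: "\<exists>r. 0 \<le> r \<and> r \<le> 1 \<and> \<Psi> \<xi> = complex_of_real r"
proof -
  have "\<Psi> \<xi> \<in> complex_of_real ` {0..1}" using lp by (simp only: littlewood_paley_function_def)
  then obtain r where "r \<in> {0..1}" "\<Psi> \<xi> = complex_of_real r" by (rule imageE)
  then show ?thesis by (intro exI[of _ r]) simp
qed

lemma Psi_support: "\<Psi> \<xi> \<noteq> 0 \<Longrightarrow> 1/2 \<le> norm \<xi> \<and> norm \<xi> < 2"
proof -
  assume "\<Psi> \<xi> \<noteq> 0"
  then have "\<xi> \<in> closure {\<xi>. \<Psi> \<xi> \<noteq> 0}" by (intro subsetD[OF closure_subset]) simp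
  moreover have "closure {\<xi>. \<Psi> \<xi> \<noteq> 0} \<subseteq> {\<xi>. 1/2 \<le> norm \<xi> \<and> norm \<xi> < 2}"
    using lp by (simp only: littlewood_paley_function_def)
  ultimately show ?thesis by auto
qed

text \<open>In this annulus every term of the partition of unity except those with
  \<open>j = 0\<close> and \<open>j = 1\<close> vanishes by the support condition.\<close>

lemma Psi_adjacent:
  assumes "1 \<le> norm \<xi>" "norm \<xi> < 2"
  shows "\<Psi> \<xi> + \<Psi> ((1/2) *\<^sub>R \<xi>) = 1"
proof -
  have nz: "\<Psi> ((2 powi (- j)) *\<^sub>R \<xi>) = 0" if "j \<notin> {0, 1}" for j :: int
  proof (rule ccontr)
    assume "\<Psi> ((2 powi (- j)) *\<^sub>R \<xi>) \<noteq> 0"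
    from Psi_support[OF this] have *: "1/2 \<le> (2 powi (- j)) * norm \<xi>" "(2 powi (- j)) * norm \<xi> < 2"
      by (auto simp: abs_of_pos)
    have "j \<noteq> 0" "j \<noteq> 1" using that by auto
    then have "j \<le> -1 \<or> j \<ge> 2" by arith
    then consider "j \<le> -1" | "j \<ge> 2" by blast
    then show False
    proof cases
      case 1
      then have "2 powi (-j) \<ge> (2::real) powi 1" by (intro power_int_increasing) auto
      then have "2 * 1 \<le> 2 powi (-j) * norm \<xi>" using assms by (intro mult_mono) auto
      then show False using * by simp
    next
      case 2
      then have "2 powi (-j) \<le> (2::real) powi (-2)" by (intro power_int_increasing) auto
      then have "2 powi (-j) * norm \<xi> < (2::real) powi (-2) * 2"
        using assms by (intro mult_le_less_imp_less) auto
      then show False using * by simp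
    qed
  qed
  have "\<xi> \<noteq> 0" using assms by auto
  then have "((\<lambda>j::int. \<Psi> ((2 powi (- j)) *\<^sub>R \<xi>)) has_sum 1) UNIV"
    using lp[unfolded littlewood_paley_function_def] by simp
  moreover have "((\<lambda>j::int. \<Psi> ((2 powi (- j)) *\<^sub>R \<xi>)) has_sum (\<Psi> \<xi> + \<Psi> ((1/2) *\<^sub>R \<xi>))) UNIV"
    by (rule has_sum_finite_neutralI[where B="{0, 1}"]) (use nz in \<open>auto simp: power_int_minus\<close>)
  ultimately show ?thesis using has_sum_unique by blast
qed

text \<open>Away from the origin this is the sum of all dilates of \<open>\<Psi>\<close> with
  \<open>j \<le> 0\<close>, that is, \<open>1\<close> minus those with \<open>j \<ge> 1\<close>.
  Inside radius \<open>3\<close> only \<open>j = 1\<close> and \<open>j = 2\<close> of the latter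
  survive; between radii \<open>2\<close> and \<open>3\<close> the first formula already gives
  \<open>0\<close>, so the two cases fit together smoothly.\<close>

definition bump :: "'n cfun" where
  "bump \<xi> = (if norm \<xi> < 3 then 1 - \<Psi> ((1/2) *\<^sub>R \<xi>) - \<Psi> ((1/4) *\<^sub>R \<xi>) else 0)"

lemma Psi_zero: "norm \<xi> < 1/2 \<Longrightarrow> \<Psi> \<xi> = 0" "norm \<xi> \<ge> 2 \<Longrightarrow> \<Psi> \<xi> = 0"
  using Psi_support[of \<xi>] by auto

lemma bump_one: "norm \<xi> < 1 \<Longrightarrow> bump \<xi> = 1"
  by (simp add: bump_def Psi_zero)

lemma bump_mid: "norm \<xi> < 2 \<Longrightarrow> bump \<xi> = 1 - \<Psi> ((1/2) *\<^sub>R \<xi>)"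
  by (simp add: bump_def Psi_zero)

lemma bump_zero: "norm \<xi> \<ge> 2 \<Longrightarrow> bump \<xi> = 0"
  using Psi_adjacent[of "(1/2) *\<^sub>R \<xi>"] by (auto simp: bump_def algebra_simps)

lemma bump_real: "\<exists>r. 0 \<le> r \<and> r \<le> 1 \<and> bump \<xi> = complex_of_real r"
proof (cases "norm \<xi> < 2")
  case True
  obtain r where "0 \<le> r" "r \<le> 1" "\<Psi> ((1/2) *\<^sub>R \<xi>) = complex_of_real r" using Psi_real by blast
  then show ?thesis using bump_mid[OF True] by (intro exI[of _ "1 - r"]) auto
qed (use bump_zero in \<open>auto intro!: exI[of _ 0]\<close>)

lemma bump_telescope: "bump \<xi> - bump (2 *\<^sub>R \<xi>) = \<Psi> \<xi>"
proof -
  consider "norm \<xi> < 1/2" | "1/2 \<le> norm \<xi>" "norm \<xi> < 1" | "1 \<le> norm \<xi>" "norm \<xi> < 2" | "norm \<xi> \<ge> 2" by linarith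
  then show ?thesis
  proof cases
    case 1 then show ?thesis by (simp add: bump_one Psi_zero)
  next
    case 2 then show ?thesis by (simp add: bump_one bump_mid)
  next
    case 3 then show ?thesis using Psi_adjacent[of \<xi>] by (simp add: bump_mid bump_zero algebra_simps)
  next
    case 4 then show ?thesis by (simp add: Psi_zero bump_zero)
  qed
qed

text \<open>Smoothness is local: on the open set \<open>norm x < 3\<close> the function agrees with
  \<open>f\<close>, on the open set \<open>norm x > 2\<close> with zero, and these two sets cover
  the space.\<close>

lemma schwartz_bump: "schwartz bump"
proof -
  define f where "f = (\<lambda>\<xi> :: real^'n. 1 - \<Psi> ((1/2) *\<^sub>R \<xi>) - \<Psi> ((1/4) *\<^sub>R \<xi>))"
  have sc: "schwartz (\<lambda>\<xi>. \<Psi> (c *\<^sub>R \<xi>))" if "c \<noteq> 0" for c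
    using schwartz_affine[OF schwartz_Psi that, of 0] by simp
  have gf: "growth k 0 {()} (\<lambda>_. f)" for k
    unfolding f_def by (intro growth_diff schwartz_imp_growth sc growth_const[where B=1]) auto
  have df: "iter_partial js f differentiable (at x)" for js x
  proof -
    have "growth (Suc 0) 0 {()} (\<lambda>_. iter_partial js f)"
      using growth_iter_partial[OF gf[of "Suc (length js)"], of js] by (simp add: Suc_diff_le)
    from growth_SucD(1)[OF this, of "()"] show ?thesis by simp
  qed
  have in_ball: "iter_partial js bump x = iter_partial js f x" if "norm x < 3" for js x
    using that by (intro iter_partial_local[of "ball 0 3"]) (auto simp: bump_def f_def)
  have out_ball: "iter_partial js bump x = 0" if "norm x > 2" for js x
  proof -
    have "iter_partial js bump x = iter_partial js (\<lambda>x. 0) x"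
      using that by (intro iter_partial_local[of "- cball 0 2"]) (auto simp: bump_zero)
    then show ?thesis by (simp add: iter_partial_zero)
  qed
  show ?thesis unfolding schwartz_def
  proof (intro allI conjI)
    fix js and x :: "real^'n"
    show "iter_partial js bump differentiable (at x)"
    proof (cases "norm x < 3")
      case True
      then show ?thesis
        using partial_local(2)[of "ball 0 3" "iter_partial js bump" "iter_partial js f" x] in_ball df by auto
    next
      case False
      then show ?thesis
        using partial_local(2)[of "- cball 0 2" "iter_partial js bump" "\<lambda>x. 0" x] out_ball by auto
    qed
  next
    fix js N
    obtain B where B: "B > 0" "\<forall>i\<in>{()}. \<forall>x. norm (iter_partial js f x) \<le> B * (1 + norm x) powr 0"
      using growthD[OF growth_iter_partial[OF gf[of "length js"], of js]] by auto
    \<comment> \<open>Inside radius \<open>3\<close> the weight is at most \<open>4 ^ N\<close>;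
      outside, the derivatives vanish.\<close>
    have "(1 + norm x) ^ N * norm (iter_partial js bump x) \<le> 4 ^ N * B" for x
    proof (cases "norm x < 3")
      case True
      then show ?thesis using B in_ball[OF True, of js] by (intro mult_mono power_mono) auto
    next
      case False
      then show ?thesis using B(1) out_ball[of x js] by simp
    qed
    then show "\<exists>B. \<forall>x. (1 + norm x) ^ N * norm (iter_partial js bump x) \<le> B" by blast
  qed
qed

lemma schwartz_bump_scale: "c \<noteq> 0 \<Longrightarrow> schwartz (\<lambda>\<xi>. bump (c *\<^sub>R \<xi>))"
  using schwartz_affine[OF schwartz_bump, of c 0] by simp

text \<open>The cutoff at radius \<open>2\<^sup>n\<close> differs from \<open>1\<close> by \<open>O(2\<^bsup>-n\<^esup>)\<close> in the sense of symbols of order one.\<close>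

lemma growth_cutoff_difference:
  assumes "\<bar>\<sigma>\<bar> = 1"
  shows "growth k 1 UNIV (\<lambda>(n::nat) \<xi>. of_real (2 ^ n) * (1 - bump ((\<sigma> / 2 ^ n) *\<^sub>R \<xi>)))"
proof -
  have s0: "\<sigma> \<noteq> 0" using assms by auto
  let ?F = "\<lambda>(n::nat) \<xi>. of_real (2 ^ n) * (1 - bump ((\<sigma> / 2 ^ n) *\<^sub>R \<xi>))"
  have 0: "growth 0 1 UNIV ?F"
  proof (rule growth_0I)
    fix n :: nat and \<xi> :: "real^'n"
    show "norm (?F n \<xi>) \<le> 1 * (1 + norm \<xi>) powr 1"
    proof (cases "norm \<xi> < 2 ^ n")
      case True
      then have "bump ((\<sigma> / 2 ^ n) *\<^sub>R \<xi>) = 1" using assms by (intro bump_one) (simp add: field_simps)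
      then show ?thesis by simp
    next
      \<comment> \<open>Here \<open>norm \<xi> \<ge> 2 ^ n\<close>, and this pays for the factor
        \<open>2 ^ n\<close> at the cost of one order of growth.\<close>
      case False
      obtain r where r: "0 \<le> r" "r \<le> 1" "bump ((\<sigma> / 2 ^ n) *\<^sub>R \<xi>) = complex_of_real r" using bump_real by blast
      have "1 - bump ((\<sigma> / 2 ^ n) *\<^sub>R \<xi>) = complex_of_real (1 - r)" using r(3) by simp
      then have "norm (1 - bump ((\<sigma> / 2 ^ n) *\<^sub>R \<xi>)) \<le> 1" using r by (simp only: norm_of_real)
      then have "2 ^ n * norm (1 - bump ((\<sigma> / 2 ^ n) *\<^sub>R \<xi>)) \<le> 2 ^ n * 1" by (intro mult_left_mono) auto
      also have "2 ^ n * 1 \<le> 1 * (1 + norm \<xi>) powr 1" using False by simp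
      finally show ?thesis by (simp add: norm_mult norm_power)
    qed
  qed
  have d: "bump differentiable (at x)" for x by (rule schwartz_differentiable[OF schwartz_bump])
  have db: "(\<lambda>\<xi>. bump (c *\<^sub>R \<xi>)) differentiable (at x)" for c x
    using partial_affine(2)[OF d, where c=c and x=x and v=0] by simp
  have pb: "partial j (\<lambda>\<xi>. bump (c *\<^sub>R \<xi>)) x = of_real c * partial j bump (c *\<^sub>R x)" for c x j
    using partial_affine(1)[OF d, where c=c and x=x and v=0 and j=j] by simp
  have pF: "partial j (?F n) = (\<lambda>x. of_real (- \<sigma>) * partial j bump ((\<sigma> / 2 ^ n) *\<^sub>R x + 0))" for n j
  proof
    fix x
    have "?F n = (\<lambda>\<xi>. of_real (2 ^ n) + of_real (- (2 ^ n)) * bump ((\<sigma> / 2 ^ n) *\<^sub>R \<xi>))"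
      by (rule ext) (simp add: algebra_simps)
    moreover have "partial j (\<lambda>\<xi>. of_real (2 ^ n) + of_real (- (2 ^ n)) * bump ((\<sigma> / 2 ^ n) *\<^sub>R \<xi>)) x
        = of_real (- (2 ^ n)) * (of_real (\<sigma> / 2 ^ n) * partial j bump ((\<sigma> / 2 ^ n) *\<^sub>R x))"
    proof -
      let ?h = "\<lambda>\<xi>. of_real (- (2 ^ n)) * bump ((\<sigma> / 2 ^ n) *\<^sub>R \<xi>)"
      have "?h differentiable (at x)" by (intro differentiable_mult db) auto
      then have "((\<lambda>\<xi>. of_real (2 ^ n) + ?h \<xi>) has_derivative (\<lambda>v. 0 + frechet_derivative ?h (at x) v)) (at x)"
        by (intro has_derivative_add differentiable_has_derivative has_derivative_const)
      from partial_eq[OF this, of j] have "partial j (\<lambda>\<xi>. of_real (2 ^ n) + ?h \<xi>) x = partial j ?h x"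
        by (simp add: partial_def)
      also have "\<dots> = of_real (- (2 ^ n)) * partial j (\<lambda>\<xi>. bump ((\<sigma> / 2 ^ n) *\<^sub>R \<xi>)) x"
        by (subst partial_mult) (auto intro!: db simp: partial_const)
      finally show ?thesis by (simp only: pb)
    qed
    moreover have "complex_of_real (- (2 ^ n)) * (of_real (\<sigma> / 2 ^ n) * a) = of_real (- \<sigma>) * a" for a by simp
    ultimately show "partial j (?F n) x = of_real (- \<sigma>) * partial j bump ((\<sigma> / 2 ^ n) *\<^sub>R x + 0)"
      by (simp only: add_0_right)
  qed
  have "growth k 1 UNIV (\<lambda>n. partial j (?F n))" for k j
  proof -
    have "growth k 0 UNIV (\<lambda>(n::nat) x. of_real (- \<sigma>) * partial j bump ((\<sigma> / 2 ^ n) *\<^sub>R x + 0))"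
      using assms by (intro growth_affine[where m=0 and B=1 and K=1] schwartz_imp_growth schwartz_partial schwartz_bump)
        (auto simp: divide_le_eq)
    then show ?thesis unfolding pF by (rule growth_le_m) simp
  qed
  with 0 show ?thesis by (cases k) (auto intro!: growth_SucI differentiable_mult differentiable_diff db)
qed

text \<open>The decay of \<open>\<phi>\<close> absorbs the loss of one order. The sign
  \<open>-1\<close> occurs when passing to the adjoint has reflected the cutoff.\<close>

lemma cutoff_null_family:
  assumes "schwartz \<phi>" "\<bar>\<sigma>\<bar> = 1"
  shows "schwartz_family UNIV (\<lambda>(n::nat) \<xi>. of_real (2 ^ n) * (\<phi> \<xi> * (1 - bump ((\<sigma> / 2 ^ n) *\<^sub>R \<xi>))))"
proof -
  have "schwartz_family UNIV (\<lambda>(n::nat) \<xi>. \<phi> \<xi> * (of_real (2 ^ n) * (1 - bump ((\<sigma> / 2 ^ n) *\<^sub>R \<xi>))))"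
    by (rule schwartz_family_mult[OF schwartz_imp_family[OF assms(1)] growth_cutoff_difference[OF assms(2)]])
  then show ?thesis by (simp only: mult.left_commute)
qed

lemma schwartz_cutoff: "schwartz \<phi> \<Longrightarrow> \<sigma> \<noteq> 0 \<Longrightarrow> schwartz (\<lambda>\<xi>. \<phi> \<xi> * (1 - bump ((\<sigma> / 2 ^ n) *\<^sub>R \<xi>)))"
  using schwartz_diff[OF _ schwartz_mult[OF _ schwartz_bump_scale[of "\<sigma> / 2 ^ n"]], of \<phi> \<phi>]
  by (simp add: right_diff_distrib)

lemma psi_eq: "\<psi> = inv_fourier \<Psi>"
  using inv_fourier_fourier[OF schwartz_psi] by simp

definition lp_mult :: "int \<Rightarrow> 'n cfun" where
  "lp_mult l \<xi> = \<Psi> ((2 powi (- l)) *\<^sub>R \<xi>)"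

definition low_mult :: "int \<Rightarrow> 'n cfun" where
  "low_mult l \<xi> = bump ((2 powi (- l)) *\<^sub>R \<xi>)"

lemma schwartz_lp_mult: "schwartz (lp_mult l)"
  using schwartz_affine[OF schwartz_Psi, of "2 powi (- l)" 0] by (simp add: lp_mult_def[abs_def])

lemma schwartz_low_mult: "schwartz (low_mult l)"
  using schwartz_affine[OF schwartz_bump, of "2 powi (- l)" 0] by (simp add: low_mult_def[abs_def])

lemma dilate_psi: "dilate l \<psi> = inv_fourier (lp_mult l)"
  using dilate_inv_fourier[OF schwartz_Psi, of l] psi_eq by (simp add: lp_mult_def[abs_def])

lemma lp_mult_eq: "lp_mult l \<xi> = low_mult l \<xi> - low_mult (l - 1) \<xi>"
proof -
  have "(2::real) powi (- (l - 1)) = 2 powi (- l) * 2"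
    by (subst power_int_add_1[symmetric]) (auto simp: algebra_simps)
  then have "low_mult (l - 1) \<xi> = bump (2 *\<^sub>R ((2 powi (- l)) *\<^sub>R \<xi>))" by (simp add: low_mult_def mult.commute)
  then show ?thesis using bump_telescope[of "(2 powi (- l)) *\<^sub>R \<xi>"] by (simp add: lp_mult_def low_mult_def)
qed

lemma norm_powi_scale: "norm ((2 powi (- l)) *\<^sub>R \<xi>) < c \<longleftrightarrow> norm \<xi> < c * 2 powi l"
    "norm ((2 powi (- l)) *\<^sub>R \<xi>) \<ge> c \<longleftrightarrow> norm \<xi> \<ge> c * 2 powi l" by (simp_all add: power_int_minus field_simps)

lemma low_mult_one: "norm \<xi> < 2 powi l \<Longrightarrow> low_mult l \<xi> = 1"
  unfolding low_mult_def by (rule bump_one) (simp only: norm_powi_scale(1) mult_1)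

lemma low_mult_support: "low_mult l \<xi> \<noteq> 0 \<Longrightarrow> norm \<xi> < 2 powi (l + 1)"
  unfolding low_mult_def using bump_zero[of "(2 powi (- l)) *\<^sub>R \<xi>"] unfolding norm_powi_scale
  by (simp add: power_int_add mult.commute) (metis not_le)

lemma lp_mult_support: "lp_mult l \<xi> \<noteq> 0 \<Longrightarrow> norm \<xi> < 2 powi (l + 1)"
  unfolding lp_mult_def using Psi_support[of "(2 powi (- l)) *\<^sub>R \<xi>"] unfolding norm_powi_scale
  by (simp add: power_int_add mult.commute)

end

lemma integrable_lborel_translate:
  fixes f :: "'a::euclidean_space \<Rightarrow> complex"
  assumes "integrable lborel f"
  shows "integrable lborel (\<lambda>x. f (h + x))"
proof -
  have [measurable]: "f \<in> borel_funs" using assms by auto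
  have "(NN x. enorm (f (h + 1 *\<^sub>R x))) = ennreal (1 / \<bar>1\<bar> ^ DIM('a)) * (NN x. enorm (f x))"
    by (rule nn_integral_lborel_affine) auto
  then show ?thesis using assms by (auto simp: integrable_iff_bounded)
qed

section \<open>Littlewood--Paley pieces do not see polynomials\<close>

text \<open>Chosen because it is stable under multiplication by polynomials: a coordinate factor
  becomes a derivative of the transform, which still vanishes near the origin.\<close>

definition vanishing_spectrum :: "'n::finite cfun \<Rightarrow> bool" where
  "vanishing_spectrum \<phi> \<longleftrightarrow> schwartz \<phi> \<and> (\<exists>e>0. \<forall>\<xi>. norm \<xi> < e \<longrightarrow> fourier \<phi> \<xi> = 0)"

lemma vanishing_spectrum_cmult: "vanishing_spectrum \<phi> \<Longrightarrow> vanishing_spectrum (\<lambda>x. c * \<phi> x)"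
  unfolding vanishing_spectrum_def by (auto simp: fourier_cmult schwartz_cmult)

lemma vanishing_spectrum_add:
  assumes "vanishing_spectrum \<phi>" "vanishing_spectrum \<theta>"
  shows "vanishing_spectrum (\<lambda>x. \<phi> x + \<theta> x)"
proof -
  obtain d e where "d > 0" "\<forall>\<xi>. norm \<xi> < d \<longrightarrow> fourier \<phi> \<xi> = 0" "e > 0" "\<forall>\<xi>. norm \<xi> < e \<longrightarrow> fourier \<theta> \<xi> = 0"
    and s: "schwartz \<phi>" "schwartz \<theta>" using assms unfolding vanishing_spectrum_def by blast
  moreover have "fourier (\<lambda>x. \<phi> x + \<theta> x) \<xi> = fourier \<phi> \<xi> + fourier \<theta> \<xi>" for \<xi>
    using fourier_diff[OF s(1) schwartz_cmult[OF s(2), of "-1"], of \<xi>] fourier_cmult[OF s(2), of "-1" \<xi>] by simp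
  ultimately show ?thesis unfolding vanishing_spectrum_def
    by (intro conjI schwartz_add exI[of _ "min d e"]) auto
qed

lemma vanishing_spectrum_sum:
  "finite A \<Longrightarrow> A \<noteq> {} \<Longrightarrow> (\<And>a. a \<in> A \<Longrightarrow> vanishing_spectrum (F a)) \<Longrightarrow> vanishing_spectrum (\<lambda>x. \<Sum>a\<in>A. F a x)"
  by (induction A rule: finite_ne_induct) (auto intro: vanishing_spectrum_add)

lemma vanishing_spectrum_coord:
  assumes "vanishing_spectrum \<phi>"
  shows "vanishing_spectrum (\<lambda>x. of_real (x $ j) * \<phi> x)"
proof -
  obtain e where e: "e > 0" "\<forall>\<xi>. norm \<xi> < e \<longrightarrow> fourier \<phi> \<xi> = 0" and s: "schwartz \<phi>"
    using assms unfolding vanishing_spectrum_def by blast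
  have "schwartz (\<lambda>x. \<phi> x * of_real (x $ j))" by (rule schwartz_mult_growth[OF s growth_coord])
  then have sj: "schwartz (\<lambda>x. of_real (x $ j) * \<phi> x)" by (simp only: mult.commute)
  have "fourier (\<lambda>x. of_real (x $ j) * \<phi> x) \<xi> = 0" if "norm \<xi> < e" for \<xi>
  proof -
    have "(- 2 * of_real pi * \<i>) * fourier (\<lambda>x. of_real (x $ j) * \<phi> x) \<xi> = partial j (fourier \<phi>) \<xi>"
      unfolding fourier_cmult[OF sj, symmetric] partial_fourier[OF s] by (simp only: mult.assoc)
    also have "\<dots> = partial j (\<lambda>_. 0) \<xi>" using e that by (intro partial_local(1)[of "ball 0 e"]) auto
    finally show ?thesis by (simp add: partial_const)
  qed
  then show ?thesis using sj e(1) unfolding vanishing_spectrum_def by (intro conjI exI[of _ e]) auto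
qed

lemma vanishing_spectrum_real_polynomial:
  assumes "real_polynomial_function p" "vanishing_spectrum \<phi>"
  shows "vanishing_spectrum (\<lambda>x. of_real (p x) * \<phi> x)" using assms
proof (induction arbitrary: \<phi>)
  case (linear f)
  have fx: "f x = (\<Sum>j\<in>UNIV. f (axis j 1) * x $ j)" for x
  proof -
    have "f x = f (\<Sum>j\<in>UNIV. (x $ j) *\<^sub>R axis j 1)"
      using basis_expansion[of x] by (simp add: scalar_mult_eq_scaleR)
    then show ?thesis using linear.hyps by (simp add: linear_sum bounded_linear.linear linear_cmul mult.commute)
  qed
  have eq: "of_real (f x) * \<phi> x = (\<Sum>j\<in>UNIV. of_real (f (axis j 1)) * (of_real (x $ j) * \<phi> x))" for x
    unfolding fx[of x] of_real_sum sum_distrib_right of_real_mult mult.assoc ..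
  have "vanishing_spectrum (\<lambda>x. \<Sum>j\<in>UNIV. of_real (f (axis j 1)) * (of_real (x $ j) * \<phi> x))"
    by (intro vanishing_spectrum_sum vanishing_spectrum_cmult vanishing_spectrum_coord linear.prems) auto
  then show ?case unfolding eq .
next
  case (const c)
  then show ?case by (rule vanishing_spectrum_cmult)
next
  case (add f g)
  then show ?case using vanishing_spectrum_add[OF add.IH] by (simp add: distrib_right)
next
  case (mult f g)
  have "vanishing_spectrum (\<lambda>x. of_real (f x) * (of_real (g x) * \<phi> x))" by (intro mult.IH mult.prems)
  then show ?case by (simp add: mult.assoc)
qed

text \<open>The integral is the value at the origin of the transform of \<open>P * \<phi>\<close>,
  whose spectrum also avoids the origin.\<close>

lemma vanishing_spectrum_polynomial:
  assumes "polynomial_function P" "vanishing_spectrum \<phi>"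
  shows "(\<integral>x. P x * \<phi> x \<partial>lebesgue) = 0"
proof -
  have "real_polynomial_function (Re \<circ> P)" "real_polynomial_function (Im \<circ> P)"
    using assms(1) bounded_linear_Re bounded_linear_Im unfolding polynomial_function_def by blast+
  then have "vanishing_spectrum (\<lambda>x. of_real ((Re \<circ> P) x) * \<phi> x + \<i> * (of_real ((Im \<circ> P) x) * \<phi> x))"
    by (intro vanishing_spectrum_add vanishing_spectrum_cmult vanishing_spectrum_real_polynomial assms(2))
  moreover have "of_real ((Re \<circ> P) x) * \<phi> x + \<i> * (of_real ((Im \<circ> P) x) * \<phi> x) = P x * \<phi> x" for x
    using complex_eq[of "P x"] by (simp add: mult.assoc[symmetric] distrib_right[symmetric])
  ultimately have "vanishing_spectrum (\<lambda>x. P x * \<phi> x)" by simp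
  then have "fourier (\<lambda>x. P x * \<phi> x) 0 = 0" unfolding vanishing_spectrum_def by (metis norm_zero)
  then show ?thesis by (simp add: fourier_def)
qed

lemma inv_fourier_reflect:
  assumes "schwartz a"
  shows "inv_fourier a (- v) = inv_fourier (\<lambda>\<xi>. a (- \<xi>)) v"
proof -
  have [measurable]: "a \<in> borel_funs" by (rule schwartz_measurable[OF assms])
  have "inv_fourier (\<lambda>\<xi>. a (- \<xi>)) v = (LBINT \<xi>. a (0 + (-1) *\<^sub>R \<xi>) * cexp (- v) (0 + (-1) *\<^sub>R \<xi>))"
    by (simp add: inv_fourier_def cexp_minus)
  also have "\<dots> = inv_fourier a (- v)"
    unfolding inv_fourier_def by (subst integral_lborel_affine[of "-1" "\<lambda>\<xi>. a \<xi> * cexp (- v) \<xi>"]) auto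
  finally show ?thesis by simp
qed

context littlewood_paley
begin

lemma vanishing_spectrum_lp: "vanishing_spectrum (\<lambda>y. inv_fourier (lp_mult l) (x - y))"
proof -
  have s: "schwartz (\<lambda>\<xi>. lp_mult l (- \<xi>))" using schwartz_reflect[OF schwartz_lp_mult, of l 0] by simp
  have "inv_fourier (lp_mult l) (x - y) = inv_fourier (\<lambda>\<xi>. lp_mult l (- \<xi>)) (y - x)" for y
    using inv_fourier_reflect[OF schwartz_lp_mult, of l "y - x"] by simp
  then have "fourier (\<lambda>y. inv_fourier (lp_mult l) (x - y)) \<xi> = cexp (- x) \<xi> * lp_mult l (- \<xi>)" for \<xi>
    using fourier_reflect_translate[OF s, of x \<xi>] by simp
  moreover have "lp_mult l (- \<xi>) = 0" if "norm \<xi> < 1/2 * 2 powi l" for \<xi>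
    unfolding lp_mult_def by (rule Psi_zero(1), subst norm_powi_scale(1)) (use that in simp)
  ultimately show ?thesis unfolding vanishing_spectrum_def
    by (intro conjI schwartz_reflect schwartz_inv_fourier schwartz_lp_mult exI[of _ "1/2 * 2 powi l"]) auto
qed

text \<open>Removes the arbitrary choice in \<open>lp_piece\<close>. In the lower bounds
  \<open>T\<close> will be the member of the class that is given by a function.\<close>

lemma lp_piece_eq:
  assumes "u \<in> tempered_mod_poly" "T \<in> u"
  shows "tempered T" and "lp_piece \<psi> l u = fourier_op (lp_mult l) T"
proof -
  obtain S where S: "tempered S" "u = poly_equiv `` {S}"
    using assms(1) unfolding tempered_mod_poly_def by (auto elim: quotientE)
  have *: "tempered T \<and> fourier_op (lp_mult l) T x = fourier_op (lp_mult l) S x" if "T \<in> u" for T x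
  proof -
    have "(S, T) \<in> poly_equiv" using that S(2) by simp
    then obtain P where P: "tempered T" "polynomial_function P"
      "\<forall>\<phi>. schwartz \<phi> \<longrightarrow> S \<phi> - T \<phi> = (\<integral>x. P x * \<phi> x \<partial>lebesgue)" unfolding poly_equiv_def by auto
    have "schwartz (\<lambda>y. inv_fourier (lp_mult l) (x - y))"
      by (intro schwartz_reflect schwartz_inv_fourier schwartz_lp_mult)
    then have "S (\<lambda>y. inv_fourier (lp_mult l) (x - y)) - T (\<lambda>y. inv_fourier (lp_mult l) (x - y)) = 0"
      using P(3) vanishing_spectrum_polynomial[OF P(2) vanishing_spectrum_lp[of l x]] by simp
    then show ?thesis using P(1) by (simp add: schwartz_convolution_def)
  qed
  show "tempered T" using *[OF assms(2)] by simp
  have "(SOME T. T \<in> u) \<in> u" using assms(2) by (rule someI[of "\<lambda>T. T \<in> u"])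
  then show "lp_piece \<psi> l u = fourier_op (lp_mult l) T"
    using * assms(2) unfolding lp_piece_def dilate_psi by (intro ext) metis
qed

end

section \<open>Distributions given by locally integrable functions\<close>

text \<open>A Borel version of local integrability, so that Fubini and substitution for
  \<open>lborel\<close> apply directly.\<close>

definition locally_integrable :: "'n::finite cfun \<Rightarrow> bool" where
  "locally_integrable g \<longleftrightarrow> g \<in> borel_funs \<and>
     (\<forall>R. integrable lborel (\<lambda>x. indicator (cball 0 R) x * g x))"

definition test_function :: "'n::finite cfun \<Rightarrow> bool" where
  "test_function \<phi> \<longleftrightarrow> schwartz \<phi> \<and> (\<exists>R. \<forall>x. R < norm x \<longrightarrow> \<phi> x = 0)"

lemma locally_integrable_times:
  assumes g: "locally_integrable g" and \<phi>: "test_function \<phi>"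
  shows "integrable lborel (\<lambda>x. g x * \<phi> x)"
proof -
  obtain R where R: "\<forall>x. R < norm x \<longrightarrow> \<phi> x = 0" using \<phi> by (auto simp: test_function_def)
  obtain B where B: "B > 0" "\<forall>x. norm (\<phi> x) \<le> B" using \<phi> schwartz_bounded unfolding test_function_def by blast
  have [measurable]: "g \<in> borel_funs" "\<phi> \<in> borel_funs"
    using g \<phi> schwartz_measurable by (auto simp: locally_integrable_def test_function_def)
  show ?thesis
  proof (rule Bochner_Integration.integrable_bound)
    show "integrable lborel (\<lambda>x. B * norm (indicator (cball 0 R) x * g x))"
      using g by (intro integrable_mult_right integrable_norm) (auto simp: locally_integrable_def)
    show "AE x in lborel. norm (g x * \<phi> x) \<le> norm (B * norm (indicator (cball 0 R) x * g x))"
    proof (rule AE_I2)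
      fix x
      show "norm (g x * \<phi> x) \<le> norm (B * norm (indicator (cball 0 R) x * g x))"
      proof (cases "R < norm x")
        case False
        then have "indicator (cball 0 R) x = (1::complex)" by simp
        then show ?thesis using B by (simp add: norm_mult mult.commute mult_right_mono)
      qed (use R in simp)
    qed
  qed measurable
qed

lemma locally_integrable_translate:
  assumes "locally_integrable g" shows "locally_integrable (\<lambda>x. g (x + h))"
  unfolding locally_integrable_def
proof safe
  have [measurable]: "g \<in> borel_funs" using assms by (simp add: locally_integrable_def)
  show "(\<lambda>x. g (x + h)) \<in> borel_funs" by measurable
  fix R
  have "integrable lborel (\<lambda>x. indicator (cball 0 (R + norm h)) x * g x)"
    using assms by (simp add: locally_integrable_def)
  then have i: "integrable lborel (\<lambda>x. indicator (cball 0 (R + norm h)) (h + x) * g (h + x))"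
    by (rule integrable_lborel_translate)
  show "integrable lborel (\<lambda>x. indicator (cball 0 R) x * g (x + h))"
  proof (rule Bochner_Integration.integrable_bound[OF i])
    show "AE x in lborel. norm (indicator (cball 0 R) x * g (x + h))
        \<le> norm (indicator (cball 0 (R + norm h)) (h + x) * g (h + x))"
      by (auto intro!: AE_I2 simp: norm_mult add.commute indicator_def split: if_splits)
        (metis add.commute add_left_mono norm_triangle_le)
    have "(\<lambda>x. indicator (cball 0 R) x * g (x + h)) \<in> borel_funs"
      by (intro borel_measurable_times borel_measurable_indicator) auto
    then show "(\<lambda>x. indicator (cball 0 R) x * g (x + h)) \<in> borel_measurable lborel" by simp
  qed
qed

lemma locally_integrable_diff:
  "locally_integrable f \<Longrightarrow> locally_integrable g \<Longrightarrow> locally_integrable (\<lambda>x. f x - g x)"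
  unfolding locally_integrable_def by (auto simp: right_diff_distrib)

lemma locally_integrable_iter_diff: "locally_integrable g \<Longrightarrow> locally_integrable (iter_diff L h g)"
proof (induction L)
  case (Suc L)
  then show ?case using locally_integrable_diff[OF locally_integrable_translate[OF Suc.IH, of h] Suc.IH] by simp
qed simp

lemma test_function_translate: 
  assumes "test_function \<phi>" shows "test_function (\<lambda>x. \<phi> (x + h))"
proof -
  obtain R where R: "\<forall>x. R < norm x \<longrightarrow> \<phi> x = 0" and s: "schwartz \<phi>" using assms by (auto simp: test_function_def)
  have "\<phi> (x + h) = 0" if "R + norm h < norm x" for x
    using R that norm_triangle_ineq4[of "x + h" h] by (intro R[rule_format]) simp
  then show ?thesis using schwartz_affine[OF s, of 1 h] by (auto simp: test_function_def)
qed

lemma test_function_diff: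
  assumes "test_function \<phi>" "test_function \<theta>" shows "test_function (\<lambda>x. \<phi> x - \<theta> x)"
proof -
  obtain R R' where "\<forall>x. R < norm x \<longrightarrow> \<phi> x = 0" "\<forall>x. R' < norm x \<longrightarrow> \<theta> x = 0"
    using assms by (auto simp: test_function_def)
  then show ?thesis using assms schwartz_diff by (auto simp: test_function_def intro!: exI[of _ "max R R'"])
qed

lemma test_function_iter_diff: "test_function \<phi> \<Longrightarrow> test_function (iter_diff L h \<phi>)"
proof (induction L)
  case (Suc L)
  then show ?case using test_function_diff[OF test_function_translate[OF Suc.IH, of h] Suc.IH] by simp
qed simp

lemma iter_diff_commute: "iter_diff L h (\<lambda>x. f (x + h) - f x) = iter_diff (Suc L) h f"
  by (induction L) simp_all

lemma integral_iter_diff: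
  assumes "locally_integrable g" "test_function \<phi>"
  shows "(LBINT x. g x * iter_diff L (- h) \<phi> x) = (LBINT x. iter_diff L h g x * \<phi> x)" using assms(1)
proof (induction L arbitrary: g)
  case (Suc L)
  let ?\<theta> = "iter_diff L (- h) \<phi>"
  have t: "test_function ?\<theta>" by (rule test_function_iter_diff[OF assms(2)])
  have [measurable]: "g \<in> borel_funs" "?\<theta> \<in> borel_funs"
    using Suc.prems t schwartz_measurable by (auto simp: locally_integrable_def test_function_def)
  have "(LBINT x. g x * iter_diff (Suc L) (- h) \<phi> x) = (LBINT x. g x * ?\<theta> (x + - h) - g x * ?\<theta> x)"
    by (simp only: iter_diff.simps right_diff_distrib)
  also have "\<dots> = (LBINT x. g x * ?\<theta> (x + - h)) - (LBINT x. g x * ?\<theta> x)"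
    by (intro Bochner_Integration.integral_diff locally_integrable_times Suc.prems test_function_translate t)
  also have "(LBINT x. g x * ?\<theta> (x + - h)) = (LBINT x. g (x + h) * ?\<theta> x)"
    using integral_lborel_affine[of 1 "\<lambda>x. g x * ?\<theta> (x + - h)" h] by (simp add: add.commute)
  also have "(LBINT x. g (x + h) * ?\<theta> x) - (LBINT x. g x * ?\<theta> x) = (LBINT x. (g (x + h) - g x) * ?\<theta> x)"
    unfolding left_diff_distrib
    by (intro Bochner_Integration.integral_diff[symmetric] locally_integrable_times locally_integrable_translate Suc.prems t)
  also have "\<dots> = (LBINT x. iter_diff (Suc L) h g x * \<phi> x)" unfolding iter_diff_commute[symmetric]
    by (intro Suc.IH locally_integrable_diff locally_integrable_translate Suc.prems)
  finally show ?case .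
qed simp

definition represents :: "'n::finite cfun \<Rightarrow> ('n cfun \<Rightarrow> complex) \<Rightarrow> bool" where
  "represents g T \<longleftrightarrow> locally_integrable g \<and> (\<forall>\<phi>. test_function \<phi> \<longrightarrow> T \<phi> = (LBINT x. g x * \<phi> x))"

context littlewood_paley
begin

text \<open>\<open>g\<close> represents \<open>T\<close> only against compactly supported functions,
  and the kernel is not compactly supported. It is cut off at radius about \<open>2 ^ n\<close>:
  under \<open>T\<close> the tail tends to zero by \<open>tempered_null_sequence\<close>, while on
  the side of the integral the integrability of kernel times difference provides the majorant for
  dominated convergence.\<close>

lemma convolution_representation:
  fixes K g :: "'n cfun" and x :: "real^'n"
  assumes T: "tempered T" and g: "represents g T" and K: "schwartz K"
    and int: "integrable lborel (\<lambda>y. K (x - y) * iter_diff L h g y)"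
  shows "conv (iter_diff L h K) T x = (LBINT y. K (x - y) * iter_diff L h g y)"
proof -
  let ?k = "\<lambda>y. K (x - y)"
  let ?c = "\<lambda>n y. bump ((1 / 2 ^ n) *\<^sub>R y)"
  let ?th = "\<lambda>n y. ?k y * ?c n y"
  let ?e = "\<lambda>n y. ?k y * (1 - ?c n y)"
  have gl: "locally_integrable g" using g by (simp add: represents_def)
  have k: "schwartz ?k" by (rule schwartz_reflect[OF K])
  have e: "schwartz (?e n)" for n by (intro schwartz_cutoff k) auto
  have th: "test_function (?th n)" for n
  proof -
    have "?c n y = 0" if "2 ^ Suc n < norm y" for y using that by (intro bump_zero) (simp add: field_simps)
    then show ?thesis
      using schwartz_mult[OF k schwartz_bump_scale[of "1 / 2 ^ n"]] by (auto simp: test_function_def intro!: exI[of _ "2 ^ Suc n"])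
  qed
  have "schwartz_family UNIV (\<lambda>n y. of_real (2 ^ n) * ?e n y)" using cutoff_null_family[OF k, of 1] by simp
  then have "schwartz_family UNIV (\<lambda>n. iter_diff L (- h) (\<lambda>y. of_real (2 ^ n) * ?e n y))"
    by (rule schwartz_family_iter_diff)
  moreover have "iter_diff L (- h) (\<lambda>y. c * f y) = (\<lambda>y. c * iter_diff L (- h) f y)" for c f
    by (induction L) (auto simp: right_diff_distrib)
  ultimately have "schwartz_family UNIV (\<lambda>n y. of_real (2 ^ n) * iter_diff L (- h) (?e n) y)" by simp
  then have "(\<lambda>n. T (iter_diff L (- h) (?e n))) \<longlonglongrightarrow> 0"
    by (rule tempered_null_sequence[OF T]) (intro schwartz_iter_diff e)
  moreover have "T (iter_diff L (- h) (?e n)) = conv (iter_diff L h K) T x - (LBINT y. iter_diff L h g y * ?th n y)" for n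
  proof -
    have "iter_diff L (- h) (\<lambda>y. f1 y - f2 y) = (\<lambda>y. iter_diff L (- h) f1 y - iter_diff L (- h) f2 y)" for f1 f2
      by (induction L) auto
    from this[of ?k "?th n"] have "iter_diff L (- h) (?e n) = (\<lambda>y. iter_diff L (- h) ?k y - iter_diff L (- h) (?th n) y)"
      by (simp add: right_diff_distrib)
    then have "T (iter_diff L (- h) (?e n)) = T (iter_diff L (- h) ?k) - T (iter_diff L (- h) (?th n))"
      using tempered_diff[OF T schwartz_iter_diff[OF k] schwartz_iter_diff[of "?th n"]] th
      by (simp only: test_function_def)
    also have "T (iter_diff L (- h) (?th n)) = (LBINT y. g y * iter_diff L (- h) (?th n) y)"
      using g test_function_iter_diff[OF th] by (simp add: represents_def)
    also have "\<dots> = (LBINT y. iter_diff L h g y * ?th n y)" by (rule integral_iter_diff[OF gl th])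
    also have "T (iter_diff L (- h) ?k) = conv (iter_diff L h K) T x"
      unfolding schwartz_convolution_def iter_diff_reflect ..
    finally show ?thesis .
  qed
  ultimately have "(\<lambda>n. conv (iter_diff L h K) T x - (LBINT y. iter_diff L h g y * ?th n y)) \<longlonglongrightarrow> 0" by simp
  from tendsto_diff[OF tendsto_const this, of "conv (iter_diff L h K) T x"]
  have 1: "(\<lambda>n. (LBINT y. iter_diff L h g y * ?th n y)) \<longlonglongrightarrow> conv (iter_diff L h K) T x" by simp
  have [measurable]: "iter_diff L h g \<in> borel_funs" "K \<in> borel_funs" "bump \<in> borel_funs"
    using locally_integrable_iter_diff[OF gl] K schwartz_bump schwartz_measurable by (auto simp: locally_integrable_def)
  have 2: "(\<lambda>n. (LBINT y. iter_diff L h g y * ?th n y)) \<longlonglongrightarrow> (LBINT y. ?k y * iter_diff L h g y)"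
  proof (rule integral_dominated_convergence[where w="\<lambda>y. norm (?k y * iter_diff L h g y)"])
    show "integrable lborel (\<lambda>y. norm (?k y * iter_diff L h g y))" using int by (rule integrable_norm)
    show "AE y in lborel. (\<lambda>n. iter_diff L h g y * ?th n y) \<longlonglongrightarrow> ?k y * iter_diff L h g y"
    proof (rule AE_I2)
      fix y :: "real^'n"
      obtain N :: nat where N: "norm y < 2 ^ N" using real_arch_pow[of 2 "norm y"] by auto
      have "?c n y = 1" if "n \<ge> N" for n
      proof (rule bump_one)
        have "(2::real) ^ N \<le> 2 ^ n" using that by (rule power_increasing) simp
        with N have "norm y < 2 ^ n" by (rule less_le_trans)
        then show "norm ((1 / 2 ^ n) *\<^sub>R y) < 1" by simp
      qed
      then have "\<forall>\<^sub>F n in sequentially. iter_diff L h g y * ?th n y = ?k y * iter_diff L h g y"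
        unfolding eventually_sequentially by (intro exI[of _ N]) (auto simp: mult_ac)
      then show "(\<lambda>n. iter_diff L h g y * ?th n y) \<longlonglongrightarrow> ?k y * iter_diff L h g y" by (rule tendsto_eventually)
    qed
    show "AE y in lborel. norm (iter_diff L h g y * ?th n y) \<le> norm (?k y * iter_diff L h g y)" for n
    proof (rule AE_I2)
      fix y
      obtain r where r: "0 \<le> r" "r \<le> 1" "?c n y = complex_of_real r" using bump_real by blast
      have "norm (iter_diff L h g y * ?th n y) = norm (?k y * iter_diff L h g y) * r"
        using r by (simp add: norm_mult mult_ac)
      also have "\<dots> \<le> norm (?k y * iter_diff L h g y)" using r by (intro mult_left_le) auto
      finally show "norm (iter_diff L h g y * ?th n y) \<le> norm (?k y * iter_diff L h g y)" .
    qed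
  qed measurable
  show ?thesis by (rule LIMSEQ_unique[OF 1 2])
qed

text \<open>The low-pass filter is moved to the test function, where it becomes the reflected cutoff
  of the transform of \<open>\<phi>\<close>. The error then has transform \<open>?e n\<close>, and
  \<open>cutoff_null_family\<close> with sign \<open>-1\<close> makes it a null sequence under
  \<open>T\<close>.\<close>

lemma low_pass_approximation:
  assumes T: "tempered T" and \<phi>: "schwartz \<phi>"
  shows "(\<lambda>n::nat. (LBINT y. \<phi> y * fourier_op (low_mult (int n)) T y)) \<longlonglongrightarrow> T \<phi>"
proof -
  let ?I = "\<lambda>n. (LBINT y. \<phi> y * fourier_op (low_mult (int n)) T y)"
  let ?e = "\<lambda>(n::nat) \<xi>. fourier \<phi> \<xi> * (1 - bump ((- 1 / 2 ^ n) *\<^sub>R \<xi>))"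
  have e: "schwartz (?e n)" for n by (intro schwartz_cutoff schwartz_fourier \<phi>) auto
  have "schwartz_family UNIV (\<lambda>n \<xi>. of_real (2 ^ n) * ?e n \<xi>)"
    by (rule cutoff_null_family[OF schwartz_fourier[OF \<phi>]]) simp
  then have "schwartz_family UNIV (\<lambda>n. inv_fourier (\<lambda>\<xi>. of_real (2 ^ n) * ?e n \<xi>))"
    by (rule schwartz_family_inv_fourier)
  moreover have "inv_fourier (\<lambda>\<xi>. of_real (2 ^ n) * ?e n \<xi>) = (\<lambda>x. of_real (2 ^ n) * inv_fourier (?e n) x)" for n
    by (rule ext) (simp add: inv_fourier_def mult.assoc)
  ultimately have "schwartz_family UNIV (\<lambda>n x. of_real (2 ^ n) * inv_fourier (?e n) x)" by simp
  then have "(\<lambda>n. T (inv_fourier (?e n))) \<longlonglongrightarrow> 0"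
    by (rule tempered_null_sequence[OF T]) (intro schwartz_inv_fourier e)
  moreover have "T (inv_fourier (?e n)) = T \<phi> - ?I n" for n
  proof -
    let ?b = "\<lambda>\<xi>. bump ((- 1 / 2 ^ n) *\<^sub>R \<xi>)"
    let ?g = "inv_fourier (\<lambda>\<xi>. ?b \<xi> * fourier \<phi> \<xi>)"
    have b: "schwartz ?b" by (rule schwartz_bump_scale) simp
    have lb: "low_mult (int n) (- \<xi>) = ?b \<xi>" for \<xi> by (simp add: low_mult_def power_int_minus divide_inverse)
    have bp: "schwartz (\<lambda>\<xi>. ?b \<xi> * fourier \<phi> \<xi>)" by (intro schwartz_mult b schwartz_fourier \<phi>)
    have "?I n
        = T (\<lambda>z. (LBINT y. \<phi> y * inv_fourier (low_mult (int n)) (y - z)))"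
      by (rule tempered_superposition[symmetric, OF T \<phi> schwartz_inv_fourier[OF schwartz_low_mult]])
    also have "(\<lambda>z. (LBINT y. \<phi> y * inv_fourier (low_mult (int n)) (y - z))) = ?g"
    proof
      fix z
      have "inv_fourier (low_mult (int n)) (y - z) = inv_fourier ?b (z - y)" for y
        using inv_fourier_reflect[OF schwartz_low_mult, of "int n" "z - y"] by (simp add: lb)
      then show "(LBINT y. \<phi> y * inv_fourier (low_mult (int n)) (y - z)) = ?g z"
        using inv_fourier_convolution[OF b \<phi>, of z] by (simp add: mult.commute)
    qed
    finally have 1: "?I n = T ?g" .
    have "inv_fourier (?e n) x = \<phi> x - ?g x" for x
    proof -
      have "inv_fourier (?e n) x = (LBINT \<xi>. fourier \<phi> \<xi> * cexp x \<xi> - (?b \<xi> * fourier \<phi> \<xi>) * cexp x \<xi>)"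
        unfolding inv_fourier_def by (rule Bochner_Integration.integral_cong) (auto simp: algebra_simps)
      also have "\<dots> = inv_fourier (fourier \<phi>) x - ?g x" unfolding inv_fourier_def
        by (intro Bochner_Integration.integral_diff schwartz_integrable schwartz_mult_cexp bp schwartz_fourier \<phi>)
      finally show ?thesis by (simp add: inv_fourier_fourier[OF \<phi>])
    qed
    then have "inv_fourier (?e n) = (\<lambda>x. \<phi> x - ?g x)" by (rule ext)
    then show ?thesis unfolding 1 using tempered_diff[OF T \<phi> schwartz_inv_fourier[OF bp]] by simp
  qed
  ultimately have "(\<lambda>n::nat. T \<phi> - ?I n) \<longlonglongrightarrow> 0" by simp
  from tendsto_diff[OF tendsto_const this, of "T \<phi>"] show ?thesis by simp
qed

section \<open>The fundamental lemma of the calculus of variations\<close>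

lemma test_function_mult: "test_function \<phi> \<Longrightarrow> test_function \<theta> \<Longrightarrow> test_function (\<lambda>x. \<phi> x * \<theta> x)"
  unfolding test_function_def using schwartz_mult by auto

text \<open>The supports of cutoff functions generate the Borel sets. The indicator of a support is the limit of
the test functions \<open>1 - (1 - \<theta>)\<^sup>m\<close>, so that no mollification is needed.\<close>

definition cutoff :: "'n cfun \<Rightarrow> bool" where
  "cutoff \<theta> \<longleftrightarrow> test_function \<theta> \<and> (\<forall>x. \<exists>r. 0 \<le> r \<and> r \<le> 1 \<and> \<theta> x = complex_of_real r)"

lemma cutoff_mult:
  assumes "cutoff \<phi>" "cutoff \<theta>" shows "cutoff (\<lambda>x. \<phi> x * \<theta> x)"
proof -
  have "\<exists>r. 0 \<le> r \<and> r \<le> 1 \<and> \<phi> x * \<theta> x = complex_of_real r" for x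
  proof -
    obtain r t where "0 \<le> r" "r \<le> 1" "\<phi> x = complex_of_real r" "0 \<le> t" "t \<le> 1" "\<theta> x = complex_of_real t"
      using assms unfolding cutoff_def by metis
    then show ?thesis by (intro exI[of _ "r * t"]) (auto simp: mult_le_one)
  qed
  then show ?thesis using assms test_function_mult by (auto simp: cutoff_def)
qed

lemma cutoff_bump:
  assumes "c > 0" shows "cutoff (\<lambda>x. bump (c *\<^sub>R (x - a)))"
proof -
  have "schwartz (\<lambda>x. bump (c *\<^sub>R (x - a)))"
    using schwartz_affine[OF schwartz_bump, of c "- (c *\<^sub>R a)"] assms by (simp add: algebra_simps)
  moreover have "bump (c *\<^sub>R (x - a)) = 0" if "norm a + 2 / c < norm x" for x
  proof (rule bump_zero)
    have "2 / c \<le> norm (x - a)" using that norm_triangle_ineq2[of x a] by linarith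
    then show "2 \<le> norm (c *\<^sub>R (x - a))" unfolding norm_scaleR using assms by (simp add: field_simps)
  qed
  ultimately show ?thesis using bump_real unfolding cutoff_def test_function_def by blast
qed

lemma cutoff_supports_generate:
  "sigma_sets UNIV {U :: (real^'n) set. \<exists>\<theta>. cutoff \<theta> \<and> U = {x. \<theta> x \<noteq> 0}} = sets borel" (is "sigma_sets UNIV ?U = _")
proof
  have "{x. \<theta> x \<noteq> 0} \<in> sets borel" if "cutoff \<theta>" for \<theta>
  proof -
    have [measurable]: "\<theta> \<in> borel_funs" using that schwartz_measurable by (auto simp: cutoff_def test_function_def)
    show ?thesis by measurable
  qed
  then show "sigma_sets UNIV ?U \<subseteq> sets borel" using sets.sigma_sets_subset[of ?U borel] by auto
  have "V \<in> sigma_sets UNIV ?U" if V: "open V" for V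
  proof -
    obtain D :: "(real^'n) set" where D: "countable D" "\<And>X. open X \<Longrightarrow> X \<noteq> {} \<Longrightarrow> \<exists>d\<in>D. d \<in> X"
      by (rule countable_dense_setE) blast
    define S where "S d m = {x. bump (real (Suc m) *\<^sub>R (x - d)) \<noteq> 0}" for d m
    have small: "dist x d * real (Suc m) < 2" if "x \<in> S d m" for x d m
      using that bump_zero[of "real (Suc m) *\<^sub>R (x - d)"] by (force simp: S_def dist_norm mult.commute simp del: of_nat_Suc)
    let ?F = "{S d m |d m. d \<in> D \<and> S d m \<subseteq> V}"
    have "V = \<Union>?F"
    proof (intro equalityI subsetI)
      fix x assume "x \<in> V"
      then obtain e where e: "e > 0" "ball x e \<subseteq> V" using V open_contains_ball by metis
      \<comment> \<open>The support around \<open>d\<close> has radius at most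
        \<open>2 / (m + 1)\<close>, and \<open>d\<close> is taken within \<open>1 / (m + 1)\<close>
        of \<open>x\<close>; together this gives the \<open>3\<close>.\<close>
      obtain m where m: "3 / e < real (Suc m)" using reals_Archimedean2 less_trans lessI of_nat_less_iff by metis
      obtain d where d: "d \<in> D" "dist x d * real (Suc m) < 1"
        using D(2)[of "ball x (1 / real (Suc m))"] by (auto simp: field_simps simp del: of_nat_Suc)
      have "x \<in> S d m" unfolding S_def using d(2) bump_one[of "real (Suc m) *\<^sub>R (x - d)"] by (simp add: dist_norm mult.commute del: of_nat_Suc)
      moreover have "S d m \<subseteq> V"
      proof
        fix y assume "y \<in> S d m"
        then have "(dist x d + dist y d) * real (Suc m) < 3" using small[of y d m] d(2) unfolding distrib_right by linarith
        also have "3 < e * real (Suc m)" using m e(1) by (simp add: field_simps del: of_nat_Suc)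
        finally have "dist x d + dist y d < e" by (simp del: of_nat_Suc)
        then show "y \<in> V" using e(2) dist_triangle2[of x y d] by auto
      qed
      ultimately show "x \<in> \<Union>?F" using d(1) by blast
    qed blast
    moreover have "\<Union>?F \<in> sigma_sets UNIV ?U"
    proof (rule sigma_sets_UNION)
      show "countable ?F" by (rule countable_subset[of _ "(\<lambda>(d, m). S d m) ` (D \<times> UNIV)"]) (use D(1) in auto)
      have "S d m \<in> ?U" for d m using cutoff_bump[of "real (Suc m)" d] unfolding S_def by auto
      then show "\<And>A. A \<in> ?F \<Longrightarrow> A \<in> sigma_sets UNIV ?U" by (auto intro: sigma_sets.Basic)
    qed
    ultimately show ?thesis by (rule ssubst)
  qed
  then have "{V. open V} \<subseteq> sigma_sets UNIV ?U" by auto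
  from sigma_sets_mono[OF this] show "sets borel \<subseteq> sigma_sets UNIV ?U" by (simp add: borel_def)
qed

text \<open>Integrals of \<open>g\<close> over supports of cutoff functions vanish by dominated
  convergence. Such supports are stable under intersection, since cutoffs may be multiplied, so
  Dynkin's theorem carries the vanishing to all Borel subsets of a large support, which forces
  \<open>g = 0\<close> there.\<close>

lemma locally_integrable_eq_zero:
  fixes g :: "'n cfun"
  assumes g: "locally_integrable g" and z: "\<And>\<phi>. test_function \<phi> \<Longrightarrow> (LBINT x. g x * \<phi> x) = 0"
  shows "AE x in lborel. g x = 0"
proof -
  have [measurable]: "g \<in> borel_funs" using g by (simp add: locally_integrable_def)
  have U: "integrable lborel (\<lambda>x. indicator {x. \<theta> x \<noteq> 0} x * g x)" "(LBINT x. indicator {x. \<theta> x \<noteq> 0} x * g x) = 0"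
    if \<theta>: "cutoff \<theta>" for \<theta>
  proof -
    define \<Phi> where "\<Phi> m x = 1 - (1 - \<theta> x) ^ m" for m :: nat and x
    have th: "test_function \<theta>" and r: "\<forall>x. \<exists>r. 0 \<le> r \<and> r \<le> 1 \<and> \<theta> x = complex_of_real r" using \<theta> by (auto simp: cutoff_def)
    obtain R where R: "\<forall>x. R < norm x \<longrightarrow> \<theta> x = 0" using th by (auto simp: test_function_def)
    have t: "test_function (\<Phi> m)" for m
    proof (induction m)
      case 0 show ?case using test_function_diff[OF th th] by (simp add: \<Phi>_def[abs_def])
    next
      case (Suc m)
      have "\<Phi> (Suc m) = (\<lambda>x. \<theta> x - (\<theta> x * \<Phi> m x - \<Phi> m x))" by (rule ext) (simp add: \<Phi>_def algebra_simps)
      then show ?case using test_function_diff[OF th test_function_diff[OF test_function_mult[OF th Suc] Suc]] by simp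
    qed
    have [measurable]: "\<Phi> m \<in> borel_funs" "\<theta> \<in> borel_funs" for m
      using t[of m] th schwartz_measurable by (auto simp: test_function_def)
    have lim: "(\<lambda>m. \<Phi> m x) \<longlonglongrightarrow> indicator {x. \<theta> x \<noteq> 0} x" and bd: "norm (\<Phi> m x) \<le> indicator (cball 0 R) x" for m x
    proof -
      obtain r where r: "0 \<le> r" "r \<le> 1" "\<theta> x = complex_of_real r" using r by blast
      have e: "\<Phi> m x = complex_of_real (1 - (1 - r) ^ m)" for m by (simp add: \<Phi>_def r(3))
      have "(\<lambda>m. 1 - (1 - r) ^ m) \<longlonglongrightarrow> (if r = 0 then 0 else 1 - 0)"
      proof (cases "r = 0")
        case False
        have "(\<lambda>m. 1 - (1 - r) ^ m) \<longlonglongrightarrow> 1 - 0"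
          using r False by (intro tendsto_diff tendsto_const LIMSEQ_realpow_zero) auto
        then show ?thesis using False by simp
      qed simp
      then have "(\<lambda>m. \<Phi> m x) \<longlonglongrightarrow> of_real (if r = 0 then 0 else 1 - 0)" unfolding e by (rule tendsto_of_real)
      then show "(\<lambda>m. \<Phi> m x) \<longlonglongrightarrow> indicator {x. \<theta> x \<noteq> 0} x" using r(3) by (cases "r = 0") auto
      have "\<bar>1 - (1 - r) ^ m\<bar> \<le> 1" using r power_le_one[of "1 - r" m] zero_le_power[of "1 - r" m] by linarith
      moreover have "R < norm x \<Longrightarrow> r = 0" using R r(3) by auto
      ultimately show "norm (\<Phi> m x) \<le> indicator (cball 0 R) x" unfolding e norm_of_real by (auto simp: indicator_def)
    qed
    let ?w = "\<lambda>x. norm (indicator (cball 0 R) x * g x)"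
    have w: "integrable lborel ?w" using g by (intro integrable_norm) (simp add: locally_integrable_def)
    show "integrable lborel (\<lambda>x. indicator {x. \<theta> x \<noteq> 0} x * g x)"
    proof (rule Bochner_Integration.integrable_bound[OF w])
      show "(\<lambda>x. indicator {x. \<theta> x \<noteq> 0} x * g x) \<in> borel_measurable lborel" by measurable
      have "\<not> R < norm x \<or> \<theta> x = 0" for x using R by auto
      then show "AE x in lborel. norm (indicator {x. \<theta> x \<noteq> 0} x * g x) \<le> norm (?w x)"
        by (intro AE_I2) (auto simp: indicator_def not_less)
    qed
    have "(\<lambda>m. (LBINT x. g x * \<Phi> m x)) \<longlonglongrightarrow> (LBINT x. g x * indicator {x. \<theta> x \<noteq> 0} x)"
    proof (rule integral_dominated_convergence[OF _ _ w])
      show "AE x in lborel. (\<lambda>m. g x * \<Phi> m x) \<longlonglongrightarrow> g x * indicator {x. \<theta> x \<noteq> 0} x"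
        by (intro AE_I2 tendsto_mult tendsto_const lim)
      have "norm (g x * \<Phi> m x) \<le> ?w x" for m x
        using mult_right_mono[OF bd[of m x] norm_ge_zero[of "g x"]] by (auto simp: norm_mult mult.commute indicator_def)
      then show "AE x in lborel. norm (g x * \<Phi> m x) \<le> ?w x" for m by (rule AE_I2)
    qed measurable
    then show "(LBINT x. indicator {x. \<theta> x \<noteq> 0} x * g x) = 0"
      by (simp add: z[OF t] LIMSEQ_const_iff mult.commute)
  qed
  have "AE x in lborel. norm x < real (Suc k) \<longrightarrow> g x = 0" for k :: nat
  proof -
    \<comment> \<open>Equal to \<open>1\<close> on the ball of radius \<open>k + 1\<close>. On its
      support \<open>g\<close> is integrable, and multiplication by it does not leave the class of
      cutoffs.\<close>
    let ?b = "\<lambda>x :: real^'n. bump ((1 / real (Suc k)) *\<^sub>R (x - 0))"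
    let ?f = "\<lambda>x. indicator {x. ?b x \<noteq> 0} x * g x"
    let ?U = "{U :: (real^'n) set. \<exists>\<theta>. cutoff \<theta> \<and> U = {x. \<theta> x \<noteq> 0}}"
    have b: "cutoff ?b" by (rule cutoff_bump) simp
    have iA: "integrable lborel (\<lambda>x. indicator A x *\<^sub>R ?f x)" if "A \<in> sets borel" for A
      using that U(1)[OF b] by (intro integrable_mult_indicator) auto
    have "Int_stable ?U"
    proof (rule Int_stableI)
      fix V W assume "V \<in> ?U" "W \<in> ?U"
      then obtain \<phi> \<theta> where "cutoff \<phi>" "V = {x. \<phi> x \<noteq> 0}" "cutoff \<theta>" "W = {x. \<theta> x \<noteq> 0}" by auto
      then show "V \<inter> W \<in> ?U" using cutoff_mult by (auto intro!: exI[of _ "\<lambda>x. \<phi> x * \<theta> x"])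
    qed
    then have "(LBINT x. indicator A x *\<^sub>R ?f x) = 0" if "A \<in> sigma_sets UNIV ?U" for A
      using subset_UNIV[of ?U, folded Pow_UNIV] that
    proof (induction rule: sigma_sets_induct_disjoint)
      case (basic A)
      then obtain \<theta> where \<theta>: "cutoff \<theta>" "A = {x. \<theta> x \<noteq> 0}" by blast
      have "indicator A x *\<^sub>R ?f x = indicator {x. \<theta> x * ?b x \<noteq> 0} x * g x" for x using \<theta>(2) by (auto simp: indicator_def)
      then show ?case using U(2)[OF cutoff_mult[OF \<theta>(1) b]] by presburger
    next
      case empty
      show ?case by simp
    next
      case (compl A)
      then have A: "A \<in> sets borel" using cutoff_supports_generate by simp
      have "indicator (UNIV - A) x *\<^sub>R ?f x = ?f x - indicator A x *\<^sub>R ?f x" for x by (simp add: indicator_def)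
      then have "(LBINT x. indicator (UNIV - A) x *\<^sub>R ?f x) = (LBINT x. ?f x) - (LBINT x. indicator A x *\<^sub>R ?f x)"
        using U(1)[OF b] iA[OF A] by (simp only: Bochner_Integration.integral_diff)
      then show ?case using compl U(2)[OF b] by simp
    next
      case (union A)
      then have A: "\<And>i. A i \<in> sets lborel" using cutoff_supports_generate by auto
      have "(LINT x:(\<Union>i. A i)|lborel. ?f x) = (\<Sum>i. (LINT x:(A i)|lborel. ?f x))"
      proof (rule lebesgue_integral_countable_add[OF A])
        show "A i \<inter> A j = {}" if "i \<noteq> j" for i j using union(1) that by (auto simp: disjoint_family_on_def)
        show "set_integrable lborel (\<Union>i. A i) ?f" unfolding set_integrable_def using A by (intro iA) auto
      qed
      then show ?case using union(3) by (simp add: set_lebesgue_integral_def)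
    qed
    then have "set_lebesgue_integral lborel A ?f = 0" if "A \<in> sets lborel" for A
      using that unfolding set_lebesgue_integral_def cutoff_supports_generate by simp
    then have "AE x in lborel. ?f x \<in> {0}"
      by (intro sigma_finite_measure.averaging_theorem[OF sigma_finite_lborel] U(1)[OF b]) auto
    then show ?thesis
    proof eventually_elim
      case (elim x)
      have "norm x < real (Suc k) \<Longrightarrow> ?b x = 1" by (rule bump_one) (simp add: field_simps del: of_nat_Suc)
      then show ?case using elim by auto
    qed
  qed
  then have "AE x in lborel. \<forall>k. norm x < real (Suc k) \<longrightarrow> g x = 0" by (subst AE_all_countable) blast
  then show ?thesis
  proof eventually_elim
    case (elim x)
    obtain k where "norm x < real k" using reals_Archimedean2 by blast
    then have "norm x < real (Suc k)" by simp
    then show ?case using elim by blast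
  qed
qed

lemma low_pass_sum:
  assumes T: "tempered T"
  shows "fourier_op (low_mult (k + int n)) T x = fourier_op (low_mult k) T x
    + (\<Sum>i<n. fourier_op (lp_mult (k + 1 + int i)) T x)"
proof (induction n)
  case (Suc n)
  let ?l = "k + 1 + int n"
  have "inv_fourier (lp_mult ?l) y = inv_fourier (low_mult ?l) y - inv_fourier (low_mult (k + int n)) y" for y
  proof -
    have "inv_fourier (lp_mult ?l) y = (LBINT \<xi>. low_mult ?l \<xi> * cexp y \<xi> - low_mult (k + int n) \<xi> * cexp y \<xi>)"
      unfolding inv_fourier_def lp_mult_eq by (simp add: left_diff_distrib)
    also have "\<dots> = inv_fourier (low_mult ?l) y - inv_fourier (low_mult (k + int n)) y" unfolding inv_fourier_def
      by (intro Bochner_Integration.integral_diff schwartz_integrable schwartz_mult_cexp schwartz_low_mult)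
    finally show ?thesis .
  qed
  then have "inv_fourier (lp_mult ?l) = (\<lambda>y. inv_fourier (low_mult ?l) y - inv_fourier (low_mult (k + int n)) y)" by (rule ext)
  then have "fourier_op (lp_mult ?l) T x = fourier_op (low_mult ?l) T x
      - fourier_op (low_mult (k + int n)) T x"
    using schwartz_convolution_diff[OF T schwartz_inv_fourier[OF schwartz_low_mult] schwartz_inv_fourier[OF schwartz_low_mult]] by simp
  moreover have "k + int (Suc n) = ?l" by simp
  ultimately show ?case using Suc by (simp add: algebra_simps)
qed simp

text \<open>The hypothesis makes the high pieces sum absolutely in \<open>L^1\<close>, so that both
  sides are locally integrable. They agree against test functions by
  \<open>low_pass_approximation\<close> and dominated convergence of the partial sums, hence almost
  everywhere. Without summability the pieces would determine \<open>g\<close> only as a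
  distribution.\<close>

lemma littlewood_paley_decomposition:
  assumes T: "tempered T" and g: "represents g T"
    and fin: "(NN x. (\<Sum>i. enorm (fourier_op (lp_mult (k + 1 + int i)) T x))) < \<infinity>"
  shows "AE x in lborel. summable (\<lambda>i. norm (fourier_op (lp_mult (k + 1 + int i)) T x)) \<and>
    g x = fourier_op (low_mult k) T x + (\<Sum>i. fourier_op (lp_mult (k + 1 + int i)) T x)"
proof -
  let ?f = "\<lambda>i. fourier_op (lp_mult (k + 1 + int i)) T"
  let ?h = "\<lambda>l. fourier_op (low_mult l) T"
  define H where "H x = (\<Sum>i. ?f i x)" for x
  define A where "A x = (\<Sum>i. norm (?f i x))" for x
  have sl: "schwartz (inv_fourier (low_mult l))" "schwartz (inv_fourier (lp_mult l))" for l
    by (intro schwartz_inv_fourier schwartz_low_mult schwartz_lp_mult)+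
  have [measurable]: "?f i \<in> borel_funs" "?h l \<in> borel_funs" for i l by (intro convolution_measurable T sl)+
  have [measurable]: "H \<in> borel_funs" unfolding H_def[abs_def] by measurable
  have [measurable]: "A \<in> borel_funs" unfolding A_def[abs_def] by measurable
  have gl: "locally_integrable g" using g by (simp add: represents_def)
  have [measurable]: "g \<in> borel_funs" using gl by (simp add: locally_integrable_def)
  have AEfin: "AE x in lborel. (\<Sum>i. enorm (?f i x)) \<noteq> \<infinity>" by (rule nn_integral_PInf_AE) (use fin in auto)
  have AEs: "AE x in lborel. summable (\<lambda>i. norm (?f i x))"
    using AEfin by eventually_elim (simp add: summable_suminf_not_top)
  have AEA: "AE x in lborel. ennreal (A x) = (\<Sum>i. enorm (?f i x))"
    using AEs by eventually_elim (auto simp: A_def intro!: suminf_ennreal2[symmetric])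
  have Ann: "AE x in lborel. 0 \<le> A x" using AEs by eventually_elim (auto simp: A_def intro!: suminf_nonneg)
  have iA: "integrable lborel A"
  proof -
    have "(NN x. enorm (A x)) = (NN x. (\<Sum>i. enorm (?f i x)))"
      by (rule nn_integral_cong_AE) (use AEA Ann in \<open>eventually_elim, auto\<close>)
    then show ?thesis using fin by (auto simp: integrable_iff_bounded)
  qed
  have HA: "AE x in lborel. norm (H x) \<le> A x"
    using AEs by eventually_elim (auto simp: A_def H_def intro!: summable_norm)
  have iH: "integrable lborel H" by (rule Bochner_Integration.integrable_bound[OF iA]) (use HA Ann in \<open>auto\<close>)
  have lH: "locally_integrable H" unfolding locally_integrable_def
    by (auto intro!: Bochner_Integration.integrable_bound[OF iH] simp: indicator_def)
  have lh: "locally_integrable (?h k)" unfolding locally_integrable_def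
  proof safe
    fix R
    obtain B where B: "\<forall>x\<in>cball 0 R. norm (?h k x) \<le> B"
      using compact_imp_bounded[OF compact_continuous_image[OF convolution_continuous[OF T sl(1)[of k]] compact_cball, of 0 R]]
      unfolding bounded_iff by auto
    show "integrable lborel (\<lambda>x. indicator (cball 0 R) x * ?h k x)"
    proof (rule Bochner_Integration.integrable_bound[where f="\<lambda>x. B * indicator (cball 0 R) x"])
      show "integrable lborel (\<lambda>x::real^'n. B * indicator (cball 0 R) x)"
        by (intro integrable_mult_right integrable_real_indicator emeasure_lborel_cball_finite) simp
      have [measurable]: "cball (0::real^'n) R \<in> sets borel" by simp
      show "(\<lambda>x. indicator (cball 0 R) x * ?h k x) \<in> borel_measurable lborel" by simp
      show "AE x in lborel. norm (indicator (cball 0 R) x * ?h k x) \<le> norm (B * indicator (cball 0 R) x)"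
        using B by (intro AE_I2) (auto simp: indicator_def intro: order_trans[OF _ abs_ge_self])
    qed
  qed measurable
  have "(LBINT x. (g x - (?h k x + H x)) * \<phi> x) = 0" if \<phi>: "test_function \<phi>" for \<phi>
  proof -
    have s\<phi>: "schwartz \<phi>" using \<phi> by (simp add: test_function_def)
    have [measurable]: "\<phi> \<in> borel_funs" by (rule schwartz_measurable[OF s\<phi>])
    obtain B where B: "B > 0" "\<forall>x. norm (\<phi> x) \<le> B" using schwartz_bounded[OF s\<phi>] by blast
    define b where "b n = (LBINT x. \<phi> x * ?h (int n) x)" for n :: nat
    have b: "b \<longlonglongrightarrow> T \<phi>" unfolding b_def by (rule low_pass_approximation[OF T s\<phi>])
    define a where "a n = (LBINT x. \<phi> x * ?h (k + int n) x)" for n :: nat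
    \<comment> \<open>The levels start at \<open>k\<close>, which may have either sign, and are
      matched with natural levels by shifting one index or the other.\<close>
    have ab: "a (n + nat (- k)) = b (n + nat k)" for n
    proof -
      have "k + int (n + nat (- k)) = int (n + nat k)" by simp
      then show ?thesis unfolding a_def b_def by (simp only:)
    qed
    have "a \<longlonglongrightarrow> T \<phi>"
    proof (rule LIMSEQ_offset[where k="nat (- k)"])
      show "(\<lambda>n. a (n + nat (- k))) \<longlonglongrightarrow> T \<phi>" unfolding ab by (rule LIMSEQ_ignore_initial_segment[OF b])
    qed
    moreover have "a \<longlonglongrightarrow> (LBINT x. \<phi> x * (?h k x + H x))" unfolding a_def low_pass_sum[OF T]
    proof (rule integral_dominated_convergence[where w="\<lambda>x. norm (?h k x * \<phi> x) + B * A x"])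
      show "integrable lborel (\<lambda>x. norm (?h k x * \<phi> x) + B * A x)"
        by (intro Bochner_Integration.integrable_add integrable_norm locally_integrable_times lh \<phi> integrable_mult_right iA)
      show "AE x in lborel. (\<lambda>n. \<phi> x * (?h k x + (\<Sum>i<n. ?f i x))) \<longlonglongrightarrow> \<phi> x * (?h k x + H x)" using AEs
      proof eventually_elim
        case (elim x)
        then have "(\<lambda>n. \<Sum>i<n. ?f i x) \<longlonglongrightarrow> H x" unfolding H_def by (rule summable_LIMSEQ[OF summable_norm_cancel])
        then show ?case by (intro tendsto_intros)
      qed
      show "AE x in lborel. norm (\<phi> x * (?h k x + (\<Sum>i<n. ?f i x))) \<le> norm (?h k x * \<phi> x) + B * A x" for n
        using AEs
      proof eventually_elim
        case (elim x)
        have "norm (\<Sum>i<n. ?f i x) \<le> (\<Sum>i<n. norm (?f i x))" by (rule norm_sum)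
        also have "\<dots> \<le> A x" unfolding A_def by (rule sum_le_suminf[OF elim]) auto
        finally have 1: "norm (\<Sum>i<n. ?f i x) \<le> A x" .
        have "norm (\<phi> x * (?h k x + (\<Sum>i<n. ?f i x))) \<le> norm (\<phi> x * ?h k x) + norm (\<phi> x * (\<Sum>i<n. ?f i x))"
          unfolding distrib_left by (rule norm_triangle_ineq)
        also have "norm (\<phi> x * (\<Sum>i<n. ?f i x)) \<le> B * A x"
          unfolding norm_mult using B 1 by (intro mult_mono) auto
        finally show ?case by (simp add: mult.commute)
      qed
    qed measurable
    ultimately have 1: "T \<phi> = (LBINT x. \<phi> x * (?h k x + H x))" by (rule LIMSEQ_unique)
    have "T \<phi> = (LBINT x. g x * \<phi> x)" using g \<phi> by (simp add: represents_def)
    moreover have "(LBINT x. (g x - (?h k x + H x)) * \<phi> x) = (LBINT x. g x * \<phi> x) - (LBINT x. (?h k x + H x) * \<phi> x)"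
      unfolding left_diff_distrib
    proof (rule Bochner_Integration.integral_diff[OF locally_integrable_times[OF gl \<phi>]])
      have "integrable lborel (\<lambda>x. ?h k x * \<phi> x + H x * \<phi> x)"
        by (intro Bochner_Integration.integrable_add locally_integrable_times lh lH \<phi>)
      then show "integrable lborel (\<lambda>x. (?h k x + H x) * \<phi> x)" by (simp only: distrib_right)
    qed
    ultimately show ?thesis using 1 by (simp add: mult.commute)
  qed
  moreover have "locally_integrable (\<lambda>x. g x - (?h k x + H x))"
    using locally_integrable_diff[OF locally_integrable_diff[OF gl lh] lH] by (simp add: diff_diff_add)
  ultimately have "AE x in lborel. g x - (?h k x + H x) = 0" by (intro locally_integrable_eq_zero)
  with AEs show ?thesis by eventually_elim (simp add: H_def)
qed

end

section \<open>Quasinorms of nonnegative functions\<close>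

lemma ennreal_powr_ennreal: "0 \<le> r \<Longrightarrow> epowr (ennreal r) a = ennreal (r powr a)"
  by (simp add: ennreal_powr_def)

lemma ennreal_powr_numeral [simp]: "epowr (numeral k) a = ennreal (numeral k powr a)"
  using ennreal_powr_ennreal[of "numeral k" a] by simp

lemma ennreal_powr_top [simp]: "epowr \<infinity> a = \<infinity>" "epowr \<top> a = \<top>"
  by (simp_all add: ennreal_powr_def)

lemma ennreal_powr_0 [simp]: "epowr 0 a = 0"
  by (simp add: ennreal_powr_def)

lemma ennreal_powr_1 [simp]: "epowr x 1 = x"
  by (cases x) (auto simp: ennreal_powr_ennreal)

lemma ennreal_powr_mono: "a > 0 \<Longrightarrow> x \<le> y \<Longrightarrow> epowr x a \<le> epowr y a"
  by (cases x; cases y) (auto simp: ennreal_powr_ennreal top_unique intro!: ennreal_leI powr_mono2)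

lemma ennreal_powr_mult: "a > 0 \<Longrightarrow> epowr (x * y) a = epowr x a * epowr y a"
proof (cases x; cases y)
  fix r s assume "a > 0" "x = ennreal r" "0 \<le> r" "y = ennreal s" "0 \<le> s"
  then show ?thesis by (simp add: ennreal_powr_ennreal powr_mult flip: ennreal_mult)
next
  fix r assume *: "a > 0" "x = ennreal r" "0 \<le> r" "y = \<top>"
  then show ?thesis by (cases "r = 0") (auto simp: ennreal_powr_ennreal ennreal_mult_top)
next
  fix s assume *: "a > 0" "x = \<top>" "y = ennreal s" "0 \<le> s"
  then show ?thesis by (cases "s = 0") (auto simp: ennreal_powr_ennreal ennreal_top_mult)
qed simp

lemma ennreal_powr_powr: "a > 0 \<Longrightarrow> b > 0 \<Longrightarrow> epowr (epowr x a) b = epowr x (a * b)"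
  by (cases x) (auto simp: ennreal_powr_ennreal powr_powr)

lemma ennreal_powr_le_iff: "a > 0 \<Longrightarrow> epowr x a \<le> epowr y a \<longleftrightarrow> x \<le> y"
  using ennreal_powr_mono[of a x y] ennreal_powr_mono[of "1/a" "epowr x a" "epowr y a"]
  by (auto simp: ennreal_powr_powr)

lemma ennreal_powr_finite: "x < \<infinity> \<Longrightarrow> epowr x a < \<infinity>"
  by (simp add: ennreal_powr_def)

lemma ennreal_powr_eq_top: "epowr x a = \<top> \<longleftrightarrow> x = \<top>"
  by (simp add: ennreal_powr_def)

lemma ennreal_powr_eq_0: "epowr x a = 0 \<longleftrightarrow> x = 0"
  by (cases x) (auto simp: ennreal_powr_ennreal)

lemma ennreal_powr_measurable [measurable]:
  assumes [measurable]: "f \<in> borel_measurable M"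
  shows "(\<lambda>x. epowr (f x) a) \<in> borel_measurable M" unfolding ennreal_powr_def by measurable

lemma ennreal_powr_SUP:
  assumes "a > 0" shows "epowr (SUP i\<in>I. f i) a = (SUP i\<in>I. epowr (f i) a)"
proof (rule antisym)
  have "f i \<le> epowr (SUP i\<in>I. epowr (f i) a) (1 / a)" if "i \<in> I" for i
  proof -
    have "epowr (epowr (f i) a) (1 / a) \<le> epowr (SUP i\<in>I. epowr (f i) a) (1 / a)"
      using assms that by (intro ennreal_powr_mono SUP_upper) auto
    then show ?thesis using assms by (simp add: ennreal_powr_powr)
  qed
  then have "(SUP i\<in>I. f i) \<le> epowr (SUP i\<in>I. epowr (f i) a) (1 / a)" by (rule SUP_least)
  from ennreal_powr_mono[OF assms this] show "epowr (SUP i\<in>I. f i) a \<le> (SUP i\<in>I. epowr (f i) a)"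
    using assms by (simp add: ennreal_powr_powr)
qed (auto intro!: SUP_least ennreal_powr_mono assms SUP_upper)

lemma ennreal_powr_add_le:
  assumes "a > 0" shows "epowr (x + y) a \<le> ennreal (2 powr a) * (epowr x a + epowr y a)"
proof -
  have *: "epowr (x + y) a \<le> ennreal (2 powr a) * (epowr x a + epowr y a)" if "x \<le> y" for x y
  proof -
    have "x + y \<le> ennreal 2 * y" using that by (simp add: mult_2 add_mono)
    then have "epowr (x + y) a \<le> epowr (ennreal 2 * y) a" by (intro ennreal_powr_mono assms)
    also have "\<dots> = ennreal (2 powr a) * epowr y a" by (simp only: ennreal_powr_mult[OF assms]) (simp only: ennreal_powr_ennreal zero_le_numeral)
    also have "\<dots> \<le> ennreal (2 powr a) * (epowr x a + epowr y a)" by (intro mult_left_mono) auto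
    finally show ?thesis .
  qed
  show ?thesis using *[of x y] *[of y x] by (metis add.commute linear)
qed

text \<open>Stated over an arbitrary measure and with values in \<open>ennreal\<close>: the same
  lemmas then serve \<open>L^p\<close> over \<open>lborel\<close> and \<open>l^q\<close> over
  \<open>count_space\<close>, with no finiteness conditions.\<close>

definition Lp_gen :: "'a measure \<Rightarrow> ennreal \<Rightarrow> ('a \<Rightarrow> ennreal) \<Rightarrow> ennreal" where
  "Lp_gen M p f = (if p = \<infinity> then esssup M f
     else epowr (\<integral>\<^sup>+x. epowr (f x) (enn2real p) \<partial>M) (1 / enn2real p))"

lemma enn2real_pos: "0 < p \<Longrightarrow> p \<noteq> \<infinity> \<Longrightarrow> 0 < enn2real p"
  by (simp add: enn2real_positive_iff less_top)

lemma Lp_gen_power: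
  assumes "0 < p" "p \<noteq> \<infinity>"
  shows "epowr (Lp_gen M p f) (enn2real p) = (\<integral>\<^sup>+x. epowr (f x) (enn2real p) \<partial>M)"
  using enn2real_pos[OF assms] assms by (simp add: Lp_gen_def ennreal_powr_powr)

lemma Lp_gen_le_iff:
  assumes "0 < p" "p \<noteq> \<infinity>"
  shows "Lp_gen M p f \<le> c \<longleftrightarrow> (\<integral>\<^sup>+x. epowr (f x) (enn2real p) \<partial>M) \<le> epowr c (enn2real p)"
  using Lp_gen_power[OF assms, of M f] ennreal_powr_le_iff[OF enn2real_pos[OF assms]] by metis

lemma Lp_gen_mono_AE:
  assumes "0 < p" "f \<in> borel_measurable M" "AE x in M. f x \<le> g x"
  shows "Lp_gen M p f \<le> Lp_gen M p g"
proof (cases "p = \<infinity>")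
  case True
  then show ?thesis using esssup_AE_mono[OF assms(2,3)] by (simp add: Lp_gen_def)
next
  case False
  note pos = enn2real_pos[OF assms(1) False]
  have "(\<integral>\<^sup>+x. epowr (f x) (enn2real p) \<partial>M) \<le> (\<integral>\<^sup>+x. epowr (g x) (enn2real p) \<partial>M)"
    by (rule nn_integral_mono_AE) (use assms(3) in \<open>eventually_elim, auto intro: ennreal_powr_mono pos\<close>)
  then show ?thesis using False pos by (simp add: Lp_gen_def ennreal_powr_mono)
qed

lemma Lp_gen_cmult_le:
  assumes "0 < p" and [measurable]: "f \<in> borel_measurable M"
  shows "Lp_gen M p (\<lambda>x. c * f x) \<le> c * Lp_gen M p f"
proof (cases "p = \<infinity>")
  case True
  have "AE x in M. c * f x \<le> c * esssup M f"
    using esssup_AE[of f M] by eventually_elim (rule mult_left_mono, auto)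
  then show ?thesis using True by (auto simp: Lp_gen_def intro!: esssup_I)
next
  case False
  note pos = enn2real_pos[OF assms(1) False]
  show ?thesis
    by (simp add: Lp_gen_le_iff[OF assms(1) False] ennreal_powr_mult[OF pos] nn_integral_cmult Lp_gen_power[OF assms(1) False])
qed

lemma Lp_gen_cmult:
  assumes "0 < p" and [measurable]: "f \<in> borel_measurable M" and "c > 0"
  shows "Lp_gen M p (\<lambda>x. ennreal c * f x) = ennreal c * Lp_gen M p f"
proof (rule antisym)
  show "Lp_gen M p (\<lambda>x. ennreal c * f x) \<le> ennreal c * Lp_gen M p f" by (intro Lp_gen_cmult_le assms)
  have 1: "ennreal (1 / c) * (ennreal c * z) = z" "ennreal c * (ennreal (1 / c) * z) = z" for z
    using assms(3) by (simp_all add: mult.assoc[symmetric] flip: ennreal_mult)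
  have "Lp_gen M p (\<lambda>x. ennreal (1 / c) * (ennreal c * f x)) \<le> ennreal (1 / c) * Lp_gen M p (\<lambda>x. ennreal c * f x)"
    by (intro Lp_gen_cmult_le assms) measurable
  then have "Lp_gen M p f \<le> ennreal (1 / c) * Lp_gen M p (\<lambda>x. ennreal c * f x)" by (simp only: 1)
  from mult_left_mono[OF this, of "ennreal c"] show "ennreal c * Lp_gen M p f \<le> Lp_gen M p (\<lambda>x. ennreal c * f x)"
    by (simp only: 1 zero_le)
qed

lemma Lp_gen_finite_AE:
  assumes "0 < p" "f \<in> borel_measurable M" "Lp_gen M p f < \<infinity>"
  shows "AE x in M. f x < \<infinity>"
proof (cases "p = \<infinity>")
  case True
  then show ?thesis using esssup_AE[of f M] assms(3) by (auto simp: Lp_gen_def elim: eventually_mono le_less_trans)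
next
  case False
  note pos = enn2real_pos[OF assms(1) False]
  have "(\<integral>\<^sup>+x. epowr (f x) (enn2real p) \<partial>M) \<noteq> \<infinity>"
    using Lp_gen_power[OF assms(1) False, of M f] ennreal_powr_finite[OF assms(3), of "enn2real p"] by auto
  then have "AE x in M. epowr (f x) (enn2real p) \<noteq> \<infinity>" using assms(2) by (intro nn_integral_PInf_AE) auto
  then show ?thesis by eventually_elim (auto simp: ennreal_powr_eq_top less_top)
qed

lemma Lp_gen_add:
  assumes "0 < p"
  shows "\<exists>C>0. \<forall>f g. f \<in> borel_measurable M \<longrightarrow> g \<in> borel_measurable M \<longrightarrow>
    Lp_gen M p (\<lambda>x. f x + g x) \<le> ennreal C * (Lp_gen M p f + Lp_gen M p g)"
proof (cases "p = \<infinity>")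
  case True
  have "esssup M (\<lambda>x. f x + g x) \<le> esssup M f + esssup M g" if [measurable]: "f \<in> borel_measurable M" "g \<in> borel_measurable M" for f g :: "_ \<Rightarrow> ennreal"
  proof (rule esssup_I)
    show "AE x in M. f x + g x \<le> esssup M f + esssup M g"
      using esssup_AE[of f M] esssup_AE[of g M] by eventually_elim (auto intro: add_mono)
  qed measurable
  then show ?thesis using True by (intro exI[of _ 1]) (auto simp: Lp_gen_def)
next
  case False
  define a where "a = enn2real p"
  have a: "a > 0" using enn2real_pos[OF assms False] by (simp add: a_def)
  have "Lp_gen M p (\<lambda>x. f x + g x) \<le> ennreal (2 * 2 powr (1 / a)) * (Lp_gen M p f + Lp_gen M p g)"
    if [measurable]: "f \<in> borel_measurable M" "g \<in> borel_measurable M" for f g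
  proof -
    let ?S = "Lp_gen M p f + Lp_gen M p g"
    have "(\<integral>\<^sup>+x. epowr (f x + g x) a \<partial>M) \<le> (\<integral>\<^sup>+x. ennreal (2 powr a) * (epowr (f x) a + epowr (g x) a) \<partial>M)"
      by (intro nn_integral_mono ennreal_powr_add_le a)
    also have "\<dots> = ennreal (2 powr a) * (epowr (Lp_gen M p f) a + epowr (Lp_gen M p g) a)"
      unfolding a_def Lp_gen_power[OF assms False] by (simp add: nn_integral_cmult nn_integral_add)
    also have "\<dots> \<le> ennreal (2 powr a) * (epowr ?S a + epowr ?S a)"
      by (intro mult_left_mono add_mono ennreal_powr_mono a) auto
    also have "\<dots> = ennreal (2 powr a) * (ennreal 2 * epowr ?S a)" by (simp add: mult_2)
    also have "\<dots> = epowr (ennreal (2 * 2 powr (1 / a)) * ?S) a"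
      using a by (simp add: ennreal_powr_mult ennreal_powr_ennreal powr_mult powr_powr ennreal_mult mult_ac)
    finally show ?thesis by (simp only: Lp_gen_le_iff[OF assms False] a_def)
  qed
  then show ?thesis by (intro exI[of _ "2 * 2 powr (1 / a)"]) auto
qed

lemma Lp_gen_sum:
  assumes "0 < p" "finite A"
  shows "\<exists>C>0. \<forall>f. (\<forall>i\<in>A. f i \<in> borel_measurable M) \<longrightarrow>
    Lp_gen M p (\<lambda>x. \<Sum>i\<in>A. f i x) \<le> ennreal C * (\<Sum>i\<in>A. Lp_gen M p (f i))" using assms(2)
proof (induction A rule: finite_induct)
  case empty
  have "Lp_gen M p (\<lambda>x. 0 * 0) \<le> 0 * Lp_gen M p (\<lambda>x. 0)" by (intro Lp_gen_cmult_le assms) simp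
  then show ?case by (intro exI[of _ 1]) simp
next
  case (insert j A)
  obtain C where C: "C > 0" "\<forall>f. (\<forall>i\<in>A. f i \<in> borel_measurable M) \<longrightarrow>
    Lp_gen M p (\<lambda>x. \<Sum>i\<in>A. f i x) \<le> ennreal C * (\<Sum>i\<in>A. Lp_gen M p (f i))" using insert.IH by blast
  obtain D where D: "D > 0" "\<forall>f g. f \<in> borel_measurable M \<longrightarrow> g \<in> borel_measurable M \<longrightarrow>
    Lp_gen M p (\<lambda>x. f x + g x) \<le> ennreal D * (Lp_gen M p f + Lp_gen M p g)" using Lp_gen_add[OF assms(1)] by blast
  have "Lp_gen M p (\<lambda>x. \<Sum>i\<in>insert j A. f i x) \<le> ennreal (D * max 1 C) * (\<Sum>i\<in>insert j A. Lp_gen M p (f i))"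
    if f: "\<forall>i\<in>insert j A. f i \<in> borel_measurable M" for f
  proof -
    have "(\<lambda>x. \<Sum>i\<in>insert j A. f i x) = (\<lambda>x. f j x + (\<Sum>i\<in>A. f i x))" using insert.hyps by simp
    moreover have "Lp_gen M p (\<lambda>x. f j x + (\<Sum>i\<in>A. f i x)) \<le> ennreal D * (Lp_gen M p (f j) + Lp_gen M p (\<lambda>x. \<Sum>i\<in>A. f i x))"
      using f by (intro D(2)[rule_format]) (auto intro!: borel_measurable_sum)
    ultimately have "Lp_gen M p (\<lambda>x. \<Sum>i\<in>insert j A. f i x) \<le> ennreal D * (Lp_gen M p (f j) + Lp_gen M p (\<lambda>x. \<Sum>i\<in>A. f i x))" by simp
    also have "\<dots> \<le> ennreal D * (ennreal (max 1 C) * Lp_gen M p (f j) + ennreal (max 1 C) * (\<Sum>i\<in>A. Lp_gen M p (f i)))"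
    proof (intro mult_left_mono add_mono)
      have "1 * Lp_gen M p (f j) \<le> ennreal (max 1 C) * Lp_gen M p (f j)" by (intro mult_right_mono) (auto simp: ennreal_1[symmetric] simp del: ennreal_1 intro!: ennreal_leI)
      then show "Lp_gen M p (f j) \<le> ennreal (max 1 C) * Lp_gen M p (f j)" by simp
      have "Lp_gen M p (\<lambda>x. \<Sum>i\<in>A. f i x) \<le> ennreal C * (\<Sum>i\<in>A. Lp_gen M p (f i))" using C(2) f by auto
      also have "\<dots> \<le> ennreal (max 1 C) * (\<Sum>i\<in>A. Lp_gen M p (f i))" by (intro mult_right_mono ennreal_leI) auto
      finally show "Lp_gen M p (\<lambda>x. \<Sum>i\<in>A. f i x) \<le> ennreal (max 1 C) * (\<Sum>i\<in>A. Lp_gen M p (f i))" .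
    qed auto
    also have "\<dots> = ennreal (D * max 1 C) * (\<Sum>i\<in>insert j A. Lp_gen M p (f i))"
      using D insert.hyps by (simp add: ennreal_mult mult.assoc distrib_left)
    finally show ?thesis .
  qed
  moreover have "D * max 1 C > 0" using D by auto
  ultimately show ?case by blast
qed

section \<open>Geometric weights\<close>

abbreviation dyad :: "real \<Rightarrow> int \<Rightarrow> ennreal" where
  "dyad \<delta> l \<equiv> ennreal (2 powr (\<delta> * \<bar>of_int l\<bar>))"

definition geo :: "real \<Rightarrow> ennreal" where
  "geo \<delta> = (NS l. dyad (- \<delta>) l)"

lemma geo_finite:
  assumes "\<delta> > 0" shows "geo \<delta> < \<infinity>"
proof -
  let ?f = "\<lambda>l::int. dyad (- \<delta>) l"
  let ?r = "2 powr (- \<delta>)"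
  have r: "0 < ?r" "?r < 1" using powr_less_mono[of "-\<delta>" 0 2] assms by auto
  have half: "(NS n. ennreal (?r ^ n)) < \<infinity>"
  proof -
    have "(NS n. ennreal (?r ^ n)) = (\<Sum>n. ennreal (?r ^ n))" by (rule nn_integral_count_space_nat)
    also have "\<dots> = ennreal (\<Sum>n. ?r ^ n)" using r by (intro suminf_ennreal2) auto
    finally show ?thesis by simp
  qed
  have p: "2 powr (- (\<delta> * real n)) = ?r ^ n" for n by (simp add: powr_powr powr_realpow[symmetric])
  have b1: "bij_betw int UNIV {0..}" by (rule bij_betwI[where g=nat]) auto
  have 1: "(\<integral>\<^sup>+l. ?f l \<partial>count_space {0..}) = (NS n. ennreal (?r ^ n))"
    using nn_integral_bij_count_space[OF b1, of ?f] by (simp add: p)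
  have b2: "bij_betw (\<lambda>n. - int n) UNIV {..0}" by (rule bij_betwI[where g="\<lambda>l. nat (- l)"]) auto
  have 2: "(\<integral>\<^sup>+l. ?f l \<partial>count_space {..0}) = (NS n. ennreal (?r ^ n))"
    using nn_integral_bij_count_space[OF b2, of ?f] by (simp add: p)
  have "geo \<delta> \<le> (NS l. ?f l * indicator {0..} l + ?f l * indicator {..0} l)"
    unfolding geo_def by (intro nn_integral_mono) (auto simp: indicator_def)
  also have "\<dots> = (\<integral>\<^sup>+l. ?f l \<partial>count_space {0..}) + (\<integral>\<^sup>+l. ?f l \<partial>count_space {..0})"
    by (simp add: nn_integral_add nn_integral_count_space_indicator)
  also have "\<dots> < \<infinity>" unfolding 1 2 using half by simp
  finally show ?thesis .
qed

lemma geo_shift: "(NS l. dyad (- \<delta>) (l - k)) = geo \<delta>"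
  "(NS l. dyad (- \<delta>) (k - l)) = geo \<delta>"
proof -
  have "bij_betw (\<lambda>l. l - k) UNIV UNIV" by (rule bij_betwI[where g="\<lambda>l. l + k"]) auto
  from nn_integral_bij_count_space[OF this, of "\<lambda>l. dyad (- \<delta>) l"]
  show 1: "(NS l. dyad (- \<delta>) (l - k)) = geo \<delta>" by (simp add: geo_def)
  show "(NS l. dyad (- \<delta>) (k - l)) = geo \<delta>" using 1 by (simp add: abs_minus_commute)
qed

text \<open>With geometric weights to spare, sums and suprema are interchangeable, which replaces the triangle
inequality for all exponents simultaneously.\<close>

lemma sum_le_geo_SUP:
  "(NS l. a l) \<le> geo \<delta> * (SUP l. dyad \<delta> (l - k) * a l)"
proof -
  let ?S = "SUP l. dyad \<delta> (l - k) * a l"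
  have "a l \<le> dyad (- \<delta>) (l - k) * ?S" for l
  proof -
    have "a l = dyad (- \<delta>) (l - k) * (dyad \<delta> (l - k) * a l)"
      unfolding mult.assoc[symmetric] by (simp flip: ennreal_mult powr_add)
    also have "\<dots> \<le> dyad (- \<delta>) (l - k) * ?S" by (intro mult_left_mono SUP_upper) auto
    finally show ?thesis .
  qed
  then have "(NS l. a l) \<le> (NS l. dyad (- \<delta>) (l - k) * ?S)" by (intro nn_integral_mono) auto
  also have "\<dots> = geo \<delta> * ?S" by (subst nn_integral_multc) (simp_all only: geo_shift, auto)
  finally show ?thesis .
qed

lemma SUP_le_sum: "(SUP l. a l) \<le> (NS l. a l)"
proof (rule SUP_least)
  fix l
  have "a l = (NS i. a l * indicator {l} i)" by (subst nn_integral_cmult_indicator) auto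
  also have "\<dots> \<le> (NS i. a i)" by (intro nn_integral_mono) (auto simp: indicator_def)
  finally show "a l \<le> (NS l. a l)" .
qed

lemma borel_measurable_nn_integral_int:
  fixes a :: "int \<Rightarrow> 'a \<Rightarrow> ennreal"
  assumes [measurable]: "\<And>l. a l \<in> borel_measurable M"
  shows "(\<lambda>x. (NS l. a l x)) \<in> borel_measurable M"
proof -
  have "(NS l. a l x) = (\<Sum>n. a (int_decode n) x)" for x
    using nn_integral_bij_count_space[OF bij_int_decode, of "\<lambda>l. a l x"] by (simp add: nn_integral_count_space_nat)
  then show ?thesis by simp
qed

text \<open>For finite \<open>p\<close> half of the rate \<open>\<epsilon>\<close> bounds the series
  pointwise by a weighted supremum. The \<open>p\<close>-th power of this supremum is at most the
  sum of the \<open>p\<close>-th powers, which integrates term by term; the other half of the rate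
  turns the sum back into a supremum. For \<open>p = \<infinity>\<close> one application of
  \<open>sum_le_geo_SUP\<close> is enough.\<close>

lemma Lp_gen_series:
  fixes M :: "'a measure"
  assumes p: "0 < p" and \<epsilon>: "\<epsilon> > 0"
  shows "\<exists>C>0. \<forall>k a. (\<forall>l. a l \<in> borel_measurable M) \<longrightarrow>
    Lp_gen M p (\<lambda>x. (NS l. a l x)) \<le> ennreal C * (SUP l. dyad \<epsilon> (l - k) * Lp_gen M p (a l))"
proof -
  have fin: "geo \<delta> = ennreal (enn2real (geo \<delta>))" if "\<delta> > 0" for \<delta> using geo_finite[OF that] by simp
  show ?thesis
  proof (cases "p = \<infinity>")
    case True
    define C where "C = enn2real (geo \<epsilon>) + 1"
    have "Lp_gen M p (\<lambda>x. (NS l. a l x)) \<le> ennreal C * (SUP l. dyad \<epsilon> (l - k) * Lp_gen M p (a l))"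
      if [measurable]: "\<And>l. a l \<in> borel_measurable M" for k :: int and a :: "int \<Rightarrow> 'a \<Rightarrow> ennreal"
    proof -
      have "AE x in M. \<forall>l. a l x \<le> esssup M (a l)" unfolding AE_all_countable using esssup_AE by blast
      then have "AE x in M. (NS l. a l x) \<le> geo \<epsilon> * (SUP l. dyad \<epsilon> (l - k) * esssup M (a l))"
      proof eventually_elim
        case (elim x)
        have "(NS l. a l x) \<le> (NS l. esssup M (a l))" using elim by (intro nn_integral_mono) auto
        also have "\<dots> \<le> geo \<epsilon> * (SUP l. dyad \<epsilon> (l - k) * esssup M (a l))" by (rule sum_le_geo_SUP)
        finally show ?case .
      qed
      then have "esssup M (\<lambda>x. (NS l. a l x)) \<le> geo \<epsilon> * (SUP l. dyad \<epsilon> (l - k) * esssup M (a l))"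
        by (intro esssup_I borel_measurable_nn_integral_int) auto
      also have "\<dots> \<le> ennreal C * (SUP l. dyad \<epsilon> (l - k) * esssup M (a l))"
        by (intro mult_right_mono) (subst fin[OF \<epsilon>], auto simp: C_def intro!: ennreal_leI)
      finally show ?thesis using True by (simp add: Lp_gen_def)
    qed
    moreover have "C > 0" by (simp add: C_def add_nonneg_pos)
    ultimately show ?thesis by blast
  next
    case False
    define r where "r = enn2real p"
    have r: "r > 0" using enn2real_pos[OF p False] by (simp add: r_def)
    define \<delta> where "\<delta> = \<epsilon> / 2"
    have \<delta>: "\<delta> > 0" using \<epsilon> by (simp add: \<delta>_def)
    have \<delta>r: "\<delta> * r > 0" using \<delta> r by simp
    define G1 where "G1 = enn2real (geo \<delta>)"
    define G2 where "G2 = enn2real (geo (\<delta> * r))"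
    have G1: "geo \<delta> = ennreal G1" "G1 \<ge> 0" using fin[OF \<delta>] by (auto simp: G1_def)
    have G2: "geo (\<delta> * r) = ennreal G2" "G2 \<ge> 0" using fin[OF \<delta>r] by (auto simp: G2_def)
    define C where "C = (G1 + 1) * (G2 + 1) powr (1 / r)"
    have "Lp_gen M p (\<lambda>x. (NS l. a l x)) \<le> ennreal C * (SUP l. dyad \<epsilon> (l - k) * Lp_gen M p (a l))"
      if [measurable]: "\<And>l. a l \<in> borel_measurable M" for k :: int and a :: "int \<Rightarrow> 'a \<Rightarrow> ennreal"
    proof -
      let ?w = "\<lambda>l. 2 powr (\<delta> * \<bar>real_of_int (l - k)\<bar>)"
      let ?S = "SUP l. dyad \<epsilon> (l - k) * Lp_gen M p (a l)"
      have pt: "epowr (NS l. a l x) r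
          \<le> ennreal (G1 powr r) * (NS l. ennreal (?w l powr r) * epowr (a l x) r)" for x
      proof -
        have "epowr (NS l. a l x) r \<le> epowr (geo \<delta> * (SUP l. ennreal (?w l) * a l x)) r"
          by (intro ennreal_powr_mono sum_le_geo_SUP r)
        also have "\<dots> = ennreal (G1 powr r) * (SUP l. ennreal (?w l powr r) * epowr (a l x) r)"
          using r G1 by (simp add: ennreal_powr_mult ennreal_powr_SUP ennreal_powr_ennreal)
        also have "\<dots> \<le> ennreal (G1 powr r) * (NS l. ennreal (?w l powr r) * epowr (a l x) r)"
          by (intro mult_left_mono SUP_le_sum) auto
        finally show ?thesis .
      qed
      have "(\<integral>\<^sup>+x. epowr (NS l. a l x) r \<partial>M)
          \<le> (\<integral>\<^sup>+x. ennreal (G1 powr r) * (NS l. ennreal (?w l powr r) * epowr (a l x) r) \<partial>M)"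
        by (intro nn_integral_mono pt)
      also have "\<dots> = ennreal (G1 powr r) * (NS l. \<integral>\<^sup>+x. ennreal (?w l powr r) * epowr (a l x) r \<partial>M)"
      proof -
        have "(\<lambda>x. (NS l. ennreal (?w l powr r) * epowr (a l x) r)) \<in> borel_measurable M"
          by (intro borel_measurable_nn_integral_int) measurable
        then show ?thesis by (subst nn_integral_cmult) (auto simp: nn_integral_count_space_nn_integral)
      qed
      also have "\<dots> = ennreal (G1 powr r) * (NS l. ennreal (?w l powr r) * epowr (Lp_gen M p (a l)) r)"
        by (simp add: nn_integral_cmult Lp_gen_power[OF p False] r_def)
      also have "\<dots> \<le> ennreal (G1 powr r) * (NS l. dyad (- (\<delta> * r)) (l - k) * epowr ?S r)"
      proof (intro mult_left_mono nn_integral_mono)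
        fix l
        have "ennreal (?w l powr r) * epowr (Lp_gen M p (a l)) r
            = dyad (- (\<delta> * r)) (l - k) * epowr (dyad \<epsilon> (l - k) * Lp_gen M p (a l)) r"
          using r by (simp add: ennreal_powr_mult ennreal_powr_ennreal powr_powr mult.assoc[symmetric] flip: ennreal_mult powr_add)
            (simp add: \<delta>_def algebra_simps)
        also have "\<dots> \<le> dyad (- (\<delta> * r)) (l - k) * epowr ?S r"
          by (intro mult_left_mono ennreal_powr_mono r SUP_upper) auto
        finally show "ennreal (?w l powr r) * epowr (Lp_gen M p (a l)) r \<le> dyad (- (\<delta> * r)) (l - k) * epowr ?S r" .
      qed auto
      also have "\<dots> = ennreal (G1 powr r) * (ennreal G2 * epowr ?S r)"
        by (subst nn_integral_multc) (simp_all only: geo_shift G2 sets_count_space, auto)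
      also have "\<dots> \<le> ennreal ((G1 + 1) powr r) * (ennreal (G2 + 1) * epowr ?S r)"
        using G1 G2 r by (intro mult_mono ennreal_leI powr_mono2 mult_right_mono) auto
      also have "\<dots> = epowr (ennreal C * ?S) r"
      proof -
        have C0: "0 \<le> C" using G1 G2 by (simp add: C_def)
        have "C powr r = (G1 + 1) powr r * (G2 + 1)" using r G1 G2 by (simp add: C_def powr_mult powr_powr)
        then have "epowr (ennreal C) r = ennreal ((G1 + 1) powr r) * ennreal (G2 + 1)"
          using G2 by (simp only: ennreal_powr_ennreal[OF C0]) (simp add: ennreal_mult del: ennreal_plus)
        then show ?thesis unfolding ennreal_powr_mult[OF r] by (simp only: mult.assoc)
      qed
      finally show ?thesis by (simp only: Lp_gen_le_iff[OF p False] r_def)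
    qed
    moreover have "C > 0" using G1 G2 by (simp add: C_def add_nonneg_pos)
    ultimately show ?thesis by blast
  qed
qed

section \<open>Convolution inequalities\<close>

text \<open>Either \<open>v \<le> \<mu>\<close>, or \<open>v = v^(1-r) * v^r\<close> with
  \<open>v^(1-r) \<le> \<mu>^(1-r)\<close>. The free threshold \<open>\<mu>\<close> makes this a
  substitute for the inequalities of Hoelder and Jensen.\<close>

lemma ennreal_young:
  assumes "r \<ge> 1" "\<mu> > 0"
  shows "v \<le> ennreal \<mu> + ennreal (\<mu> powr (1 - r)) * epowr v r"
proof (cases v)
  case (real u)
  show ?thesis
  proof (cases "u \<le> \<mu>")
    case True
    then have "v \<le> ennreal \<mu>" using real by (simp add: ennreal_leI)
    then show ?thesis by (rule order_trans) simp
  next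
    case False
    then have u: "u > 0" using assms by linarith
    have "u = u powr (1 - r) * u powr r" using u by (simp flip: powr_add)
    also have "\<dots> \<le> \<mu> powr (1 - r) * u powr r" using False assms by (intro mult_right_mono powr_mono2') auto
    finally have "v \<le> ennreal (\<mu> powr (1 - r)) * epowr v r"
      using real by (simp add: ennreal_powr_ennreal ennreal_leI flip: ennreal_mult)
    then show ?thesis by (rule order_trans) simp
  qed
next
  case top
  then show ?thesis using assms by (simp add: ennreal_mult_top)
qed

text \<open>Jensen's inequality for a weight of mass at most \<open>W\<close>, up to the factor
  \<open>2 powr r\<close>. The values \<open>0\<close> and infinity of the right-hand integral are
  separated first, because the threshold is computed from it.\<close>

lemma nn_integral_power_le:
  assumes [measurable]: "w \<in> borel_measurable M" "V \<in> borel_measurable M"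
    and r: "r \<ge> 1" and W: "W > 0" "(\<integral>\<^sup>+x. w x \<partial>M) \<le> ennreal W"
  shows "epowr (\<integral>\<^sup>+x. w x * V x \<partial>M) r \<le> ennreal (2 powr r * W powr (r - 1)) * (\<integral>\<^sup>+x. w x * epowr (V x) r \<partial>M)"
proof -
  define Q where "Q = (\<integral>\<^sup>+x. w x * epowr (V x) r \<partial>M)"
  have c: "2 powr r * W powr (r - 1) > 0" using W by simp
  consider "Q = \<top>" | "Q = 0" | q where "q > 0" "Q = ennreal q" by (cases Q) (auto simp: le_less)
  then show ?thesis
  proof cases
    case 1
    then show ?thesis using c W unfolding Q_def[symmetric] by (simp add: ennreal_mult_top)
  next
    case 2
    have "AE x in M. w x * epowr (V x) r = 0" using 2 unfolding Q_def by (subst (asm) nn_integral_0_iff_AE) auto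
    then have "AE x in M. w x * V x = 0" by eventually_elim (auto simp: ennreal_powr_eq_0)
    then have "(\<integral>\<^sup>+x. w x * V x \<partial>M) = 0" by (subst nn_integral_0_iff_AE) auto
    then show ?thesis by simp
  next
    case 3
    \<comment> \<open>The threshold that balances the two terms of \<open>ennreal_young\<close>
      after integration: each becomes \<open>\<mu> * W\<close>.\<close>
    define \<mu> where "\<mu> = (q / W) powr (1 / r)"
    have \<mu>: "\<mu> > 0" using 3 W by (simp add: \<mu>_def)
    have lr: "\<mu> powr r = q / W" using 3 W r by (simp add: \<mu>_def powr_powr)
    have "(\<integral>\<^sup>+x. w x * V x \<partial>M) \<le> (\<integral>\<^sup>+x. ennreal \<mu> * w x + ennreal (\<mu> powr (1 - r)) * (w x * epowr (V x) r) \<partial>M)"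
    proof (rule nn_integral_mono)
      fix x
      have "w x * V x \<le> w x * (ennreal \<mu> + ennreal (\<mu> powr (1 - r)) * epowr (V x) r)"
        by (intro mult_left_mono ennreal_young r \<mu>) auto
      then show "w x * V x \<le> ennreal \<mu> * w x + ennreal (\<mu> powr (1 - r)) * (w x * epowr (V x) r)"
        by (simp add: distrib_left mult_ac)
    qed
    also have "\<dots> = ennreal \<mu> * (\<integral>\<^sup>+x. w x \<partial>M) + ennreal (\<mu> powr (1 - r)) * Q"
      unfolding Q_def by (simp add: nn_integral_add nn_integral_cmult)
    also have "\<dots> \<le> ennreal \<mu> * ennreal W + ennreal (\<mu> powr (1 - r)) * ennreal q"
      using W 3 by (intro add_mono mult_left_mono) auto
    also have "\<dots> = ennreal (2 * \<mu> * W)"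
    proof -
      have "\<mu> powr (1 - r) * q = \<mu> * (\<mu> powr (- r) * q)" using \<mu> by (simp add: powr_diff powr_minus_divide)
      also have "\<mu> powr (- r) * q = W" using lr 3 W by (simp add: powr_minus)
      finally show ?thesis using \<mu> W 3 by (simp flip: ennreal_mult ennreal_plus)
    qed
    finally have "epowr (\<integral>\<^sup>+x. w x * V x \<partial>M) r \<le> epowr (ennreal (2 * \<mu> * W)) r"
      using r by (intro ennreal_powr_mono) auto
    also have "\<dots> = ennreal (2 powr r * W powr (r - 1)) * ennreal q"
    proof -
      have "(2 * \<mu> * W) powr r = 2 powr r * (q / W) * W powr r" using \<mu> W lr by (simp add: powr_mult)
      also have "\<dots> = 2 powr r * W powr (r - 1) * q" using W by (simp add: powr_diff)
      finally show ?thesis using \<mu> W 3 by (simp add: ennreal_powr_ennreal flip: ennreal_mult)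
    qed
    finally show ?thesis using 3 by (simp add: Q_def)
  qed
qed

lemma nn_integral_lborel_reflect:
  fixes w :: "'a::euclidean_space \<Rightarrow> ennreal"
  assumes "w \<in> borel_funs"
  shows "(NN y. w (x - y)) = (NN y. w y)" "(NN x. w (x - y)) = (NN y. w y)"
  using nn_integral_lborel_affine[of "-1" w x] nn_integral_lborel_affine[of 1 w "- y"] assms by simp_all

text \<open>The Fubini step shared by both ranges of exponents. The pointwise hypothesis comes from
  \<open>nn_integral_power_le\<close> for \<open>p \<ge> 1\<close>, and for \<open>p < 1\<close>
  from Nikolskii's inequality, where \<open>w\<close> is the \<open>p\<close>-th power of the
  kernel.\<close>

lemma Lp_gen_convolution_power:
  fixes w V :: "'a::euclidean_space \<Rightarrow> ennreal"
  assumes [measurable]: "w \<in> borel_funs" "V \<in> borel_funs" "S \<in> borel_funs"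
    and p: "0 < p" "p \<noteq> \<infinity>" and c: "c > 0" and K: "(NN x. w x) \<le> ennreal K" "K > 0"
    and le: "\<And>x. epowr (S x) (enn2real p) \<le> ennreal c * (NN y. w (x - y) * epowr (V y) (enn2real p))"
  shows "Lp_gen lborel p S \<le> ennreal ((c * K) powr (1 / enn2real p)) * Lp_gen lborel p V"
proof -
  define r where "r = enn2real p"
  have r: "r > 0" using enn2real_pos[OF p] by (simp add: r_def)
  have "(NN x. epowr (S x) r) \<le> (NN x. ennreal c * (NN y. w (x - y) * epowr (V y) r))"
    unfolding r_def by (intro nn_integral_mono le)
  also have "\<dots> = ennreal c * (NN x. (NN y. w (x - y) * epowr (V y) r))" by (rule nn_integral_cmult) measurable
  also have "(NN x. (NN y. w (x - y) * epowr (V y) r)) = (NN y. (NN x. w (x - y) * epowr (V y) r))"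
    by (rule lborel_pair.Fubini'[symmetric]) measurable
  also have "\<dots> = (NN y. (NN x. w x) * epowr (V y) r)"
    by (simp add: nn_integral_multc nn_integral_lborel_reflect)
  also have "\<dots> = (NN x. w x) * epowr (Lp_gen lborel p V) r"
    by (simp add: nn_integral_cmult Lp_gen_power[OF p] r_def)
  also have "ennreal c * \<dots> \<le> ennreal c * (ennreal K * epowr (Lp_gen lborel p V) r)"
    by (intro mult_left_mono mult_right_mono K) auto
  also have "\<dots> = epowr (ennreal ((c * K) powr (1 / r)) * Lp_gen lborel p V) r"
    using r c K by (simp add: ennreal_powr_mult ennreal_powr_ennreal powr_powr ennreal_mult mult_ac)
  finally show ?thesis by (simp only: Lp_gen_le_iff[OF p] r_def)
qed

lemma Lp_gen_convolution:
  fixes w V :: "'a::euclidean_space \<Rightarrow> ennreal"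
  assumes [measurable]: "w \<in> borel_funs" "V \<in> borel_funs"
    and p: "1 \<le> p" and W: "W > 0" "(NN x. w x) \<le> ennreal W"
  shows "Lp_gen lborel p (\<lambda>x. (NN y. w (x - y) * V y)) \<le> ennreal (2 * W) * Lp_gen lborel p V"
proof (cases "p = \<infinity>")
  case True
  have "(NN y. w (x - y) * V y) \<le> ennreal (2 * W) * esssup lborel V" for x
  proof -
    have "(NN y. w (x - y) * V y) \<le> (NN y. w (x - y) * esssup lborel V)"
    proof (rule nn_integral_mono_AE)
      have "AE y in lborel. V y \<le> esssup lborel V" by (rule esssup_AE)
      then show "AE y in lborel. w (x - y) * V y \<le> w (x - y) * esssup lborel V"
        by eventually_elim (simp add: mult_left_mono)
    qed
    also have "\<dots> = (NN y. w y) * esssup lborel V" by (simp add: nn_integral_multc nn_integral_lborel_reflect)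
    also have "\<dots> \<le> ennreal (2 * W) * esssup lborel V"
      using W by (intro mult_right_mono order_trans[OF W(2)] ennreal_leI) auto
    finally show ?thesis .
  qed
  then show ?thesis using True by (auto simp: Lp_gen_def intro!: esssup_I)
next
  case False
  define r where "r = enn2real p"
  have p0: "0 < p" using p by (metis less_le_trans zero_less_one)
  have r: "r \<ge> 1"
  proof -
    have "p = ennreal r" "r \<ge> 0" using False by (auto simp: r_def less_top)
    then show ?thesis using p by (simp add: ennreal_1[symmetric] del: ennreal_1)
  qed
  have "Lp_gen lborel p (\<lambda>x. (NN y. w (x - y) * V y)) \<le> ennreal ((2 powr r * W powr (r - 1) * W) powr (1 / enn2real p)) * Lp_gen lborel p V"
  proof (rule Lp_gen_convolution_power[OF _ _ _ p0 False])
    fix x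
    show "epowr (NN y. w (x - y) * V y) (enn2real p)
        \<le> ennreal (2 powr r * W powr (r - 1)) * (NN y. w (x - y) * epowr (V y) (enn2real p))"
      using nn_integral_power_le[of "\<lambda>y. w (x - y)" lborel V r W] r W by (simp add: nn_integral_lborel_reflect r_def)
  qed (use W in auto)
  also have "(2 powr r * W powr (r - 1) * W) powr (1 / enn2real p) = 2 * W"
  proof -
    have "2 powr r * W powr (r - 1) * W = (2 * W) powr r" using W by (simp add: powr_mult powr_diff)
    then show ?thesis using r W by (simp add: r_def[symmetric] powr_powr)
  qed
  finally show ?thesis .
qed

lemma Lp_gen_translate:
  fixes f :: "'a::euclidean_space \<Rightarrow> ennreal"
  assumes "0 < p" and [measurable]: "f \<in> borel_funs"
  shows "Lp_gen lborel p (\<lambda>x. f (x + h)) \<le> Lp_gen lborel p f"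
proof (cases "p = \<infinity>")
  case True
  have "AE x in lborel. f (x + h) \<le> esssup lborel f"
  proof -
    have "AE x in distr lborel borel ((+) h). f x \<le> esssup lborel f"
      unfolding lborel_distr_plus by (rule esssup_AE)
    then have "AE x in lborel. f (h + x) \<le> esssup lborel f" by (subst (asm) AE_distr_iff) auto
    then show ?thesis by (simp add: add.commute)
  qed
  then show ?thesis using True by (auto simp: Lp_gen_def intro!: esssup_I)
next
  case False
  have "(NN x. epowr (f (x + h)) (enn2real p)) = (NN x. epowr (f x) (enn2real p))"
    using nn_integral_lborel_affine[of 1 "\<lambda>x. epowr (f x) (enn2real p)" h] by (simp add: add.commute)
  then show ?thesis using False by (simp add: Lp_gen_def)
qed

lemma iter_diff_measurable [measurable]:
  assumes [measurable]: "f \<in> borel_funs"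
  shows "iter_diff L h f \<in> borel_funs" by (induction L) simp_all

lemma Lp_gen_iter_diff:
  assumes p: "0 < p"
  shows "\<exists>C>0. \<forall>h f. f \<in> borel_funs \<longrightarrow>
    Lp_gen lborel p (\<lambda>x::real^'n::finite. enorm (iter_diff L h f x)) \<le> ennreal C * Lp_gen lborel p (\<lambda>x. enorm (f x))"
proof (induction L)
  case 0
  show ?case by (intro exI[of _ 1]) simp
next
  case (Suc L)
  obtain C where C: "C > 0" "\<forall>h f. f \<in> borel_funs \<longrightarrow>
    Lp_gen lborel p (\<lambda>x::real^'n. enorm (iter_diff L h f x)) \<le> ennreal C * Lp_gen lborel p (\<lambda>x. enorm (f x))"
    using Suc by blast
  obtain D where D: "D > 0" "\<forall>f g. f \<in> borel_measurable lborel \<longrightarrow> g \<in> borel_measurable lborel \<longrightarrow>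
    Lp_gen lborel p (\<lambda>x::real^'n. f x + g x) \<le> ennreal D * (Lp_gen lborel p f + Lp_gen lborel p g)" using Lp_gen_add[OF p] by blast
  have "Lp_gen lborel p (\<lambda>x::real^'n. enorm (iter_diff (Suc L) h f x)) \<le> ennreal (D * 2 * C) * Lp_gen lborel p (\<lambda>x. enorm (f x))"
    if [measurable]: "f \<in> borel_funs" for f h
  proof -
    let ?g = "\<lambda>x. enorm (iter_diff L h f x)"
    have "Lp_gen lborel p (\<lambda>x. enorm (iter_diff (Suc L) h f x)) \<le> Lp_gen lborel p (\<lambda>x. ?g (x + h) + ?g x)"
      by (intro Lp_gen_mono_AE p AE_I2) (auto simp: norm_triangle_ineq4 ennreal_plus[symmetric] intro!: ennreal_leI simp del: ennreal_plus)
    also have "\<dots> \<le> ennreal D * (Lp_gen lborel p (\<lambda>x. ?g (x + h)) + Lp_gen lborel p ?g)"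
      by (intro D(2)[rule_format]) auto
    also have "\<dots> \<le> ennreal D * (Lp_gen lborel p ?g + Lp_gen lborel p ?g)"
      by (intro mult_left_mono add_mono Lp_gen_translate p) auto
    also have "\<dots> = ennreal (D * 2) * Lp_gen lborel p ?g"
      using D by (simp add: ennreal_mult mult.assoc mult_2[symmetric])
    also have "\<dots> \<le> ennreal (D * 2) * (ennreal C * Lp_gen lborel p (\<lambda>x. enorm (f x)))"
      using C(2) that by (intro mult_left_mono) auto
    also have "\<dots> = ennreal (D * 2 * C) * Lp_gen lborel p (\<lambda>x. enorm (f x))"
      using C D by (simp add: ennreal_mult mult.assoc)
    finally show ?thesis .
  qed
  moreover have "D * 2 * C > 0" using C D by simp
  ultimately show ?case by blast
qed

text \<open>A function dominated by its own mean has comparable \<open>L\<^sup>1\<close> and \<open>L\<^sup>r\<close> quasinorms, \<open>r < 1\<close>. This is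
Nikolskii's inequality for band-limited functions.\<close>

lemma nikolskii_power:
  fixes F :: "'a \<Rightarrow> complex"
  assumes F: "integrable M F" and r: "0 < r" "r \<le> 1" and K: "K > 0"
    and le: "\<And>x. norm (F x) \<le> K * (\<integral>y. norm (F y) \<partial>M)"
  shows "epowr (\<integral>\<^sup>+x. enorm (F x) \<partial>M) r \<le> ennreal (K powr (1 - r)) * (\<integral>\<^sup>+x. ennreal (norm (F x) powr r) \<partial>M)"
proof -
  have [measurable]: "F \<in> borel_measurable M" using F by simp
  define I where "I = (\<integral>y. norm (F y) \<partial>M)"
  define Q where "Q = (\<integral>\<^sup>+x. ennreal (norm (F x) powr r) \<partial>M)"
  have I: "(\<integral>\<^sup>+x. enorm (F x) \<partial>M) = ennreal I" "I \<ge> 0"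
    unfolding I_def using F by (auto intro!: nn_integral_eq_integral)
  show ?thesis
  proof (cases "I = 0 \<or> Q = \<top>")
    case True
    then show ?thesis using K I unfolding Q_def[symmetric] by (auto simp: ennreal_mult_top)
  next
    case False
    then obtain q where q: "q \<ge> 0" "Q = ennreal q" by (cases Q) auto
    have Ip: "I > 0" using False I by auto
    have "ennreal I \<le> (\<integral>\<^sup>+x. ennreal ((K * I) powr (1 - r)) * ennreal (norm (F x) powr r) \<partial>M)"
      unfolding I(1)[symmetric]
    proof (rule nn_integral_mono)
      fix x
      have "norm (F x) = norm (F x) powr (1 - r) * norm (F x) powr r"
        by (cases "F x = 0") (auto simp flip: powr_add)
      also have "\<dots> \<le> (K * I) powr (1 - r) * norm (F x) powr r"
        using le[of x] r unfolding I_def by (intro mult_right_mono powr_mono2) auto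
      finally show "enorm (F x) \<le> ennreal ((K * I) powr (1 - r)) * ennreal (norm (F x) powr r)"
        by (simp add: ennreal_leI flip: ennreal_mult)
    qed
    also have "\<dots> = ennreal ((K * I) powr (1 - r)) * Q" unfolding Q_def by (simp add: nn_integral_cmult)
    finally have "I \<le> (K * I) powr (1 - r) * q" using q by (simp add: ennreal_le_iff flip: ennreal_mult)
    \<comment> \<open>The factor \<open>I powr (1 - r)\<close> on the right is divided out; this is
      possible because \<open>I\<close> is finite and positive here.\<close>
    then have "I * I powr (r - 1) \<le> (K * I) powr (1 - r) * q * I powr (r - 1)" by (intro mult_right_mono) auto
    moreover have "I * I powr (r - 1) = I powr r" using Ip by (simp add: powr_diff)
    moreover have "(K * I) powr (1 - r) * q * I powr (r - 1) = K powr (1 - r) * q * (I powr (1 - r) * I powr (r - 1))"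
      using K Ip by (simp add: powr_mult)
    moreover have "I powr (1 - r) * I powr (r - 1) = 1" using Ip by (simp flip: powr_add)
    ultimately have "I powr r \<le> K powr (1 - r) * q" by simp
    then show ?thesis using q I unfolding Q_def[symmetric] I(1) by (simp add: ennreal_powr_ennreal ennreal_leI flip: ennreal_mult)
  qed
qed

section \<open>Kernel estimates and Fourier multipliers on \<open>L^p\<close>\<close>

abbreviation Lp_norm :: "ennreal \<Rightarrow> 'n::finite cfun \<Rightarrow> ennreal" where
  "Lp_norm p f \<equiv> Lp_gen lborel p (\<lambda>x. enorm (f x))"

abbreviation diff_norms :: "ennreal \<Rightarrow> nat \<Rightarrow> real^'n \<Rightarrow> 'n::finite cfun \<Rightarrow> ennreal" where
  "diff_norms p L t g \<equiv> (\<Sum>j\<in>UNIV. Lp_norm p (axis_diff L (t $ j) j g))"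

lemma schwartz_family_nn_integral:
  fixes F :: "'i \<Rightarrow> 'n::finite cfun"
  assumes F: "schwartz_family I F" and r: "r > 0"
  shows "\<exists>K>0. \<forall>i\<in>I. (NN x. ennreal (norm (F i x) powr r)) \<le> ennreal K"
proof -
  let ?W = "weight_exponent TYPE('n)"
  have "growth 0 (- ?W / r) I F" using F by (simp add: schwartz_family_def)
  then obtain B where B: "B > 0" "\<forall>i\<in>I. \<forall>x. norm (F i x) \<le> B * (1 + norm x) powr (- ?W / r)"
    using growthD by blast
  define N where "N = enn2real (NN x. ennreal ((1 + norm (x :: real^'n)) powr (- ?W)))"
  have N: "(NN x. ennreal ((1 + norm (x :: real^'n)) powr (- ?W))) = ennreal N" "N \<ge> 0"
    using nn_integral_weight[OF order_refl, where 'n='n] by (auto simp: N_def)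
  have "(NN x. ennreal (norm (F i x) powr r)) \<le> ennreal (B powr r * (N + 1))" if "i \<in> I" for i
  proof -
    have "norm (F i x) powr r \<le> B powr r * (1 + norm x) powr (- ?W)" for x
    proof -
      have "norm (F i x) powr r \<le> (B * (1 + norm x) powr (- ?W / r)) powr r"
        using B that r by (intro powr_mono2) auto
      also have "\<dots> = B powr r * (1 + norm x) powr (- ?W)" using B r by (simp add: powr_mult powr_powr)
      finally show ?thesis .
    qed
    then have "(NN x. ennreal (norm (F i x) powr r)) \<le> (NN x. ennreal (B powr r) * ennreal ((1 + norm (x :: real^'n)) powr (- ?W)))"
      by (intro nn_integral_mono) (simp add: ennreal_leI flip: ennreal_mult)
    also have "\<dots> = ennreal (B powr r) * ennreal N" by (simp add: nn_integral_cmult N)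
    also have "\<dots> = ennreal (B powr r * N)" using N by (simp flip: ennreal_mult)
    also have "\<dots> \<le> ennreal (B powr r * (N + 1))" using N by (intro ennreal_leI mult_left_mono) auto
    finally show ?thesis .
  qed
  moreover have "B powr r * (N + 1) > 0" using B N by (simp add: add_nonneg_pos)
  ultimately show ?thesis by blast
qed

text \<open>The prefactor of the dilation contributes the exponent \<open>n * r\<close>, the
  substitution \<open>- n\<close>. For \<open>r = 1\<close> the integral is scale invariant; for
  \<open>r < 1\<close> the remaining power will cancel the scale in Nikolskii's inequality.\<close>

lemma nn_integral_dilate:
  fixes f :: "'n::finite cfun"
  assumes [measurable]: "f \<in> borel_funs" and r: "r > 0"
  shows "(NN x. ennreal (norm (dilate l f x) powr r))
    = ennreal (2 powr (of_int l * real CARD('n) * (r - 1))) * (NN x. ennreal (norm (f x) powr r))"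
proof -
  let ?c = "2 powi l :: real"
  have c: "?c > 0" "?c \<noteq> 0" by auto
  have "(NN x. ennreal (norm (dilate l f x) powr r)) = (NN x. ennreal ((?c ^ CARD('n)) powr r) * ennreal (norm (f (0 + ?c *\<^sub>R x)) powr r))"
    by (intro nn_integral_cong) (simp add: dilate_def norm_mult powr_mult norm_power norm_power_int flip: ennreal_mult)
  also have "\<dots> = ennreal ((?c ^ CARD('n)) powr r) * (ennreal (1 / \<bar>?c\<bar> ^ DIM(real^'n)) * (NN x. ennreal (norm (f x) powr r)))"
  proof -
    let ?g = "\<lambda>x. ennreal (norm (f x) powr r)"
    have g: "?g \<in> borel_funs" by measurable
    have "(\<lambda>x. ?g (0 + ?c *\<^sub>R x)) \<in> borel_measurable lborel" by measurable
    from nn_integral_cmult[OF this] show ?thesis unfolding nn_integral_lborel_affine[OF c(2) g, of 0] .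
  qed
  also have "\<dots> = ennreal (2 powr (of_int l * real CARD('n) * (r - 1))) * (NN x. ennreal (norm (f x) powr r))"
  proof -
    have cc: "?c ^ CARD('n) = 2 powr (real_of_int l * real CARD('n))"
      by (simp add: powr_real_of_int' powr_powr[symmetric] powr_realpow)
    have "(?c ^ CARD('n)) powr r * (1 / \<bar>?c\<bar> ^ DIM(real^'n)) = 2 powr (real_of_int l * real CARD('n) * (r - 1))"
      using c unfolding abs_of_pos[OF c(1)] by (simp add: cc powr_powr powr_diff algebra_simps)
    then show ?thesis by (simp add: mult.assoc[symmetric] flip: ennreal_mult)
  qed
  finally show ?thesis .
qed

lemma sigma_p_eq:
  assumes "0 < p" "p \<noteq> \<infinity>" shows "sigma_p n p = max 0 (real n * (1 / enn2real p - 1))"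
proof -
  have "p = ennreal (enn2real p)" "enn2real p > 0" using assms enn2real_pos[OF assms] by (auto simp: less_top)
  then have "1 / p = ennreal (1 / enn2real p)" by (metis divide_ennreal ennreal_1 zero_le_one)
  then show ?thesis using \<open>enn2real p > 0\<close> by (simp add: sigma_p_def)
qed

lemma sigma_p_nonneg: "sigma_p n p \<ge> 0"
  by (simp add: sigma_p_def)

context littlewood_paley
begin

definition scaled :: "'n cfun \<Rightarrow> int \<Rightarrow> 'n cfun" where
  "scaled A l \<xi> = A ((2 powi (- l)) *\<^sub>R \<xi>)"

lemma schwartz_scaled: "schwartz A \<Longrightarrow> schwartz (scaled A l)"
  using schwartz_affine[of A "2 powi (- l)" 0] by (simp add: scaled_def[abs_def])

lemma inv_fourier_scaled: "schwartz A \<Longrightarrow> inv_fourier (scaled A l) = dilate l (inv_fourier A)"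
  using dilate_inv_fourier[of A l] by (simp add: scaled_def[abs_def])

lemma kernel_L1_bound:
  assumes "schwartz_family I A"
  shows "\<exists>W>0. \<forall>i\<in>I. \<forall>l. (NN x. enorm (inv_fourier (scaled (A i) l) x)) \<le> ennreal W"
proof -
  obtain W where W: "W > 0" "\<forall>i\<in>I. (NN x. ennreal (norm (inv_fourier (A i) x) powr 1)) \<le> ennreal W"
    using schwartz_family_nn_integral[OF schwartz_family_inv_fourier[OF assms], of 1] by auto
  have "(NN x. enorm (inv_fourier (scaled (A i) l) x)) \<le> ennreal W" if "i \<in> I" for i l
  proof -
    have s: "schwartz (A i)" by (rule schwartz_familyD[OF assms that])
    have "(NN x. ennreal (norm (dilate l (inv_fourier (A i)) x) powr 1)) \<le> ennreal W"
      using W that nn_integral_dilate[OF schwartz_measurable[OF schwartz_inv_fourier[OF s]], of 1 l] by simp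
    then show ?thesis by (simp add: inv_fourier_scaled[OF s])
  qed
  then show ?thesis using W by blast
qed

lemma Lp_kernel_convolution:
  assumes "schwartz_family I A" and p: "1 \<le> p"
  shows "\<exists>C>0. \<forall>i\<in>I. \<forall>l V. V \<in> borel_funs \<longrightarrow>
    Lp_gen lborel p (\<lambda>x. (NN y. enorm (inv_fourier (scaled (A i) l) (x - y)) * V y)) \<le> ennreal C * Lp_gen lborel p V"
proof -
  obtain W where W: "W > 0" "\<forall>i\<in>I. \<forall>l. (NN x. enorm (inv_fourier (scaled (A i) l) x)) \<le> ennreal W"
    using kernel_L1_bound[OF assms(1)] by blast
  have "Lp_gen lborel p (\<lambda>x. (NN y. enorm (inv_fourier (scaled (A i) l) (x - y)) * V y)) \<le> ennreal (2 * W) * Lp_gen lborel p V"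
    if i: "i \<in> I" and [measurable]: "V \<in> borel_funs" for i l V
  proof (rule Lp_gen_convolution)
    have "inv_fourier (scaled (A i) l) \<in> borel_funs"
      by (intro schwartz_measurable schwartz_inv_fourier schwartz_scaled schwartz_familyD[OF assms(1) i])
    then show "(\<lambda>x. enorm (inv_fourier (scaled (A i) l) x)) \<in> borel_funs" by measurable
    show "(NN x. enorm (inv_fourier (scaled (A i) l) x)) \<le> ennreal W" using W i by blast
  qed (use W p in auto)
  then show ?thesis using W by (intro exI[of _ "2 * W"]) auto
qed

lemma convolution_integrable:
  fixes K :: "'n cfun"
  assumes T: "tempered T" and K: "schwartz K" and \<eta>: "schwartz \<eta>"
  shows "integrable lborel (\<lambda>y. K (x - y) * conv \<eta> T y)"
proof -
  obtain N C where NC: "N \<ge> 0" "C > 0" "\<forall>y. norm (conv \<eta> T y) \<le> C * (1 + norm y) powr N"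
    by (rule convolution_growth[OF T \<eta>])
  have [measurable]: "conv \<eta> T \<in> borel_funs" "K \<in> borel_funs"
    using convolution_measurable[OF T \<eta>] schwartz_measurable[OF K] by auto
  have "growth 0 N {()} (\<lambda>_. conv \<eta> T)" by (rule growth_0I[where B=C]) (use NC in auto)
  from growth_mult[OF schwartz_imp_growth[OF schwartz_reflect[OF K], of 0 "- weight_exponent TYPE('n) - N" "{()}" x] this]
  have "growth 0 (- weight_exponent TYPE('n)) {()} (\<lambda>_ y. K (x - y) * conv \<eta> T y)" by (simp del: growth.simps)
  then show ?thesis by (rule growth_integrable_single) measurable
qed

lemma low_kernel_bound:
  shows "\<exists>S>0. \<forall>m x. norm (inv_fourier (low_mult m) x) \<le> S * 2 powr (real_of_int m * real CARD('n))"
proof -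
  obtain S where S: "S > 0" "\<forall>x. norm (inv_fourier bump x) \<le> S"
    using schwartz_bounded[OF schwartz_inv_fourier[OF schwartz_bump]] by blast
  have "norm (inv_fourier (low_mult m) x) \<le> S * 2 powr (real_of_int m * real CARD('n))" for m x
  proof -
    have "low_mult m = scaled bump m" by (rule ext) (simp add: low_mult_def scaled_def)
    then have "inv_fourier (low_mult m) x = dilate m (inv_fourier bump) x" by (simp add: inv_fourier_scaled[OF schwartz_bump])
    moreover have cc: "(2 powi m) ^ CARD('n) = 2 powr (real_of_int m * real CARD('n))"
      by (simp add: powr_real_of_int' powr_powr[symmetric] powr_realpow)
    ultimately have "norm (inv_fourier (low_mult m) x) = 2 powr (real_of_int m * real CARD('n)) * norm (inv_fourier bump ((2 powi m) *\<^sub>R x))"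
      by (simp add: dilate_def norm_mult norm_power norm_power_int)
    also have "\<dots> \<le> 2 powr (real_of_int m * real CARD('n)) * S" using S by (intro mult_left_mono) auto
    finally show ?thesis by (simp add: mult.commute)
  qed
  then show ?thesis using S by blast
qed

text \<open>The integrand has spectrum in the ball of radius \<open>2 * 2^m\<close> and is
  reproduced by the low-pass kernel of level \<open>m + 2\<close>. So it is bounded by
  \<open>M\<close> times its own \<open>L^1\<close> norm, which is the hypothesis of
  \<open>nikolskii_power\<close>.\<close>

lemma product_nikolskii:
  fixes A B :: "'n cfun" and x :: "real^'n"
  assumes T: "tempered T" and A: "schwartz A" and B: "schwartz B"
    and supp: "\<And>\<xi>. A \<xi> \<noteq> 0 \<Longrightarrow> norm \<xi> \<le> 2 powi m" "\<And>\<xi>. B \<xi> \<noteq> 0 \<Longrightarrow> norm \<xi> \<le> 2 powi m"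
    and r: "0 < r" "r \<le> 1" and M: "M > 0" "\<And>x. norm (inv_fourier (low_mult (m + 2)) x) \<le> M"
  shows "epowr (NN y. enorm (inv_fourier A (x - y) * fourier_op B T y)) r
    \<le> ennreal (M powr (1 - r)) * (NN y. ennreal (norm (inv_fourier A (x - y)) powr r) * epowr (enorm (fourier_op B T y)) r)"
proof -
  let ?F = "\<lambda>y. inv_fourier A (x - y) * fourier_op B T y"
  have F: "integrable lborel ?F"
    by (rule convolution_integrable[OF T schwartz_inv_fourier[OF A] schwartz_inv_fourier[OF B]])
  \<comment> \<open>Level \<open>m + 2\<close>, since the low-pass symbol is known to be
    \<open>1\<close> only strictly inside its radius and \<open>2 * 2^m\<close> is attained.\<close>
  have one: "low_mult (m + 2) \<xi> = 1" if "norm \<xi> \<le> 2 * 2 powi m" for \<xi>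
  proof (rule low_mult_one)
    have "2 * 2 powi m < (4 :: real) * 2 powi m" by simp
    from le_less_trans[OF that this] show "norm \<xi> < 2 powi (m + 2)" by (simp add: power_int_add)
  qed
  have Fle: "norm (?F w) \<le> M * (LBINT y. norm (?F y))" for w
  proof -
    have "(LBINT y. inv_fourier (low_mult (m + 2)) (w - y) * ?F y) = ?F w"
      by (rule band_limited_product_reproducing[OF T A B schwartz_low_mult supp one])
    then have "norm (?F w) = norm (LBINT y. inv_fourier (low_mult (m + 2)) (w - y) * ?F y)" by (rule arg_cong[OF sym])
    also have "\<dots> \<le> (LBINT y. norm (inv_fourier (low_mult (m + 2)) (w - y) * ?F y))"
      by (rule integral_norm_bound)
    also have "\<dots> \<le> (LBINT y. M * norm (?F y))"
    proof (rule integral_mono_AE')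
      show "integrable lborel (\<lambda>y. M * norm (?F y))" using F by (intro integrable_mult_right integrable_norm)
      show "AE y in lborel. norm (inv_fourier (low_mult (m + 2)) (w - y) * ?F y) \<le> M * norm (?F y)"
        unfolding norm_mult[of "inv_fourier (low_mult (m + 2)) _"]
        by (intro AE_I2 mult_right_mono M norm_ge_zero)
    qed (use M in \<open>auto intro!: AE_I2 mult_nonneg_nonneg\<close>)
    finally show ?thesis by simp
  qed
  have "epowr (NN y. enorm (?F y)) r \<le> ennreal (M powr (1 - r)) * (NN y. ennreal (norm (?F y) powr r))"
    by (rule nikolskii_power[OF F r M(1) Fle])
  also have "(NN y. ennreal (norm (?F y) powr r))
      = (NN y. ennreal (norm (inv_fourier A (x - y)) powr r) * epowr (enorm (fourier_op B T y)) r)"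
    by (intro nn_integral_cong) (simp add: norm_mult powr_mult ennreal_powr_ennreal flip: ennreal_mult)
  finally show ?thesis .
qed

text \<open>For \<open>p \<ge> 1\<close> this is Young's inequality, the extra factor being at least
  \<open>1\<close>. For \<open>p < 1\<close> the Nikolskii constant \<open>2^((l+m0+N+2) n)\<close>
  enters with exponent \<open>1 - p\<close>, and the \<open>p\<close>-th power of the kernel
  integrates to a multiple of \<open>2^(l n (p-1))\<close>. The scale \<open>l\<close> cancels, and
  the root of order \<open>p\<close> of the rest is a constant times
  \<open>2^(N n (1/p - 1))\<close>.\<close>

lemma Lp_multiplier:
  assumes p: "0 < p" and A: "schwartz_family I A" and supp: "\<And>i \<xi>. i \<in> I \<Longrightarrow> A i \<xi> \<noteq> 0 \<Longrightarrow> norm \<xi> \<le> 2 powi m0"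
  shows "\<exists>C>0. \<forall>i\<in>I. \<forall>l (N::nat) T B. tempered T \<longrightarrow> schwartz B \<longrightarrow>
    (\<forall>\<xi>. B \<xi> \<noteq> 0 \<longrightarrow> norm \<xi> \<le> 2 powi (l + m0 + int N)) \<longrightarrow>
    Lp_norm p (fourier_op (\<lambda>\<xi>. scaled (A i) l \<xi> * B \<xi>) T)
      \<le> ennreal (C * 2 powr (real N * sigma_p CARD('n) p)) * Lp_norm p (fourier_op B T)"
proof -
  let ?h = "\<lambda>B T. fourier_op B T"
  let ?H = "\<lambda>i l B. ?h (\<lambda>\<xi>. scaled (A i) l \<xi> * B \<xi>)" and ?q = "\<lambda>N. 2 powr (real N * sigma_p CARD('n) p)"
  let ?k = "\<lambda>i l. inv_fourier (scaled (A i) l)"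
  have sA: "schwartz (scaled (A i) l)" if "i \<in> I" for i l by (intro schwartz_scaled schwartz_familyD[OF A that])
  have mk: "?k i l \<in> borel_funs" if "i \<in> I" for i l by (intro schwartz_measurable schwartz_inv_fourier sA that)
  have eq: "?H i l B T x = (LBINT y. ?k i l (x - y) * ?h B T y)"
    if "i \<in> I" "tempered T" "schwartz B" for i l B T x
    by (rule convolution_inv_fourier[symmetric, OF that(2) sA[OF that(1)] that(3)])
  have mh: "?h B T \<in> borel_funs" if "tempered T" "schwartz B" for B T
    by (intro convolution_measurable that schwartz_inv_fourier)
  have mhA: "?H i l B T \<in> borel_funs" if "i \<in> I" "tempered T" "schwartz B" for i l B T
    by (intro mh that schwartz_mult sA)
  have le: "enorm (?H i l B T x) \<le> (NN y. enorm (?k i l (x - y) * ?h B T y))"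
    if "i \<in> I" "tempered T" "schwartz B" for i l B T x unfolding eq[OF that]
    by (rule integral_norm_bound_ennreal[OF convolution_integrable[OF that(2) schwartz_inv_fourier[OF sA[OF that(1)]] schwartz_inv_fourier[OF that(3)]]])
  show ?thesis
  proof (cases "1 \<le> p")
    case True
    obtain C where C: "C > 0" "\<forall>i\<in>I. \<forall>l V. V \<in> borel_funs \<longrightarrow>
      Lp_gen lborel p (\<lambda>x. (NN y. enorm (?k i l (x - y)) * V y)) \<le> ennreal C * Lp_gen lborel p V"
      using Lp_kernel_convolution[OF A True] by blast
    have "Lp_norm p (?H i l B T) \<le> ennreal (C * ?q N) * Lp_norm p (?h B T)"
      if i: "i \<in> I" and T: "tempered T" and B: "schwartz B" for i l B T and N :: nat
    proof -
      have [measurable]: "?h B T \<in> borel_funs" "?H i l B T \<in> borel_funs" using mh mhA that by auto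
      have "Lp_norm p (?H i l B T) \<le> Lp_gen lborel p (\<lambda>x. (NN y. enorm (?k i l (x - y)) * enorm (?h B T y)))"
        using le[OF that] by (intro Lp_gen_mono_AE p AE_I2) (auto simp: norm_mult ennreal_mult)
      also have "\<dots> \<le> ennreal C * Lp_norm p (?h B T)" using C(2) i by simp
      also have "\<dots> \<le> ennreal (C * ?q N) * Lp_norm p (?h B T)"
      proof (intro mult_right_mono ennreal_leI)
        have "1 \<le> ?q N" using sigma_p_nonneg by (intro ge_one_powr_ge_zero) auto
        then show "C \<le> C * ?q N" using C by simp
      qed auto
      finally show ?thesis .
    qed
    then show ?thesis using C by blast
  next
    case False
    define r where "r = enn2real p"
    have pt: "p \<noteq> \<infinity>" using False by auto
    have r0: "r > 0" using enn2real_pos[OF p pt] by (simp add: r_def)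
    have pr: "p = ennreal r" using pt by (simp add: r_def less_top)
    have r1: "r < 1" using False r0 unfolding pr by (simp add: ennreal_1[symmetric] del: ennreal_1)
    let ?n = "real CARD('n)"
    obtain S where S: "S > 0" "\<forall>m x. norm (inv_fourier (low_mult m) x) \<le> S * 2 powr (real_of_int m * ?n)"
      using low_kernel_bound by blast
    obtain K where K: "K > 0" "\<forall>i\<in>I. (NN x. ennreal (norm (inv_fourier (A i) x) powr r)) \<le> ennreal K"
      using schwartz_family_nn_integral[OF schwartz_family_inv_fourier[OF A] r0] by blast
    define C where "C = ((S * 2 powr ((real_of_int m0 + 2) * ?n)) powr (1 - r) * K) powr (1 / r)"
    have Cpos: "C > 0" using S K by (simp add: C_def)
    have "Lp_norm p (?H i l B T) \<le> ennreal (C * ?q N) * Lp_norm p (?h B T)"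
      if i: "i \<in> I" and T: "tempered T" and B: "schwartz B"
      and sB: "\<forall>\<xi>. B \<xi> \<noteq> 0 \<longrightarrow> norm \<xi> \<le> 2 powi (l + m0 + int N)" for i l B T and N :: nat
    proof -
      define m where "m = l + m0 + int N"
      define Mx where "Mx = S * 2 powr (real_of_int (m + 2) * ?n)"
      have Mx: "Mx > 0" using S by (simp add: Mx_def)
      define K' where "K' = 2 powr (real_of_int l * ?n * (r - 1)) * K"
      have K': "K' > 0" using K by (simp add: K'_def)
      have [measurable]: "?h B T \<in> borel_funs" "?H i l B T \<in> borel_funs"
        "?k i l \<in> borel_funs" using mh mhA mk that by auto
      have sAm: "norm \<xi> \<le> 2 powi m" if "scaled (A i) l \<xi> \<noteq> 0" for \<xi>
      proof -
        have "norm ((2 powi (- l)) *\<^sub>R \<xi>) \<le> 2 powi m0" using that unfolding scaled_def by (rule supp[OF i])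
        then have "norm \<xi> \<le> 2 powi m0 * 2 powi l" by (simp add: power_int_minus field_simps)
        also have "\<dots> = 2 powi (l + m0)" by (simp add: power_int_add)
        also have "\<dots> \<le> 2 powi m" unfolding m_def by (intro power_int_increasing) auto
        finally show ?thesis .
      qed
      have "Lp_norm p (?H i l B T) \<le> ennreal ((Mx powr (1 - r) * K') powr (1 / enn2real p)) * Lp_norm p (?h B T)"
      proof (rule Lp_gen_convolution_power[OF _ _ _ p pt, where w="\<lambda>y. ennreal (norm (?k i l y) powr r)"])
        show "Mx powr (1 - r) > 0" "K' > 0" using Mx K' by auto
        show "(NN x. ennreal (norm (?k i l x) powr r)) \<le> ennreal K'"
        proof -
          have s: "schwartz (A i)" by (rule schwartz_familyD[OF A i])
          have "(NN x. ennreal (norm (?k i l x) powr r)) = ennreal (2 powr (of_int l * ?n * (r - 1))) * (NN x. ennreal (norm (inv_fourier (A i) x) powr r))"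
            unfolding inv_fourier_scaled[OF s] by (rule nn_integral_dilate[OF schwartz_measurable[OF schwartz_inv_fourier[OF s]] r0])
          also have "\<dots> \<le> ennreal (2 powr (of_int l * ?n * (r - 1))) * ennreal K"
            using K i by (intro mult_left_mono) auto
          finally show ?thesis using K by (simp add: K'_def ennreal_mult)
        qed
        fix x
        have "epowr (enorm (?H i l B T x)) r
            \<le> epowr (NN y. enorm (?k i l (x - y) * ?h B T y)) r"
          using le[OF i T B] r0 by (intro ennreal_powr_mono) auto
        also have "\<dots> \<le> ennreal (Mx powr (1 - r)) * (NN y. ennreal (norm (?k i l (x - y)) powr r) * epowr (enorm (?h B T y)) r)"
          by (rule product_nikolskii[OF T sA[OF i] B sAm _ r0 less_imp_le[OF r1] Mx])
            (use sB S(2)[rule_format, of "m + 2"] in \<open>auto simp: m_def Mx_def\<close>)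
        finally show "epowr (enorm (?H i l B T x)) (enn2real p)
            \<le> ennreal (Mx powr (1 - r)) * (NN y. ennreal (norm (?k i l (x - y)) powr r) * epowr (enorm (?h B T y)) (enn2real p))"
          by (simp only: r_def)
      qed measurable
      also have "(Mx powr (1 - r) * K') powr (1 / enn2real p) = C * ?q N"
      proof -
        have sig: "sigma_p CARD('n) p = ?n * (1 / r - 1)"
          unfolding sigma_p_eq[OF p pt] r_def[symmetric] using r0 r1 by (simp add: max_def field_simps)
        have M1: "Mx = (S * 2 powr ((real_of_int m0 + 2) * ?n)) * 2 powr ((real_of_int l + real N) * ?n)"
          by (simp add: Mx_def m_def mult.assoc powr_add[symmetric] algebra_simps)
        have "Mx powr (1 - r) * K' = ((S * 2 powr ((real_of_int m0 + 2) * ?n)) powr (1 - r) * K) * 2 powr (real N * ?n * (1 - r))"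
        proof -
          have "Mx powr (1 - r) = (S * 2 powr ((real_of_int m0 + 2) * ?n)) powr (1 - r) * 2 powr ((real_of_int l + real N) * ?n * (1 - r))"
            unfolding M1 by (simp only: powr_mult powr_powr)
          moreover have "2 powr ((real_of_int l + real N) * ?n * (1 - r)) * 2 powr (real_of_int l * ?n * (r - 1)) = 2 powr (real N * ?n * (1 - r))"
            unfolding powr_add[symmetric] by (simp add: algebra_simps)
          moreover have "a * (w * K) = u * K * z" if "a = u * v" "v * w = z" for a u v w z :: real
            unfolding that(1) that(2)[symmetric] by (simp only: mult_ac)
          ultimately show ?thesis unfolding K'_def by blast
        qed
        then have "(Mx powr (1 - r) * K') powr (1 / r) = C * (2 powr (real N * ?n * (1 - r))) powr (1 / r)"
          unfolding C_def by (simp only: powr_mult)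
        also have "(2 powr (real N * ?n * (1 - r))) powr (1 / r) = ?q N"
          unfolding sig powr_powr using r0 by (simp add: field_simps)
        finally show ?thesis by (simp only: r_def)
      qed
      finally show ?thesis .
    qed
    then show ?thesis using Cpos by blast
  qed
qed

end

section \<open>Sequence norms and dyadic blocks\<close>

lemma lq_qnorm_eq: "lq_qnorm q a = Lp_gen (count_space UNIV) q a"
proof -
  have "esssup (count_space UNIV) a = (SUP k. a k)"
  proof (rule antisym)
    show "esssup (count_space UNIV) a \<le> (SUP k. a k)" by (rule esssup_I) (auto simp: AE_count_space intro: SUP_upper)
    have "AE k in count_space UNIV. a k \<le> esssup (count_space UNIV) a" by (rule esssup_AE)
    then show "(SUP k. a k) \<le> esssup (count_space UNIV) a" by (auto simp: AE_count_space intro: SUP_least)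
  qed
  then show ?thesis by (simp add: lq_qnorm_def Lp_gen_def)
qed

lemma lq_qnorm_mono: "0 < q \<Longrightarrow> (\<And>k. a k \<le> b k) \<Longrightarrow> lq_qnorm q a \<le> lq_qnorm q b"
  unfolding lq_qnorm_eq by (intro Lp_gen_mono_AE) auto

lemma lq_qnorm_cmult_le: "0 < q \<Longrightarrow> lq_qnorm q (\<lambda>k. c * a k) \<le> c * lq_qnorm q a"
  unfolding lq_qnorm_eq by (intro Lp_gen_cmult_le) auto

lemma lq_qnorm_add:
  assumes "0 < q"
  shows "\<exists>C>0. \<forall>a b. lq_qnorm q (\<lambda>k. a k + b k) \<le> ennreal C * (lq_qnorm q a + lq_qnorm q b)"
  using Lp_gen_add[OF assms, of "count_space (UNIV :: int set)"] unfolding lq_qnorm_eq by simp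

lemma lq_qnorm_sum:
  assumes "0 < q" "finite A"
  shows "\<exists>C>0. \<forall>a. lq_qnorm q (\<lambda>k. \<Sum>i\<in>A. a i k) \<le> ennreal C * (\<Sum>i\<in>A. lq_qnorm q (a i))"
  using Lp_gen_sum[OF assms, of "count_space (UNIV :: int set)"] unfolding lq_qnorm_eq by simp

lemma lq_qnorm_shift: "lq_qnorm q (\<lambda>k. a (k + m)) = lq_qnorm q a"
proof -
  have b: "bij (\<lambda>k. k + m :: int)" by (rule bij_betwI[where g="\<lambda>k. k - m"]) auto
  have "range (\<lambda>k. a (k + m)) = a ` range (\<lambda>k. k + m)" by (simp only: image_image)
  also have "range (\<lambda>k. k + m) = UNIV" using b by (simp add: bij_def)
  finally show ?thesis
    using nn_integral_bij_count_space[OF b, of "\<lambda>k. epowr (a k) (enn2real q)"] by (simp add: lq_qnorm_def)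
qed

lemma le_lq_qnorm:
  assumes "0 < q" shows "a k \<le> lq_qnorm q a"
proof (cases "q = \<infinity>")
  case False
  note r = enn2real_pos[OF assms False]
  have "epowr (a k) (enn2real q) \<le> (SUP k. epowr (a k) (enn2real q))" by (rule SUP_upper) simp
  also have "\<dots> \<le> (NS k. epowr (a k) (enn2real q))" by (rule SUP_le_sum)
  also have "\<dots> = epowr (lq_qnorm q a) (enn2real q)"
    unfolding lq_qnorm_eq by (rule Lp_gen_power[OF assms False, symmetric])
  finally show ?thesis using r by (simp add: ennreal_powr_le_iff)
qed (simp add: lq_qnorm_def SUP_upper)

text \<open>Takes the place of Young's inequality for sequences, for all \<open>q\<close> alike: the
  \<open>q\<close>-th power of the supremum is at most the sum of the \<open>q\<close>-th powers,
  and after exchanging the sums the weights add up to \<open>geo (\<delta> * q)\<close>.\<close>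

lemma lq_qnorm_geometric:
  assumes q: "0 < q" and \<delta>: "\<delta> > 0"
  shows "\<exists>C>0. \<forall>a. lq_qnorm q (\<lambda>k. SUP l. dyad (- \<delta>) (l - k) * a l) \<le> ennreal C * lq_qnorm q a"
proof (cases "q = \<infinity>")
  case True
  have "lq_qnorm q (\<lambda>k. SUP l. dyad (- \<delta>) (l - k) * a l) \<le> ennreal 1 * lq_qnorm q a" for a
  proof -
    have "dyad (- \<delta>) (l - k) * a l \<le> (SUP l. a l)" for l k
    proof -
      have "2 powr (- \<delta> * \<bar>real_of_int (l - k)\<bar>) \<le> 2 powr 0" using \<delta> by (intro powr_mono) auto
      then have "dyad (- \<delta>) (l - k) * a l \<le> ennreal 1 * a l" by (intro mult_right_mono ennreal_leI) auto
      also have "\<dots> \<le> (SUP l. a l)" by (simp add: SUP_upper)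
      finally show ?thesis .
    qed
    then show ?thesis using True by (auto simp: lq_qnorm_def intro!: SUP_least)
  qed
  then show ?thesis by (intro exI[of _ 1]) auto
next
  case False
  define r where "r = enn2real q"
  have r: "r > 0" using enn2real_pos[OF q False] by (simp add: r_def)
  have \<delta>r: "\<delta> * r > 0" using \<delta> r by simp
  define G where "G = enn2real (geo (\<delta> * r))"
  have G: "geo (\<delta> * r) = ennreal G" "G \<ge> 0" using geo_finite[OF \<delta>r] by (auto simp: G_def)
  have "lq_qnorm q (\<lambda>k. SUP l. dyad (- \<delta>) (l - k) * a l) \<le> ennreal ((G + 1) powr (1 / r)) * lq_qnorm q a" for a
  proof -
    let ?w = "\<lambda>l k. 2 powr (- (\<delta> * r) * \<bar>real_of_int (l - k)\<bar>)"
    have "(NS k. epowr (SUP l. dyad (- \<delta>) (l - k) * a l) r)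
        \<le> (NS k. (NS l. ennreal (?w l k) * epowr (a l) r))"
    proof (rule nn_integral_mono)
      fix k
      have "epowr (SUP l. dyad (- \<delta>) (l - k) * a l) r = (SUP l. ennreal (?w l k) * epowr (a l) r)"
        using r by (simp add: ennreal_powr_SUP ennreal_powr_mult ennreal_powr_ennreal powr_powr algebra_simps)
      also have "\<dots> \<le> (NS l. ennreal (?w l k) * epowr (a l) r)" by (rule SUP_le_sum)
      finally show "epowr (SUP l. dyad (- \<delta>) (l - k) * a l) r
        \<le> (NS l. ennreal (?w l k) * epowr (a l) r)" .
    qed
    also have "\<dots> = (NS l. (NS k. ennreal (?w l k) * epowr (a l) r))"
      by (rule nn_integral_count_space_nn_integral) auto
    also have "\<dots> = (NS l. ennreal G * epowr (a l) r)"
      by (intro nn_integral_cong) (subst nn_integral_multc, simp_all only: geo_shift G sets_count_space, auto)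
    also have "\<dots> = ennreal G * epowr (lq_qnorm q a) r"
      unfolding lq_qnorm_eq r_def Lp_gen_power[OF q False] by (simp add: nn_integral_cmult)
    also have "\<dots> \<le> ennreal (G + 1) * epowr (lq_qnorm q a) r" by (intro mult_right_mono ennreal_leI) auto
    also have "\<dots> = epowr (ennreal ((G + 1) powr (1 / r)) * lq_qnorm q a) r"
      using r G by (simp add: ennreal_powr_mult ennreal_powr_ennreal powr_powr)
    finally show ?thesis unfolding lq_qnorm_eq[of q "\<lambda>k. SUP l. _ k l"] by (simp only: Lp_gen_le_iff[OF q False] r_def)
  qed
  moreover have "(G + 1) powr (1 / r) > 0" using G by simp
  ultimately show ?thesis by blast
qed

text \<open>Numbered by frequency: steps in block \<open>k\<close> have size about
  \<open>2^(-k)\<close> and match frequencies about \<open>2^k\<close>. The blocks partition the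
  positive reals.\<close>

definition dyadic_block :: "int \<Rightarrow> real set" where
  "dyadic_block k = {2 powr (- real_of_int k) ..< 2 powr (1 - real_of_int k)}"

lemma dyadic_block_pos: "t \<in> dyadic_block k \<Longrightarrow> 0 < t"
  by (auto simp: dyadic_block_def intro: less_le_trans[of 0 "2 powr _"])

lemma dyadic_block_iff: "t > 0 \<Longrightarrow> t \<in> dyadic_block k \<longleftrightarrow> k = - \<lfloor>log 2 t\<rfloor>"
proof -
  assume t: "t > 0"
  have "t \<in> dyadic_block k \<longleftrightarrow> real_of_int (- k) \<le> log 2 t \<and> log 2 t < real_of_int (- k) + 1"
    using t by (auto simp: dyadic_block_def le_log_iff log_less_iff)
  also have "\<dots> \<longleftrightarrow> \<lfloor>log 2 t\<rfloor> = - k" by (rule floor_eq_iff[symmetric])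
  finally show ?thesis by auto
qed

lemma emeasure_dyadic_block: "emeasure lborel (dyadic_block k) = ennreal (2 powr (- of_int k))"
proof -
  have "2 powr (1 - real_of_int k) = 2 * 2 powr (- real_of_int k)" using powr_add[of 2 1 "- real_of_int k"] by simp
  then show ?thesis by (simp add: dyadic_block_def)
qed

lemma dyadic_block_sets [measurable]: "dyadic_block k \<in> sets borel"
  by (simp add: dyadic_block_def)

lemma nn_integral_dyadic:
  "(NN t. (NS k. c k * indicator (dyadic_block k) t))
    = (NS k. c k * ennreal (2 powr (- of_int k)))" by (subst nn_integral_count_space_nn_integral)
    (auto intro!: nn_integral_cong simp: nn_integral_cmult_indicator emeasure_dyadic_block)

lemma dyadic_sum:
  assumes "t \<in> dyadic_block k"
  shows "(NS i. c i * indicator (dyadic_block i) t) = c k"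
proof -
  have "c i * indicator (dyadic_block i) t = c k * indicator {k} i" for i
    using assms dyadic_block_iff[OF dyadic_block_pos[OF assms]] by (auto simp: indicator_def)
  then have "(NS i. c i * indicator (dyadic_block i) t) = (NS i. c k * indicator {k} i)" by simp
  also have "\<dots> = c k" by (subst nn_integral_cmult_indicator) auto
  finally show ?thesis .
qed

text \<open>A block has Lebesgue measure \<open>2^(-k)\<close>, and \<open>1 / t \<le> 2^k\<close>
  on it, so its mass under \<open>dt / t\<close> is at most \<open>1\<close>. The integrand is
  compared with a step function, whatever the regularity of \<open>F\<close>.\<close>

lemma weighted_integral_le:
  assumes q: "0 < q" "q \<noteq> \<infinity>" and le: "\<And>k t. t \<in> dyadic_block k \<Longrightarrow> ennreal (t powr (- s)) * F t \<le> b k"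
  shows "weighted_integral q s F \<le> lq_qnorm q b"
proof -
  define r where "r = enn2real q"
  have r: "r > 0" using enn2real_pos[OF q] by (simp add: r_def)
  have "(\<integral>\<^sup>+t\<in>{0<..}. ennreal (t powr (- s * r)) * epowr (F t) r * ennreal (1 / t) \<partial>lborel)
      \<le> (NN t. (NS k. (epowr (b k) r * ennreal (2 powr real_of_int k)) * indicator (dyadic_block k) t))"
  proof (rule nn_integral_mono)
    fix t :: real
    show "ennreal (t powr (- s * r)) * epowr (F t) r * ennreal (1 / t) * indicator {0<..} t
      \<le> (NS k. (epowr (b k) r * ennreal (2 powr real_of_int k)) * indicator (dyadic_block k) t)"
    proof (cases "t > 0")
      case True
      define k where "k = - \<lfloor>log 2 t\<rfloor>"
      have k: "t \<in> dyadic_block k" using dyadic_block_iff[OF True] by (simp add: k_def)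
      have "ennreal (t powr (- s * r)) * epowr (F t) r = epowr (ennreal (t powr (- s)) * F t) r"
        using r by (simp add: ennreal_powr_mult ennreal_powr_ennreal powr_powr)
      also have "\<dots> \<le> epowr (b k) r" by (intro ennreal_powr_mono r le k)
      moreover have "1 / t \<le> 2 powr real_of_int k"
      proof -
        have "1 / t \<le> 1 / 2 powr (- real_of_int k)" using k True by (intro divide_left_mono) (auto simp: dyadic_block_def)
        then show ?thesis by (simp add: powr_minus_divide)
      qed
      ultimately show ?thesis unfolding dyadic_sum[OF k] using True by (simp add: mult_mono ennreal_leI)
    qed simp
  qed
  also have "\<dots> = (NS k. epowr (b k) r)"
    unfolding nn_integral_dyadic by (simp add: mult.assoc flip: ennreal_mult powr_add)
  finally show ?thesis using q r
    by (simp add: weighted_integral_def lq_qnorm_def r_def nn_integral_completion ennreal_powr_mono)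
qed

definition weighted_norm :: "ennreal \<Rightarrow> real \<Rightarrow> (real \<Rightarrow> ennreal) \<Rightarrow> ennreal" where
  "weighted_norm q s F = (if q = \<infinity> then weighted_esssup s F else weighted_integral q s F)"

text \<open>The infimum over a block is a constant minorant of the integrand there, and the block
  has mass at least \<open>1/2\<close> under \<open>dt / t\<close>. For
  \<open>q = \<infinity>\<close> it suffices that the block has positive measure and so meets the
  set where the essential bound holds. In both cases \<open>F\<close> may be arbitrary.\<close>

lemma lq_qnorm_INF_le_weighted_norm:
  assumes q: "0 < q"
  shows "\<exists>C>0. \<forall>F. lq_qnorm q (\<lambda>k. INF t\<in>dyadic_block k. ennreal (t powr (- s)) * F t) \<le> ennreal C * weighted_norm q s F"
proof (cases "q = \<infinity>")
  case True
  have "(INF t\<in>dyadic_block k. ennreal (t powr (- s)) * F t) \<le> weighted_esssup s F" for k F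
  proof -
    let ?E = "weighted_esssup s F"
    have "AE t in restrict_space lebesgue {0<..}. ennreal (t powr (- s)) * F t \<le> ?E"
      unfolding weighted_esssup_def by (rule esssup_AE)
    then have ae: "AE t in lborel. t \<in> {0<..} \<longrightarrow> ennreal (t powr (- s)) * F t \<le> ?E"
      by (subst (asm) AE_restrict_space_iff) (auto simp: AE_completion_iff)
    have "\<exists>t\<in>dyadic_block k. ennreal (t powr (- s)) * F t \<le> ?E"
    proof (rule ccontr)
      assume n: "\<not> ?thesis"
      from ae have "AE t in lborel. t \<notin> dyadic_block k" by eventually_elim (use n dyadic_block_pos in auto)
      then have "emeasure lborel (dyadic_block k) = 0" by (subst (asm) AE_iff_measurable[where N="dyadic_block k"]) auto
      then show False by (simp add: emeasure_dyadic_block)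
    qed
    then show ?thesis by (auto intro: INF_lower2)
  qed
  then show ?thesis using True by (intro exI[of _ 1]) (auto simp: lq_qnorm_def weighted_norm_def intro!: SUP_least)
next
  case False
  define r where "r = enn2real q"
  have r: "r > 0" using enn2real_pos[OF q False] by (simp add: r_def)
  have "lq_qnorm q (\<lambda>k. INF t\<in>dyadic_block k. ennreal (t powr (- s)) * F t) \<le> ennreal (2 powr (1 / r)) * weighted_norm q s F" for F
  proof -
    let ?b = "\<lambda>k. INF t\<in>dyadic_block k. ennreal (t powr (- s)) * F t"
    define W where "W = (\<integral>\<^sup>+t\<in>{0<..}. ennreal (t powr (- s * r)) * epowr (F t) r * ennreal (1 / t) \<partial>lborel)"
    have "(NS k. ennreal (1 / 2) * epowr (?b k) r)
      = (NN t. (NS k. (epowr (?b k) r * ennreal (2 powr real_of_int k / 2)) * indicator (dyadic_block k) t))"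
      unfolding nn_integral_dyadic
    proof (rule nn_integral_cong)
      fix k
      have "2 powr real_of_int k / 2 * 2 powr (- real_of_int k) = 1 / 2" by (simp flip: powr_add)
      then have "ennreal (2 powr real_of_int k / 2) * ennreal (2 powr (- of_int k)) = ennreal (1 / 2)" by (simp flip: ennreal_mult)
      then show "ennreal (1 / 2) * epowr (?b k) r = epowr (?b k) r * ennreal (2 powr real_of_int k / 2) * ennreal (2 powr (- of_int k))"
        unfolding mult.assoc by (simp only: mult.commute)
    qed
    also have "\<dots> \<le> W" unfolding W_def
    proof (rule nn_integral_mono)
      fix t :: real
      show "(NS k. (epowr (?b k) r * ennreal (2 powr real_of_int k / 2)) * indicator (dyadic_block k) t)
        \<le> ennreal (t powr (- s * r)) * epowr (F t) r * ennreal (1 / t) * indicator {0<..} t"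
      proof (cases "t > 0")
        case True
        define k where "k = - \<lfloor>log 2 t\<rfloor>"
        have k: "t \<in> dyadic_block k" using dyadic_block_iff[OF True] by (simp add: k_def)
        have "epowr (?b k) r \<le> epowr (ennreal (t powr (- s)) * F t) r" by (intro ennreal_powr_mono r INF_lower k)
        also have "\<dots> = ennreal (t powr (- s * r)) * epowr (F t) r"
          using r by (simp add: ennreal_powr_mult ennreal_powr_ennreal powr_powr)
        moreover have "2 powr real_of_int k / 2 \<le> 1 / t"
        proof -
          have "t \<le> 2 * 2 powr (- real_of_int k)" using k powr_add[of 2 1 "- real_of_int k"] by (simp add: dyadic_block_def)
          then show ?thesis using True by (simp add: powr_minus field_simps)
        qed
        ultimately show ?thesis unfolding dyadic_sum[OF k] using True by (simp add: mult_mono ennreal_leI)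
      next
        case False
        then have "t \<notin> dyadic_block k" for k using dyadic_block_pos by auto
        then show ?thesis by simp
      qed
    qed
    finally have "ennreal (1 / 2) * (NS k. epowr (?b k) r) \<le> W" by (subst (asm) nn_integral_cmult) auto
    from mult_left_mono[OF this, of "ennreal 2"]
    have "(NS k. epowr (?b k) r) \<le> ennreal 2 * W"
      by (simp only: mult.assoc[symmetric] ennreal_mult[symmetric]) simp
    also have "\<dots> = epowr (ennreal (2 powr (1 / r)) * epowr W (1 / r)) r"
      using r by (simp add: ennreal_powr_mult ennreal_powr_ennreal powr_powr ennreal_powr_powr)
    finally have "(NS k. epowr (?b k) r) \<le> epowr (ennreal (2 powr (1 / r)) * epowr W (1 / r)) r" .
    moreover have "weighted_norm q s F = epowr W (1 / r)"
      using False by (simp add: weighted_norm_def weighted_integral_def W_def r_def nn_integral_completion)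
    ultimately show ?thesis unfolding lq_qnorm_eq by (simp only: Lp_gen_le_iff[OF q False] r_def)
  qed
  then show ?thesis by (intro exI[of _ "2 powr (1 / r)"]) auto
qed

text \<open>The arguments \<open>t j\<close> may be chosen independently, so each infimum is
  approximated on its own, all within a common error.\<close>

lemma le_sum_INF:
  fixes X :: "'i \<Rightarrow> 't \<Rightarrow> ennreal"
  assumes J: "finite J" and S: "S \<noteq> {}" and le: "\<And>t. (\<forall>j\<in>J. t j \<in> S) \<Longrightarrow> a \<le> d + (\<Sum>j\<in>J. X j (t j))"
  shows "a \<le> d + (\<Sum>j\<in>J. INF t\<in>S. X j t)"
proof (rule ennreal_le_epsilon)
  fix e :: real assume fin: "d + (\<Sum>j\<in>J. INF t\<in>S. X j t) < top" and e: "e > 0"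
  \<comment> \<open>The added \<open>1\<close> avoids a division by zero for empty
    \<open>J\<close>.\<close>
  define \<eta> where "\<eta> = e / (real (card J) + 1)"
  have \<eta>: "\<eta> > 0" using e by (simp add: \<eta>_def)
  have "\<exists>t\<in>S. X j t \<le> (INF t\<in>S. X j t) + ennreal \<eta>" if "j \<in> J" for j
  proof -
    have "(INF t\<in>S. X j t) \<le> (\<Sum>j\<in>J. INF t\<in>S. X j t)" using that J by (intro member_le_sum) auto
    then have "(INF t\<in>S. X j t) < top" using fin by (metis (no_types, lifting) ennreal_add_less_top le_less_trans)
    then have "(INF t\<in>S. X j t) < (INF t\<in>S. X j t) + ennreal \<eta>" using \<eta>
      by (cases "INF t\<in>S. X j t") (auto simp: ennreal_less_iff simp flip: ennreal_plus)
    then show ?thesis unfolding INF_less_iff by (auto intro: less_imp_le)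
  qed
  then obtain t where t: "\<forall>j\<in>J. t j \<in> S \<and> X j (t j) \<le> (INF t\<in>S. X j t) + ennreal \<eta>" by metis
  have "a \<le> d + (\<Sum>j\<in>J. X j (t j))" by (rule le) (use t in auto)
  also have "\<dots> \<le> d + (\<Sum>j\<in>J. (INF t\<in>S. X j t) + ennreal \<eta>)" using t by (intro add_left_mono sum_mono) auto
  also have "\<dots> = d + (\<Sum>j\<in>J. INF t\<in>S. X j t) + ennreal (real (card J) * \<eta>)"
    using \<eta> by (simp add: sum.distrib add.assoc ennreal_mult ennreal_of_nat_eq_real_of_nat)
  also have "\<dots> \<le> d + (\<Sum>j\<in>J. INF t\<in>S. X j t) + ennreal e"
    using e by (intro add_left_mono ennreal_leI) (simp add: \<eta>_def field_simps)
  finally show "a \<le> d + (\<Sum>j\<in>J. INF t\<in>S. X j t) + ennreal e" .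
qed

lemma Lp_qnorm_eq_AE:
  fixes f g :: "'n::finite cfun"
  assumes "0 < p" and [measurable]: "g \<in> borel_funs" and "AE x in lborel. f x = g x"
  shows "Lp_qnorm p f = Lp_norm p g"
proof -
  have ae: "AE x in lebesgue. f x = g x" using assms(3) by (simp add: AE_completion_iff)
  have g: "g \<in> borel_measurable lebesgue" by (rule measurable_completion) simp
  \<comment> \<open>By completeness of Lebesgue measure. The comparison of essential suprema below
    asks for measurability of both functions.\<close>
  have f: "f \<in> borel_measurable lebesgue"
  proof (rule measurableI)
    fix S :: "complex set" assume "S \<in> sets borel"
    then have m: "g -` S \<inter> space lebesgue \<in> sets lebesgue" by (rule measurable_sets[OF g])
    have "AE x in lebesgue. x \<in> g -` S \<inter> space lebesgue \<longleftrightarrow> x \<in> f -` S \<inter> space lebesgue"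
      using ae by eventually_elim auto
    from completion.in_sets_AE[OF this m] show "f -` S \<inter> space lebesgue \<in> sets lebesgue" by simp
  qed auto
  show ?thesis
  proof (cases "p = \<infinity>")
    case True
    have "Lp_qnorm p f = esssup lebesgue (\<lambda>x. enorm (g x))"
    proof -
      have "esssup lebesgue (\<lambda>x. enorm (f x)) = esssup lebesgue (\<lambda>x. enorm (g x))"
        using f g by (intro esssup_AE_cong) (auto intro: eventually_mono[OF ae])
      then show ?thesis using True by (simp add: Lp_qnorm_def)
    qed
    also have "\<dots> = esssup lborel (\<lambda>x. enorm (g x))"
    proof (rule antisym)
      show "esssup lebesgue (\<lambda>x. enorm (g x)) \<le> esssup lborel (\<lambda>x. enorm (g x))"
        using g by (intro esssup_I AE_completion esssup_AE) auto
      have "AE x in lebesgue. enorm (g x) \<le> esssup lebesgue (\<lambda>x. enorm (g x))" by (rule esssup_AE)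
      then show "esssup lborel (\<lambda>x. enorm (g x)) \<le> esssup lebesgue (\<lambda>x. enorm (g x))"
        by (intro esssup_I) (auto simp: AE_completion_iff)
    qed
    finally show ?thesis using True by (simp add: Lp_gen_def)
  next
    case False
    have "(\<integral>\<^sup>+x. ennreal (norm (f x) powr enn2real p) \<partial>lebesgue) = (NN x. epowr (enorm (g x)) (enn2real p))"
      unfolding nn_integral_completion using assms(3)
      by (intro nn_integral_cong_AE) (auto simp: ennreal_powr_ennreal elim: eventually_mono)
    then show ?thesis using False by (simp add: Lp_qnorm_def Lp_gen_def)
  qed
qed

lemma Lp_qnorm_eq: "0 < p \<Longrightarrow> g \<in> borel_funs \<Longrightarrow> Lp_qnorm p g = Lp_norm p g"
  by (rule Lp_qnorm_eq_AE) auto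

section \<open>Series of differences\<close>

text \<open>For finite \<open>p\<close> this is Tonelli. For \<open>p = \<infinity>\<close> a
  sublevel set consists of those \<open>t\<close> for which the set where \<open>H t\<close> exceeds
  \<open>c\<close> has measure zero, and that measure depends measurably on
  \<open>t\<close>.\<close>

lemma Lp_gen_measurable:
  fixes H :: "real \<Rightarrow> 'a::euclidean_space \<Rightarrow> ennreal"
  assumes [measurable]: "(\<lambda>(t, x). H t x) \<in> borel_measurable (borel \<Otimes>\<^sub>M borel)"
  shows "(\<lambda>t. Lp_gen lborel p (H t)) \<in> borel_funs"
proof (cases "p = \<infinity>")
  case True
  have "{t. esssup lborel (H t) \<le> c} \<in> sets borel" for c
  proof -
    have m: "H t \<in> borel_funs" for t by measurable
    have "esssup lborel (H t) \<le> c \<longleftrightarrow> (NN x. indicator {c<..} (H t x)) = 0" for t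
    proof -
      have "esssup lborel (H t) \<le> c \<longleftrightarrow> (AE x in lborel. H t x \<le> c)"
      proof
        assume "esssup lborel (H t) \<le> c"
        then show "AE x in lborel. H t x \<le> c" using esssup_AE[of "H t" lborel] by (auto elim!: eventually_mono)
      qed (use m in auto)
      also have "\<dots> \<longleftrightarrow> (AE x in lborel. indicator {c<..} (H t x) = (0 :: ennreal))"
        by (intro AE_cong) (auto simp: indicator_def)
      also have "\<dots> \<longleftrightarrow> (NN x. indicator {c<..} (H t x)) = 0" using m by (subst nn_integral_0_iff_AE) auto
      finally show ?thesis .
    qed
    then have "{t. esssup lborel (H t) \<le> c} = {t \<in> space borel. (NN x. indicator {c<..} (H t x)) = 0}" by simp
    also have "\<dots> \<in> sets borel" by measurable
    finally show ?thesis .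
  qed
  then show ?thesis using True by (intro borel_measurableI_le) (simp add: Lp_gen_def)
next
  case False
  then show ?thesis by (simp add: Lp_gen_def)
qed

lemma summable_on_int:
  fixes f :: "int \<Rightarrow> complex"
  shows "f summable_on UNIV \<longleftrightarrow> (NS l. enorm (f l)) < \<infinity>" and "enorm (infsum f UNIV) \<le> (NS l. enorm (f l))"
    and "(NS l. enorm (f l)) < \<infinity> \<Longrightarrow> infsum f UNIV = (\<Sum>n. f (int_decode n))"
proof -
  let ?I = "(NS l. enorm (f l))"
  have "?I = (NS n. enorm (f (int_decode n)))"
    using nn_integral_bij_count_space[OF bij_int_decode, of "\<lambda>l. enorm (f l)"] by simp
  then have I: "?I = (\<Sum>n. enorm (f (int_decode n)))" by (simp add: nn_integral_count_space_nat)
  have s: "f summable_on UNIV \<longleftrightarrow> (\<lambda>n. f (int_decode n)) summable_on UNIV"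
    using summable_on_reindex_bij_betw[OF bij_int_decode, of f] by simp
  have fin: "?I < \<infinity> \<Longrightarrow> summable (\<lambda>n. norm (f (int_decode n)))" unfolding I by (rule summable_suminf_not_top) auto
  show iff: "f summable_on UNIV \<longleftrightarrow> ?I < \<infinity>"
  proof
    assume "f summable_on UNIV"
    then have "(\<lambda>n. norm (f (int_decode n))) summable_on UNIV"
      unfolding s by (simp add: summable_on_iff_abs_summable_on_complex)
    then have "summable (\<lambda>n. norm (f (int_decode n)))" by (rule summable_on_imp_summable)
    then show "?I < \<infinity>" unfolding I by (subst suminf_ennreal2) auto
  next
    assume "?I < \<infinity>"
    then show "f summable_on UNIV" unfolding s by (intro norm_summable_imp_summable_on fin)
  qed
  show eq: "infsum f UNIV = (\<Sum>n. f (int_decode n))" if "?I < \<infinity>"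
  proof -
    have "((\<lambda>n. f (int_decode n)) has_sum infsum f UNIV) UNIV"
      using iff that infsum_reindex_bij_betw[OF bij_int_decode, of f] s by (metis summable_iff_has_sum_infsum)
    then show ?thesis by (auto dest: has_sum_imp_sums simp: sums_iff)
  qed
  show "enorm (infsum f UNIV) \<le> ?I"
  proof (cases "?I < \<infinity>")
    case True
    have "norm (infsum f UNIV) \<le> (\<Sum>n. norm (f (int_decode n)))"
      unfolding eq[OF True] by (rule summable_norm[OF fin[OF True]])
    then have "enorm (infsum f UNIV) \<le> ennreal (\<Sum>n. norm (f (int_decode n)))" by (rule ennreal_leI)
    also have "\<dots> = ?I" unfolding I using fin[OF True] by (subst suminf_ennreal2) auto
    finally show ?thesis .
  next
    case False
    then show ?thesis using top.not_eq_extremum by force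
  qed
qed

context littlewood_paley
begin

abbreviation piece :: "('n cfun \<Rightarrow> complex) \<Rightarrow> int \<Rightarrow> 'n cfun" where
  "piece T l \<equiv> fourier_op (lp_mult l) T"

abbreviation pnorm :: "ennreal \<Rightarrow> ('n cfun \<Rightarrow> complex) \<Rightarrow> int \<Rightarrow> ennreal" where
  "pnorm p T l \<equiv> Lp_norm p (piece T l)"

lemma piece_measurable: "tempered T \<Longrightarrow> piece T l \<in> borel_funs"
  by (intro convolution_measurable schwartz_inv_fourier schwartz_lp_mult)

lemma class_nonempty:
  assumes "u \<in> tempered_mod_poly" shows "\<exists>T. T \<in> u"
proof -
  obtain S where S: "tempered S" "u = poly_equiv `` {S}"
    using assms unfolding tempered_mod_poly_def by (auto elim: quotientE)
  have "(S, S) \<in> poly_equiv" using S(1) unfolding poly_equiv_def by (auto intro!: exI[of _ "\<lambda>_. 0"])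
  then show ?thesis using S(2) by blast
qed

lemma besov_qnorm_eq:
  assumes u: "u \<in> tempered_mod_poly" "T \<in> u" and p: "0 < p"
  shows "besov_qnorm \<psi> s p q u = lq_qnorm q (\<lambda>k. ennreal (2 powr (of_int k * s)) * pnorm p T k)"
proof -
  have T: "tempered T" by (rule lp_piece_eq(1)[OF u])
  have "Lp_qnorm p (\<lambda>x. of_real (2 powr (real_of_int k * s)) * piece T k x) = ennreal (2 powr (of_int k * s)) * pnorm p T k" for k
  proof -
    have [measurable]: "piece T k \<in> borel_funs" by (rule piece_measurable[OF T])
    have "Lp_qnorm p (\<lambda>x. of_real (2 powr (real_of_int k * s)) * piece T k x) = Lp_norm p (\<lambda>x. of_real (2 powr (real_of_int k * s)) * piece T k x)"
      by (intro Lp_qnorm_eq p) measurable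
    also have "\<dots> = Lp_gen lborel p (\<lambda>x. ennreal (2 powr (of_int k * s)) * enorm (piece T k x))"
      by (simp add: norm_mult ennreal_mult)
    also have "\<dots> = ennreal (2 powr (of_int k * s)) * pnorm p T k" by (intro Lp_gen_cmult p) auto
    finally show ?thesis .
  qed
  then show ?thesis unfolding besov_qnorm_def lp_piece_eq(2)[OF u] by simp
qed

text \<open>The quotient \<open>(e^(2 pi i \<tau> \<xi>_j) - 1) / \<tau>\<close> grows at most
  linearly, with bounded derivatives, uniformly for \<open>0 < \<tau> \<le> 1\<close>. Having
  divided by \<open>\<tau> ^ L\<close>, one gains exactly this power for small steps. The cutoff
  equals \<open>1\<close> for \<open>norm \<xi> < 4\<close>, beyond the spectrum of a normalised
  piece, and makes the symbols Schwartz.\<close>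

lemma schwartz_family_small_difference:
  fixes j :: 'n
  defines "e \<equiv> axis j 1 :: real^'n"
  shows "schwartz_family {0<..1} (\<lambda>\<tau> \<xi>. bump ((1/4) *\<^sub>R \<xi>) * (of_real (1 / \<tau>) * (cexp (\<tau> *\<^sub>R e) \<xi> - 1)) ^ L)"
proof (rule schwartz_family_mult)
  show "schwartz_family {0<..1::real} (\<lambda>_ \<xi>. bump ((1/4) *\<^sub>R \<xi>))" by (intro schwartz_imp_family schwartz_bump_scale) simp
  let ?I = "{0<..1::real}"
  let ?F = "\<lambda>\<tau> \<xi>. of_real (1 / \<tau>) * (cexp (\<tau> *\<^sub>R e) \<xi> - 1)"
  have ne: "norm e = 1" by (simp add: e_def)
  have g: "growth k 0 ?I (\<lambda>\<tau>. cexp (\<tau> *\<^sub>R e))" for k by (rule growth_cexp[where B=1]) (auto simp: ne)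
  have "growth 0 1 ?I ?F"
  proof (rule growth_0I[where B="2 * pi"])
    fix \<tau> :: real and \<xi> :: "real^'n" assume \<tau>: "\<tau> \<in> ?I"
    have "norm (cexp (\<tau> *\<^sub>R e) \<xi> - 1) \<le> \<bar>((2 * pi) *\<^sub>R \<tau> *\<^sub>R e) \<bullet> \<xi>\<bar>"
      using iexp_approx1[of "((2 * pi) *\<^sub>R \<tau> *\<^sub>R e) \<bullet> \<xi>" 0] by (simp add: cexp_def)
    also have "\<dots> \<le> norm ((2 * pi) *\<^sub>R \<tau> *\<^sub>R e) * norm \<xi>" by (rule Cauchy_Schwarz_ineq2)
    also have "\<dots> = \<tau> * (2 * pi * norm \<xi>)" using \<tau> by (simp add: ne)
    finally have "norm (cexp (\<tau> *\<^sub>R e) \<xi> - 1) / \<tau> \<le> 2 * pi * norm \<xi>" using \<tau> by (simp add: field_simps)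
    also have "\<dots> \<le> 2 * pi * (1 + norm \<xi>)" by simp
    finally show "norm (?F \<tau> \<xi>) \<le> 2 * pi * (1 + norm \<xi>) powr 1" using \<tau> by (simp add: norm_mult norm_divide)
  qed
  moreover have "?F \<tau> differentiable (at \<xi>)" for \<tau> and \<xi> :: "real^'n"
    by (intro differentiable_mult differentiable_diff cexp_differentiable differentiable_const)
  moreover have "growth k 1 ?I (\<lambda>\<tau>. partial i (?F \<tau>))" for k i
  proof -
    have eq: "partial i (?F \<tau>) = (\<lambda>\<xi>. 2 * of_real pi * \<i> * of_real (e $ i) * cexp (\<tau> *\<^sub>R e) \<xi>)" if "\<tau> \<in> ?I" for \<tau>
    proof
      fix \<xi> :: "real^'n"
      have "((\<lambda>\<xi>. cexp (\<tau> *\<^sub>R e) \<xi> - 1) has_derivative (\<lambda>h. frechet_derivative (cexp (\<tau> *\<^sub>R e)) (at \<xi>) h - 0)) (at \<xi>)"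
        by (intro has_derivative_diff differentiable_has_derivative cexp_differentiable has_derivative_const)
      from partial_eq[OF this] have "partial i (\<lambda>\<xi>. cexp (\<tau> *\<^sub>R e) \<xi> - 1) \<xi> = partial i (cexp (\<tau> *\<^sub>R e)) \<xi>" by (simp add: partial_def)
      moreover have "partial i (?F \<tau>) \<xi> = of_real (1 / \<tau>) * partial i (\<lambda>\<xi>. cexp (\<tau> *\<^sub>R e) \<xi> - 1) \<xi>"
        by (subst partial_mult) (auto simp: partial_const intro!: differentiable_diff cexp_differentiable)
      ultimately show "partial i (?F \<tau>) \<xi> = 2 * of_real pi * \<i> * of_real (e $ i) * cexp (\<tau> *\<^sub>R e) \<xi>"
        using that by (simp add: partial_cexp)
    qed
    have "growth k 0 ?I (\<lambda>\<tau> \<xi>. 2 * of_real pi * \<i> * of_real (e $ i) * cexp (\<tau> *\<^sub>R e) \<xi>)"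
      by (rule growth_cmult[OF g order_refl])
    from growth_le_m[OF this, of 1] show ?thesis using growth_cong[of ?I, OF eq] by simp
  qed
  ultimately have "growth (Suc k) 1 ?I ?F" for k by (intro growth_SucI)
  then have "growth k 1 ?I ?F" for k by (rule growth_le_k[of "Suc k"]) auto
  from growth_power[OF this] show "growth k (of_nat L * 1) ?I (\<lambda>\<tau> \<xi>. ?F \<tau> \<xi> ^ L)" for k .
qed

text \<open>If \<open>2^l * t > 1\<close>, the trivial bound for differences suffices. Otherwise,
  with \<open>\<tau> = 2^l * t\<close>, the difference is \<open>\<tau> ^ L\<close> times a
  multiplier from the bounded family above, rescaled to level \<open>l\<close>.\<close>

lemma Lp_diff_piece:
  assumes p: "0 < p"
  shows "\<exists>C>0. \<forall>T l t. tempered T \<longrightarrow> 0 < t \<longrightarrow>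
    Lp_norm p (axis_diff L t j (piece T l)) \<le> ennreal (C * min 1 ((2 powi l * t) ^ L)) * pnorm p T l"
proof -
  let ?e = "axis j 1 :: real^'n"
  let ?A = "\<lambda>\<tau> \<xi>. bump ((1/4) *\<^sub>R \<xi>) * (of_real (1 / \<tau>) * (cexp (\<tau> *\<^sub>R ?e) \<xi> - 1)) ^ L"
  obtain C1 where C1: "C1 > 0" "\<forall>h (f :: 'n cfun). f \<in> borel_funs \<longrightarrow> Lp_norm p (iter_diff L h f) \<le> ennreal C1 * Lp_norm p f"
    using Lp_gen_iter_diff[OF p, of L, where 'n='n] by auto
  have sA: "norm \<xi> \<le> 2 powi 3" if "?A \<tau> \<xi> \<noteq> 0" for \<tau> \<xi>
  proof (rule ccontr)
    assume "\<not> norm \<xi> \<le> 2 powi 3"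
    then have "bump ((1/4) *\<^sub>R \<xi>) = 0" by (intro bump_zero) simp
    then show False using that by simp
  qed
  obtain C2 where C2: "C2 > 0" "\<forall>\<tau>\<in>{0<..1}. \<forall>l (N::nat) T B. tempered T \<longrightarrow> schwartz B \<longrightarrow>
    (\<forall>\<xi>. B \<xi> \<noteq> 0 \<longrightarrow> norm \<xi> \<le> 2 powi (l + 3 + int N)) \<longrightarrow>
    Lp_norm p (fourier_op (\<lambda>\<xi>. scaled (?A \<tau>) l \<xi> * B \<xi>) T)
      \<le> ennreal (C2 * 2 powr (real N * sigma_p CARD('n) p)) * Lp_norm p (fourier_op B T)"
    using Lp_multiplier[OF p schwartz_family_small_difference[of j L], of 3] sA by blast
  have "Lp_norm p (axis_diff L t j (piece T l)) \<le> ennreal (max C1 C2 * min 1 ((2 powi l * t) ^ L)) * pnorm p T l"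
    if T: "tempered T" and t: "0 < t" for T l t
  proof (cases "2 powi l * t \<le> 1")
    case False
    then have "1 \<le> (2 powi l * t) ^ L" by (intro one_le_power) simp
    then have *: "ennreal (max C1 C2 * min 1 ((2 powi l * t) ^ L)) = ennreal (max C1 C2)" by simp
    have "Lp_norm p (axis_diff L t j (piece T l)) \<le> ennreal C1 * pnorm p T l"
      unfolding axis_diff_def using C1(2) piece_measurable[OF T] by blast
    also have "\<dots> \<le> ennreal (max C1 C2) * pnorm p T l" by (intro mult_right_mono ennreal_leI) auto
    finally show ?thesis unfolding * .
  next
    case True
    define \<tau> where "\<tau> = 2 powi l * t"
    have \<tau>: "\<tau> \<in> {0<..1}" using True t by (simp add: \<tau>_def)
    let ?D = "fourier_op (\<lambda>\<xi>. scaled (?A \<tau>) l \<xi> * lp_mult l \<xi>) T"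
    have sD: "schwartz (\<lambda>\<xi>. scaled (?A \<tau>) l \<xi> * lp_mult l \<xi>)"
      by (intro schwartz_mult schwartz_lp_mult schwartz_scaled schwartz_familyD[OF schwartz_family_small_difference \<tau>])
    have mD [measurable]: "?D \<in> borel_funs" by (intro convolution_measurable T schwartz_inv_fourier sD)
    have mult: "lp_mult l \<xi> * (cexp (t *\<^sub>R ?e) \<xi> - 1) ^ L = of_real (\<tau> ^ L) * (scaled (?A \<tau>) l \<xi> * lp_mult l \<xi>)" for \<xi>
    proof (cases "lp_mult l \<xi> = 0")
      case False
      let ?\<eta> = "(2 powi (- l)) *\<^sub>R \<xi>"
      have "norm ?\<eta> < 2" using Psi_support[of ?\<eta>] False by (simp add: lp_mult_def)
      then have "bump ((1/4) *\<^sub>R ?\<eta>) = 1" by (intro bump_one) simp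
      moreover have "cexp (\<tau> *\<^sub>R ?e) ?\<eta> = cexp (t *\<^sub>R ?e) \<xi>"
        by (simp add: cexp_def \<tau>_def power_int_minus field_simps)
      ultimately show ?thesis using \<tau> unfolding scaled_def by (simp add: power_mult_distrib power_divide)
    qed simp
    have "axis_diff L t j (piece T l) = conv (iter_diff L (t *\<^sub>R ?e) (inv_fourier (lp_mult l))) T"
      unfolding axis_diff_def by (rule iter_diff_convolution[OF T schwartz_inv_fourier[OF schwartz_lp_mult]])
    also have "iter_diff L (t *\<^sub>R ?e) (inv_fourier (lp_mult l)) = inv_fourier (\<lambda>\<xi>. of_real (\<tau> ^ L) * (scaled (?A \<tau>) l \<xi> * lp_mult l \<xi>))"
      unfolding iter_diff_inv_fourier(1)[OF schwartz_lp_mult] mult ..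
    also have "\<dots> = (\<lambda>x. of_real (\<tau> ^ L) * inv_fourier (\<lambda>\<xi>. scaled (?A \<tau>) l \<xi> * lp_mult l \<xi>) x)"
      by (rule ext) (simp add: inv_fourier_def mult.assoc)
    also have "conv \<dots> T = (\<lambda>x. of_real (\<tau> ^ L) * ?D x)" unfolding schwartz_convolution_def
      by (intro ext tempered_cmult[OF T] schwartz_reflect schwartz_inv_fourier sD)
    finally have eq: "axis_diff L t j (piece T l) = (\<lambda>x. of_real (\<tau> ^ L) * ?D x)" .
    \<comment> \<open>Used with \<open>N = 0\<close>: multiplier and piece live at comparable
      frequencies, so nothing is lost even for \<open>p < 1\<close>.\<close>
    have D: "Lp_norm p ?D \<le> ennreal (C2 * 2 powr (real 0 * sigma_p CARD('n) p)) * pnorm p T l"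
    proof (rule C2(2)[rule_format, OF \<tau> T schwartz_lp_mult])
      fix \<xi> assume "lp_mult l \<xi> \<noteq> 0"
      then have "norm \<xi> < 2 powi (l + 1)" by (rule lp_mult_support)
      also have "\<dots> \<le> 2 powi (l + 3 + int 0)" by (intro power_int_increasing) auto
      finally show "norm \<xi> \<le> 2 powi (l + 3 + int 0)" by simp
    qed
    have "Lp_norm p (axis_diff L t j (piece T l)) = Lp_gen lborel p (\<lambda>x. ennreal (\<tau> ^ L) * enorm (?D x))"
      unfolding eq using \<tau> by (simp only: norm_mult norm_of_real) (simp add: ennreal_mult)
    also have "\<dots> \<le> ennreal (\<tau> ^ L) * Lp_norm p ?D" by (intro Lp_gen_cmult_le p) measurable
    also have "\<dots> \<le> ennreal (\<tau> ^ L) * (ennreal (C2 * 2 powr (real 0 * sigma_p CARD('n) p)) * pnorm p T l)"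
      by (intro mult_left_mono D) simp
    also have "\<dots> = ennreal (C2 * \<tau> ^ L) * pnorm p T l"
    proof -
      have "ennreal (\<tau> ^ L) * ennreal (C2 * 2 powr (real 0 * sigma_p CARD('n) p)) = ennreal (C2 * \<tau> ^ L)"
        using C2 \<tau> by (simp add: mult.commute flip: ennreal_mult)
      then show ?thesis by (simp only: mult.assoc[symmetric])
    qed
    also have "\<dots> \<le> ennreal (max C1 C2 * min 1 ((2 powi l * t) ^ L)) * pnorm p T l"
    proof (intro mult_right_mono ennreal_leI)
      have "\<tau> ^ L \<le> 1" using \<tau> by (intro power_le_one) auto
      then show "C2 * \<tau> ^ L \<le> max C1 C2 * min 1 ((2 powi l * t) ^ L)"
        using \<tau> by (simp add: \<tau>_def[symmetric] min_def mult_right_mono)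
    qed auto
    finally show ?thesis .
  qed
  then show ?thesis using C1 C2 by (intro exI[of _ "max C1 C2"]) auto
qed

end

section \<open>Upper bounds for differences\<close>

lemma iter_diff_measurable_pair:
  fixes f :: "'n::finite cfun"
  assumes [measurable]: "f \<in> borel_funs"
  shows "(\<lambda>(t, x). iter_diff L (t *\<^sub>R e) f x) \<in> borel_measurable (borel \<Otimes>\<^sub>M borel)"
proof (induction L)
  case (Suc L)
  have "(\<lambda>(t, x). (t, x + t *\<^sub>R e)) \<in> borel \<Otimes>\<^sub>M borel \<rightarrow>\<^sub>M borel \<Otimes>\<^sub>M borel" by measurable
  from measurable_compose[OF this Suc]
  have "(\<lambda>(t, x). iter_diff L (t *\<^sub>R e) f (x + t *\<^sub>R e)) \<in> borel_measurable (borel \<Otimes>\<^sub>M borel)"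
    by (simp add: case_prod_beta')
  from borel_measurable_diff[OF this Suc] show ?case by (simp add: case_prod_beta')
qed simp

text \<open>With \<open>x = 2^l * t\<close>, comparable to \<open>2^(l-k)\<close>, the claim
  extracts \<open>x powr s\<close> and leaves geometric decay in \<open>l - k\<close>. For
  \<open>l \<ge> k\<close> the decay comes from \<open>s > 0\<close>, and for \<open>l < k\<close>
  from \<open>x ^ L = x powr (L - s) * x powr s\<close>, hence from \<open>s < L\<close>. The factor
  \<open>2 ^ L\<close> pays for the width of the block.\<close>

lemma dyadic_difference_weight:
  assumes t: "t \<in> dyadic_block k" and s: "0 < \<epsilon>" "2 * \<epsilon> \<le> s" "2 * \<epsilon> \<le> real L - s"
  shows "min 1 ((2 powi l * t) ^ L) \<le> 2 ^ L * 2 powr (- 2 * \<epsilon> * \<bar>real_of_int (l - k)\<bar>) * (2 powi l * t) powr s"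
proof -
  define x where "x = 2 powi l * t"
  define d where "d = real_of_int (l - k)"
  have t0: "t > 0" by (rule dyadic_block_pos[OF t])
  have x0: "x > 0" using t0 by (simp add: x_def)
  have xe: "x = 2 powr real_of_int l * t" by (simp add: x_def powr_real_of_int')
  have lo: "2 powr d \<le> x"
  proof -
    have "2 powr d = 2 powr real_of_int l * 2 powr (- real_of_int k)" by (simp add: d_def flip: powr_add)
    also have "\<dots> \<le> x" unfolding xe using t by (intro mult_left_mono) (auto simp: dyadic_block_def)
    finally show ?thesis .
  qed
  have hi: "x \<le> 2 powr (d + 1)"
  proof -
    have "x \<le> 2 powr real_of_int l * 2 powr (1 - real_of_int k)" unfolding xe using t by (intro mult_left_mono) (auto simp: dyadic_block_def)
    also have "\<dots> = 2 powr (d + 1)" by (simp add: d_def algebra_simps flip: powr_add)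
    finally show ?thesis .
  qed
  show ?thesis
  proof (cases "d \<ge> 0")
    case True
    have "2 powr (2 * \<epsilon> * d) \<le> (2 powr d) powr s" using True s by (simp add: powr_powr mult_left_mono mult.commute)
    also have "\<dots> \<le> x powr s" using lo s by (intro powr_mono2) auto
    finally have "2 powr (- 2 * \<epsilon> * d) * 2 powr (2 * \<epsilon> * d) \<le> 2 powr (- 2 * \<epsilon> * d) * x powr s" by (intro mult_left_mono) auto
    then have 1: "1 \<le> 2 powr (- 2 * \<epsilon> * d) * x powr s" by (simp flip: powr_add)
    have "min 1 (x ^ L) \<le> 1 * (2 powr (- 2 * \<epsilon> * d) * x powr s)" using 1 by (simp only: mult_1 min.coboundedI1)
    also have "\<dots> \<le> 2 ^ L * (2 powr (- 2 * \<epsilon> * d) * x powr s)" by (intro mult_right_mono one_le_power) auto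
    finally show ?thesis using True unfolding x_def[symmetric] d_def[symmetric] by (simp only: abs_of_nonneg mult.assoc)
  next
    case False
    have "x powr (real L - s) \<le> (2 powr (d + 1)) powr (real L - s)" using hi x0 s by (intro powr_mono2) auto
    also have "\<dots> = 2 powr (real L - s) * 2 powr (d * (real L - s))" by (simp add: powr_powr algebra_simps flip: powr_add)
    also have "\<dots> \<le> 2 powr real L * 2 powr (- 2 * \<epsilon> * \<bar>d\<bar>)"
    proof (rule mult_mono)
      have "- d * (2 * \<epsilon>) \<le> - d * (real L - s)" using False s by (intro mult_left_mono) auto
      then show "2 powr (d * (real L - s)) \<le> 2 powr (- 2 * \<epsilon> * \<bar>d\<bar>)" using False by (intro powr_mono) (auto simp: algebra_simps)
      show "2 powr (real L - s) \<le> 2 powr real L" using s by (intro powr_mono) auto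
    qed auto
    finally have "x powr (real L - s) * x powr s \<le> 2 powr real L * 2 powr (- 2 * \<epsilon> * \<bar>d\<bar>) * x powr s"
      by (intro mult_right_mono) auto
    moreover have "x powr (real L - s) * x powr s = x ^ L" using x0 by (simp add: powr_realpow flip: powr_add)
    ultimately show ?thesis unfolding x_def[symmetric] d_def[symmetric] by (simp add: powr_realpow min.coboundedI2)
  qed
qed

context littlewood_paley
begin

text \<open>The sum of the absolute values of the differences of all pieces is estimated, not only
  the sum of the series. One bound thus gives both the convergence almost everywhere and the
  inequality.\<close>

lemma differences_upper_bound:
  assumes p: "0 < p" and q: "0 < q" and s: "0 < s" "s < real L"
  shows "\<exists>C>0. \<forall>u\<in>besov_space \<psi> s p q.
    class_diff_converges \<psi> L j u \<and>
    weighted_norm q s (\<lambda>t. Lp_qnorm p (class_diff \<psi> L t j u)) \<le> ennreal C * besov_qnorm \<psi> s p q u"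
proof -
  \<comment> \<open>Half of the available decay, because it is spent twice: once in summing the
    pieces inside \<open>L^p\<close>, once in summing over the blocks.\<close>
  define \<epsilon> where "\<epsilon> = min s (real L - s) / 2"
  have e: "0 < \<epsilon>" "2 * \<epsilon> \<le> s" "2 * \<epsilon> \<le> real L - s" using s by (auto simp: \<epsilon>_def)
  obtain C1 where C1: "C1 > 0" "\<forall>k a. (\<forall>l. a l \<in> borel_measurable lborel) \<longrightarrow>
    Lp_gen lborel p (\<lambda>x :: real^'n. (NS l. a l x)) \<le> ennreal C1 * (SUP l. dyad \<epsilon> (l - k) * Lp_gen lborel p (a l))"
    using Lp_gen_series[OF p e(1), of "lborel :: (real^'n) measure"] by blast
  obtain C2 where C2: "C2 > 0" "\<forall>T l t. tempered T \<longrightarrow> 0 < t \<longrightarrow>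
    Lp_norm p (axis_diff L t j (piece T l)) \<le> ennreal (C2 * min 1 ((2 powi l * t) ^ L)) * pnorm p T l"
    using Lp_diff_piece[OF p, of L j] by blast
  obtain C4 where C4: "C4 > 0" "\<forall>a. lq_qnorm q (\<lambda>k. SUP l. dyad (- \<epsilon>) (l - k) * a l) \<le> ennreal C4 * lq_qnorm q a"
    using lq_qnorm_geometric[OF q e(1)] by blast
  define C where "C = C1 * (C2 * 2 ^ L)"
  have C: "C > 0" using C1 C2 by (simp add: C_def)
  have "class_diff_converges \<psi> L j u \<and>
    weighted_norm q s (\<lambda>t. Lp_qnorm p (class_diff \<psi> L t j u)) \<le> ennreal (C * C4) * besov_qnorm \<psi> s p q u"
    if ub: "u \<in> besov_space \<psi> s p q" for u
  proof -
    let ?cd = "\<lambda>t. class_diff \<psi> L t j u"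
    have um: "u \<in> tempered_mod_poly" and fin: "besov_qnorm \<psi> s p q u < \<infinity>" using ub by (auto simp: besov_space_def)
    obtain T where Tu: "T \<in> u" using class_nonempty[OF um] by blast
    have T: "tempered T" by (rule lp_piece_eq(1)[OF um Tu])
    note pc = lp_piece_eq(2)[OF um Tu]
    have [measurable]: "piece T l \<in> borel_funs" for l by (rule piece_measurable[OF T])
    define a where "a l = ennreal (2 powr (of_int l * s)) * pnorm p T l" for l
    define b where "b k = (SUP l. dyad (- \<epsilon>) (l - k) * a l)" for k
    define V where "V t l x = enorm (axis_diff L t j (piece T l) x)" for t l x
    define S where "S t x = (NS l. V t l x)" for t x
    have Vpair: "(\<lambda>(t, x). axis_diff L t j (piece T l) x) \<in> borel_measurable (borel \<Otimes>\<^sub>M borel)" for l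
      unfolding axis_diff_def by (rule iter_diff_measurable_pair) measurable
    have Vm [measurable]: "V t l \<in> borel_funs" for t l unfolding V_def axis_diff_def by measurable
    have Sm [measurable]: "S t \<in> borel_funs" for t
      unfolding S_def[abs_def] by (intro borel_measurable_nn_integral_int Vm)
    have bes: "besov_qnorm \<psi> s p q u = lq_qnorm q a" unfolding besov_qnorm_eq[OF um Tu p] a_def ..
    have lqb: "lq_qnorm q b \<le> ennreal C4 * lq_qnorm q a" unfolding b_def using C4(2) by blast
    have bfin: "b k < \<infinity>" for k
    proof -
      have "b k \<le> lq_qnorm q b" by (rule le_lq_qnorm[OF q])
      also note lqb
      also have "ennreal C4 * lq_qnorm q a < \<infinity>" using fin by (simp add: bes ennreal_mult_less_top)
      finally show ?thesis .
    qed
    have key: "Lp_gen lborel p (S t) \<le> ennreal (t powr s) * (ennreal C * b k)" if t: "t \<in> dyadic_block k" for t k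
    proof -
      let ?c = "t powr s * (C2 * 2 ^ L)"
      have t0: "t > 0" by (rule dyadic_block_pos[OF t])
      have "Lp_gen lborel p (S t) \<le> ennreal C1 * (SUP l. dyad \<epsilon> (l - k) * Lp_gen lborel p (V t l))"
        unfolding S_def using C1(2) Vm by simp
      also have "\<dots> \<le> ennreal C1 * (ennreal ?c * b k)"
      proof (intro mult_left_mono SUP_least)
        fix l
        let ?d = "\<bar>real_of_int (l - k)\<bar>"
        let ?e = "2 powr (\<epsilon> * ?d)" and ?m = "C2 * min 1 ((2 powi l * t) ^ L)"
        have "ennreal ?e * Lp_gen lborel p (V t l)
            \<le> ennreal ?e * (ennreal ?m * pnorm p T l)"
          unfolding V_def using C2(2) T t0 by (intro mult_left_mono) auto
        also have "\<dots> = ennreal (?e * ?m) * pnorm p T l" using C2 t0 by (simp add: mult.assoc ennreal_mult)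
        also have "\<dots> \<le> ennreal (?c * (2 powr (- \<epsilon> * ?d) * 2 powr (real_of_int l * s))) * pnorm p T l"
        proof (intro mult_right_mono ennreal_leI)
          have x: "(2 powi l * t) powr s = 2 powr (real_of_int l * s) * t powr s"
            using t0 by (simp add: powr_mult powr_real_of_int' powr_powr[symmetric])
          have "?e * ?m
            \<le> ?e * (C2 * (2 ^ L * 2 powr (- 2 * \<epsilon> * ?d) * (2 powi l * t) powr s))"
            using C2 dyadic_difference_weight[OF t e, of l] by (intro mult_left_mono) auto
          also have "\<dots> = (?e * 2 powr (- 2 * \<epsilon> * ?d)) * (?c * 2 powr (real_of_int l * s))"
            unfolding x by (simp only: mult_ac)
          also have "?e * 2 powr (- 2 * \<epsilon> * ?d) = 2 powr (- \<epsilon> * ?d)" by (simp flip: powr_add)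
          finally show "?e * ?m \<le> ?c * (2 powr (- \<epsilon> * ?d) * 2 powr (real_of_int l * s))" by (simp only: mult_ac)
        qed auto
        also have "\<dots> = ennreal ?c * (ennreal (2 powr (- \<epsilon> * ?d)) * a l)"
          using C2 by (simp add: a_def mult.assoc ennreal_mult)
        also have "\<dots> \<le> ennreal ?c * b k" unfolding b_def by (intro mult_left_mono SUP_upper) auto
        finally show "ennreal ?e * Lp_gen lborel p (V t l) \<le> ennreal ?c * b k" .
      qed auto
      also have "\<dots> = ennreal (C1 * ?c) * b k"
        using C1 C2 by (simp only: ennreal_mult mult.assoc less_imp_le powr_ge_zero zero_le_power zero_le_numeral mult_nonneg_nonneg)
      also have "C1 * ?c = t powr s * C" by (simp add: C_def)
      also have "ennreal (t powr s * C) * b k = ennreal (t powr s) * (ennreal C * b k)"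
        using C by (simp add: ennreal_mult mult.assoc)
      finally show ?thesis .
    qed
    have block: "t \<in> dyadic_block (- \<lfloor>log 2 t\<rfloor>)" if "t > 0" for t using dyadic_block_iff[OF that] by simp
    have conv: "AE x in lborel. S t x < \<infinity>" if "t > 0" for t
    proof (rule Lp_gen_finite_AE[OF p])
      have "Lp_gen lborel p (S t) \<le> ennreal (t powr s) * (ennreal C * b (- \<lfloor>log 2 t\<rfloor>))" by (rule key[OF block[OF that]])
      also have "\<dots> < \<infinity>" using bfin by (simp add: ennreal_mult_less_top)
      finally show "Lp_gen lborel p (S t) < \<infinity>" .
    qed simp
    have ccv: "class_diff_converges \<psi> L j u" unfolding class_diff_converges_def
    proof (rule AE_I2, rule impI)
      fix t :: real assume t: "t > 0"
      have "AE x in lborel. (\<lambda>l. axis_diff L t j (lp_piece \<psi> l u) x) summable_on UNIV"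
        using conv[OF t] unfolding pc S_def V_def summable_on_int(1) .
      then show "AE x in lebesgue. (\<lambda>l. axis_diff L t j (lp_piece \<psi> l u) x) summable_on UNIV" by (rule AE_completion)
    qed
    \<comment> \<open>Where absolute convergence fails \<open>infsum\<close> is \<open>0\<close>, so
      \<open>class_diff\<close> is an ordinary series cut by a jointly measurable condition. Joint
      measurability in \<open>t\<close> and \<open>x\<close> is required for the essential supremum
      over \<open>t\<close>.\<close>
    have cd: "?cd t x = (if S t x < \<infinity> then \<Sum>n. axis_diff L t j (piece T (int_decode n)) x else 0)" for t x
    proof (cases "S t x < \<infinity>")
      case True
      then show ?thesis unfolding class_diff_def pc using summable_on_int(3) by (simp add: S_def V_def)
    next
      case False
      then have "\<not> (\<lambda>l. axis_diff L t j (piece T l) x) summable_on UNIV" unfolding summable_on_int(1) by (simp add: S_def V_def)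
      then show ?thesis unfolding class_diff_def pc using False by (simp add: infsum_not_exists)
    qed
    have pair: "(\<lambda>(t, x). ?cd t x) \<in> borel_measurable (borel \<Otimes>\<^sub>M borel)"
    proof -
      have [measurable]: "(\<lambda>z. axis_diff L (fst z) j (piece T l) (snd z)) \<in> borel_measurable (borel \<Otimes>\<^sub>M borel)" for l
        using Vpair[of l] by (simp add: case_prod_beta')
      have [measurable]: "(\<lambda>z. S (fst z) (snd z)) \<in> borel_measurable (borel \<Otimes>\<^sub>M borel)"
        unfolding S_def V_def by (intro borel_measurable_nn_integral_int) measurable
      show ?thesis unfolding cd case_prod_beta' by measurable
    qed
    have cdm: "?cd t \<in> borel_funs" for t using measurable_compose[OF measurable_Pair1' pair, of t] by simp
    have Leq: "Lp_qnorm p (?cd t) = Lp_norm p (?cd t)" for t by (rule Lp_qnorm_eq[OF p cdm])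
    have le: "ennreal (t powr (- s)) * Lp_qnorm p (?cd t) \<le> ennreal C * b k" if t: "t \<in> dyadic_block k" for t k
    proof -
      have t0: "t > 0" by (rule dyadic_block_pos[OF t])
      have "Lp_norm p (?cd t) \<le> Lp_gen lborel p (S t)"
      proof (intro Lp_gen_mono_AE p AE_I2)
        show "enorm (?cd t x) \<le> S t x" for x
          unfolding class_diff_def pc S_def V_def by (rule summable_on_int(2))
      qed (use cdm in measurable)
      also note key[OF t]
      finally have "ennreal (t powr (- s)) * Lp_qnorm p (?cd t) \<le> ennreal (t powr (- s)) * (ennreal (t powr s) * (ennreal C * b k))"
        unfolding Leq by (intro mult_left_mono) auto
      also have "\<dots> = ennreal C * b k"
        using t0 unfolding mult.assoc[of "ennreal (t powr (- s))", symmetric] by (simp flip: ennreal_mult powr_add)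
      finally show ?thesis .
    qed
    have cb: "lq_qnorm q (\<lambda>k. ennreal C * b k) \<le> ennreal (C * C4) * besov_qnorm \<psi> s p q u"
    proof -
      have "lq_qnorm q (\<lambda>k. ennreal C * b k) \<le> ennreal C * lq_qnorm q b" by (rule lq_qnorm_cmult_le[OF q])
      also have "\<dots> \<le> ennreal C * (ennreal C4 * lq_qnorm q a)" by (intro mult_left_mono lqb) auto
      also have "\<dots> = ennreal (C * C4) * lq_qnorm q a" using C C4 by (simp add: ennreal_mult mult.assoc)
      finally show ?thesis unfolding bes .
    qed
    have "weighted_norm q s (\<lambda>t. Lp_qnorm p (?cd t)) \<le> lq_qnorm q (\<lambda>k. ennreal C * b k)"
    proof (cases "q = \<infinity>")
      case True
      let ?F = "\<lambda>t. ennreal (t powr (- s)) * Lp_qnorm p (?cd t)"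
      have "weighted_esssup s (\<lambda>t. Lp_qnorm p (?cd t)) \<le> (SUP k. ennreal C * b k)" unfolding weighted_esssup_def
      proof (rule esssup_I)
        have "(\<lambda>t. Lp_norm p (?cd t)) \<in> borel_funs"
          by (rule Lp_gen_measurable) (use pair in \<open>simp add: case_prod_beta'\<close>)
        then have "?F \<in> borel_funs" unfolding Leq by measurable
        then have "?F \<in> borel_measurable lebesgue" by (intro measurable_completion) simp
        then show "?F \<in> borel_measurable (restrict_space lebesgue {0<..})" by (rule measurable_restrict_space1)
        show "AE t in restrict_space lebesgue {0<..}. ?F t \<le> (SUP k. ennreal C * b k)"
        proof (rule AE_I2)
          fix t :: real assume "t \<in> space (restrict_space lebesgue {0<..})"
          then have "t > 0" by (simp add: space_restrict_space)
          from le[OF block[OF this]] show "?F t \<le> (SUP k. ennreal C * b k)" by (rule order_trans) (rule SUP_upper, simp)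
        qed
      qed
      then show ?thesis using True by (simp add: weighted_norm_def lq_qnorm_def)
    next
      case False
      then show ?thesis using weighted_integral_le[OF q False le] by (simp add: weighted_norm_def)
    qed
    also note cb
    finally show ?thesis using ccv by blast
  qed
  moreover have "C * C4 > 0" using C C4 by simp
  ultimately show ?thesis by blast
qed

end

section \<open>Reconstruction from differences\<close>

text \<open>The normalised steps \<open>2^k * t_j\<close>: with \<open>t_j\<close> in block
  \<open>k + 5\<close> they lie between \<open>2^-5\<close> and \<open>2^-4\<close>.\<close>

definition step_box :: "(real^'n::finite) set" where
  "step_box = {\<tau>. \<forall>i. 1/32 \<le> \<tau> $ i \<and> \<tau> $ i \<le> 1/16}"

definition step :: "real^'n::finite \<Rightarrow> 'n \<Rightarrow> real^'n" where
  "step \<tau> j = (\<tau> $ j) *\<^sub>R axis j 1"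

text \<open>The common denominator in the reconstruction. The even exponent makes each summand the
  product of \<open>(cexp v \<xi> - 1) ^ L\<close> with its conjugate, hence a smooth function of
  the frequency.\<close>

definition diff_sum :: "nat \<Rightarrow> real^'n::finite \<Rightarrow> real^'n \<Rightarrow> real" where
  "diff_sum L \<tau> \<xi> = (\<Sum>j\<in>UNIV. norm (cexp (step \<tau> j) \<xi> - 1) ^ (2 * L))"

lemma diff_sum_eq:
  "complex_of_real (diff_sum L \<tau> \<xi>) = (\<Sum>j\<in>UNIV. (cexp (step \<tau> j) \<xi> - 1) ^ L * (cexp (- step \<tau> j) \<xi> - 1) ^ L)"
proof -
  have "(cexp v \<xi> - 1) ^ L * (cexp (- v) \<xi> - 1) ^ L = complex_of_real (norm (cexp v \<xi> - 1) ^ (2 * L))" for v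
  proof -
    have "cexp (- v) \<xi> = cnj (cexp v \<xi>)" by (simp add: cexp_def exp_cnj)
    then have "(cexp v \<xi> - 1) * (cexp (- v) \<xi> - 1) = complex_of_real ((norm (cexp v \<xi> - 1))\<^sup>2)"
      using complex_norm_square[of "cexp v \<xi> - 1"] by simp
    then show ?thesis by (simp only: power_mult_distrib[symmetric] power_mult of_real_power)
  qed
  then show ?thesis by (simp add: diff_sum_def)
qed

lemma diff_sum_nonneg: "0 \<le> diff_sum L \<tau> \<xi>"
  unfolding diff_sum_def by (intro sum_nonneg) auto

lemma diff_sum_pos:
  assumes \<tau>: "\<tau> \<in> step_box" and \<xi>: "0 < norm \<xi>" "norm \<xi> \<le> 4"
  shows "0 < diff_sum L \<tau> \<xi>"
proof (rule ccontr)
  assume "\<not> ?thesis"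
  then have "diff_sum L \<tau> \<xi> = 0" using diff_sum_nonneg[of L \<tau> \<xi>] by linarith
  then have z: "norm (cexp (step \<tau> j) \<xi> - 1) ^ (2 * L) = 0" for j
    unfolding diff_sum_def by (subst (asm) sum_nonneg_eq_0_iff) auto
  have "\<xi> $ j = 0" for j
  proof -
    have "cexp (step \<tau> j) \<xi> = 1" using z[of j] by (simp only: power_eq_0_iff norm_eq_zero) simp
    then obtain m :: int where m: "2 * pi * (\<tau> $ j * \<xi> $ j) = of_int (2 * m) * pi"
      by (auto simp: cexp_def step_def exp_eq_1 inner_axis' mult.assoc)
    then have e: "\<tau> $ j * \<xi> $ j = of_int m" by simp
    have t: "1/32 \<le> \<tau> $ j" "\<tau> $ j \<le> 1/16" using \<tau> by (auto simp: step_box_def)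
    \<comment> \<open>The character equals \<open>1\<close> only if this product is an integer;
      being at most \<open>1/4\<close> in size, it must be zero. This is where the upper end
      \<open>1/16\<close> of the box matters.\<close>
    have "\<bar>\<tau> $ j * \<xi> $ j\<bar> \<le> 1/16 * 4"
      unfolding abs_mult using t order_trans[OF component_le_norm_cart \<xi>(2)] by (intro mult_mono) auto
    then have "m = 0" unfolding e by linarith
    then show ?thesis using e t by simp
  qed
  then have "\<xi> = 0" by (simp add: vec_eq_iff)
  then show False using \<xi> by simp
qed

text \<open>A continuous positive function on the compact product of the box and a closed annulus
  attains a positive minimum. This makes the constants uniform in the choice of the steps.\<close>

lemma diff_sum_bound: "\<exists>c>0. \<forall>\<tau>\<in>step_box. \<forall>\<xi> :: real^'n::finite. 1/4 \<le> norm \<xi> \<longrightarrow> norm \<xi> \<le> 4 \<longrightarrow> c \<le> diff_sum L \<tau> \<xi>"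
proof -
  let ?K = "(step_box :: (real^'n) set) \<times> (cball 0 4 - ball (0 :: real^'n) (1/4))"
  have "(step_box :: (real^'n) set) = cbox (\<chi> i. 1/32) (\<chi> i. 1/16)" by (auto simp: step_box_def mem_box_cart)
  then have "compact (step_box :: (real^'n) set)" using compact_cbox by metis
  then have "compact ?K" by (intro compact_Times compact_diff) auto
  moreover have "((\<chi> i. 1/32), axis undefined 1) \<in> ?K" by (simp add: step_box_def)
  then have "?K \<noteq> {}" by blast
  moreover have "continuous_on ?K (\<lambda>z. diff_sum L (fst z) (snd z))"
    unfolding diff_sum_def cexp_def step_def by (intro continuous_intros)
  ultimately obtain z where z: "z \<in> ?K" "\<forall>y\<in>?K. diff_sum L (fst z) (snd z) \<le> diff_sum L (fst y) (snd y)"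
    using continuous_attains_inf by blast
  have "0 < diff_sum L (fst z) (snd z)"
  proof (rule diff_sum_pos)
    have "1/4 \<le> norm (snd z)" using z(1) by auto
    then show "0 < norm (snd z)" by linarith
  qed (use z(1) in auto)
  moreover have "diff_sum L (fst z) (snd z) \<le> diff_sum L \<tau> \<xi>" if "\<tau> \<in> step_box" "1/4 \<le> norm \<xi>" "norm \<xi> \<le> 4" for \<tau> and \<xi> :: "real^'n"
    using z(2)[rule_format, of "(\<tau>, \<xi>)"] that by simp
  ultimately show ?thesis by blast
qed

lemma growth_step:
  fixes j :: "'n::finite"
  shows "growth k 0 step_box (\<lambda>\<tau> \<xi>. (cexp (c *\<^sub>R step \<tau> j) \<xi> - 1) ^ L)"
proof (intro growth_power0 growth_diff growth_cexp[where B="\<bar>c\<bar>"] growth_const[where B=1])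
  fix \<tau> :: "real^'n" assume "\<tau> \<in> step_box"
  then have "1/32 \<le> \<tau> $ j" "\<tau> $ j \<le> 1/16" by (auto simp: step_box_def)
  then have "\<bar>c\<bar> * \<bar>\<tau> $ j\<bar> \<le> \<bar>c\<bar> * 1" by (intro mult_left_mono) auto
  then show "norm (c *\<^sub>R step \<tau> j) \<le> \<bar>c\<bar>" by (simp add: step_def abs_mult)
qed simp

lemma inv_fourier_sum:
  assumes "\<And>i. i \<in> A \<Longrightarrow> schwartz (a i)"
  shows "inv_fourier (\<lambda>\<xi>. \<Sum>i\<in>A. a i \<xi>) x = (\<Sum>i\<in>A. inv_fourier (a i) x)"
  unfolding inv_fourier_def sum_distrib_right
  by (intro Bochner_Integration.integral_sum schwartz_integrable schwartz_mult_cexp assms)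

text \<open>In place of Hoelder's inequality: \<open>norm G \<le> 1 + norm G ^ p\<close>, and the
  kernel is both integrable and bounded. It is here that \<open>p \<ge> 1\<close> makes differences
  of \<open>g\<close> accessible to convolution.\<close>

lemma integrable_mult_Lp:
  fixes G K :: "'n::finite cfun"
  assumes K: "schwartz K" and [measurable]: "G \<in> borel_funs" and p: "1 \<le> p" and fin: "Lp_norm p G < \<infinity>"
  shows "integrable lborel (\<lambda>y. K (x - y) * G y)"
proof (rule integrableI_bounded)
  have k: "schwartz (\<lambda>y. K (x - y))" by (rule schwartz_reflect[OF K])
  have [measurable]: "(\<lambda>y. K (x - y)) \<in> borel_funs" by (rule schwartz_measurable[OF k])
  show "(\<lambda>y. K (x - y) * G y) \<in> borel_measurable lborel" by measurable
  have kf: "(NN y. enorm (K (x - y))) < \<infinity>" using schwartz_integrable[OF k] by (simp add: integrable_iff_bounded)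
  obtain B where B: "B > 0" "\<forall>y. norm (K y) \<le> B" using schwartz_bounded[OF K] by blast
  show "(NN y. enorm (K (x - y) * G y)) < \<infinity>"
  proof (cases "p = \<infinity>")
    case True
    have "AE y in lborel. enorm (G y) \<le> Lp_norm p G" unfolding True by (simp add: Lp_gen_def esssup_AE)
    then have "AE y in lborel. enorm (K (x - y) * G y) \<le> enorm (K (x - y)) * Lp_norm p G"
      by eventually_elim (simp add: norm_mult ennreal_mult mult_left_mono)
    then have "(NN y. enorm (K (x - y) * G y)) \<le> (NN y. enorm (K (x - y)) * Lp_norm p G)"
      by (rule nn_integral_mono_AE)
    also have "\<dots> = (NN y. enorm (K (x - y))) * Lp_norm p G" by (rule nn_integral_multc) measurable
    also have "\<dots> < \<infinity>" using kf fin by (simp add: ennreal_mult_less_top)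
    finally show ?thesis .
  next
    case False
    define r where "r = enn2real p"
    have p0: "0 < p" using p by (metis less_le_trans zero_less_one)
    have r: "r \<ge> 1"
    proof -
      have "p = ennreal r" "r \<ge> 0" using False by (auto simp: r_def less_top)
      then show ?thesis using p by (simp add: ennreal_1[symmetric] del: ennreal_1)
    qed
    have "enorm (K (x - y) * G y) \<le> enorm (K (x - y)) + ennreal B * epowr (enorm (G y)) r" for y
    proof -
      have "enorm (K (x - y) * G y) = enorm (K (x - y)) * enorm (G y)" by (simp add: norm_mult ennreal_mult)
      also have "\<dots> \<le> enorm (K (x - y)) * (1 + epowr (enorm (G y)) r)"
        using ennreal_young[OF r, of 1 "enorm (G y)"] by (intro mult_left_mono) auto
      also have "\<dots> \<le> enorm (K (x - y)) + ennreal B * epowr (enorm (G y)) r"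
        unfolding distrib_left mult_1_right using B by (intro add_left_mono mult_right_mono ennreal_leI) auto
      finally show ?thesis .
    qed
    then have "(NN y. enorm (K (x - y) * G y))
        \<le> (NN y. enorm (K (x - y)) + ennreal B * epowr (enorm (G y)) r)" by (intro nn_integral_mono) auto
    also have "\<dots> = (NN y. enorm (K (x - y))) + ennreal B * epowr (Lp_norm p G) r"
      unfolding r_def Lp_gen_power[OF p0 False] by (simp add: nn_integral_add nn_integral_cmult)
    also have "\<dots> < \<infinity>" using kf ennreal_powr_finite[OF fin, of r] by (simp add: ennreal_mult_less_top)
    finally show ?thesis .
  qed
qed

lemma Lp_norm_sum:
  assumes "0 < p" "finite A"
  shows "\<exists>C>0. \<forall>f :: 'i \<Rightarrow> 'n::finite cfun. (\<forall>i\<in>A. f i \<in> borel_funs) \<longrightarrow>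
    Lp_norm p (\<lambda>x. \<Sum>i\<in>A. f i x) \<le> ennreal C * (\<Sum>i\<in>A. Lp_norm p (f i))"
proof -
  obtain C where C: "C > 0" "\<forall>f. (\<forall>i\<in>A. f i \<in> borel_measurable lborel) \<longrightarrow>
    Lp_gen lborel p (\<lambda>x::real^'n. \<Sum>i\<in>A. f i x) \<le> ennreal C * (\<Sum>i\<in>A. Lp_gen lborel p (f i))"
    using Lp_gen_sum[OF assms, of "lborel :: (real^'n) measure"] by blast
  have "Lp_norm p (\<lambda>x. \<Sum>i\<in>A. f i x) \<le> ennreal C * (\<Sum>i\<in>A. Lp_norm p (f i))"
    if [measurable]: "\<And>i. i \<in> A \<Longrightarrow> f i \<in> borel_funs" for f :: "'i \<Rightarrow> 'n cfun"
  proof -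
    have "Lp_norm p (\<lambda>x. \<Sum>i\<in>A. f i x) \<le> Lp_gen lborel p (\<lambda>x. \<Sum>i\<in>A. enorm (f i x))"
    proof (intro Lp_gen_mono_AE assms(1) AE_I2)
      show "enorm (\<Sum>i\<in>A. f i x) \<le> (\<Sum>i\<in>A. enorm (f i x))" for x by (simp add: sum_ennreal norm_sum ennreal_leI)
    qed measurable
    also have "\<dots> \<le> ennreal C * (\<Sum>i\<in>A. Lp_norm p (f i))" by (intro C(2)[rule_format]) measurable
    finally show ?thesis .
  qed
  then show ?thesis using C(1) by (intro exI[of _ C]) auto
qed

context littlewood_paley
begin

text \<open>The coefficient of the \<open>j\<close>-th difference. The character with the opposite
  step is the conjugate, so the sum over \<open>j\<close> reproduces \<open>diff_sum\<close> and
  cancels the denominator. The two \<open>bump\<close> terms vanish on the support of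
  \<open>\<Psi>\<close>; elsewhere they keep the denominator away from zero, so that its inverse is
  smooth everywhere.\<close>

definition diff_mult :: "nat \<Rightarrow> 'n \<Rightarrow> real^'n \<Rightarrow> 'n cfun" where
  "diff_mult L j \<tau> \<xi> = \<Psi> \<xi> * ((cexp ((-1) *\<^sub>R step \<tau> j) \<xi> - 1) ^ L
     * inverse (of_real (diff_sum L \<tau> \<xi>) + (1 - bump ((1/2) *\<^sub>R \<xi>)) + bump (4 *\<^sub>R \<xi>)))"

lemma diff_mult_support: "diff_mult L j \<tau> \<xi> \<noteq> 0 \<Longrightarrow> norm \<xi> < 2"
  using Psi_support[of \<xi>] by (auto simp: diff_mult_def)

lemma schwartz_family_diff_mult: "schwartz_family step_box (diff_mult L j)"
proof -
  let ?E = "\<lambda>\<tau> \<xi>. of_real (diff_sum L \<tau> \<xi>) + (1 - bump ((1/2) *\<^sub>R \<xi>)) + bump (4 *\<^sub>R \<xi>)"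
  have s1: "growth k 0 step_box (\<lambda>\<tau> \<xi>. (cexp (step \<tau> j) \<xi> - 1) ^ L * (cexp (- step \<tau> j) \<xi> - 1) ^ L)" for k and j :: 'n
    using growth_mult[OF growth_step[of k 1 j L] growth_step[of k "-1" j L]] by simp
  have b: "growth k 0 step_box (\<lambda>_ \<xi>. bump (c *\<^sub>R \<xi>))" if "c \<noteq> 0" for k and c
    by (intro schwartz_imp_growth schwartz_bump_scale that)
  have E: "growth k 0 step_box ?E" for k
    unfolding diff_sum_eq by (intro growth_add growth_sum s1 growth_diff growth_const[where B=1] b) auto
  obtain c where c: "c > 0" "\<forall>\<tau>\<in>step_box. \<forall>\<xi> :: real^'n. 1/4 \<le> norm \<xi> \<longrightarrow> norm \<xi> \<le> 4 \<longrightarrow> c \<le> diff_sum L \<tau> \<xi>"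
    using diff_sum_bound by blast
  \<comment> \<open>Near the origin the second \<open>bump\<close> term is \<open>1\<close>, far
    away the term \<open>1 - bump\<close> is, and in between \<open>diff_sum_bound\<close> applies;
    all three contributions are nonnegative.\<close>
  have low: "min c 1 * (1 + norm \<xi>) powr 0 \<le> norm (?E \<tau> \<xi>)" if \<tau>: "\<tau> \<in> step_box" for \<tau> \<xi>
  proof -
    obtain b1 where b1: "0 \<le> b1" "b1 \<le> 1" "bump ((1/2) *\<^sub>R \<xi>) = complex_of_real b1" using bump_real by blast
    obtain b2 where b2: "0 \<le> b2" "b2 \<le> 1" "bump (4 *\<^sub>R \<xi>) = complex_of_real b2" using bump_real by blast
    have "?E \<tau> \<xi> = complex_of_real (diff_sum L \<tau> \<xi> + (1 - b1) + b2)" by (simp add: b1 b2)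
    then have n: "norm (?E \<tau> \<xi>) = diff_sum L \<tau> \<xi> + (1 - b1) + b2"
      using diff_sum_nonneg[of L \<tau> \<xi>] b1 b2 by (simp only: norm_of_real)
    consider "norm \<xi> < 1/4" | "1/4 \<le> norm \<xi>" "norm \<xi> \<le> 4" | "norm \<xi> > 4" by linarith
    then have "min c 1 \<le> norm (?E \<tau> \<xi>)"
    proof cases
      case 1
      then have "bump (4 *\<^sub>R \<xi>) = 1" by (intro bump_one) simp
      then have "b2 = 1" using b2 by simp
      then show ?thesis unfolding n using b1 diff_sum_nonneg[of L \<tau> \<xi>] by simp
    next
      case 2
      then show ?thesis unfolding n using c(2) \<tau> b1 b2 by (metis add.commute add_increasing diff_ge_0_iff_ge min.coboundedI1)
    next
      case 3
      then have "bump ((1/2) *\<^sub>R \<xi>) = 0" by (intro bump_zero) simp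
      then have "b1 = 0" using b1 by simp
      then show ?thesis unfolding n using b2 diff_sum_nonneg[of L \<tau> \<xi>] by simp
    qed
    then show ?thesis by simp
  qed
  have "growth k (- 0) step_box (\<lambda>\<tau> \<xi>. inverse (?E \<tau> \<xi>))" for k
    by (rule growth_inverse[OF E _ low]) (use c in auto)
  from growth_mult[OF growth_step[where c="-1"] this]
  have "growth k 0 step_box (\<lambda>\<tau> \<xi>. (cexp ((-1) *\<^sub>R step \<tau> j) \<xi> - 1) ^ L * inverse (?E \<tau> \<xi>))" for k by simp
  from schwartz_family_mult[OF schwartz_imp_family[OF schwartz_Psi] this]
  show ?thesis unfolding diff_mult_def[abs_def] .
qed

lemma diff_mult_sum:
  assumes \<tau>: "\<tau> \<in> step_box"
  shows "(\<Sum>j\<in>UNIV. diff_mult L j \<tau> \<xi> * (cexp (step \<tau> j) \<xi> - 1) ^ L) = \<Psi> \<xi>"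
proof (cases "\<Psi> \<xi> = 0")
  case False
  then have \<xi>: "1/2 \<le> norm \<xi>" "norm \<xi> < 2" using Psi_support by auto
  let ?D = "complex_of_real (diff_sum L \<tau> \<xi>)"
  have "0 < norm \<xi>" using \<xi>(1) by linarith
  from diff_sum_pos[OF \<tau> this, of L] \<xi> have D: "?D \<noteq> 0" by simp
  have "bump ((1/2) *\<^sub>R \<xi>) = 1" "bump (4 *\<^sub>R \<xi>) = 0" using \<xi> by (auto intro!: bump_one bump_zero)
  then have "(\<Sum>j\<in>UNIV. diff_mult L j \<tau> \<xi> * (cexp (step \<tau> j) \<xi> - 1) ^ L)
      = (\<Sum>j\<in>UNIV. (\<Psi> \<xi> * inverse ?D) * ((cexp (step \<tau> j) \<xi> - 1) ^ L * (cexp (- step \<tau> j) \<xi> - 1) ^ L))"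
    by (intro sum.cong refl) (simp add: diff_mult_def)
  also have "\<dots> = \<Psi> \<xi> * inverse ?D * ?D" unfolding diff_sum_eq sum_distrib_left ..
  finally show ?thesis using D by simp
qed (simp add: diff_mult_def)

lemma lp_mult_differences:
  assumes t: "\<And>j. t $ j \<in> dyadic_block (k + 5)"
  shows "(2 powi k) *\<^sub>R t \<in> step_box"
    and "lp_mult k \<xi> = (\<Sum>j\<in>UNIV. scaled (diff_mult L j ((2 powi k) *\<^sub>R t)) k \<xi> * (cexp (step t j) \<xi> - 1) ^ L)"
proof -
  let ?\<tau> = "(2 powi k) *\<^sub>R t"
  show \<tau>: "?\<tau> \<in> step_box"
  proof -
    have "1/32 \<le> 2 powi k * t $ j \<and> 2 powi k * t $ j \<le> 1/16" for j
    proof -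
      have 1: "2 powr real_of_int k * 2 powr (- real_of_int (k + 5)) = 1/32"
        "2 powr real_of_int k * 2 powr (1 - real_of_int (k + 5)) = 1/16" by (simp_all add: powr_minus flip: powr_add)
      have "2 powr real_of_int k * 2 powr (- real_of_int (k + 5)) \<le> 2 powr real_of_int k * t $ j"
        "2 powr real_of_int k * t $ j \<le> 2 powr real_of_int k * 2 powr (1 - real_of_int (k + 5))"
        using t[of j] by (auto simp: dyadic_block_def simp del: of_int_add)
      then have "1/32 \<le> 2 powr real_of_int k * t $ j \<and> 2 powr real_of_int k * t $ j \<le> 1/16" unfolding 1 by (rule conjI)
      then show ?thesis by (simp add: powr_real_of_int')
    qed
    then show ?thesis by (simp add: step_box_def)
  qed
  have "cexp (step ?\<tau> j) ((2 powi (- k)) *\<^sub>R \<xi>) = cexp (step t j) \<xi>" for j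
  proof -
    have "step ?\<tau> j = (2 powi k) *\<^sub>R step t j" by (simp add: step_def)
    then show ?thesis by (simp only: cexp_scaleR) (simp add: power_int_minus)
  qed
  then show "lp_mult k \<xi> = (\<Sum>j\<in>UNIV. scaled (diff_mult L j ?\<tau>) k \<xi> * (cexp (step t j) \<xi> - 1) ^ L)"
    using diff_mult_sum[OF \<tau>, of L "(2 powi (- k)) *\<^sub>R \<xi>"] by (simp add: lp_mult_def scaled_def)
qed

lemma piece_sum:
  fixes b :: "'j::finite \<Rightarrow> 'n cfun"
  assumes T: "tempered T" and b: "\<And>j. schwartz (b j)" and eq: "\<And>\<xi>. lp_mult k \<xi> = (\<Sum>j\<in>UNIV. b j \<xi>)"
  shows "piece T k = (\<lambda>x. \<Sum>j\<in>UNIV. fourier_op (b j) T x)"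
proof
  fix x
  have "inv_fourier (lp_mult k) = inv_fourier (\<lambda>\<xi>. \<Sum>j\<in>UNIV. b j \<xi>)" by (rule arg_cong[where f=inv_fourier]) (rule ext, rule eq)
  also have "\<dots> = (\<lambda>x. \<Sum>j\<in>UNIV. inv_fourier (b j) x)" by (rule ext, rule inv_fourier_sum[OF b])
  finally show "piece T k x = (\<Sum>j\<in>UNIV. fourier_op (b j) T x)"
    using schwartz_convolution_sum[OF T, of UNIV "\<lambda>j. inv_fourier (b j)" x] schwartz_inv_fourier[OF b] by simp
qed

text \<open>For \<open>p \<ge> 1\<close> the differences of \<open>g\<close> can be integrated
  against the kernels, so a piece is a sum of convolutions with differences of \<open>g\<close>
  itself and Young's inequality concludes. No condition on the smoothness enters.\<close>

lemma piece_le_differences: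
  assumes p: "1 \<le> p"
  shows "\<exists>C>0. \<forall>T g k t. tempered T \<longrightarrow> represents g T \<longrightarrow> (\<forall>j. t $ j \<in> dyadic_block (k + 5)) \<longrightarrow>
    pnorm p T k \<le> ennreal C * diff_norms p L t g"
proof -
  have p0: "0 < p" using p by (metis less_le_trans zero_less_one)
  obtain C1 where C1: "C1 > 0" "\<forall>f. (\<forall>j\<in>UNIV. f j \<in> borel_measurable lborel) \<longrightarrow>
    Lp_gen lborel p (\<lambda>x::real^'n. \<Sum>j\<in>(UNIV :: 'n set). f j x) \<le> ennreal C1 * (\<Sum>j\<in>UNIV. Lp_gen lborel p (f j))"
    using Lp_gen_sum[OF p0 finite, where M="lborel :: (real^'n) measure"] by blast
  have "\<exists>C>0. \<forall>\<tau>\<in>step_box. \<forall>l V. V \<in> borel_funs \<longrightarrow>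
    Lp_gen lborel p (\<lambda>x. (NN y. enorm (inv_fourier (scaled (diff_mult L j \<tau>) l) (x - y)) * V y)) \<le> ennreal C * Lp_gen lborel p V" for j
    by (rule Lp_kernel_convolution[OF schwartz_family_diff_mult p])
  then have "\<forall>j. \<exists>C>0. \<forall>\<tau>\<in>step_box. \<forall>l V. V \<in> borel_funs \<longrightarrow>
    Lp_gen lborel p (\<lambda>x. (NN y. enorm (inv_fourier (scaled (diff_mult L j \<tau>) l) (x - y)) * V y)) \<le> ennreal C * Lp_gen lborel p V" ..
  from choice[OF this] obtain c where c: "\<forall>j. c j > 0 \<and> (\<forall>\<tau>\<in>step_box. \<forall>l V. V \<in> borel_funs \<longrightarrow>
    Lp_gen lborel p (\<lambda>x. (NN y. enorm (inv_fourier (scaled (diff_mult L j \<tau>) l) (x - y)) * V y)) \<le> ennreal (c j) * Lp_gen lborel p V)"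
    by (elim exE)
  define C2 where "C2 = (\<Sum>j\<in>UNIV. c j)"
  have C2: "C2 > 0" unfolding C2_def using c by (intro sum_pos) auto
  have cC2: "c j \<le> C2" for j unfolding C2_def using c by (intro member_le_sum) (auto intro: less_imp_le)
  have "pnorm p T k \<le> ennreal (C1 * C2) * diff_norms p L t g"
    if T: "tempered T" and g: "represents g T" and t: "\<And>j. t $ j \<in> dyadic_block (k + 5)" for T g k t
  proof (cases "\<forall>j. Lp_norm p (axis_diff L (t $ j) j g) < \<infinity>")
    \<comment> \<open>An infinite quasinorm on the right leaves nothing to prove. In the other case
      finiteness gives the integrability that \<open>convolution_representation\<close> asks
      for.\<close>
    case False
    then obtain j where "Lp_norm p (axis_diff L (t $ j) j g) = \<top>" using top.not_eq_extremum by auto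
    moreover have "Lp_norm p (axis_diff L (t $ j) j g) \<le> diff_norms p L t g" by (rule member_le_sum) auto
    ultimately have top: "diff_norms p L t g = \<top>" by (simp add: top_unique)
    show ?thesis unfolding top using C1(1) C2 by (simp add: ennreal_mult_top)
  next
    case True
    define \<tau> where "\<tau> = (2 powi k) *\<^sub>R t"
    have \<tau>: "\<tau> \<in> step_box" unfolding \<tau>_def by (rule lp_mult_differences(1)[OF t])
    let ?a = "\<lambda>j. scaled (diff_mult L j \<tau>) k"
    let ?K = "\<lambda>j. inv_fourier (?a j)"
    let ?G = "\<lambda>j. axis_diff L (t $ j) j g"
    let ?W = "\<lambda>j x. (NN y. enorm (?K j (x - y)) * enorm (?G j y))"
    have a: "schwartz (?a j)" for j by (intro schwartz_scaled schwartz_familyD[OF schwartz_family_diff_mult \<tau>])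
    have [measurable]: "g \<in> borel_funs" using g by (simp add: represents_def locally_integrable_def)
    have [measurable]: "?G j \<in> borel_funs" for j unfolding axis_diff_def by measurable
    have [measurable]: "?K j \<in> borel_funs" for j by (intro schwartz_measurable schwartz_inv_fourier a)
    have int: "integrable lborel (\<lambda>y. ?K j (x - y) * ?G j y)" for j x
      using True by (intro integrable_mult_Lp[OF _ _ p] schwartz_inv_fourier a) auto
    have eq: "piece T k = (\<lambda>x. \<Sum>j\<in>UNIV. fourier_op (\<lambda>\<xi>. ?a j \<xi> * (cexp (step t j) \<xi> - 1) ^ L) T x)"
      by (rule piece_sum[OF T iter_diff_inv_fourier(2)[OF a]]) (simp only: lp_mult_differences(2)[OF t, of _ L] \<tau>_def)
    have rep: "fourier_op (\<lambda>\<xi>. ?a j \<xi> * (cexp (step t j) \<xi> - 1) ^ L) T x = (LBINT y. ?K j (x - y) * ?G j y)" for j x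
      unfolding iter_diff_inv_fourier(1)[OF a, symmetric]
      using convolution_representation[OF T g schwartz_inv_fourier[OF a[of j]], where x=x and L=L and h="step t j"] int[of j x]
      by (simp add: axis_diff_def step_def)
    have "enorm (piece T k x) \<le> (\<Sum>j\<in>UNIV. ?W j x)" for x
    proof -
      have "enorm (piece T k x) \<le> (\<Sum>j\<in>UNIV. enorm (LBINT y. ?K j (x - y) * ?G j y))"
        unfolding eq rep by (simp add: sum_ennreal norm_sum ennreal_leI)
      also have "\<dots> \<le> (\<Sum>j\<in>UNIV. (NN y. enorm (?K j (x - y) * ?G j y)))"
        by (intro sum_mono integral_norm_bound_ennreal int)
      finally show ?thesis by (simp add: norm_mult ennreal_mult)
    qed
    then have "pnorm p T k \<le> Lp_gen lborel p (\<lambda>x. \<Sum>j\<in>UNIV. ?W j x)"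
      using piece_measurable[OF T, of k] by (intro Lp_gen_mono_AE p0 AE_I2) auto
    also have "\<dots> \<le> ennreal C1 * (\<Sum>j\<in>UNIV. Lp_gen lborel p (?W j))" by (intro C1(2)[rule_format]) measurable
    also have "\<dots> \<le> ennreal C1 * (\<Sum>j\<in>UNIV. ennreal C2 * Lp_norm p (?G j))"
    proof (intro mult_left_mono sum_mono)
      fix j
      have "Lp_gen lborel p (?W j) \<le> ennreal (c j) * Lp_norm p (?G j)" using c \<tau> by simp
      also have "\<dots> \<le> ennreal C2 * Lp_norm p (?G j)" by (intro mult_right_mono ennreal_leI cC2) simp
      finally show "Lp_gen lborel p (?W j) \<le> ennreal C2 * Lp_norm p (?G j)" .
    qed simp
    also have "\<dots> = ennreal (C1 * C2) * (\<Sum>j\<in>UNIV. Lp_norm p (?G j))"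
      using C1 C2 by (simp add: ennreal_mult mult.assoc sum_distrib_left)
    finally show ?thesis .
  qed
  then show ?thesis using C1 C2 by (intro exI[of _ "C1 * C2"]) auto
qed

end

text \<open>Passes from an estimate for all choices of steps to the weighted norms, by taking the
  infimum in each step separately. \<open>d\<close> is an error term to be absorbed later. It
  matters that \<open>C\<close> is chosen before \<open>c\<close>: the constant \<open>c\<close>
  will depend on how far the error has been pushed down, and the factor in front of \<open>d\<close>
  must not.\<close>

lemma lq_qnorm_le_weighted_norms:
  assumes q: "0 < q"
  shows "\<exists>C>0. \<forall>c>0. \<forall>a d (F :: 'n::finite \<Rightarrow> real \<Rightarrow> ennreal).
    (\<forall>k t. (\<forall>j. t $ j \<in> dyadic_block (k + 5)) \<longrightarrow> a k \<le> d k + ennreal c * (\<Sum>j\<in>UNIV. ennreal ((t $ j) powr (- s)) * F j (t $ j))) \<longrightarrow>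
    lq_qnorm q a \<le> ennreal C * lq_qnorm q d + ennreal (C * c) * (\<Sum>j\<in>UNIV. weighted_norm q s (F j))"
proof -
  obtain C1 where C1: "C1 > 0" "\<forall>a b. lq_qnorm q (\<lambda>k. a k + b k) \<le> ennreal C1 * (lq_qnorm q a + lq_qnorm q b)"
    using lq_qnorm_add[OF q] by blast
  obtain C2 where C2: "C2 > 0" "\<forall>a. lq_qnorm q (\<lambda>k. \<Sum>j\<in>(UNIV :: 'n set). a j k) \<le> ennreal C2 * (\<Sum>j\<in>UNIV. lq_qnorm q (a j))"
    using lq_qnorm_sum[OF q finite, of "UNIV :: 'n set"] by blast
  obtain C3 where C3: "C3 > 0" "\<forall>F. lq_qnorm q (\<lambda>k. INF t\<in>dyadic_block k. ennreal (t powr (- s)) * F t) \<le> ennreal C3 * weighted_norm q s F"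
    using lq_qnorm_INF_le_weighted_norm[OF q] by blast
  define C where "C = C1 * max 1 (C2 * C3)"
  have C: "C1 \<le> C" "C1 * C2 * C3 \<le> C" "C > 0"
    using C1 mult_left_mono[of 1 "max 1 (C2 * C3)" C1] mult_left_mono[of "C2 * C3" "max 1 (C2 * C3)" C1]
    by (auto simp: C_def mult.assoc)
  have "lq_qnorm q a \<le> ennreal C * lq_qnorm q d + ennreal (C * c) * (\<Sum>j\<in>UNIV. weighted_norm q s (F j))"
    if c: "c > 0" and le: "\<And>k (t :: real^'n). (\<forall>j. t $ j \<in> dyadic_block (k + 5)) \<Longrightarrow> a k \<le> d k + ennreal c * (\<Sum>j\<in>UNIV. ennreal ((t $ j) powr (- s)) * F j (t $ j))"
    for c a d and F :: "'n \<Rightarrow> real \<Rightarrow> ennreal"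
  proof -
    let ?W = "\<Sum>j\<in>UNIV. weighted_norm q s (F j)"
    let ?I = "\<lambda>j k. INF t\<in>dyadic_block k. ennreal (t powr (- s)) * F j t"
    \<comment> \<open>\<open>le_sum_INF\<close> has no factor in front of its sum, so the estimate
      is divided by \<open>c\<close> first and multiplied back at the end.\<close>
    let ?v = "ennreal (1 / c)"
    have inv: "?v * (ennreal c * z) = z" "ennreal c * (?v * z) = z" for z
      using c by (simp_all add: mult.assoc[symmetric] flip: ennreal_mult)
    have pt: "?v * a k \<le> ?v * d k + (\<Sum>j\<in>UNIV. ?I j (k + 5))" for k
    proof (rule le_sum_INF)
      show "dyadic_block (k + 5) \<noteq> {}" using emeasure_dyadic_block[of "k + 5"] by auto
      fix t :: "'n \<Rightarrow> real" assume "\<forall>j\<in>UNIV. t j \<in> dyadic_block (k + 5)"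
      then have "a k \<le> d k + ennreal c * (\<Sum>j\<in>UNIV. ennreal (t j powr (- s)) * F j (t j))" using le[of "\<chi> j. t j" k] by simp
      from mult_left_mono[OF this, of ?v]
      show "?v * a k \<le> ?v * d k + (\<Sum>j\<in>UNIV. ennreal (t j powr (- s)) * F j (t j))" by (simp add: distrib_left inv)
    qed simp
    have "lq_qnorm q (\<lambda>k. ?v * a k) \<le> lq_qnorm q (\<lambda>k. ?v * d k + (\<Sum>j\<in>UNIV. ?I j (k + 5)))"
      by (rule lq_qnorm_mono[OF q pt])
    also have "\<dots> \<le> ennreal C1 * (lq_qnorm q (\<lambda>k. ?v * d k) + lq_qnorm q (\<lambda>k. \<Sum>j\<in>UNIV. ?I j (k + 5)))"
      using C1(2)[rule_format, of "\<lambda>k. ?v * d k" "\<lambda>k. \<Sum>j\<in>UNIV. ?I j (k + 5)"] .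
    also have "\<dots> \<le> ennreal C1 * (?v * lq_qnorm q d + ennreal (C2 * C3) * ?W)"
    proof (intro mult_left_mono add_mono lq_qnorm_cmult_le[OF q])
      have "lq_qnorm q (\<lambda>k. \<Sum>j\<in>UNIV. ?I j (k + 5)) \<le> ennreal C2 * (\<Sum>j\<in>UNIV. lq_qnorm q (\<lambda>k. ?I j (k + 5)))"
        using C2(2)[rule_format, of "\<lambda>j k. ?I j (k + 5)"] .
      also have "\<dots> = ennreal C2 * (\<Sum>j\<in>UNIV. lq_qnorm q (?I j))" unfolding lq_qnorm_shift[of q "?I _" 5] ..
      also have "\<dots> \<le> ennreal C2 * (\<Sum>j\<in>UNIV. ennreal C3 * weighted_norm q s (F j))"
        using C3(2) by (intro mult_left_mono sum_mono) auto
      also have "\<dots> = ennreal (C2 * C3) * ?W" using C2 C3 by (simp add: sum_distrib_left ennreal_mult mult.assoc)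
      finally show "lq_qnorm q (\<lambda>k. \<Sum>j\<in>UNIV. ?I j (k + 5)) \<le> ennreal (C2 * C3) * ?W" .
    qed auto
    finally have 1: "lq_qnorm q (\<lambda>k. ?v * a k) \<le> ennreal C1 * (?v * lq_qnorm q d + ennreal (C2 * C3) * ?W)" .
    have "lq_qnorm q a = lq_qnorm q (\<lambda>k. ennreal c * (?v * a k))" by (simp only: inv)
    also have "\<dots> \<le> ennreal c * lq_qnorm q (\<lambda>k. ?v * a k)" by (rule lq_qnorm_cmult_le[OF q])
    also have "\<dots> \<le> ennreal c * (ennreal C1 * (?v * lq_qnorm q d + ennreal (C2 * C3) * ?W))" by (intro mult_left_mono 1) simp
    also have "\<dots> = ennreal C1 * (ennreal c * (?v * lq_qnorm q d)) + ennreal (C1 * C2 * C3 * c) * ?W"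
      using C1 C2 C3 c by (simp only: ennreal_mult less_imp_le mult_nonneg_nonneg distrib_left mult_ac)
    also have "\<dots> \<le> ennreal C * lq_qnorm q d + ennreal (C * c) * ?W"
      unfolding inv using C c by (intro add_mono mult_right_mono ennreal_leI) auto
    finally show ?thesis .
  qed
  then show ?thesis using C(3) by (intro exI[of _ C]) blast
qed

text \<open>In this block \<open>2^k * t\<close> lies between \<open>1/32\<close> and
  \<open>1/16\<close>; the absolute value of \<open>s\<close> in the exponent covers both
  signs.\<close>

lemma dyadic_weight:
  assumes "t \<in> dyadic_block (k + 5)"
  shows "2 powr (real_of_int k * s) \<le> 32 powr \<bar>s\<bar> * t powr (- s)"
proof -
  define \<tau> where "\<tau> = 2 powr real_of_int k * t"
  have t: "t > 0" by (rule dyadic_block_pos[OF assms])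
  have "2 powr real_of_int k * 2 powr (- real_of_int (k + 5)) = 1/32"
    "2 powr real_of_int k * 2 powr (1 - real_of_int (k + 5)) = 1/16" by (simp_all add: powr_minus flip: powr_add)
  moreover have "2 powr real_of_int k * 2 powr (- real_of_int (k + 5)) \<le> \<tau>" "\<tau> \<le> 2 powr real_of_int k * 2 powr (1 - real_of_int (k + 5))"
    using assms by (auto simp: \<tau>_def dyadic_block_def simp del: of_int_add)
  ultimately have \<tau>: "1/32 \<le> \<tau>" "\<tau> \<le> 1/16" by (simp_all only:)
  have "\<tau> powr s \<le> 32 powr \<bar>s\<bar>"
  proof (cases "s \<ge> 0")
    case True
    have "\<tau> powr s \<le> 32 powr s" using True \<tau> by (intro powr_mono2) auto
    then show ?thesis using True by simp
  next
    case False
    have "\<tau> powr s \<le> (1/32) powr s" using False \<tau> by (intro powr_mono2') auto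
    also have "(1/32 :: real) powr s = 32 powr (- s)" by (simp add: powr_divide powr_minus_divide)
    finally show ?thesis using False by simp
  qed
  then have "\<tau> powr s * t powr (- s) \<le> 32 powr \<bar>s\<bar> * t powr (- s)" by (intro mult_right_mono) auto
  moreover have "\<tau> powr s * t powr (- s) = 2 powr (real_of_int k * s)"
    using t by (simp add: \<tau>_def powr_mult powr_powr mult.assoc flip: powr_add)
  ultimately show ?thesis by simp
qed

lemma iter_diff_cong_AE:
  assumes "AE x in lborel. g x = g' x"
  shows "AE x in lborel. iter_diff L h g x = iter_diff L h g' x"
proof (induction L)
  case (Suc L)
  have "AE x in distr lborel borel ((+) h). iter_diff L h g x = iter_diff L h g' x" unfolding lborel_distr_plus by (rule Suc)
  then have "AE x in lborel. iter_diff L h g (h + x) = iter_diff L h g' (h + x)" by (rule AE_distrD[rotated]) simp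
  with Suc show ?case by eventually_elim (simp add: add.commute)
qed (use assms in simp)

text \<open>A representative is only Lebesgue measurable, as the limit of its restrictions to balls.
  Real and imaginary part are replaced by Borel functions equal to them almost everywhere, a change
  that the quasinorms of differences do not notice.\<close>

lemma function_representative_imp_represents:
  fixes g :: "'n::finite cfun"
  assumes "function_representative g u"
  shows "\<exists>T\<in>u. \<exists>g'. represents g' T \<and> (AE x in lborel. g x = g' x)"
proof -
  obtain T where T: "T \<in> u" "\<forall>\<phi>. schwartz \<phi> \<longrightarrow> compact (closure {x. \<phi> x \<noteq> 0}) \<longrightarrow> T \<phi> = (\<integral>x. g x * \<phi> x \<partial>lebesgue)"
    and loc: "\<forall>K. compact K \<longrightarrow> set_integrable lebesgue K g"
    using assms unfolding function_representative_def by blast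
  have cb: "integrable lebesgue (\<lambda>x. indicator (cball 0 R) x *\<^sub>R g x)" for R
    using loc compact_cball unfolding set_integrable_def by blast
  have g: "g \<in> borel_measurable lebesgue"
  proof (rule borel_measurable_LIMSEQ_metric)
    show "(\<lambda>x. indicator (cball 0 (real n)) x *\<^sub>R g x) \<in> borel_measurable lebesgue" for n
      using cb by (rule borel_measurable_integrable)
    fix x
    have "eventually (\<lambda>n. indicator (cball 0 (real n)) x *\<^sub>R g x = g x) sequentially"
      using eventually_ge_at_top[of "nat \<lceil>norm x\<rceil>"] by eventually_elim (simp add: nat_le_iff ceiling_le_iff)
    then show "(\<lambda>n. indicator (cball 0 (real n)) x *\<^sub>R g x) \<longlonglongrightarrow> g x" by (rule tendsto_eventually)
  qed
  obtain gr where gr: "gr \<in> borel_measurable lborel" "AE x in lborel. Re (g x) = gr x"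
    using completion_ex_borel_measurable_real[of "\<lambda>x. Re (g x)" lborel] g by auto
  obtain gi where gi: "gi \<in> borel_measurable lborel" "AE x in lborel. Im (g x) = gi x"
    using completion_ex_borel_measurable_real[of "\<lambda>x. Im (g x)" lborel] g by auto
  define g' where "g' x = Complex (gr x) (gi x)" for x
  have g'm: "g' \<in> borel_funs" unfolding borel_measurable_complex_iff using gr(1) gi(1) by (simp add: g'_def)
  have ae: "AE x in lborel. g x = g' x" using gr(2) gi(2) by eventually_elim (simp add: g'_def complex_eq_iff)
  then have ael: "AE x in lebesgue. g x = g' x" by (rule AE_completion)
  have g'l: "(\<lambda>x. g' x * \<phi> x) \<in> borel_measurable lebesgue" if "\<phi> \<in> borel_funs" for \<phi> :: "'n cfun"
  proof -
    have "(\<lambda>x. g' x * \<phi> x) \<in> borel_funs" using g'm that by measurable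
    then show ?thesis by (intro measurable_completion) simp
  qed
  have "represents g' T" unfolding represents_def locally_integrable_def
  proof (intro conjI allI impI)
    show "g' \<in> borel_funs" by (rule g'm)
    fix R
    have cm: "cball (0 :: real^'n) R \<in> sets borel" by simp
    have m: "(\<lambda>x. indicator (cball 0 R) x * g' x) \<in> borel_funs" using g'm cm by measurable
    have "integrable lebesgue (\<lambda>x. indicator (cball 0 R) x * g' x)"
    proof (rule integrable_cong_AE_imp[OF cb[of R]])
      show "(\<lambda>x. indicator (cball 0 R) x * g' x) \<in> borel_measurable lebesgue" using m by (intro measurable_completion) simp
      show "AE x in lebesgue. indicator (cball 0 R) x *\<^sub>R g x = indicator (cball 0 R) x * g' x"
        using ael by eventually_elim (simp add: indicator_def)
    qed
    then show "integrable lborel (\<lambda>x. indicator (cball 0 R) x * g' x)" using m by (simp add: integrable_completion)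
  next
    fix \<phi> :: "'n cfun" assume \<phi>: "test_function \<phi>"
    then obtain R where R: "\<forall>x. R < norm x \<longrightarrow> \<phi> x = 0" and s: "schwartz \<phi>" by (auto simp: test_function_def)
    have "{x. \<phi> x \<noteq> 0} \<subseteq> cball 0 R"
    proof
      fix x assume "x \<in> {x. \<phi> x \<noteq> 0}"
      then have "\<not> R < norm x" using R by blast
      then show "x \<in> cball 0 R" by simp
    qed
    then have "compact (closure {x. \<phi> x \<noteq> 0})" using bounded_cball bounded_subset compact_closure by metis
    then have "T \<phi> = (\<integral>x. g x * \<phi> x \<partial>lebesgue)" using T(2) s by blast
    also have "\<dots> = (\<integral>x. g' x * \<phi> x \<partial>lebesgue)"
    proof (rule integral_cong_AE)
      have "\<phi> \<in> borel_measurable lebesgue" using schwartz_measurable[OF s] by (intro measurable_completion) simp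
      then show "(\<lambda>x. g x * \<phi> x) \<in> borel_measurable lebesgue" using g by (rule borel_measurable_times[rotated])
      show "AE x in lebesgue. g x * \<phi> x = g' x * \<phi> x" using ael by eventually_elim simp
    qed (rule g'l[OF schwartz_measurable[OF s]])
    also have "\<dots> = (LBINT x. g' x * \<phi> x)"
      using g'm schwartz_measurable[OF s] by (intro integral_completion) simp
    finally show "T \<phi> = (LBINT x. g' x * \<phi> x)" .
  qed
  then show ?thesis using T(1) ae by blast
qed

section \<open>Reconstruction for exponents below one\<close>

context littlewood_paley
begin

text \<open>Nikolskii's inequality from \<open>L^p\<close> to \<open>L^1\<close> for one piece. The
  piece is reproduced by the low-pass kernel of the next level, so \<open>product_nikolskii\<close>
  bounds its \<open>p\<close>-th power pointwise by a constant \<open>M\<close> of order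
  \<open>2^(l n)\<close> times its integral. Interpolating between this bound and the integral
  raises \<open>M\<close> to the power \<open>1/p - 1\<close>, which produces the factor in the
  statement.\<close>

lemma piece_L1:
  assumes p: "0 < p" "p < 1"
  shows "\<exists>C>0. \<forall>T l. tempered T \<longrightarrow>
    (NN x. enorm (piece T l x)) \<le> ennreal (C * 2 powr (real_of_int l * sigma_p CARD('n) p)) * pnorm p T l"
proof -
  define r where "r = enn2real p"
  have pt: "p \<noteq> \<infinity>" using p by auto
  have r0: "r > 0" using enn2real_pos[OF p(1) pt] by (simp add: r_def)
  have pr: "p = ennreal r" using pt by (simp add: r_def less_top)
  have r1: "r < 1" using p(2) r0 unfolding pr by (simp add: ennreal_1[symmetric] ennreal_less_iff del: ennreal_1)
  let ?n = "real CARD('n)"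
  \<comment> \<open>Determined by \<open>r * e + r = 1\<close>, so that \<open>norm f\<close> is
    \<open>(norm f powr r) powr e * norm f powr r\<close>; moreover \<open>n * e\<close> is
    \<open>sigma_p\<close>.\<close>
  define e where "e = (1 - r) / r"
  have e0: "e > 0" using r0 r1 by (simp add: e_def)
  have sig: "sigma_p CARD('n) p = ?n * e"
    unfolding sigma_p_eq[OF p(1) pt] r_def[symmetric] e_def using r0 r1 by (simp add: max_def field_simps)
  obtain S where S: "S > 0" "\<forall>m x. norm (inv_fourier (low_mult m) x) \<le> S * 2 powr (real_of_int m * ?n)"
    using low_kernel_bound by blast
  define C where "C = (S * 2 powr (4 * ?n)) powr e"
  have "(NN x. enorm (piece T l x)) \<le> ennreal (C * 2 powr (real_of_int l * sigma_p CARD('n) p)) * pnorm p T l"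
    if T: "tempered T" for T l
  proof -
    define M where "M = S * 2 powr (real_of_int (l + 4) * ?n)"
    have M: "M > 0" using S by (simp add: M_def)
    let ?f = "piece T l"
    let ?A = "inv_fourier (low_mult (l + 1))"
    have [measurable]: "?f \<in> borel_funs" by (rule piece_measurable[OF T])
    have AM: "norm (?A y) \<le> M" for y
    proof -
      have "norm (?A y) \<le> S * 2 powr (real_of_int (l + 1) * ?n)" using S by blast
      also have "\<dots> \<le> M" unfolding M_def using S by (intro mult_left_mono powr_mono mult_right_mono) auto
      finally show ?thesis .
    qed
    define X where "X = (NN x. ennreal (norm (?f x) powr r))"
    have LX: "Lp_norm p ?f = epowr X (1 / r)"
      using pt by (simp add: Lp_gen_def X_def r_def ennreal_powr_ennreal)
    have pw: "ennreal (norm (?f x) powr r) \<le> ennreal M * X" for x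
    proof -
      have "(\<lambda>\<xi>. low_mult (l + 1) \<xi> * lp_mult l \<xi>) = lp_mult l"
      proof
        fix \<xi>
        show "low_mult (l + 1) \<xi> * lp_mult l \<xi> = lp_mult l \<xi>"
          using low_mult_one[OF lp_mult_support, of l \<xi>] by (cases "lp_mult l \<xi> = 0") auto
      qed
      then have "?f x = (LBINT y. ?A (x - y) * ?f y)"
        using convolution_inv_fourier[OF T schwartz_low_mult[of "l + 1"] schwartz_lp_mult[of l], where x=x] by simp
      then have "enorm (?f x) \<le> (NN y. enorm (?A (x - y) * ?f y))"
        using integral_norm_bound_ennreal[OF convolution_integrable[OF T schwartz_inv_fourier[OF schwartz_low_mult[of "l + 1"]] schwartz_inv_fourier[OF schwartz_lp_mult[of l]], of x]]
        by simp
      then have "epowr (enorm (?f x)) r \<le> epowr (NN y. enorm (?A (x - y) * ?f y)) r"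
        by (intro ennreal_powr_mono r0)
      also have "\<dots> \<le> ennreal (M powr (1 - r)) * (NN y. ennreal (norm (?A (x - y)) powr r) * epowr (enorm (?f y)) r)"
      proof (rule product_nikolskii[OF T schwartz_low_mult schwartz_lp_mult _ _ r0 less_imp_le[OF r1] M])
        show "norm (inv_fourier (low_mult (l + 2 + 2)) x) \<le> M" for x
          using S(2)[rule_format, of "l + 2 + 2" x] by (simp add: M_def add.commute)
        show "norm \<xi> \<le> 2 powi (l + 2)" if "low_mult (l + 1) \<xi> \<noteq> 0" for \<xi> using low_mult_support[OF that] by (simp add: add.commute)
        show "norm \<xi> \<le> 2 powi (l + 2)" if "lp_mult l \<xi> \<noteq> 0" for \<xi>
        proof -
          have "norm \<xi> < 2 powi (l + 1)" by (rule lp_mult_support[OF that])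
          also have "\<dots> \<le> 2 powi (l + 2)" by (intro power_int_increasing) auto
          finally show ?thesis by simp
        qed
      qed
      also have "\<dots> \<le> ennreal (M powr (1 - r)) * (NN y. ennreal (M powr r) * ennreal (norm (?f y) powr r))"
        using AM r0 by (intro mult_left_mono nn_integral_mono mult_mono ennreal_leI powr_mono2) (auto simp: ennreal_powr_ennreal)
      also have "\<dots> = ennreal (M powr (1 - r)) * ennreal (M powr r) * X"
        unfolding X_def mult.assoc by (subst nn_integral_cmult) auto
      also have "ennreal (M powr (1 - r)) * ennreal (M powr r) = ennreal M" using M by (simp flip: ennreal_mult powr_add)
      finally show ?thesis by (simp add: ennreal_powr_ennreal)
    qed
    show ?thesis
    proof (cases X)
      case top
      then show ?thesis unfolding LX using S by (simp add: C_def ennreal_mult_top)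
    next
      case (real X')
      have "(NN x. enorm (?f x)) \<le> (NN x. ennreal ((M * X') powr e) * ennreal (norm (?f x) powr r))"
      proof (rule nn_integral_mono)
        fix x
        have le: "norm (?f x) powr r \<le> M * X'" using pw[of x] real M by (simp add: ennreal_le_iff flip: ennreal_mult)
        have "norm (?f x) = (norm (?f x) powr r) powr e * norm (?f x) powr r"
          using r0 by (cases "?f x = 0") (auto simp: powr_powr e_def simp flip: powr_add)
        also have "\<dots> \<le> (M * X') powr e * norm (?f x) powr r"
          using le e0 by (intro mult_right_mono powr_mono2) auto
        finally show "enorm (?f x) \<le> ennreal ((M * X') powr e) * ennreal (norm (?f x) powr r)"
          by (simp add: ennreal_leI flip: ennreal_mult)
      qed
      also have "\<dots> = ennreal ((M * X') powr e) * ennreal X'" using real by (simp add: nn_integral_cmult X_def)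
      also have "\<dots> = ennreal (M powr e) * ennreal (X' powr (1 / r))"
      proof -
        have "X' powr e * X' = X' powr (1 / r)"
        proof (cases "X' = 0")
          case False
          have "e + 1 = 1 / r" using r0 by (simp add: e_def field_simps)
          then have "X' powr e * X' powr 1 = X' powr (1 / r)" by (simp only: powr_add[symmetric])
          then show ?thesis using False real by simp
        qed simp
        then show ?thesis using M real by (simp add: powr_mult mult.assoc flip: ennreal_mult)
      qed
      also have "ennreal (X' powr (1 / r)) = Lp_norm p ?f" unfolding LX using real by (simp add: ennreal_powr_ennreal)
      also have "M powr e = C * 2 powr (real_of_int l * sigma_p CARD('n) p)"
      proof -
        have "M = (S * 2 powr (4 * ?n)) * 2 powr (real_of_int l * ?n)"
          by (simp add: M_def mult.assoc algebra_simps flip: powr_add)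
        then show ?thesis unfolding C_def sig by (simp add: powr_mult powr_powr mult.assoc)
      qed
      finally show ?thesis .
    qed
  qed
  moreover have "C > 0" using S by (simp add: C_def)
  ultimately show ?thesis by blast
qed

text \<open>By \<open>piece_L1\<close> the \<open>L^1\<close> norms are dominated by a geometric
  series of ratio \<open>2^(\<sigma> - s)\<close>, which is below \<open>1\<close> exactly when
  \<open>s > \<sigma>\<close>.\<close>

lemma high_pieces_integrable:
  assumes p: "0 < p" "p < 1" and s: "sigma_p CARD('n) p < s" and T: "tempered T"
    and M: "\<And>l. ennreal (2 powr (of_int l * s)) * pnorm p T l \<le> M" "M < \<infinity>"
  shows "(NN x. (\<Sum>i. enorm (piece T (k + 1 + int i) x))) < \<infinity>"
proof -
  let ?\<sigma> = "sigma_p CARD('n) p"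
  obtain C where C: "C > 0" "\<forall>T l. tempered T \<longrightarrow>
    (NN x. enorm (piece T l x)) \<le> ennreal (C * 2 powr (real_of_int l * ?\<sigma>)) * pnorm p T l"
    using piece_L1[OF p] by blast
  obtain m where m: "M = ennreal m" "m \<ge> 0" using M(2) by (cases M) auto
  define \<rho> where "\<rho> = 2 powr (?\<sigma> - s)"
  have \<rho>: "0 < \<rho>" "\<rho> < 1" using powr_less_mono[of "?\<sigma> - s" 0 2] s by (auto simp: \<rho>_def)
  let ?c = "C * 2 powr (real_of_int (k + 1) * (?\<sigma> - s)) * m"
  have [measurable]: "piece T l \<in> borel_funs" for l by (rule piece_measurable[OF T])
  have le: "(NN x. enorm (piece T (k + 1 + int i) x)) \<le> ennreal (?c * \<rho> ^ i)" for i
  proof -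
    let ?l = "k + 1 + int i"
    have "(NN x. enorm (piece T ?l x)) \<le> ennreal (C * 2 powr (real_of_int ?l * ?\<sigma>)) * Lp_norm p (piece T ?l)"
      using C(2) T by blast
    also have "\<dots> = ennreal (C * 2 powr (real_of_int ?l * (?\<sigma> - s))) * (ennreal (2 powr (of_int ?l * s)) * Lp_norm p (piece T ?l))"
    proof -
      have "2 powr (real_of_int ?l * ?\<sigma>) = 2 powr (real_of_int ?l * (?\<sigma> - s)) * 2 powr (real_of_int ?l * s)"
        by (simp add: right_diff_distrib flip: powr_add)
      then show ?thesis using C by (simp only: ennreal_mult mult.assoc less_imp_le powr_ge_zero mult_nonneg_nonneg)
    qed
    also have "\<dots> \<le> ennreal (C * 2 powr (real_of_int ?l * (?\<sigma> - s))) * ennreal m"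
      unfolding m(1)[symmetric] by (intro mult_left_mono M) simp
    also have "\<dots> = ennreal (?c * \<rho> ^ i)"
    proof -
      have "\<rho> ^ i = 2 powr (real i * (?\<sigma> - s))" by (simp add: \<rho>_def powr_powr mult.commute flip: powr_realpow)
      then have "2 powr (real_of_int ?l * (?\<sigma> - s)) = 2 powr (real_of_int (k + 1) * (?\<sigma> - s)) * \<rho> ^ i"
        by (simp add: distrib_right flip: powr_add)
      then show ?thesis using C(1) m \<rho>(1) by (simp add: mult_ac flip: ennreal_mult)
    qed
    finally show ?thesis .
  qed
  have "(NN x. (\<Sum>i. enorm (piece T (k + 1 + int i) x))) = (\<Sum>i. (NN x. enorm (piece T (k + 1 + int i) x)))"
    by (rule nn_integral_suminf) measurable
  also have "\<dots> \<le> (\<Sum>i. ennreal (?c * \<rho> ^ i))" by (intro suminf_le le) auto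
  also have "\<dots> = ennreal (\<Sum>i. ?c * \<rho> ^ i)" using C m \<rho> by (intro suminf_ennreal2 summable_mult summable_geometric) auto
  finally show ?thesis by (rule le_less_trans) simp
qed

end

lemma iter_diff_minus: "iter_diff L h (\<lambda>x. f x - g x) x = iter_diff L h f x - iter_diff L h g x"
  by (induction L arbitrary: x) simp_all

text \<open>Finiteness of \<open>x\<close> is essential: an infinite \<open>x\<close> satisfies the
  first premise for every positive \<open>\<theta>\<close>. This is why the lower bounds are stated
  for members of the Besov space.\<close>

lemma ennreal_half_absorb:
  assumes "x \<le> ennreal \<theta> * x + y" "\<theta> \<le> 1/2" "x < \<infinity>"
  shows "x \<le> 2 * y"
proof (cases y)
  case (real v)
  obtain w where w: "x = ennreal w" "w \<ge> 0" using assms(3) by (cases x) auto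
  have "ennreal w \<le> ennreal (1/2) * ennreal w + ennreal v"
    using assms(1) add_right_mono[OF mult_right_mono[OF ennreal_leI[OF assms(2)], of x], of y] w real by (metis order_trans zero_le)
  also have "ennreal (1/2) * ennreal w = ennreal (w / 2)" using w by (subst ennreal_mult[symmetric]) auto
  also have "ennreal (w / 2) + ennreal v = ennreal (w / 2 + v)" using w real by simp
  finally have "w \<le> w / 2 + v" using w real by (simp add: ennreal_le_iff del: ennreal_plus)
  then have "ennreal w \<le> ennreal (2 * v)" by (intro ennreal_leI) linarith
  then show ?thesis using w real by (simp add: ennreal_mult)
qed (simp add: ennreal_mult_top)

context littlewood_paley
begin

text \<open>The remainder is the series of pieces above \<open>k\<close>, to which
  \<open>Lp_gen_series\<close> applies after extending it by zero to all levels. The bound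
  \<open>M\<close> serves the decomposition of \<open>g\<close>; the constant is uniform in
  it.\<close>

lemma high_frequency_remainder:
  assumes p: "0 < p" "p < 1" and s: "sigma_p CARD('n) p < s" and \<epsilon>: "\<epsilon> > 0"
  shows "\<exists>C>0. \<forall>T g k M. tempered T \<longrightarrow> represents g T \<longrightarrow>
    (\<forall>l. ennreal (2 powr (of_int l * s)) * pnorm p T l \<le> M) \<longrightarrow> M < \<infinity> \<longrightarrow>
    Lp_norm p (\<lambda>x. g x - fourier_op (low_mult k) T x)
      \<le> ennreal C * (SUP l\<in>{k<..}. dyad \<epsilon> (l - k) * pnorm p T l)"
proof -
  obtain C where C: "C > 0" "\<forall>k a. (\<forall>l. a l \<in> borel_measurable lborel) \<longrightarrow>
    Lp_gen lborel p (\<lambda>x :: real^'n. (NS l. a l x)) \<le> ennreal C * (SUP l. dyad \<epsilon> (l - k) * Lp_gen lborel p (a l))"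
    using Lp_gen_series[OF p(1) \<epsilon>, of "lborel :: (real^'n) measure"] by blast
  have "Lp_norm p (\<lambda>x. g x - fourier_op (low_mult k) T x)
      \<le> ennreal C * (SUP l\<in>{k<..}. dyad \<epsilon> (l - k) * pnorm p T l)" if T: "tempered T" and g: "represents g T"
      and M: "\<And>l. ennreal (2 powr (of_int l * s)) * pnorm p T l \<le> M" "M < \<infinity>" for T g k M
  proof -
    let ?R = "\<lambda>x. g x - fourier_op (low_mult k) T x"
    define V where "V l x = (if k < l then enorm (piece T l x) else 0)" for l x
    have [measurable]: "g \<in> borel_funs" using g by (simp add: represents_def locally_integrable_def)
    have [measurable]: "fourier_op (low_mult k) T \<in> borel_funs"
      by (intro convolution_measurable T schwartz_inv_fourier schwartz_low_mult)
    have [measurable]: "piece T l \<in> borel_funs" for l by (rule piece_measurable[OF T])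
    have [measurable]: "V l \<in> borel_funs" for l unfolding V_def[abs_def] by measurable
    have b: "bij_betw (\<lambda>i. k + 1 + int i) UNIV {k<..}" by (rule bij_betwI[where g="\<lambda>l. nat (l - k - 1)"]) auto
    have sumV: "(\<Sum>i. enorm (piece T (k + 1 + int i) x)) = (NS l. V l x)" for x
    proof -
      have "(\<Sum>i. enorm (piece T (k + 1 + int i) x)) = (\<integral>\<^sup>+l. enorm (piece T l x) \<partial>count_space {k<..})"
        using nn_integral_bij_count_space[OF b, of "\<lambda>l. enorm (piece T l x)"] by (simp add: nn_integral_count_space_nat)
      also have "\<dots> = (NS l. V l x)"
        by (subst nn_integral_count_space_indicator) (auto intro!: nn_integral_cong simp: V_def indicator_def)
      finally show ?thesis .
    qed
    have "AE x in lborel. enorm (?R x) \<le> (NS l. V l x)"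
      using littlewood_paley_decomposition[OF T g high_pieces_integrable[OF p s T M, of k]]
    proof eventually_elim
      case (elim x)
      then have sm: "summable (\<lambda>i. norm (piece T (k + 1 + int i) x))" and R: "?R x = (\<Sum>i. piece T (k + 1 + int i) x)" by auto
      have "enorm (?R x) \<le> ennreal (\<Sum>i. norm (piece T (k + 1 + int i) x))"
        unfolding R by (intro ennreal_leI summable_norm sm)
      also have "\<dots> = (\<Sum>i. enorm (piece T (k + 1 + int i) x))" by (rule suminf_ennreal2[symmetric, OF _ sm]) simp
      finally show ?case unfolding sumV .
    qed
    then have "Lp_norm p ?R \<le> Lp_gen lborel p (\<lambda>x. (NS l. V l x))" by (intro Lp_gen_mono_AE p(1)) measurable
    also have "\<dots> \<le> ennreal C * (SUP l. dyad \<epsilon> (l - k) * Lp_gen lborel p (V l))" using C(2) by simp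
    also have "\<dots> \<le> ennreal C * (SUP l\<in>{k<..}. dyad \<epsilon> (l - k) * pnorm p T l)"
    proof (intro mult_left_mono SUP_least)
      fix l
      show "dyad \<epsilon> (l - k) * Lp_gen lborel p (V l)
        \<le> (SUP l\<in>{k<..}. dyad \<epsilon> (l - k) * pnorm p T l)"
      proof (cases "k < l")
        case True
        then have "V l = (\<lambda>x. enorm (piece T l x))" by (simp add: V_def[abs_def])
        then show ?thesis using True by (intro SUP_upper2[of l]) auto
      next
        case False
        have "Lp_gen lborel p (\<lambda>x :: real^'n. 0) = 0"
          using Lp_gen_cmult_le[OF p(1), of "\<lambda>x :: real^'n. 0" lborel 0] by simp
        then show ?thesis using False by (simp add: V_def[abs_def])
      qed
    qed simp
    finally show ?thesis .
  qed
  then show ?thesis using C(1) by (intro exI[of _ C]) blast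
qed

text \<open>The coefficients \<open>diff_mult\<close> act on differences of the low-pass part at
  level \<open>k + N\<close>, which is band-limited, so \<open>Lp_multiplier\<close> applies. The
  difference of the low-pass part is that of \<open>g\<close> minus that of the high-frequency
  remainder, and the latter is bounded through the remainder itself.\<close>

lemma piece_le_differences_small:
  assumes p: "0 < p" "p < 1" and s: "sigma_p CARD('n) p < s" and \<epsilon>: "\<epsilon> > 0"
  shows "\<exists>K>0. \<forall>N\<ge>1. \<forall>T g k t M. tempered T \<longrightarrow> represents g T \<longrightarrow>
    (\<forall>l. ennreal (2 powr (of_int l * s)) * pnorm p T l \<le> M) \<longrightarrow> M < \<infinity> \<longrightarrow>
    (\<forall>j. t $ j \<in> dyadic_block (k + 5)) \<longrightarrow>
    pnorm p T k \<le> ennreal (K * 2 powr (real N * sigma_p CARD('n) p)) *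
      (diff_norms p L t g
        + (SUP l\<in>{k + int N<..}. dyad \<epsilon> (l - (k + int N)) * pnorm p T l))"
proof -
  let ?\<sigma> = "sigma_p CARD('n) p"
  obtain C1 where C1: "C1 > 0" "\<forall>f :: 'n \<Rightarrow> 'n cfun. (\<forall>i\<in>UNIV. f i \<in> borel_funs) \<longrightarrow>
    Lp_norm p (\<lambda>x. \<Sum>i\<in>UNIV. f i x) \<le> ennreal C1 * (\<Sum>i\<in>UNIV. Lp_norm p (f i))"
    using Lp_norm_sum[OF p(1) finite, of "UNIV :: 'n set", where 'n='n] by blast
  have m1: "norm \<xi> \<le> 2 powi 1" if "diff_mult L j \<tau> \<xi> \<noteq> 0" for j \<tau> \<xi> using diff_mult_support[OF that] by simp
  have "\<forall>j. \<exists>C>0. \<forall>\<tau>\<in>step_box. \<forall>l (N::nat) T B. tempered T \<longrightarrow> schwartz B \<longrightarrow>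
    (\<forall>\<xi>. B \<xi> \<noteq> 0 \<longrightarrow> norm \<xi> \<le> 2 powi (l + 1 + int N)) \<longrightarrow>
    Lp_norm p (fourier_op (\<lambda>\<xi>. scaled (diff_mult L j \<tau>) l \<xi> * B \<xi>) T)
      \<le> ennreal (C * 2 powr (real N * ?\<sigma>)) * Lp_norm p (fourier_op B T)"
    by (rule allI, rule Lp_multiplier[OF p(1) schwartz_family_diff_mult m1])
  from choice[OF this] obtain c where c: "\<forall>j. c j > 0 \<and> (\<forall>\<tau>\<in>step_box. \<forall>l (N::nat) T B. tempered T \<longrightarrow> schwartz B \<longrightarrow>
    (\<forall>\<xi>. B \<xi> \<noteq> 0 \<longrightarrow> norm \<xi> \<le> 2 powi (l + 1 + int N)) \<longrightarrow>
    Lp_norm p (fourier_op (\<lambda>\<xi>. scaled (diff_mult L j \<tau>) l \<xi> * B \<xi>) T)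
      \<le> ennreal (c j * 2 powr (real N * ?\<sigma>)) * Lp_norm p (fourier_op B T))" by (elim exE)
  define C2 where "C2 = (\<Sum>j\<in>UNIV. c j)"
  have C2: "C2 > 0" unfolding C2_def using c by (intro sum_pos) auto
  have cC2: "c j \<le> C2" for j unfolding C2_def using c by (intro member_le_sum) (auto intro: less_imp_le)
  obtain C3 where C3: "C3 > 0" "\<forall>h (f :: 'n cfun). f \<in> borel_funs \<longrightarrow> Lp_norm p (iter_diff L h f) \<le> ennreal C3 * Lp_norm p f"
    using Lp_gen_iter_diff[OF p(1), of L, where 'n='n] by auto
  obtain C4 where C4: "C4 > 0" "\<forall>f g. f \<in> borel_measurable lborel \<longrightarrow> g \<in> borel_measurable lborel \<longrightarrow>
    Lp_gen lborel p (\<lambda>x::real^'n. f x + g x) \<le> ennreal C4 * (Lp_gen lborel p f + Lp_gen lborel p g)" using Lp_gen_add[OF p(1)] by blast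
  obtain C5 where C5: "C5 > 0" "\<forall>T g k M. tempered T \<longrightarrow> represents g T \<longrightarrow>
    (\<forall>l. ennreal (2 powr (of_int l * s)) * pnorm p T l \<le> M) \<longrightarrow> M < \<infinity> \<longrightarrow>
    Lp_norm p (\<lambda>x. g x - fourier_op (low_mult k) T x)
      \<le> ennreal C5 * (SUP l\<in>{k<..}. dyad \<epsilon> (l - k) * pnorm p T l)"
    using high_frequency_remainder[OF p s \<epsilon>] by blast
  define K0 where "K0 = C1 * C2 * C4"
  define E where "E = real CARD('n) * (C3 * C5)"
  define K where "K = K0 * max 1 E"
  have K0: "K0 > 0" using C1 C2 C4 by (simp add: K0_def)
  have E0: "E \<ge> 0" using C3 C5 by (simp add: E_def)
  have K: "K > 0" using K0 by (simp add: K_def)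
  have "pnorm p T k \<le> ennreal (K * 2 powr (real N * ?\<sigma>)) *
      (diff_norms p L t g
        + (SUP l\<in>{k + int N<..}. dyad \<epsilon> (l - (k + int N)) * pnorm p T l))"
    if N: "N \<ge> 1" and T: "tempered T" and g: "represents g T"
      and M: "\<forall>l. ennreal (2 powr (of_int l * s)) * pnorm p T l \<le> M" "M < \<infinity>"
      and t: "\<And>j. t $ j \<in> dyadic_block (k + 5)" for N T g k t M
  proof -
    define k' where "k' = k + int N"
    define \<tau> where "\<tau> = (2 powi k) *\<^sub>R t"
    have \<tau>: "\<tau> \<in> step_box" unfolding \<tau>_def by (rule lp_mult_differences(1)[OF t])
    define S where "S = (SUP l\<in>{k'<..}. dyad \<epsilon> (l - k') * pnorm p T l)"
    let ?D = "\<lambda>j. axis_diff L (t $ j) j g"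
    let ?q = "2 powr (real N * ?\<sigma>)"
    define low where "low = fourier_op (low_mult k') T"
    define R where "R x = g x - low x" for x
    let ?a = "\<lambda>j. scaled (diff_mult L j \<tau>) k"
    let ?B = "\<lambda>j \<xi>. low_mult k' \<xi> * (cexp (step t j) \<xi> - 1) ^ L"
    let ?c = "\<lambda>j. fourier_op (\<lambda>\<xi>. ?a j \<xi> * ?B j \<xi>) T"
    let ?r = "\<lambda>j. ennreal C4 * (Lp_norm p (?D j) + ennreal (C3 * C5) * S)"
    have a: "schwartz (?a j)" for j by (intro schwartz_scaled schwartz_familyD[OF schwartz_family_diff_mult \<tau>])
    have B: "schwartz (?B j)" for j by (rule iter_diff_inv_fourier(2)[OF schwartz_low_mult])
    have [measurable]: "g \<in> borel_funs" using g by (simp add: represents_def locally_integrable_def)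
    have [measurable]: "low \<in> borel_funs"
      unfolding low_def by (intro convolution_measurable T schwartz_inv_fourier schwartz_low_mult)
    have [measurable]: "R \<in> borel_funs" unfolding R_def[abs_def] by measurable
    have RS: "Lp_norm p R \<le> ennreal C5 * S" unfolding R_def[abs_def] low_def S_def using C5(2) T g M by blast
    have eq: "piece T k = (\<lambda>x. \<Sum>j\<in>UNIV. ?c j x)"
    proof (rule piece_sum[OF T schwartz_mult[OF a B]])
      fix \<xi>
      \<comment> \<open>The low-pass factor can be inserted because \<open>N \<ge> 1\<close>: it
        equals \<open>1\<close> on the support of \<open>?a j\<close>, where
        \<open>norm \<xi> < 2^(k+1)\<close>.\<close>
      have "?a j \<xi> * ?B j \<xi> = ?a j \<xi> * (cexp (step t j) \<xi> - 1) ^ L" for j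
      proof (cases "?a j \<xi> = 0")
        case False
        then have "norm ((2 powi (- k)) *\<^sub>R \<xi>) < 2" unfolding scaled_def by (rule diff_mult_support)
        then have "norm \<xi> < 2 * 2 powi k" unfolding norm_powi_scale .
        also have "2 * 2 powi k = (2 :: real) powi (k + 1)" by (simp add: power_int_add)
        also have "\<dots> \<le> 2 powi k'" using N by (intro power_int_increasing) (auto simp: k'_def)
        finally show ?thesis by (simp add: low_mult_one)
      qed simp
      then show "lp_mult k \<xi> = (\<Sum>j\<in>UNIV. ?a j \<xi> * ?B j \<xi>)" unfolding lp_mult_differences(2)[OF t, of \<xi> L] \<tau>_def[symmetric] by (simp only:)
    qed
    have low_diff: "Lp_norm p (fourier_op (?B j) T) \<le> ?r j" for j
    proof -
      have "fourier_op (?B j) T = iter_diff L (step t j) low"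
        unfolding low_def iter_diff_convolution[OF T schwartz_inv_fourier[OF schwartz_low_mult]] iter_diff_inv_fourier(1)[OF schwartz_low_mult] ..
      also have "\<dots> = (\<lambda>x. ?D j x - iter_diff L (step t j) R x)"
      proof
        fix x
        show "iter_diff L (step t j) low x = ?D j x - iter_diff L (step t j) R x"
          using iter_diff_minus[of L "step t j" g low x] by (simp add: R_def[abs_def] axis_diff_def step_def)
      qed
      finally have e: "fourier_op (?B j) T = (\<lambda>x. ?D j x - iter_diff L (step t j) R x)" .
      have [measurable]: "?D j \<in> borel_funs" unfolding axis_diff_def by measurable
      have "Lp_norm p (\<lambda>x. ?D j x - iter_diff L (step t j) R x)
          \<le> Lp_gen lborel p (\<lambda>x. enorm (?D j x) + enorm (iter_diff L (step t j) R x))"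
        by (intro Lp_gen_mono_AE p(1) AE_I2) (auto simp: norm_triangle_ineq4 ennreal_plus[symmetric] intro!: ennreal_leI simp del: ennreal_plus)
      also have "\<dots> \<le> ennreal C4 * (Lp_norm p (?D j) + Lp_norm p (iter_diff L (step t j) R))"
        by (intro C4(2)[rule_format]) measurable
      also have "\<dots> \<le> ?r j"
      proof (intro mult_left_mono add_left_mono)
        have "Lp_norm p (iter_diff L (step t j) R) \<le> ennreal C3 * Lp_norm p R" using C3(2) by simp
        also have "\<dots> \<le> ennreal C3 * (ennreal C5 * S)" by (intro mult_left_mono RS) simp
        finally show "Lp_norm p (iter_diff L (step t j) R) \<le> ennreal (C3 * C5) * S" using C3 C5 by (simp add: ennreal_mult mult.assoc)
      qed simp
      finally show ?thesis unfolding e .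
    qed
    have mB: "?c j \<in> borel_funs" for j
      by (intro convolution_measurable T schwartz_inv_fourier schwartz_mult a B)
    have "pnorm p T k \<le> ennreal C1 * (\<Sum>j\<in>UNIV. Lp_norm p (?c j))"
      unfolding eq using C1(2)[rule_format, of "\<lambda>j. ?c j"] mB by blast
    also have "\<dots> \<le> ennreal C1 * (\<Sum>j\<in>UNIV. ennreal (C2 * ?q) * ?r j)"
    proof (intro mult_left_mono sum_mono)
      fix j
      have "Lp_norm p (?c j)
          \<le> ennreal (c j * ?q) * Lp_norm p (fourier_op (?B j) T)"
      proof (rule c[rule_format, THEN conjunct2, rule_format, OF \<tau> T B])
        \<comment> \<open>The band limit of \<open>?B j\<close> is \<open>2^(k'+1)\<close>, that is
          \<open>N\<close> levels above that of the coefficient; hence the factor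
          \<open>?q\<close>.\<close>
        fix \<xi> assume "?B j \<xi> \<noteq> 0"
        then have "low_mult k' \<xi> \<noteq> 0" by auto
        from low_mult_support[OF this] show "norm \<xi> \<le> 2 powi (k + 1 + int N)" by (simp add: k'_def add_ac)
      qed
      also have "\<dots> \<le> ennreal (C2 * ?q) * ?r j"
        by (intro mult_mono low_diff ennreal_leI mult_right_mono cC2) auto
      finally show "Lp_norm p (?c j)
        \<le> ennreal (C2 * ?q) * ?r j" .
    qed simp
    also have "\<dots> = ennreal (K0 * ?q) * ((\<Sum>j\<in>UNIV. Lp_norm p (?D j)) + ennreal E * S)"
    proof -
      have "(\<Sum>j\<in>(UNIV :: 'n set). ennreal (C3 * C5) * S) = ennreal E * S"
        using C3 C5 by (simp add: E_def ennreal_mult ennreal_of_nat_eq_real_of_nat mult.assoc)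
      then have "(\<Sum>j\<in>UNIV. ennreal (C2 * ?q) * ?r j)
          = ennreal (C2 * ?q) * (ennreal C4 * ((\<Sum>j\<in>UNIV. Lp_norm p (?D j)) + ennreal E * S))"
        by (simp only: sum_distrib_left[symmetric] sum.distrib)
      moreover have "ennreal C1 * (ennreal (C2 * ?q) * (ennreal C4 * z)) = ennreal (K0 * ?q) * z" for z
      proof -
        have "ennreal (K0 * ?q) = ennreal C1 * (ennreal (C2 * ?q) * ennreal C4)"
          using C1 C2 C4 by (simp add: K0_def mult_ac flip: ennreal_mult)
        then show ?thesis by (simp only: mult.assoc)
      qed
      ultimately show ?thesis by (simp only:)
    qed
    also have "\<dots> \<le> ennreal (K0 * ?q) * (ennreal (max 1 E) * ((\<Sum>j\<in>UNIV. Lp_norm p (?D j)) + S))"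
    proof (intro mult_left_mono)
      have "1 * (\<Sum>j\<in>UNIV. Lp_norm p (?D j)) \<le> ennreal (max 1 E) * (\<Sum>j\<in>UNIV. Lp_norm p (?D j))"
        by (intro mult_right_mono) (auto simp: ennreal_1[symmetric] simp del: ennreal_1 intro!: ennreal_leI)
      moreover have "ennreal E * S \<le> ennreal (max 1 E) * S" by (intro mult_right_mono ennreal_leI) auto
      ultimately show "(\<Sum>j\<in>UNIV. Lp_norm p (?D j)) + ennreal E * S \<le> ennreal (max 1 E) * ((\<Sum>j\<in>UNIV. Lp_norm p (?D j)) + S)"
        by (simp only: distrib_left mult_1 add_mono)
    qed simp
    also have "\<dots> = ennreal (K * ?q) * ((\<Sum>j\<in>UNIV. Lp_norm p (?D j)) + S)"
    proof -
      have "ennreal (K0 * ?q) * ennreal (max 1 E) = ennreal (K * ?q)" using K0 by (simp add: K_def mult_ac flip: ennreal_mult)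
      then show ?thesis by (simp only: mult.assoc[symmetric])
    qed
    finally show ?thesis unfolding S_def k'_def .
  qed
  then show ?thesis using K by (intro exI[of _ K]) blast
qed

text \<open>The inequality is first shown for a tempered distribution \<open>T\<close> and a Borel
  function representing it. It passes to classes because the pieces may be computed from any member
  and the quasinorms of differences ignore null sets.\<close>

lemma differences_lower_bound:
  assumes p: "0 < p" and q: "0 < q" and cond: "1 \<le> p \<or> p < 1 \<and> sigma_p CARD('n) p < s"
  shows "\<exists>C>0. \<forall>u\<in>besov_space \<psi> s p q. \<forall>g. function_representative g u \<longrightarrow>
    besov_qnorm \<psi> s p q u \<le> ennreal C * (\<Sum>j\<in>UNIV. weighted_norm q s (\<lambda>t. Lp_qnorm p (axis_diff L t j g)))"
proof -
  obtain C0 where C0: "C0 > 0" "\<forall>c>0. \<forall>a d (F :: 'n \<Rightarrow> real \<Rightarrow> ennreal).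
    (\<forall>k t. (\<forall>j. t $ j \<in> dyadic_block (k + 5)) \<longrightarrow> a k \<le> d k + ennreal c * (\<Sum>j\<in>UNIV. ennreal ((t $ j) powr (- s)) * F j (t $ j))) \<longrightarrow>
    lq_qnorm q a \<le> ennreal C0 * lq_qnorm q d + ennreal (C0 * c) * (\<Sum>j\<in>UNIV. weighted_norm q s (F j))"
    using lq_qnorm_le_weighted_norms[OF q, where 'n='n and s=s] by blast
  let ?a = "\<lambda>T k. ennreal (2 powr (of_int k * s)) * pnorm p T k"
  let ?W = "\<lambda>g. \<Sum>j\<in>UNIV. weighted_norm q s (\<lambda>t. Lp_norm p (axis_diff L t j g))" and ?p = "\<lambda>k. 2 powr (real_of_int k * s)"
  let ?s = "\<lambda>g t. \<Sum>j\<in>UNIV. ennreal ((t $ j) powr (- s)) * Lp_norm p (axis_diff L (t $ j) j g)"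
  have main: "\<exists>C>0. \<forall>T g. tempered T \<longrightarrow> represents g T \<longrightarrow> lq_qnorm q (?a T) < \<infinity> \<longrightarrow>
    lq_qnorm q (?a T) \<le> ennreal C * ?W g"
  proof -
    have weight: "ennreal (?p k) * (ennreal B * (\<Sum>j\<in>UNIV. F j (t $ j)))
        \<le> ennreal (B * 32 powr \<bar>s\<bar>) * (\<Sum>j\<in>UNIV. ennreal ((t $ j) powr (- s)) * F j (t $ j))"
      if B: "B > 0" and t: "\<And>j. t $ j \<in> dyadic_block (k + 5)" for B k and t :: "real^'n" and F :: "'n \<Rightarrow> real \<Rightarrow> ennreal"
    proof -
      have "ennreal (?p k) * F j (t $ j) \<le> ennreal (32 powr \<bar>s\<bar>) * (ennreal ((t $ j) powr (- s)) * F j (t $ j))" for j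
        unfolding mult.assoc[symmetric]
        using dyadic_weight[OF t[of j], of s] by (intro mult_right_mono) (auto simp flip: ennreal_mult intro: ennreal_leI)
      then have "(\<Sum>j\<in>UNIV. ennreal (?p k) * F j (t $ j)) \<le> (\<Sum>j\<in>UNIV. ennreal (32 powr \<bar>s\<bar>) * (ennreal ((t $ j) powr (- s)) * F j (t $ j)))"
        by (rule sum_mono)
      from mult_left_mono[OF this, of "ennreal B"] show ?thesis
        using B unfolding sum_distrib_left[symmetric] by (simp add: ennreal_mult mult_ac)
    qed
    show ?thesis
    proof (cases "1 \<le> p")
      case True
      obtain C where C: "C > 0" "\<forall>T g k t. tempered T \<longrightarrow> represents g T \<longrightarrow> (\<forall>j. t $ j \<in> dyadic_block (k + 5)) \<longrightarrow>
        pnorm p T k \<le> ennreal C * diff_norms p L t g" using piece_le_differences[OF True] by blast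
      have "lq_qnorm q (?a T) \<le> ennreal (C0 * (C * 32 powr \<bar>s\<bar>)) * ?W g"
        if T: "tempered T" and g: "represents g T" for T g
      proof -
        have "?a T k \<le> 0 + ennreal (C * 32 powr \<bar>s\<bar>) * ?s g t"
          if t: "\<forall>j. t $ j \<in> dyadic_block (k + 5)" for k and t :: "real^'n"
        proof -
          have "?a T k \<le> ennreal (?p k) * (ennreal C * diff_norms p L t g)"
            using C(2) T g t by (intro mult_left_mono) auto
          also have "\<dots> \<le> ennreal (C * 32 powr \<bar>s\<bar>) * ?s g t"
            using t by (intro weight[of _ _ _ "\<lambda>j t. Lp_norm p (axis_diff L t j g)"] C(1)) auto
          finally show ?thesis by simp
        qed
        then have "lq_qnorm q (?a T) \<le> ennreal C0 * lq_qnorm q (\<lambda>k. 0) + ennreal (C0 * (C * 32 powr \<bar>s\<bar>)) * ?W g"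
          using C(1) by (intro C0(2)[rule_format]) auto
        moreover have "lq_qnorm q (\<lambda>k. 0) = 0" using lq_qnorm_cmult_le[OF q, of 0 "\<lambda>k. 0"] by simp
        ultimately show ?thesis by simp
      qed
      then show ?thesis using C C0(1) by (intro exI[of _ "C0 * (C * 32 powr \<bar>s\<bar>)"]) auto
    next
      case False
      then have p1: "p < 1" and s: "sigma_p CARD('n) p < s" using cond by auto
      let ?\<sigma> = "sigma_p CARD('n) p"
      have s0: "s > 0" using s sigma_p_nonneg[of "CARD('n)" p] by linarith
      \<comment> \<open>For a piece \<open>m\<close> levels above \<open>k + N\<close> the factor
        \<open>2^(- s m)\<close> is available. One half cancels the weight
        \<open>2^(\<epsilon> m)\<close> of the remainder estimate, the other half is the decay
        needed to sum over \<open>m\<close>.\<close>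
      define \<epsilon> where "\<epsilon> = s / 2"
      have \<epsilon>: "\<epsilon> > 0" using s0 by (simp add: \<epsilon>_def)
      obtain K where K: "K > 0" "\<forall>N\<ge>1. \<forall>T g k t M. tempered T \<longrightarrow> represents g T \<longrightarrow>
        (\<forall>l. ?a T l \<le> M) \<longrightarrow> M < \<infinity> \<longrightarrow> (\<forall>j. t $ j \<in> dyadic_block (k + 5)) \<longrightarrow>
        pnorm p T k \<le> ennreal (K * 2 powr (real N * ?\<sigma>)) *
          (diff_norms p L t g
            + (SUP l\<in>{k + int N<..}. dyad \<epsilon> (l - (k + int N)) * pnorm p T l))"
        using piece_le_differences_small[OF p p1 s \<epsilon>] by blast
      obtain C6 where C6: "C6 > 0" "\<forall>a. lq_qnorm q (\<lambda>k. SUP l. dyad (- \<epsilon>) (l - k) * a l) \<le> ennreal C6 * lq_qnorm q a"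
        using lq_qnorm_geometric[OF q \<epsilon>] by blast
      define \<rho> where "\<rho> = 2 powr (?\<sigma> - s)"
      have \<rho>: "0 < \<rho>" "\<rho> < 1" using powr_less_mono[of "?\<sigma> - s" 0 2] s by (auto simp: \<rho>_def)
      have "0 < 1 / (2 * C0 * K * C6)" using C0(1) K(1) C6(1) by simp
      \<comment> \<open>\<open>C0\<close>, \<open>K\<close> and \<open>C6\<close> are fixed before
        \<open>N\<close>, so \<open>N\<close> may be chosen to make their product with
        \<open>\<rho> ^ N\<close> at most \<open>1/2\<close>; only \<open>c\<close> grows with
        \<open>N\<close>. Taking \<open>Suc n\<close> below ensures
        \<open>N \<ge> 1\<close>.\<close>
      from real_arch_pow_inv[OF this \<rho>(2)] obtain n where n: "\<rho> ^ n < 1 / (2 * C0 * K * C6)" by blast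
      define N where "N = Suc n"
      have "\<rho> ^ N \<le> \<rho> ^ n" using \<rho> by (simp add: N_def mult_left_le_one_le)
      then have "\<rho> ^ N \<le> 1 / (2 * C0 * K * C6)" using n by linarith
      then have small: "C0 * (K * \<rho> ^ N * C6) \<le> 1/2" using C0(1) K(1) C6(1) by (simp add: field_simps)
      define c where "c = K * 2 powr (real N * ?\<sigma>) * 32 powr \<bar>s\<bar>"
      have c: "c > 0" using K by (simp add: c_def)
      have "lq_qnorm q (?a T) \<le> ennreal (2 * (C0 * c)) * ?W g"
        if T: "tempered T" and g: "represents g T" and fin: "lq_qnorm q (?a T) < \<infinity>" for T g
      proof -
        define b where "b k = (SUP l. dyad (- \<epsilon>) (l - k) * ?a T l)" for k
        let ?d = "\<lambda>k. ennreal (K * \<rho> ^ N) * b (k + int N)"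
        have "?a T k \<le> ?d k + ennreal c * ?s g t"
          if t: "\<forall>j. t $ j \<in> dyadic_block (k + 5)" for k and t :: "real^'n"
        proof -
          let ?k' = "k + int N"
          let ?D = "\<Sum>j\<in>UNIV. Lp_norm p (axis_diff L (t $ j) j g)"
          let ?S = "SUP l\<in>{?k'<..}. ennreal (2 powr (\<epsilon> * \<bar>of_int (l - ?k')\<bar>)) * pnorm p T l"
          let ?B = "K * 2 powr (real N * ?\<sigma>)"
          let ?w = "ennreal (?p k)"
          \<comment> \<open>Each term of a sequence is bounded by its quasinorm, so the Besov
            quasinorm, finite by assumption, itself serves as the bound \<open>M\<close>.\<close>
          have M: "\<forall>l. ?a T l \<le> lq_qnorm q (?a T)" using le_lq_qnorm[OF q, of "?a T"] by blast
          have N1: "N \<ge> 1" by (simp add: N_def)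
          have "pnorm p T k \<le> ennreal ?B * (?D + ?S)"
            using K(2)[rule_format, OF N1 T g M[rule_format] fin t[rule_format]] .
          then have "?a T k \<le> ?w * (ennreal ?B * (?D + ?S))" by (rule mult_left_mono) simp
          also have "\<dots> = ?w * (ennreal ?B * ?S) + ?w * (ennreal ?B * ?D)" by (simp only: distrib_left add.commute)
          also have "\<dots> \<le> ?d k + ennreal c * ?s g t"
          proof (rule add_mono)
            show "?w * (ennreal ?B * ?D) \<le> ennreal c * ?s g t"
              unfolding c_def using t K by (intro weight[of _ _ _ "\<lambda>j t. Lp_norm p (axis_diff L t j g)"]) auto
            have "?w * (ennreal ?B * ?S) = ennreal (?p k * ?B) * ?S"
              using K by (simp add: ennreal_mult mult.assoc)
            also have "\<dots> = (SUP l\<in>{?k'<..}. ennreal (?p k * ?B) * (ennreal (2 powr (\<epsilon> * \<bar>of_int (l - ?k')\<bar>)) * pnorm p T l))"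
              by (rule SUP_mult_left_ennreal)
            also have "\<dots> \<le> ?d k"
            proof (rule SUP_least)
              fix l assume l: "l \<in> {?k'<..}"
              define m where "m = real_of_int (l - ?k')"
              have m: "m > 0" using l by (simp add: m_def)
              have lm: "real_of_int l = real_of_int k + real N + m" by (simp add: m_def)
              have \<rho>N: "\<rho> ^ N = 2 powr (real N * (?\<sigma> - s))" by (simp add: \<rho>_def powr_powr mult.commute flip: powr_realpow)
              have "?p k * ?B * 2 powr (\<epsilon> * \<bar>m\<bar>)
                  = K * (?p k * 2 powr (real N * ?\<sigma>) * 2 powr (\<epsilon> * \<bar>m\<bar>))" by (simp only: mult_ac)
              also have "?p k * 2 powr (real N * ?\<sigma>) * 2 powr (\<epsilon> * \<bar>m\<bar>)
                  = \<rho> ^ N * 2 powr (- \<epsilon> * \<bar>m\<bar>) * ?p l"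
                unfolding \<rho>N powr_add[symmetric] lm using m by (intro arg_cong2[where f="(powr)"]) (auto simp: \<epsilon>_def algebra_simps)
              finally have eq: "?p k * ?B * 2 powr (\<epsilon> * \<bar>m\<bar>) = (K * \<rho> ^ N) * (2 powr (- \<epsilon> * \<bar>m\<bar>) * ?p l)"
                by (simp only: mult.assoc)
              have "ennreal (?p k * ?B) * (ennreal (2 powr (\<epsilon> * \<bar>m\<bar>)) * pnorm p T l)
                  = ennreal (?p k * ?B * 2 powr (\<epsilon> * \<bar>m\<bar>)) * pnorm p T l"
                using K by (simp add: mult.assoc ennreal_mult)
              also have "\<dots> = ennreal (K * \<rho> ^ N) * (ennreal (2 powr (- \<epsilon> * \<bar>m\<bar>)) * ?a T l)"
                unfolding eq using K \<rho> by (simp add: mult.assoc ennreal_mult)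
              also have "\<dots> \<le> ?d k" unfolding b_def m_def by (intro mult_left_mono SUP_upper) auto
              finally show "ennreal (?p k * ?B) * (ennreal (2 powr (\<epsilon> * \<bar>of_int (l - ?k')\<bar>)) * pnorm p T l) \<le> ?d k"
                unfolding m_def .
            qed
            finally show "?w * (ennreal ?B * ?S) \<le> ?d k" .
          qed
          finally show ?thesis .
        qed
        then have "lq_qnorm q (?a T) \<le> ennreal C0 * lq_qnorm q ?d + ennreal (C0 * c) * (?W g)"
          by (intro C0(2)[rule_format] c) blast
        also have "\<dots> \<le> ennreal (C0 * (K * \<rho> ^ N * C6)) * lq_qnorm q (?a T) + ennreal (C0 * c) * (?W g)"
        proof (rule add_right_mono)
          have "lq_qnorm q ?d \<le> ennreal (K * \<rho> ^ N) * lq_qnorm q (\<lambda>k. b (k + int N))" by (rule lq_qnorm_cmult_le[OF q])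
          also have "\<dots> = ennreal (K * \<rho> ^ N) * lq_qnorm q b" by (simp only: lq_qnorm_shift)
          also have "\<dots> \<le> ennreal (K * \<rho> ^ N) * (ennreal C6 * lq_qnorm q (?a T))"
            unfolding b_def using C6(2) by (intro mult_left_mono) auto
          finally have "ennreal C0 * lq_qnorm q ?d \<le> ennreal C0 * (ennreal (K * \<rho> ^ N) * (ennreal C6 * lq_qnorm q (?a T)))"
            by (rule mult_left_mono) simp
          also have "\<dots> = ennreal (C0 * (K * \<rho> ^ N * C6)) * lq_qnorm q (?a T)"
            using C0(1) K(1) C6(1) \<rho> by (simp add: ennreal_mult mult.assoc)
          finally show "ennreal C0 * lq_qnorm q ?d \<le> ennreal (C0 * (K * \<rho> ^ N * C6)) * lq_qnorm q (?a T)" .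
        qed
        finally have "lq_qnorm q (?a T) \<le> 2 * (ennreal (C0 * c) * (?W g))" using small fin by (rule ennreal_half_absorb)
        then show ?thesis using C0(1) c by (simp add: ennreal_mult mult.assoc)
      qed
      moreover have "2 * (C0 * c) > 0" using C0(1) c by simp
      ultimately show ?thesis by blast
    qed
  qed
  then obtain C where C: "C > 0" "\<forall>T g. tempered T \<longrightarrow> represents g T \<longrightarrow> lq_qnorm q (?a T) < \<infinity> \<longrightarrow>
    lq_qnorm q (?a T) \<le> ennreal C * ?W g" by blast
  have "besov_qnorm \<psi> s p q u \<le> ennreal C * (\<Sum>j\<in>UNIV. weighted_norm q s (\<lambda>t. Lp_qnorm p (axis_diff L t j g)))"
    if u: "u \<in> besov_space \<psi> s p q" and g: "function_representative g u" for u g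
  proof -
    have um: "u \<in> tempered_mod_poly" and fin: "besov_qnorm \<psi> s p q u < \<infinity>" using u by (auto simp: besov_space_def)
    obtain T g' where T: "T \<in> u" "represents g' T" "AE x in lborel. g x = g' x"
      using function_representative_imp_represents[OF g] by blast
    have "Lp_qnorm p (axis_diff L t j g) = Lp_norm p (axis_diff L t j g')" for t j
    proof (rule Lp_qnorm_eq_AE[OF p])
      have [measurable]: "g' \<in> borel_funs" using T(2) by (simp add: represents_def locally_integrable_def)
      show "axis_diff L t j g' \<in> borel_funs" unfolding axis_diff_def by measurable
      show "AE x in lborel. axis_diff L t j g x = axis_diff L t j g' x" unfolding axis_diff_def by (rule iter_diff_cong_AE[OF T(3)])
    qed
    then show ?thesis
      using C(2) lp_piece_eq(1)[OF um T(1)] T(2) fin unfolding besov_qnorm_eq[OF um T(1) p] by simp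
  qed
  then show ?thesis using C(1) by (intro exI[of _ C]) blast
qed

end

theorem theorem1p12:
  fixes \<psi> :: "real^'n::finite \<Rightarrow> complex" and L :: nat and p q :: ennreal and s :: real
  assumes "littlewood_paley_function \<psi>" and "L \<ge> 1" and "0 < p" and "0 < q"
  shows
    "(q < \<infinity> \<and> 0 < s \<and> s < real L \<longrightarrow>
       (\<forall>j. \<exists>C>0. \<forall>u\<in>besov_space \<psi> s p q.
         class_diff_converges \<psi> L j u \<and>
         weighted_integral q s (\<lambda>t. Lp_qnorm p (class_diff \<psi> L t j u))
           \<le> ennreal C * besov_qnorm \<psi> s p q u)) \<and>
     (q < \<infinity> \<and>
       ((1 < p \<and> 1 \<le> q) \<or>
        (1 < p \<and> q < 1 \<and> 0 < s \<and> s < real L) \<or>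
        (p \<le> 1 \<and> sigma_p CARD('n) p < s \<and> s < real L)) \<longrightarrow>
       (\<exists>C>0. \<forall>u\<in>besov_space \<psi> s p q. \<forall>g. function_representative g u \<longrightarrow>
         besov_qnorm \<psi> s p q u
           \<le> ennreal C * (\<Sum>j\<in>UNIV. weighted_integral q s (\<lambda>t. Lp_qnorm p (axis_diff L t j g))))) \<and>
     (q = \<infinity> \<and> 0 < s \<and> s < real L \<longrightarrow>
       (\<forall>j. \<exists>C>0. \<forall>u\<in>besov_space \<psi> s p q.
         class_diff_converges \<psi> L j u \<and>
         weighted_esssup s (\<lambda>t. Lp_qnorm p (class_diff \<psi> L t j u))
           \<le> ennreal C * besov_qnorm \<psi> s p q u)) \<and>
     (q = \<infinity> \<and> (1 < p \<or> (p \<le> 1 \<and> sigma_p CARD('n) p < s)) \<longrightarrow>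
       (\<exists>C>0. \<forall>u\<in>besov_space \<psi> s p q. \<forall>g. function_representative g u \<longrightarrow>
         besov_qnorm \<psi> s p q u
           \<le> ennreal C * (\<Sum>j\<in>UNIV. weighted_esssup s (\<lambda>t. Lp_qnorm p (axis_diff L t j g)))))"
proof -
  interpret littlewood_paley \<psi> by unfold_locales (rule assms(1))
  have fin: "weighted_norm q s = weighted_integral q s" if "q < \<infinity>"
    using that by (intro ext) (auto simp: weighted_norm_def)
  have inf: "weighted_norm q s = weighted_esssup s" if "q = \<infinity>" using that by (intro ext) (simp add: weighted_norm_def)
  have upper: "\<forall>j. \<exists>C>0. \<forall>u\<in>besov_space \<psi> s p q. class_diff_converges \<psi> L j u \<and>
      weighted_norm q s (\<lambda>t. Lp_qnorm p (class_diff \<psi> L t j u)) \<le> ennreal C * besov_qnorm \<psi> s p q u"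
    if "0 < s" "s < real L" using differences_upper_bound[OF assms(3,4) that] by (rule allI)
  \<comment> \<open>The border between the two methods is shifted: \<open>p = 1\<close> is covered
    by Young's inequality, so Nikolskii's inequality is used only for \<open>p < 1\<close>.\<close>
  have lower: "\<exists>C>0. \<forall>u\<in>besov_space \<psi> s p q. \<forall>g. function_representative g u \<longrightarrow>
      besov_qnorm \<psi> s p q u \<le> ennreal C * (\<Sum>j\<in>UNIV. weighted_norm q s (\<lambda>t. Lp_qnorm p (axis_diff L t j g)))"
    if "1 < p \<or> p \<le> 1 \<and> sigma_p CARD('n) p < s"
    by (rule differences_lower_bound[OF assms(3,4)]) (use that in auto)
  show ?thesis
  proof (intro conjI impI)
    assume "q < \<infinity> \<and> 0 < s \<and> s < real L"
    then show "\<forall>j. \<exists>C>0. \<forall>u\<in>besov_space \<psi> s p q. class_diff_converges \<psi> L j u \<and>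
      weighted_integral q s (\<lambda>t. Lp_qnorm p (class_diff \<psi> L t j u)) \<le> ennreal C * besov_qnorm \<psi> s p q u"
      using upper fin by metis
  next
    assume h: "q < \<infinity> \<and> ((1 < p \<and> 1 \<le> q) \<or> (1 < p \<and> q < 1 \<and> 0 < s \<and> s < real L) \<or>
        (p \<le> 1 \<and> sigma_p CARD('n) p < s \<and> s < real L))"
    then have "1 < p \<or> p \<le> 1 \<and> sigma_p CARD('n) p < s" by blast
    from lower[OF this] show "\<exists>C>0. \<forall>u\<in>besov_space \<psi> s p q. \<forall>g. function_representative g u \<longrightarrow>
      besov_qnorm \<psi> s p q u \<le> ennreal C * (\<Sum>j\<in>UNIV. weighted_integral q s (\<lambda>t. Lp_qnorm p (axis_diff L t j g)))"
      using h by (simp only: fin)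
  next
    assume "q = \<infinity> \<and> 0 < s \<and> s < real L"
    then show "\<forall>j. \<exists>C>0. \<forall>u\<in>besov_space \<psi> s p q. class_diff_converges \<psi> L j u \<and>
      weighted_esssup s (\<lambda>t. Lp_qnorm p (class_diff \<psi> L t j u)) \<le> ennreal C * besov_qnorm \<psi> s p q u"
      using upper inf by metis
  next
    assume h: "q = \<infinity> \<and> (1 < p \<or> (p \<le> 1 \<and> sigma_p CARD('n) p < s))"
    from lower[OF h[THEN conjunct2]] show "\<exists>C>0. \<forall>u\<in>besov_space \<psi> s p q. \<forall>g. function_representative g u \<longrightarrow>
      besov_qnorm \<psi> s p q u \<le> ennreal C * (\<Sum>j\<in>UNIV. weighted_esssup s (\<lambda>t. Lp_qnorm p (axis_diff L t j g)))"
      unfolding inf[OF h[THEN conjunct1]] .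
  qed
qed

end
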